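(* Let $H$ be a Hopf algebra with invertible antipode over a field $\Bbbk$, equipped with a bicovariant differential calculus $(\Omega^\bullet,\wedge,\mathrm d)$. Let $M,N$ be bicovariant bimodules over $H$, finitely generated as right $H$-modules, and let $\nabla^M\in\mathrm{Con}_H(M)$, $\nabla^N\in\mathrm{Con}_H(N)$ be right connections. The curvature of their sum $\nabla^M\oplus\nabla^N\in\mathrm{Con}_H(M\otimes_HN)$ is $$\begin{aligned}\mathrm R^{\nabla^M\oplus\nabla^N}&=\sigma^{\mathcal W}_{23}\circ(\mathrm R^{\nabla^M}\otimes_{\sigma^{\mathcal W}}\mathrm{id}_N)+\mathrm{id}_M\otimes_{\sigma^{\mathcal W}}\mathrm R^{\nabla^N}\\&\quad+\wedge_{34}\circ\sigma^{\mathcal W}_{23}\circ\big((\nabla^M-\mathrm d^M)\otimes_{\sigma^{\mathcal W}}(\nabla^N-\mathrm d^N)\big)\\&\quad+\wedge_{34}\circ\big(\mathrm{id}_M\otimes_{\sigma^{\mathcal W}}(\nabla^N-\mathrm d^N)\otimes_{\sigma^{\mathcal W}}\mathrm{id}_{\Omega^1}\big)\circ\sigma^{\mathcal W}_{23}\circ\big((\nabla^M-\mathrm d^M)\otimes_{\sigma^{\mathcal W}}\mathrm{id}_N\big),\end{aligned}$$ where all addends are right $H$-linear maps $M\otimes_HN\to M\otimes_HN\otimes_H\Omega^2$.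
   Context: $\Bbbk$ is a field, $\otimes=\otimes_\Bbbk$, $H$ is a Hopf algebra with coproduct $\Delta(h)=h_1\otimes h_2$ and invertible antipode $S$, $\overline S=S^{-1}$. Right/left coactions: $m\mapsto m_0\otimes m_1$, $m\mapsto m_{-1}\otimes m_0$, iterated as $m_0\otimes m_1\otimes m_2$, $m_{-2}\otimes m_{-1}\otimes m_0$, etc. A bicovariant bimodule is an $H$-bimodule $M$ with commuting right and left $H$-coactions satisfying $\delta_M(amb)=\Delta(a)\delta_M(m)\Delta(b)$, $\lambda_M(amb)=\Delta(a)\lambda_M(m)\Delta(b)$. $M\otimes_HN$ is again one, with actions on the outer factors and diagonal coactions. The Woronowicz braiding is the isomorphism of bicovariant bimodules $\sigma^{\mathcal W}_{M,N}\colon M\otimes_HN\to N\otimes_HM$, $\sigma^{\mathcal W}_{M,N}(m\otimes_Hn)=m_{-2}n_0S(n_1)\otimes_HS(m_{-1})m_0n_2$. $\sigma^{\mathcal W}_{23}$ means $\sigma^{\mathcal W}$ applied to tensor factors 2 and 3 (e.g. $\mathrm{id}_M\otimes_H\sigma^{\mathcal W}_{\Omega^2,N}$ on $M\otimes_H\Omega^2\otimes_HN$), and $\wedge_{34}$ means $\wedge$ applied to factors 3 and 4. Rational morphisms: $\mathrm{HOM}(M,N)$ is the space of $\Bbbk$-linear $\phi\colon M\to N$ for which $\delta^{\mathrm{Ad}}(\phi)(m)=\phi(m_0)_0\otimes\phi(m_0)_1S(m_1)$ defines an element of $\mathrm{Hom}_\Bbbk(M,N)\otimes H\subseteq\mathrm{Hom}_\Bbbk(M,N\otimes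 H)$ and $\lambda^{\mathrm{Ad}}(\phi)(m)=\phi(m_0)_{-1}\overline S(m_{-1})\otimes\phi(m_0)_0$ defines an element $\phi_{-1}\otimes\phi_0$ of $H\otimes\mathrm{Hom}_\Bbbk(M,N)\subseteq\mathrm{Hom}_\Bbbk(M,H\otimes N)$; iterations are $\phi_{-2}\otimes\phi_{-1}\otimes\phi_0$ etc. If $M$ is finitely generated as a right $H$-module, right $H$-linear maps from $M$ to bicovariant bimodules and right connections on $M$ are rational. For right $H$-linear rational maps $\phi\colon M\to M'$, $\psi\colon N\to N'$ between bicovariant bimodules, $\phi\otimes_{\sigma^{\mathcal W}}\psi\colon M\otimes_HN\to M'\otimes_HN'$ is the (associative) product $(\phi\otimes_{\sigma^{\mathcal W}}\psi)(m\otimes_Hn)=\phi(\psi_{-2}m_0S(m_1))\otimes_HS(\psi_{-1})\psi_0(m_2n)$. A differential calculus on $H$ is a differential graded algebra $(\Omega^\bullet=\bigoplus_{k\ge0}\Omega^k,\wedge,\mathrm d)$ with $\Omega^0=H$ and $\Omega^k=\mathrm{span}_\Bbbk\{a^0\mathrm da^1\wedge\cdots\wedge\mathrm da^k\}$; it is bicovariant if $\Omega^\bullet$ is a graded $H$-bicomodule algebra (with coactions extending $\Delta$ in degree $0$) and $\mathrm d$ is $H$-bicolinear. A right connection on a right $H$-module $M$ is a linear map $\nabla\colon M\to M\otimes_H\Omega^1$ with $\nabla(ma)=\nabla(m)a+m\otimes_H\mathrm da$; the set of them is $\mathrm{Con}_H(M)$. The canonical right connection of a bicovariant bimodule $M$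 is $\mathrm d^M(m)=m_0S(m_1)\otimes_H\mathrm dm_2$, so $\nabla-\mathrm d^M$ is right $H$-linear for every $\nabla\in\mathrm{Con}_H(M)$. A right connection extends to $\nabla^\bullet\colon M\otimes_H\Omega^\bullet\to M\otimes_H\Omega^{\bullet+1}$, $\nabla^\bullet(m\otimes_H\omega)=\nabla(m)\wedge\omega+m\otimes_H\mathrm d\omega$, and its curvature is the right $H$-linear map $\mathrm R^\nabla=\nabla^\bullet\circ\nabla\colon M\to M\otimes_H\Omega^2$. The sum of connections is the right connection on $M\otimes_HN$ given by $(\nabla^M\oplus\nabla^N)(m\otimes_Hn)=\sigma^{\mathcal W}_{23}(\nabla^M(m_0S(m_1))\otimes_Hm_2n)+\nabla^N_{-2}m_0S(\nabla^N_{-1}m_1)\otimes_H\nabla^N_0(m_2n)$, equivalently $\nabla^M\oplus\nabla^N=\mathrm d^{M\otimes_HN}+\sigma^{\mathcal W}_{23}\circ((\nabla^M-\mathrm d^M)\otimes_{\sigma^{\mathcal W}}\mathrm{id}_N)+\mathrm{id}_M\otimes_{\sigma^{\mathcal W}}(\nabla^N-\mathrm d^N)$. *)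

theory Defs
  imports Complex_Main "HOL-Library.Poly_Mapping" "HOL-Library.Function_Algebras"
begin

section \<open>Vector spaces and tensor products over the ground field\<close>

text \<open>
  A \<open>\<Bbbk>\<close>-vector space is a subspace \<open>car\<close> of a (typed) vector space. Maps are total functions
  of which only the values on the carrier matter.
\<close>

record ('k, 'a) vsp =
  car :: "'a set"
  scl :: "'k \<Rightarrow> 'a \<Rightarrow> 'a"

definition vspace :: "('k::field, 'a::ab_group_add, 'z) vsp_scheme \<Rightarrow> bool" where
  "vspace X \<longleftrightarrow> vector_space (scl X) \<and> module.subspace (scl X) (car X)"

definition klinear ::
  "('k::field, 'a::ab_group_add, 'y) vsp_scheme \<Rightarrow> ('k, 'b::ab_group_add, 'z) vsp_scheme \<Rightarrow>
   ('a \<Rightarrow> 'b) \<Rightarrow> bool" where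
  "klinear X Y f \<longleftrightarrow>
     (\<forall>x\<in>car X. f x \<in> car Y) \<and>
     (\<forall>x\<in>car X. \<forall>y\<in>car X. f (x + y) = f x + f y) \<and>
     (\<forall>c. \<forall>x\<in>car X. f (scl X c x) = scl Y c (f x))"

text \<open>Functions are made extensional (zero outside the carrier), so that equality in
  \<open>khom X Y\<close> is equality of linear maps.\<close>

definition khom ::
  "('k::field, 'a::ab_group_add, 'y) vsp_scheme \<Rightarrow> ('k, 'b::ab_group_add, 'z) vsp_scheme \<Rightarrow>
   ('k, 'a \<Rightarrow> 'b) vsp" where
  "khom X Y = \<lparr> car = {f. klinear X Y f \<and> (\<forall>x. x \<notin> car X \<longrightarrow> f x = 0)},
                scl = (\<lambda>c f x. scl Y c (f x)) \<rparr>"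

text \<open>The free vector space on a set \<open>'p\<close> of generators is \<open>'p \<Rightarrow>\<^sub>0 'k\<close>.\<close>

definition fscale :: "'k::field \<Rightarrow> ('p \<Rightarrow>\<^sub>0 'k) \<Rightarrow> ('p \<Rightarrow>\<^sub>0 'k)" where
  "fscale c = Poly_Mapping.map ((*) c)"

lemma lookup_fscale [simp]: "Poly_Mapping.lookup (fscale c x) p = c * Poly_Mapping.lookup x p"
  by (simp add: fscale_def Poly_Mapping.map.rep_eq when_def)

lemma vector_space_fscale: "vector_space fscale"
  by unfold_locales (auto intro!: poly_mapping_eqI simp: lookup_add algebra_simps)

text \<open>
  The quotient of a free vector space by the subspace generated by a set \<open>R\<close> of relations.
  A class is represented by its normal form, where \<open>nf R\<close> is a (chosen) linear projection with
  kernel \<open>span R\<close>; the quotient space is thus modelled as the range of \<open>nf R\<close>, and its vector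
  space operations are those of the ambient type. See \<open>nf_eq_iff\<close>.
\<close>

definition nf :: "('p \<Rightarrow>\<^sub>0 'k::field) set \<Rightarrow> ('p \<Rightarrow>\<^sub>0 'k) \<Rightarrow> ('p \<Rightarrow>\<^sub>0 'k)" where
  "nf R = (SOME p. Vector_Spaces.linear fscale fscale p \<and> (\<forall>x. p (p x) = p x) \<and>
                   {x. p x = 0} = module.span fscale R)"

lemma nf_spec:
  fixes R :: "('p \<Rightarrow>\<^sub>0 'k::field) set"
  shows "Vector_Spaces.linear fscale fscale (nf R) \<and> (\<forall>x. nf R (nf R x) = nf R x) \<and>
         {x. nf R x = 0} = module.span fscale R"
proof -
  interpret vector_space "fscale :: 'k \<Rightarrow> ('p \<Rightarrow>\<^sub>0 'k) \<Rightarrow> _" by (rule vector_space_fscale)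
  interpret vp: vector_space_pair "fscale :: 'k \<Rightarrow> ('p \<Rightarrow>\<^sub>0 'k) \<Rightarrow> _" "fscale :: 'k \<Rightarrow> ('p \<Rightarrow>\<^sub>0 'k) \<Rightarrow> _"
    by unfold_locales
  obtain B where B: "B \<subseteq> R" "independent B" "R \<subseteq> span B"
    by (rule maximal_independent_subset)
  have spB: "span B = span R"
    using B by (meson span_eq span_superset subset_trans)
  define C where "C = extend_basis B"
  have C: "B \<subseteq> C" "independent C" "span C = UNIV"
    unfolding C_def using B(2) extend_basis_superset independent_extend_basis span_extend_basis by auto
  define p where "p = vp.construct C (\<lambda>b. if b \<in> B then 0 else b)"
  have lin: "Vector_Spaces.linear fscale fscale p"
    unfolding p_def by (rule vp.linear_construct[OF C(2)])
  interpret p: Vector_Spaces.linear fscale fscale p by (rule lin)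
  have pb: "p b = (if b \<in> B then 0 else b)" if "b \<in> C" for b
    unfolding p_def by (rule vp.construct_basis[OF C(2) that])
  have diff: "x - p x \<in> span B" for x
  proof -
    have "x \<in> span C" using C by simp
    then show ?thesis
    proof (induction rule: span_induct_alt)
      case base then show ?case by (simp add: p.zero span_zero)
    next
      case (step c b y)
      have "b - p b \<in> span B" using pb[OF step(1)] by (auto intro: span_base span_zero)
      then have "fscale c (b - p b) + (y - p y) \<in> span B"
        using step(2) by (intro span_add span_scale)
      moreover have "fscale c b + y - p (fscale c b + y) = fscale c (b - p b) + (y - p y)"
        by (simp add: p.add p.scale scale_right_diff_distrib)
      ultimately show ?case by metis
    qed
  qed
  have pB: "p x = 0" if "x \<in> span B" for x
    using that
  proof (induction rule: span_induct_alt)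
    case base then show ?case by (simp add: p.zero)
  next
    case (step c b y)
    then show ?case using pb[of b] C(1) by (auto simp: p.add p.scale)
  qed
  have idem: "p (p x) = p x" for x
    using pB[OF diff[of x]] by (simp add: p.diff)
  have ker: "{x. p x = 0} = span R"
  proof -
    have "x \<in> span B" if "p x = 0" for x using diff[of x] that by simp
    then show ?thesis using pB spB by auto
  qed
  show ?thesis
    unfolding nf_def by (rule someI[where x = p]) (use lin idem ker in auto)
qed

lemma nf_eq_iff: "nf R x = nf R y \<longleftrightarrow> x - y \<in> module.span fscale R"
proof -
  interpret Vector_Spaces.linear fscale fscale "nf R" using nf_spec by blast
  have "nf R x = nf R y \<longleftrightarrow> nf R (x - y) = 0" by (simp add: diff)
  then show ?thesis using nf_spec[of R] by blast
qed

text \<open>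
  If \<open>t\<close> represents \<open>\<Sum> x\<^sub>i \<otimes> y\<^sub>i\<close> and \<open>f\<close> is a (balanced) bilinear map to \<open>Z\<close>, then
  \<open>sw Z t f = \<Sum> f x\<^sub>i y\<^sub>i\<close>. So \<open>sw Z (comult H h) (\<lambda>h\<^sub>1 h\<^sub>2. E)\<close> is the Sweedler expression \<open>E\<close>.
\<close>

definition sw ::
  "('k::field, 'c::ab_group_add, 'z) vsp_scheme \<Rightarrow> ('a \<times> 'b \<Rightarrow>\<^sub>0 'k) \<Rightarrow> ('a \<Rightarrow> 'b \<Rightarrow> 'c) \<Rightarrow> 'c" where
  "sw Z t f = (\<Sum>(x, y)\<in>Poly_Mapping.keys t. scl Z (Poly_Mapping.lookup t (x, y)) (f x y))"

definition gen :: "'a \<Rightarrow> 'b \<Rightarrow> ('a \<times> 'b \<Rightarrow>\<^sub>0 'k::field)" where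
  "gen x y = Poly_Mapping.single (x, y) 1"

lemma sw_gen: "vector_space (scl Z) \<Longrightarrow> sw Z (gen x y) f = f x y"
  by (simp add: sw_def gen_def vector_space_def)

lemma linear_sw:
  fixes f :: "'a \<Rightarrow> 'b \<Rightarrow> 'c::ab_group_add" and Z :: "('k::field, 'c, 'z) vsp_scheme"
  assumes "vector_space (scl Z)"
  shows "Vector_Spaces.linear fscale (scl Z) (\<lambda>t. sw Z t f)"
proof -
  interpret Z: vector_space "scl Z" by fact
  interpret F: vector_space "fscale :: 'k \<Rightarrow> ('a \<times> 'b \<Rightarrow>\<^sub>0 'k) \<Rightarrow> _" by (rule vector_space_fscale)
  have *: "sw Z t f = (\<Sum>p\<in>A. scl Z (Poly_Mapping.lookup t p) (case p of (x, y) \<Rightarrow> f x y))"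
    if "finite A" "Poly_Mapping.keys t \<subseteq> A" for t :: "'a \<times> 'b \<Rightarrow>\<^sub>0 'k" and A
    unfolding sw_def
    by (rule sum.mono_neutral_cong_left) (use that in \<open>auto simp: in_keys_iff\<close>)
  show ?thesis
  proof unfold_locales
    fix s t :: "'a \<times> 'b \<Rightarrow>\<^sub>0 'k"
    have "Poly_Mapping.keys (s + t) \<subseteq> Poly_Mapping.keys s \<union> Poly_Mapping.keys t" by (rule keys_add)
    then show "sw Z (s + t) f = sw Z s f + sw Z t f"
      by (subst (1 2 3) *[of "Poly_Mapping.keys s \<union> Poly_Mapping.keys t"])
         (auto simp: lookup_add Z.scale_left_distrib sum.distrib)
  next
    fix c and t :: "'a \<times> 'b \<Rightarrow>\<^sub>0 'k"
    have "Poly_Mapping.keys (fscale c t) \<subseteq> Poly_Mapping.keys t" by (auto simp: in_keys_iff)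
    then show "sw Z (fscale c t) f = scl Z c (sw Z t f)"
      by (subst (1 2) *[of "Poly_Mapping.keys t"]) (auto simp: Z.scale_sum_right)
  qed
qed

lemma sw_nf:
  fixes f :: "'a \<Rightarrow> 'b \<Rightarrow> 'c::ab_group_add" and Z :: "('k::field, 'c, 'z) vsp_scheme"
  assumes "vector_space (scl Z)" and "\<And>r. r \<in> R \<Longrightarrow> sw Z r f = 0"
  shows "sw Z (nf R t) f = sw Z t f"
proof -
  interpret L: Vector_Spaces.linear fscale "scl Z" "\<lambda>t. sw Z t f"
    by (rule linear_sw) fact
  have "nf R t - t \<in> module.span fscale R" using nf_spec[of R] nf_eq_iff[of R "nf R t" t] by simp
  then have "sw Z (nf R t - t) f = 0" using L.eq_0_on_span[of R "nf R t - t"] assms(2) by blast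
  then show ?thesis by (simp add: L.diff)
qed

definition krel ::
  "('k::field, 'a::ab_group_add, 'y) vsp_scheme \<Rightarrow> ('k, 'b::ab_group_add, 'z) vsp_scheme \<Rightarrow>
   ('a \<times> 'b \<Rightarrow>\<^sub>0 'k) set" where
  "krel X Y =
     {gen (x + x') y - gen x y - gen x' y | x x' y. x \<in> car X \<and> x' \<in> car X \<and> y \<in> car Y} \<union>
     {gen x (y + y') - gen x y - gen x y' | x y y'. x \<in> car X \<and> y \<in> car Y \<and> y' \<in> car Y} \<union>
     {gen (scl X c x) y - fscale c (gen x y) | c x y. x \<in> car X \<and> y \<in> car Y} \<union>
     {gen x (scl Y c y) - fscale c (gen x y) | c x y. x \<in> car X \<and> y \<in> car Y}"

definition kpure ::
  "('k::field, 'a::ab_group_add, 'y) vsp_scheme \<Rightarrow> ('k, 'b::ab_group_add, 'z) vsp_scheme \<Rightarrow>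
   'a \<Rightarrow> 'b \<Rightarrow> ('a \<times> 'b \<Rightarrow>\<^sub>0 'k)" where
  "kpure X Y x y = nf (krel X Y) (gen x y)"

definition ktens ::
  "('k::field, 'a::ab_group_add, 'y) vsp_scheme \<Rightarrow> ('k, 'b::ab_group_add, 'z) vsp_scheme \<Rightarrow>
   ('k, 'a \<times> 'b \<Rightarrow>\<^sub>0 'k) vsp" where
  "ktens X Y = \<lparr> car = nf (krel X Y) ` {t. Poly_Mapping.keys t \<subseteq> car X \<times> car Y}, scl = fscale \<rparr>"


section \<open>Hopf algebras\<close>

text \<open>The ring structure of the Hopf algebra is the one of the type \<open>'h\<close>.\<close>

record (overloaded) ('k, 'h) hopf = "('k, 'h) vsp" +
  comult :: "'h \<Rightarrow> ('h \<times> 'h \<Rightarrow>\<^sub>0 'k)"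
  counit :: "'h \<Rightarrow> 'k"
  antip :: "'h \<Rightarrow> 'h"

definition k_algebra :: "('k::field \<Rightarrow> 'a::ring_1 \<Rightarrow> 'a) \<Rightarrow> bool" where
  "k_algebra s \<longleftrightarrow> vector_space s \<and> (\<forall>c a b. s c (a * b) = s c a * b \<and> s c (a * b) = a * s c b)"

definition coalgebra :: "('k::field, 'h::ring_1) hopf \<Rightarrow> bool" where
  "coalgebra H \<longleftrightarrow>
     klinear H (ktens H H) (comult H) \<and>
     (\<forall>a b. counit H (a + b) = counit H a + counit H b) \<and>
     (\<forall>c a. counit H (scl H c a) = c * counit H a) \<and>
     (let T = ktens (ktens H H) H; p = (\<lambda>a b c. kpure (ktens H H) H (kpure H H a b) c) in
      \<forall>h. sw T (comult H h) (\<lambda>a c. sw T (comult H a) (\<lambda>a1 a2. p a1 a2 c)) =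
          sw T (comult H h) (\<lambda>a c. sw T (comult H c) (\<lambda>c1 c2. p a c1 c2))) \<and>
     (\<forall>h. sw H (comult H h) (\<lambda>h1 h2. scl H (counit H h1) h2) = h) \<and>
     (\<forall>h. sw H (comult H h) (\<lambda>h1 h2. scl H (counit H h2) h1) = h)"

definition bialgebra :: "('k::field, 'h::ring_1) hopf \<Rightarrow> bool" where
  "bialgebra H \<longleftrightarrow>
     car H = UNIV \<and> k_algebra (scl H) \<and> coalgebra H \<and>
     (\<forall>a b. comult H (a * b) =
        sw (ktens H H) (comult H a) (\<lambda>a1 a2. sw (ktens H H) (comult H b) (\<lambda>b1 b2.
          kpure H H (a1 * b1) (a2 * b2)))) \<and>
     comult H 1 = kpure H H 1 1 \<and>
     (\<forall>a b. counit H (a * b) = counit H a * counit H b) \<and>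
     counit H 1 = 1"

definition hopf_algebra :: "('k::field, 'h::ring_1) hopf \<Rightarrow> bool" where
  "hopf_algebra H \<longleftrightarrow>
     bialgebra H \<and> klinear H H (antip H) \<and>
     (\<forall>h. sw H (comult H h) (\<lambda>h1 h2. antip H h1 * h2) = scl H (counit H h) 1) \<and>
     (\<forall>h. sw H (comult H h) (\<lambda>h1 h2. h1 * antip H h2) = scl H (counit H h) 1)"


section \<open>Bicovariant bimodules\<close>

record (overloaded) ('k, 'h, 'm) bcb = "('k, 'm) vsp" +
  lact :: "'h \<Rightarrow> 'm \<Rightarrow> 'm"
  ract :: "'m \<Rightarrow> 'h \<Rightarrow> 'm"
  rco :: "'m \<Rightarrow> ('m \<times> 'h \<Rightarrow>\<^sub>0 'k)"
  lco :: "'m \<Rightarrow> ('h \<times> 'm \<Rightarrow>\<^sub>0 'k)"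

definition bimodule ::
  "('k::field, 'h::ring_1) hopf \<Rightarrow> ('k, 'h, 'm::ab_group_add) bcb \<Rightarrow> bool" where
  "bimodule H M \<longleftrightarrow>
     vspace M \<and>
     (\<forall>a. klinear M M (lact M a)) \<and>
     (\<forall>a. klinear M M (\<lambda>m. ract M m a)) \<and>
     (\<forall>m\<in>car M. klinear H M (\<lambda>a. lact M a m)) \<and>
     (\<forall>m\<in>car M. klinear H M (\<lambda>a. ract M m a)) \<and>
     (\<forall>m\<in>car M. \<forall>a b. lact M (a * b) m = lact M a (lact M b m)) \<and>
     (\<forall>m\<in>car M. \<forall>a b. ract M m (a * b) = ract M (ract M m a) b) \<and>
     (\<forall>m\<in>car M. lact M 1 m = m \<and> ract M m 1 = m) \<and>
     (\<forall>m\<in>car M. \<forall>a b. lact M a (ract M m b) = ract M (lact M a m) b)"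

text \<open>Commuting right and left coactions.\<close>

definition bicomodule ::
  "('k::field, 'h::ring_1) hopf \<Rightarrow> ('k, 'h, 'm::ab_group_add) bcb \<Rightarrow> bool" where
  "bicomodule H M \<longleftrightarrow>
     vspace M \<and> klinear M (ktens M H) (rco M) \<and> klinear M (ktens H M) (lco M) \<and>
     (let T = ktens (ktens M H) H; p = (\<lambda>m a b. kpure (ktens M H) H (kpure M H m a) b) in
      \<forall>m\<in>car M. sw T (rco M m) (\<lambda>m0 b. sw T (rco M m0) (\<lambda>m00 a. p m00 a b)) =
                sw T (rco M m) (\<lambda>m0 c. sw T (comult H c) (\<lambda>a b. p m0 a b))) \<and>
     (\<forall>m\<in>car M. sw M (rco M m) (\<lambda>m0 a. scl M (counit H a) m0) = m) \<and>
     (let T = ktens (ktens H H) M; p = (\<lambda>a b m. kpure (ktens H H) M (kpure H H a b) m) in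
      \<forall>m\<in>car M. sw T (lco M m) (\<lambda>a m0. sw T (lco M m0) (\<lambda>b m00. p a b m00)) =
                sw T (lco M m) (\<lambda>c m0. sw T (comult H c) (\<lambda>a b. p a b m0))) \<and>
     (\<forall>m\<in>car M. sw M (lco M m) (\<lambda>a m0. scl M (counit H a) m0) = m) \<and>
     (let T = ktens (ktens H M) H; p = (\<lambda>a m b. kpure (ktens H M) H (kpure H M a m) b) in
      \<forall>m\<in>car M. sw T (rco M m) (\<lambda>m0 b. sw T (lco M m0) (\<lambda>a m00. p a m00 b)) =
                sw T (lco M m) (\<lambda>a m0. sw T (rco M m0) (\<lambda>m00 b. p a m00 b)))"

definition bicov_bimodule ::
  "('k::field, 'h::ring_1) hopf \<Rightarrow> ('k, 'h, 'm::ab_group_add) bcb \<Rightarrow> bool" where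
  "bicov_bimodule H M \<longleftrightarrow>
     bimodule H M \<and> bicomodule H M \<and>
     (\<forall>a b. \<forall>m\<in>car M. rco M (lact M a (ract M m b)) =
        (let T = ktens M H in
         sw T (comult H a) (\<lambda>a1 a2. sw T (rco M m) (\<lambda>m0 m1. sw T (comult H b) (\<lambda>b1 b2.
           kpure M H (lact M a1 (ract M m0 b1)) (a2 * m1 * b2)))))) \<and>
     (\<forall>a b. \<forall>m\<in>car M. lco M (lact M a (ract M m b)) =
        (let T = ktens H M in
         sw T (comult H a) (\<lambda>a1 a2. sw T (lco M m) (\<lambda>m1 m0. sw T (comult H b) (\<lambda>b1 b2.
           kpure H M (a1 * m1 * b1) (lact M a2 (ract M m0 b2)))))))"

definition fin_gen_right ::
  "('k::field, 'h::ring_1, 'm::ab_group_add) bcb \<Rightarrow> bool" where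
  "fin_gen_right M \<longleftrightarrow>
     (\<exists>S. finite S \<and> S \<subseteq> car M \<and> (\<forall>m\<in>car M. \<exists>c. m = (\<Sum>s\<in>S. ract M s (c s))))"

definition right_linear ::
  "('k::field, 'h::ring_1, 'm::ab_group_add) bcb \<Rightarrow> ('k, 'h, 'n::ab_group_add) bcb \<Rightarrow>
   ('m \<Rightarrow> 'n) \<Rightarrow> bool" where
  "right_linear M N f \<longleftrightarrow>
     klinear M N f \<and> (\<forall>m\<in>car M. \<forall>a. f (ract M m a) = ract N (f m) a)"


section \<open>Tensor products over the Hopf algebra\<close>

definition hrel ::
  "('k::field, 'h::ring_1, 'm::ab_group_add) bcb \<Rightarrow> ('k, 'h, 'n::ab_group_add) bcb \<Rightarrow>
   ('m \<times> 'n \<Rightarrow>\<^sub>0 'k) set" where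
  "hrel M N = krel M N \<union>
     {gen (ract M m a) n - gen m (lact N a n) | m a n. m \<in> car M \<and> n \<in> car N}"

definition hpure ::
  "('k::field, 'h::ring_1, 'm::ab_group_add) bcb \<Rightarrow> ('k, 'h, 'n::ab_group_add) bcb \<Rightarrow>
   'm \<Rightarrow> 'n \<Rightarrow> ('m \<times> 'n \<Rightarrow>\<^sub>0 'k)" where
  "hpure M N m n = nf (hrel M N) (gen m n)"

definition hspace ::
  "('k::field, 'h::ring_1, 'm::ab_group_add) bcb \<Rightarrow> ('k, 'h, 'n::ab_group_add) bcb \<Rightarrow>
   ('k, 'm \<times> 'n \<Rightarrow>\<^sub>0 'k) vsp" where
  "hspace M N = \<lparr> car = nf (hrel M N) ` {t. Poly_Mapping.keys t \<subseteq> car M \<times> car N}, scl = fscale \<rparr>"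

text \<open>Actions on the outer factors and diagonal coactions.\<close>

definition htens ::
  "('k::field, 'h::ring_1) hopf \<Rightarrow> ('k, 'h, 'm::ab_group_add) bcb \<Rightarrow>
   ('k, 'h, 'n::ab_group_add) bcb \<Rightarrow> ('k, 'h, 'm \<times> 'n \<Rightarrow>\<^sub>0 'k) bcb" where
  "htens H M N =
     \<lparr> car = car (hspace M N),
       scl = scl (hspace M N),
       lact = (\<lambda>a t. sw (hspace M N) t (\<lambda>m n. hpure M N (lact M a m) n)),
       ract = (\<lambda>t a. sw (hspace M N) t (\<lambda>m n. hpure M N m (ract N n a))),
       rco = (\<lambda>t. let T = ktens (hspace M N) H in
         sw T t (\<lambda>m n. sw T (rco M m) (\<lambda>m0 m1. sw T (rco N n) (\<lambda>n0 n1.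
           kpure (hspace M N) H (hpure M N m0 n0) (m1 * n1))))),
       lco = (\<lambda>t. let T = ktens H (hspace M N) in
         sw T t (\<lambda>m n. sw T (lco M m) (\<lambda>m1 m0. sw T (lco N n) (\<lambda>n1 n0.
           kpure H (hspace M N) (m1 * n1) (hpure M N m0 n0))))) \<rparr>"

abbreviation htens_syntax ("(_ \<otimes>\<^bsub>_\<^esub>/ _)" [71, 0, 70] 70) where
  "M \<otimes>\<^bsub>H\<^esub> N \<equiv> htens H M N"

text \<open>\<open>f \<otimes>\<^sub>H g\<close> with values in \<open>M' \<otimes>\<^sub>H N'\<close>, for right \<open>H\<close>-linear \<open>f\<close> and left
  \<open>H\<close>-linear \<open>g\<close>.\<close>

definition hmap ::
  "('k::field, 'h::ring_1) hopf \<Rightarrow> ('k, 'h, 'm2::ab_group_add) bcb \<Rightarrow>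
   ('k, 'h, 'n2::ab_group_add) bcb \<Rightarrow> ('m \<Rightarrow> 'm2) \<Rightarrow> ('n \<Rightarrow> 'n2) \<Rightarrow>
   ('m \<times> 'n \<Rightarrow>\<^sub>0 'k) \<Rightarrow> ('m2 \<times> 'n2 \<Rightarrow>\<^sub>0 'k)" where
  "hmap H M' N' f g t = sw (M' \<otimes>\<^bsub>H\<^esub> N') t (\<lambda>m n. hpure M' N' (f m) (g n))"

text \<open>The isomorphism \<open>(X \<otimes> Y) \<otimes> Z \<rightarrow> X \<otimes> (Y \<otimes> Z)\<close> and its inverse.\<close>

definition hassoc ::
  "('k::field, 'h::ring_1) hopf \<Rightarrow> ('k, 'h, 'x::ab_group_add) bcb \<Rightarrow>
   ('k, 'h, 'y::ab_group_add) bcb \<Rightarrow> ('k, 'h, 'z::ab_group_add) bcb \<Rightarrow>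
   (('x \<times> 'y \<Rightarrow>\<^sub>0 'k) \<times> 'z \<Rightarrow>\<^sub>0 'k) \<Rightarrow> ('x \<times> ('y \<times> 'z \<Rightarrow>\<^sub>0 'k) \<Rightarrow>\<^sub>0 'k)" where
  "hassoc H X Y Z t =
     (let T = X \<otimes>\<^bsub>H\<^esub> (Y \<otimes>\<^bsub>H\<^esub> Z) in
      sw T t (\<lambda>s z. sw T s (\<lambda>x y. hpure X (Y \<otimes>\<^bsub>H\<^esub> Z) x (hpure Y Z y z))))"

definition hassoc_inv ::
  "('k::field, 'h::ring_1) hopf \<Rightarrow> ('k, 'h, 'x::ab_group_add) bcb \<Rightarrow>
   ('k, 'h, 'y::ab_group_add) bcb \<Rightarrow> ('k, 'h, 'z::ab_group_add) bcb \<Rightarrow>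
   ('x \<times> ('y \<times> 'z \<Rightarrow>\<^sub>0 'k) \<Rightarrow>\<^sub>0 'k) \<Rightarrow> (('x \<times> 'y \<Rightarrow>\<^sub>0 'k) \<times> 'z \<Rightarrow>\<^sub>0 'k)" where
  "hassoc_inv H X Y Z t =
     (let T = (X \<otimes>\<^bsub>H\<^esub> Y) \<otimes>\<^bsub>H\<^esub> Z in
      sw T t (\<lambda>x s. sw T s (\<lambda>y z. hpure (X \<otimes>\<^bsub>H\<^esub> Y) Z (hpure X Y x y) z)))"


section \<open>The Woronowicz braiding and the tensor product of rational morphisms\<close>

definition woronowicz ::
  "('k::field, 'h::ring_1) hopf \<Rightarrow> ('k, 'h, 'm::ab_group_add) bcb \<Rightarrow>
   ('k, 'h, 'n::ab_group_add) bcb \<Rightarrow> ('m \<times> 'n \<Rightarrow>\<^sub>0 'k) \<Rightarrow> ('n \<times> 'm \<Rightarrow>\<^sub>0 'k)" where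
  "woronowicz H M N t =
     (let T = N \<otimes>\<^bsub>H\<^esub> M; S = antip H in
      sw T t (\<lambda>m n.
        sw T (lco M m) (\<lambda>g m0. sw T (comult H g) (\<lambda>m2 m1.
        sw T (rco N n) (\<lambda>n0 h. sw T (comult H h) (\<lambda>n1 n2.
          hpure N M (ract N (lact N m2 n0) (S n1)) (ract M (lact M (S m1) m0) n2)))))))"

text \<open>\<open>\<sigma>\<^sub>2\<^sub>3 = id\<^sub>X \<otimes> \<sigma>\<^sub>Y\<^sub>,\<^sub>Z\<close>, with three-fold tensor products bracketed to the left.\<close>

definition sigma23 ::
  "('k::field, 'h::ring_1) hopf \<Rightarrow> ('k, 'h, 'x::ab_group_add) bcb \<Rightarrow>
   ('k, 'h, 'y::ab_group_add) bcb \<Rightarrow> ('k, 'h, 'z::ab_group_add) bcb \<Rightarrow>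
   (('x \<times> 'y \<Rightarrow>\<^sub>0 'k) \<times> 'z \<Rightarrow>\<^sub>0 'k) \<Rightarrow> (('x \<times> 'z \<Rightarrow>\<^sub>0 'k) \<times> 'y \<Rightarrow>\<^sub>0 'k)" where
  "sigma23 H X Y Z =
     hassoc_inv H X Z Y \<circ> hmap H X (Z \<otimes>\<^bsub>H\<^esub> Y) id (woronowicz H Y Z) \<circ> hassoc H X Y Z"

text \<open>
  \<open>represents_left H M N \<phi> t\<close>: the element \<open>t\<close> of \<open>H \<otimes> Hom(M, N)\<close>, viewed in
  \<open>Hom(M, H \<otimes> N)\<close>, is the map \<open>\<lambda>\<^sup>A\<^sup>d(\<phi>)\<close>; similarly on the right for \<open>\<delta>\<^sup>A\<^sup>d(\<phi>)\<close>.
\<close>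

definition represents_left ::
  "('k::field, 'h::ring_1) hopf \<Rightarrow> ('k, 'h, 'm::ab_group_add) bcb \<Rightarrow>
   ('k, 'h, 'n::ab_group_add) bcb \<Rightarrow> ('m \<Rightarrow> 'n) \<Rightarrow> ('h \<times> ('m \<Rightarrow> 'n) \<Rightarrow>\<^sub>0 'k) \<Rightarrow> bool" where
  "represents_left H M N \<phi> t \<longleftrightarrow>
     t \<in> car (ktens H (khom M N)) \<and>
     (let T = ktens H N in
      \<forall>m\<in>car M. sw T t (\<lambda>h f. kpure H N h (f m)) =
        sw T (lco M m) (\<lambda>m1 m0. sw T (lco N (\<phi> m0)) (\<lambda>n1 n0.
          kpure H N (n1 * inv (antip H) m1) n0)))"

definition represents_right ::
  "('k::field, 'h::ring_1) hopf \<Rightarrow> ('k, 'h, 'm::ab_group_add) bcb \<Rightarrow>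
   ('k, 'h, 'n::ab_group_add) bcb \<Rightarrow> ('m \<Rightarrow> 'n) \<Rightarrow> (('m \<Rightarrow> 'n) \<times> 'h \<Rightarrow>\<^sub>0 'k) \<Rightarrow> bool" where
  "represents_right H M N \<phi> t \<longleftrightarrow>
     t \<in> car (ktens (khom M N) H) \<and>
     (let T = ktens N H in
      \<forall>m\<in>car M. sw T t (\<lambda>f h. kpure N H (f m) h) =
        sw T (rco M m) (\<lambda>m0 m1. sw T (rco N (\<phi> m0)) (\<lambda>n0 n1.
          kpure N H n0 (n1 * antip H m1))))"

definition rational ::
  "('k::field, 'h::ring_1) hopf \<Rightarrow> ('k, 'h, 'm::ab_group_add) bcb \<Rightarrow>
   ('k, 'h, 'n::ab_group_add) bcb \<Rightarrow> ('m \<Rightarrow> 'n) \<Rightarrow> bool" where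
  "rational H M N \<phi> \<longleftrightarrow>
     klinear M N \<phi> \<and> (\<exists>t. represents_left H M N \<phi> t) \<and> (\<exists>t. represents_right H M N \<phi> t)"

text \<open>\<open>\<lambda>\<^sup>A\<^sup>d(\<phi>) = \<phi>\<^sub>-\<^sub>1 \<otimes> \<phi>\<^sub>0\<close>; meaningful for rational \<open>\<phi>\<close>.
  It is unique since \<open>H \<otimes> Hom(M, N) \<rightarrow> Hom(M, H \<otimes> N)\<close> is injective.\<close>

definition ad_left ::
  "('k::field, 'h::ring_1) hopf \<Rightarrow> ('k, 'h, 'm::ab_group_add) bcb \<Rightarrow>
   ('k, 'h, 'n::ab_group_add) bcb \<Rightarrow> ('m \<Rightarrow> 'n) \<Rightarrow> ('h \<times> ('m \<Rightarrow> 'n) \<Rightarrow>\<^sub>0 'k)" where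
  "ad_left H M N \<phi> = (THE t. represents_left H M N \<phi> t)"

text \<open>\<open>\<phi> \<otimes>\<^sub>\<sigma> \<psi> : M \<otimes>\<^sub>H N \<rightarrow> M' \<otimes>\<^sub>H N'\<close> for \<open>\<phi> : M \<rightarrow> M'\<close> and \<open>\<psi> : N \<rightarrow> N'\<close>.\<close>

definition tsigma ::
  "('k::field, 'h::ring_1) hopf \<Rightarrow> ('k, 'h, 'm::ab_group_add) bcb \<Rightarrow>
   ('k, 'h, 'n::ab_group_add) bcb \<Rightarrow> ('k, 'h, 'm2::ab_group_add) bcb \<Rightarrow>
   ('k, 'h, 'n2::ab_group_add) bcb \<Rightarrow> ('m \<Rightarrow> 'm2) \<Rightarrow> ('n \<Rightarrow> 'n2) \<Rightarrow>
   ('m \<times> 'n \<Rightarrow>\<^sub>0 'k) \<Rightarrow> ('m2 \<times> 'n2 \<Rightarrow>\<^sub>0 'k)" where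
  "tsigma H M N M' N' \<phi> \<psi> t =
     (let T = M' \<otimes>\<^bsub>H\<^esub> N'; S = antip H in
      sw T t (\<lambda>m n.
        sw T (ad_left H N N' \<psi>) (\<lambda>g \<psi>0. sw T (comult H g) (\<lambda>\<psi>2 \<psi>1.
        sw T (rco M m) (\<lambda>m0 h. sw T (comult H h) (\<lambda>m1 m2.
          hpure M' N' (\<phi> (ract M (lact M \<psi>2 m0) (S m1)))
                      (lact N' (S \<psi>1) (\<psi>0 (lact N m2 n)))))))))"


section \<open>Bicovariant differential calculi\<close>

text \<open>
  The total algebra of forms is the ring \<open>'w\<close>, whose multiplication is the wedge product;
  \<open>emb\<close> identifies \<open>H\<close> with \<open>\<Omega>\<^sup>0\<close>. The coactions are of degree zero, so they are given as
  families \<open>\<Omega>\<^sup>k \<rightarrow> \<Omega>\<^sup>k \<otimes> H\<close> and \<open>\<Omega>\<^sup>k \<rightarrow> H \<otimes> \<Omega>\<^sup>k\<close>.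
\<close>

record (overloaded) ('k, 'h, 'w) calculus =
  wscl :: "'k \<Rightarrow> 'w \<Rightarrow> 'w"
  deg :: "nat \<Rightarrow> 'w set"
  emb :: "'h \<Rightarrow> 'w"
  dif :: "'w \<Rightarrow> 'w"
  wrco :: "nat \<Rightarrow> 'w \<Rightarrow> ('w \<times> 'h \<Rightarrow>\<^sub>0 'k)"
  wlco :: "nat \<Rightarrow> 'w \<Rightarrow> ('h \<times> 'w \<Rightarrow>\<^sub>0 'k)"

definition forms :: "('k, 'h, 'w::ring_1) calculus \<Rightarrow> nat \<Rightarrow> ('k, 'h, 'w) bcb" where
  "forms \<Omega> k =
     \<lparr> car = deg \<Omega> k, scl = wscl \<Omega>,
       lact = (\<lambda>a \<omega>. emb \<Omega> a * \<omega>), ract = (\<lambda>\<omega> a. \<omega> * emb \<Omega> a),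
       rco = wrco \<Omega> k, lco = wlco \<Omega> k \<rparr>"

definition diff_calculus ::
  "('k::field, 'h::ring_1) hopf \<Rightarrow> ('k, 'h, 'w::ring_1) calculus \<Rightarrow> bool" where
  "diff_calculus H \<Omega> \<longleftrightarrow>
     k_algebra (wscl \<Omega>) \<and>
     (\<forall>k. module.subspace (wscl \<Omega>) (deg \<Omega> k)) \<and>
     (\<forall>\<omega>. \<exists>!f. (\<forall>k. f k \<in> deg \<Omega> k) \<and> finite {k. f k \<noteq> 0} \<and> \<omega> = (\<Sum>k | f k \<noteq> 0. f k)) \<and>
     (\<forall>k l. \<forall>\<omega>\<in>deg \<Omega> k. \<forall>\<eta>\<in>deg \<Omega> l. \<omega> * \<eta> \<in> deg \<Omega> (k + l)) \<and>
     inj (emb \<Omega>) \<and> range (emb \<Omega>) = deg \<Omega> 0 \<and>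
     Vector_Spaces.linear (scl H) (wscl \<Omega>) (emb \<Omega>) \<and>
     emb \<Omega> 1 = 1 \<and> (\<forall>a b. emb \<Omega> (a * b) = emb \<Omega> a * emb \<Omega> b) \<and>
     Vector_Spaces.linear (wscl \<Omega>) (wscl \<Omega>) (dif \<Omega>) \<and>
     (\<forall>k. \<forall>\<omega>\<in>deg \<Omega> k. dif \<Omega> \<omega> \<in> deg \<Omega> (Suc k)) \<and>
     (\<forall>\<omega>. dif \<Omega> (dif \<Omega> \<omega>) = 0) \<and>
     (\<forall>k. \<forall>\<omega>\<in>deg \<Omega> k. \<forall>\<eta>. dif \<Omega> (\<omega> * \<eta>) = dif \<Omega> \<omega> * \<eta> + (- 1) ^ k * (\<omega> * dif \<Omega> \<eta>)) \<and>
     (\<forall>k. deg \<Omega> k = module.span (wscl \<Omega>)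
        {emb \<Omega> a * prod_list (map (\<lambda>b. dif \<Omega> (emb \<Omega> b)) bs) | a bs. length bs = k})"

definition bicov_calculus ::
  "('k::field, 'h::ring_1) hopf \<Rightarrow> ('k, 'h, 'w::ring_1) calculus \<Rightarrow> bool" where
  "bicov_calculus H \<Omega> \<longleftrightarrow>
     diff_calculus H \<Omega> \<and>
     (\<forall>k. bicomodule H (forms \<Omega> k)) \<and>
     (\<forall>k l. \<forall>\<omega>\<in>deg \<Omega> k. \<forall>\<eta>\<in>deg \<Omega> l. wrco \<Omega> (k + l) (\<omega> * \<eta>) =
        (let X = forms \<Omega> (k + l); T = ktens X H in
         sw T (wrco \<Omega> k \<omega>) (\<lambda>\<omega>0 \<omega>1. sw T (wrco \<Omega> l \<eta>) (\<lambda>\<eta>0 \<eta>1.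
           kpure X H (\<omega>0 * \<eta>0) (\<omega>1 * \<eta>1))))) \<and>
     (\<forall>k l. \<forall>\<omega>\<in>deg \<Omega> k. \<forall>\<eta>\<in>deg \<Omega> l. wlco \<Omega> (k + l) (\<omega> * \<eta>) =
        (let X = forms \<Omega> (k + l); T = ktens H X in
         sw T (wlco \<Omega> k \<omega>) (\<lambda>\<omega>1 \<omega>0. sw T (wlco \<Omega> l \<eta>) (\<lambda>\<eta>1 \<eta>0.
           kpure H X (\<omega>1 * \<eta>1) (\<omega>0 * \<eta>0))))) \<and>
     (\<forall>a. wrco \<Omega> 0 (emb \<Omega> a) =
        (let X = forms \<Omega> 0 in sw (ktens X H) (comult H a) (\<lambda>a1 a2. kpure X H (emb \<Omega> a1) a2))) \<and>
     (\<forall>a. wlco \<Omega> 0 (emb \<Omega> a) =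
        (let X = forms \<Omega> 0 in sw (ktens H X) (comult H a) (\<lambda>a1 a2. kpure H X a1 (emb \<Omega> a2)))) \<and>
     (\<forall>k. \<forall>\<omega>\<in>deg \<Omega> k. wrco \<Omega> (Suc k) (dif \<Omega> \<omega>) =
        (let X = forms \<Omega> (Suc k) in
         sw (ktens X H) (wrco \<Omega> k \<omega>) (\<lambda>\<omega>0 \<omega>1. kpure X H (dif \<Omega> \<omega>0) \<omega>1))) \<and>
     (\<forall>k. \<forall>\<omega>\<in>deg \<Omega> k. wlco \<Omega> (Suc k) (dif \<Omega> \<omega>) =
        (let X = forms \<Omega> (Suc k) in
         sw (ktens H X) (wlco \<Omega> k \<omega>) (\<lambda>\<omega>1 \<omega>0. kpure H X \<omega>1 (dif \<Omega> \<omega>0))))"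

definition wedge ::
  "('k::field, 'h::ring_1, 'w::ring_1) calculus \<Rightarrow> nat \<Rightarrow> nat \<Rightarrow> ('w \<times> 'w \<Rightarrow>\<^sub>0 'k) \<Rightarrow> 'w" where
  "wedge \<Omega> k l t = sw (forms \<Omega> (k + l)) t (\<lambda>\<omega> \<eta>. \<omega> * \<eta>)"

text \<open>\<open>id\<^sub>X \<otimes> \<and> : (X \<otimes>\<^sub>H \<Omega>\<^sup>k) \<otimes>\<^sub>H \<Omega>\<^sup>l \<rightarrow> X \<otimes>\<^sub>H \<Omega>\<^sup>k\<^sup>+\<^sup>l\<close>. For \<open>X = M \<otimes>\<^sub>H N\<close> this is \<open>\<and>\<^sub>3\<^sub>4\<close>.\<close>

definition wedge_last ::
  "('k::field, 'h::ring_1) hopf \<Rightarrow> ('k, 'h, 'w::ring_1) calculus \<Rightarrow>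
   ('k, 'h, 'x::ab_group_add) bcb \<Rightarrow> nat \<Rightarrow> nat \<Rightarrow>
   (('x \<times> 'w \<Rightarrow>\<^sub>0 'k) \<times> 'w \<Rightarrow>\<^sub>0 'k) \<Rightarrow> ('x \<times> 'w \<Rightarrow>\<^sub>0 'k)" where
  "wedge_last H \<Omega> X k l =
     hmap H X (forms \<Omega> (k + l)) id (wedge \<Omega> k l) \<circ> hassoc H X (forms \<Omega> k) (forms \<Omega> l)"


section \<open>Right connections\<close>

definition connections ::
  "('k::field, 'h::ring_1) hopf \<Rightarrow> ('k, 'h, 'w::ring_1) calculus \<Rightarrow>
   ('k, 'h, 'm::ab_group_add) bcb \<Rightarrow> ('m \<Rightarrow> ('m \<times> 'w \<Rightarrow>\<^sub>0 'k)) set" where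
  "connections H \<Omega> M =
     {D. klinear M (M \<otimes>\<^bsub>H\<^esub> forms \<Omega> 1) D \<and>
          (\<forall>m\<in>car M. \<forall>a. D (ract M m a) =
             ract (M \<otimes>\<^bsub>H\<^esub> forms \<Omega> 1) (D m) a + hpure M (forms \<Omega> 1) m (dif \<Omega> (emb \<Omega> a)))}"

definition canonical_connection ::
  "('k::field, 'h::ring_1) hopf \<Rightarrow> ('k, 'h, 'w::ring_1) calculus \<Rightarrow>
   ('k, 'h, 'm::ab_group_add) bcb \<Rightarrow> 'm \<Rightarrow> ('m \<times> 'w \<Rightarrow>\<^sub>0 'k)" where
  "canonical_connection H \<Omega> M m =
     (let T = M \<otimes>\<^bsub>H\<^esub> forms \<Omega> 1 in
      sw T (rco M m) (\<lambda>m0 h. sw T (comult H h) (\<lambda>m1 m2.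
        hpure M (forms \<Omega> 1) (ract M m0 (antip H m1)) (dif \<Omega> (emb \<Omega> m2)))))"

text \<open>\<open>\<nabla>\<^sup>\<bullet> : M \<otimes>\<^sub>H \<Omega>\<^sup>k \<rightarrow> M \<otimes>\<^sub>H \<Omega>\<^sup>k\<^sup>+\<^sup>1\<close>.\<close>

definition connection_ext ::
  "('k::field, 'h::ring_1) hopf \<Rightarrow> ('k, 'h, 'w::ring_1) calculus \<Rightarrow>
   ('k, 'h, 'm::ab_group_add) bcb \<Rightarrow> ('m \<Rightarrow> ('m \<times> 'w \<Rightarrow>\<^sub>0 'k)) \<Rightarrow> nat \<Rightarrow>
   ('m \<times> 'w \<Rightarrow>\<^sub>0 'k) \<Rightarrow> ('m \<times> 'w \<Rightarrow>\<^sub>0 'k)" where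
  "connection_ext H \<Omega> M D k t =
     sw (M \<otimes>\<^bsub>H\<^esub> forms \<Omega> (1 + k)) t (\<lambda>m \<omega>.
       wedge_last H \<Omega> M 1 k (hpure (M \<otimes>\<^bsub>H\<^esub> forms \<Omega> 1) (forms \<Omega> k) (D m) \<omega>) +
       hpure M (forms \<Omega> (1 + k)) m (dif \<Omega> \<omega>))"

definition curvature ::
  "('k::field, 'h::ring_1) hopf \<Rightarrow> ('k, 'h, 'w::ring_1) calculus \<Rightarrow>
   ('k, 'h, 'm::ab_group_add) bcb \<Rightarrow> ('m \<Rightarrow> ('m \<times> 'w \<Rightarrow>\<^sub>0 'k)) \<Rightarrow> 'm \<Rightarrow> ('m \<times> 'w \<Rightarrow>\<^sub>0 'k)" where
  "curvature H \<Omega> M D = connection_ext H \<Omega> M D 1 \<circ> D"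

definition connection_sum ::
  "('k::field, 'h::ring_1) hopf \<Rightarrow> ('k, 'h, 'w::ring_1) calculus \<Rightarrow>
   ('k, 'h, 'm::ab_group_add) bcb \<Rightarrow> ('k, 'h, 'n::ab_group_add) bcb \<Rightarrow>
   ('m \<Rightarrow> ('m \<times> 'w \<Rightarrow>\<^sub>0 'k)) \<Rightarrow> ('n \<Rightarrow> ('n \<times> 'w \<Rightarrow>\<^sub>0 'k)) \<Rightarrow>
   ('m \<times> 'n \<Rightarrow>\<^sub>0 'k) \<Rightarrow> (('m \<times> 'n \<Rightarrow>\<^sub>0 'k) \<times> 'w \<Rightarrow>\<^sub>0 'k)" where
  "connection_sum H \<Omega> M N DM DN t =
     (let X = forms \<Omega> 1; T = (M \<otimes>\<^bsub>H\<^esub> N) \<otimes>\<^bsub>H\<^esub> X; S = antip H in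
      sw T t (\<lambda>m n.
        sw T (rco M m) (\<lambda>m0 h. sw T (comult H h) (\<lambda>m1 m2.
          sigma23 H M X N
            (hpure (M \<otimes>\<^bsub>H\<^esub> X) N (DM (ract M m0 (S m1))) (lact N m2 n)))) +
        sw T (ad_left H N (N \<otimes>\<^bsub>H\<^esub> X) DN) (\<lambda>g D0. sw T (comult H g) (\<lambda>D2 D1.
        sw T (rco M m) (\<lambda>m0 h. sw T (comult H h) (\<lambda>m1 m2.
          hassoc_inv H M N X
            (hpure M (N \<otimes>\<^bsub>H\<^esub> X) (ract M (lact M D2 m0) (S (D1 * m1))) (D0 (lact N m2 n)))))))))"

end

theory Submission
  imports Defs
begin

text \<open>
  Write \<open>h \<triangleright> m = h\<^sub>1 m S(h\<^sub>2)\<close>. A bicovariant bimodule is generated as a right \<open>H\<close>-module by its right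
  coinvariants, so \<open>M \<otimes>\<^sub>H N\<close> is generated by the elements \<open>m \<otimes> n\<close> with \<open>m\<close>, \<open>n\<close> right coinvariant.
  On these \<open>d\<^sup>M\<close> and \<open>d\<^sup>N\<close> vanish, the braiding becomes \<open>\<sigma>(\<omega> \<otimes> n) = \<omega>\<^sub>-\<^sub>1 \<triangleright> n \<otimes> \<omega>\<^sub>0\<close>, the product of
  rational maps becomes \<open>(\<phi> \<otimes>\<^sub>\<sigma> \<psi>)(m \<otimes> n) = \<phi>(\<psi>\<^sub>-\<^sub>1 \<triangleright> m) \<otimes> \<psi>\<^sub>0(n)\<close>, and with \<open>A = \<nabla>\<^sup>M - d\<^sup>M\<close>,
  \<open>B = \<nabla>\<^sup>N - d\<^sup>N\<close> the sum of the connections is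
  \<open>m \<otimes> n \<mapsto> \<sigma>\<^sub>2\<^sub>3(A(m) \<otimes> n) + B\<^sub>-\<^sub>1 \<triangleright> m \<otimes> B\<^sub>0(n)\<close>. Applying its extension to these two terms
  separately, the first gives the addends with \<open>R\<close> of \<open>\<nabla>\<^sup>M\<close> and with \<open>A\<close> before \<open>B\<close>, the second the
  addends with \<open>A \<otimes>\<^sub>\<sigma> B\<close> and with \<open>R\<close> of \<open>\<nabla>\<^sup>N\<close>; for the last one \<open>\<lambda>\<^sup>A\<^sup>d\<close> of the curvature is found
  from its multiplicativity along \<open>\<nabla>\<^sup>N\<^sup>\<bullet> \<circ> \<nabla>\<^sup>N\<close>. Both sides are right \<open>H\<close>-linear.
\<close>

section \<open>Linear algebra with carriers\<close>

text \<open>The braiding, \<phi> \<otimes>_\<sigma> \<psi> and the sum of connections all contain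
  m_0 S(m_1) \<otimes> m_2. At m b with m coinvariant this collapses: m b_1 S(b_2) \<otimes> b_3 = m
  \<otimes> b. Balancedness, which each definition leaves open, is checked on such elements. The
  main obstacle is \<lambda>^Ad. A Sweedler sum runs over a chosen normal form whose components have
  no useful property, whereas right linearity of \<phi> \<otimes>_\<sigma> \<psi> and extension of
  the components to forms ask for right linear ones. So \<lambda>^Ad is handled through arbitrary
  formal representatives (\<open>lrep\<close>); one with right linear components exists on a
  finitely generated module, and \<open>ad_left\<close> is recovered by uniqueness. For tensor
  products the axioms of a bicovariant bimodule are replaced by the predicates
  \<open>rcomod\<close>, \<open>lcomod\<close>, \<open>cogen\<close> and \<open>lcov\<close>, which
  isolate the consequences that the argument takes from them. For the same reason
  \<open>coinv\<close> is stated through the orbit m b.\<close>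

named_theorems klin

lemma vspace_vector_space: "vspace X \<Longrightarrow> vector_space (scl X)"
  by (simp add: vspace_def)

lemma vspace_subspace: "vspace X \<Longrightarrow> module.subspace (scl X) (car X)"
  by (simp add: vspace_def)

lemma vspace_closed:
  assumes "vspace X"
  shows vspace_zero: "0 \<in> car X"
    and vspace_add: "x \<in> car X \<Longrightarrow> y \<in> car X \<Longrightarrow> x + y \<in> car X"
    and vspace_scl: "x \<in> car X \<Longrightarrow> scl X c x \<in> car X"
    and vspace_diff: "x \<in> car X \<Longrightarrow> y \<in> car X \<Longrightarrow> x - y \<in> car X"
    and vspace_sum: "(\<And>i. i \<in> I \<Longrightarrow> g i \<in> car X) \<Longrightarrow> sum g I \<in> car X"
proof -
  interpret vector_space "scl X" using assms by (rule vspace_vector_space)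
  have sp: "subspace (car X)" using assms by (rule vspace_subspace)
  show "0 \<in> car X" "x \<in> car X \<Longrightarrow> y \<in> car X \<Longrightarrow> x + y \<in> car X"
    "x \<in> car X \<Longrightarrow> scl X c x \<in> car X" "x \<in> car X \<Longrightarrow> y \<in> car X \<Longrightarrow> x - y \<in> car X"
    "(\<And>i. i \<in> I \<Longrightarrow> g i \<in> car X) \<Longrightarrow> sum g I \<in> car X"
    by (fact subspace_0[OF sp] subspace_add[OF sp] subspace_scale[OF sp] subspace_diff[OF sp]
        subspace_sum[OF sp])+
qed

lemma vspace_scl_simps:
  assumes "vspace X"
  shows "scl X c (x + y) = scl X c x + scl X c y" "scl X (c + d) x = scl X c x + scl X d x"
    "scl X c (scl X d x) = scl X (c * d) x" "scl X 1 x = x" "scl X c 0 = 0" "scl X 0 x = 0"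
    "scl X c (x - y) = scl X c x - scl X c y"
proof -
  interpret vector_space "scl X" using assms by (rule vspace_vector_space)
  show "scl X c (x + y) = scl X c x + scl X c y" "scl X (c + d) x = scl X c x + scl X d x"
    "scl X c (scl X d x) = scl X (c * d) x" "scl X 1 x = x" "scl X c 0 = 0" "scl X 0 x = 0"
    "scl X c (x - y) = scl X c x - scl X c y"
    by (simp_all add: scale_right_distrib scale_left_distrib scale_right_diff_distrib)
qed

lemma klinear_closed: "klinear X Y f \<Longrightarrow> x \<in> car X \<Longrightarrow> f x \<in> car Y"
  and klinear_add: "klinear X Y f \<Longrightarrow> x \<in> car X \<Longrightarrow> y \<in> car X \<Longrightarrow> f (x + y) = f x + f y"
  and klinear_scl: "klinear X Y f \<Longrightarrow> x \<in> car X \<Longrightarrow> f (scl X c x) = scl Y c (f x)"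
  by (simp_all add: klinear_def)

lemma klinearI:
  assumes "\<And>x. x \<in> car X \<Longrightarrow> f x \<in> car Y"
    and "\<And>x y. x \<in> car X \<Longrightarrow> y \<in> car X \<Longrightarrow> f (x + y) = f x + f y"
    and "\<And>c x. x \<in> car X \<Longrightarrow> f (scl X c x) = scl Y c (f x)"
  shows "klinear X Y f"
  using assms by (simp add: klinear_def)

lemma klinear_zero: "klinear X Y f \<Longrightarrow> vspace X \<Longrightarrow> f 0 = 0"
  using klinear_add[of X Y f 0 0] vspace_zero[of X] by simp

lemma klinear_diff:
  assumes "klinear X Y f" "vspace X" "x \<in> car X" "y \<in> car X"
  shows "f (x - y) = f x - f y"
  using klinear_add[of X Y f "x - y" y] assms vspace_diff[of X x y] by simp

lemma klinear_sum:
  assumes "klinear X Y f" "vspace X" "\<And>i. i \<in> I \<Longrightarrow> g i \<in> car X"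
  shows "f (sum g I) = (\<Sum>i\<in>I. f (g i))"
  using assms(3)
proof (induction I rule: infinite_finite_induct)
  case (insert i I)
  then show ?case using klinear_add[OF assms(1), of "g i" "sum g I"] vspace_sum[OF assms(2), of I g]
    by simp
qed (use klinear_zero[OF assms(1,2)] in auto)

lemma klinear_cong:
  assumes "klinear X Y f" "vspace X" "\<And>x. x \<in> car X \<Longrightarrow> f x = g x"
  shows "klinear X Y g"
proof (rule klinearI)
  fix x y c assume x: "x \<in> car X"
  show "g x \<in> car Y" using klinear_closed[OF assms(1) x] assms(3)[OF x] by simp
  show "g (scl X c x) = scl Y c (g x)"
    using klinear_scl[OF assms(1) x] assms(3)[OF x] assms(3)[OF vspace_scl[OF assms(2) x]] by simp
  assume y: "y \<in> car X"
  show "g (x + y) = g x + g y"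
    using klinear_add[OF assms(1) x y] assms(3)[OF x] assms(3)[OF y]
      assms(3)[OF vspace_add[OF assms(2) x y]] by simp
qed

lemma klinear_comp:
  "klinear X Y f \<Longrightarrow> klinear Y Z g \<Longrightarrow> klinear X Z (\<lambda>x. g (f x))"
  by (simp add: klinear_def)

text \<open>The rules collected in \<open>klin\<close> carry an inner map in their conclusion
  instead of being stated for a bare operation. Resolution with them proves linearity of a nested
  Sweedler expression in any one of its variables; a proof only adds the rules for the maps at
  hand.\<close>

lemma klinear_id [klin]: "klinear X X (\<lambda>x. x)"
  by (simp add: klinear_def)

lemma klinear_const_0 [klin]: "vspace Y \<Longrightarrow> klinear X Y (\<lambda>x. 0)"
  by (simp add: klinear_def vspace_zero vspace_scl_simps)

lemma klinear_plus [klin]: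
  "vspace Y \<Longrightarrow> klinear X Y f \<Longrightarrow> klinear X Y g \<Longrightarrow> klinear X Y (\<lambda>x. f x + g x)"
  by (simp add: klinear_def vspace_add vspace_scl_simps)

lemma klinear_minus [klin]:
  "vspace Y \<Longrightarrow> klinear X Y f \<Longrightarrow> klinear X Y g \<Longrightarrow> klinear X Y (\<lambda>x. f x - g x)"
  by (simp add: klinear_def vspace_diff vspace_scl_simps)

lemma klinear_scale [klin]:
  "vspace Y \<Longrightarrow> klinear X Y f \<Longrightarrow> klinear X Y (\<lambda>x. scl Y c (f x))"
  by (simp add: klinear_def vspace_scl vspace_scl_simps mult.commute)

definition bilin ::
  "('k::field, 'a::ab_group_add, 'y) vsp_scheme \<Rightarrow> ('k, 'b::ab_group_add, 'z) vsp_scheme \<Rightarrow>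
   ('k, 'c::ab_group_add, 'w) vsp_scheme \<Rightarrow> ('a \<Rightarrow> 'b \<Rightarrow> 'c) \<Rightarrow> bool" where
  "bilin X Y Z f \<longleftrightarrow>
     (\<forall>y\<in>car Y. klinear X Z (\<lambda>x. f x y)) \<and> (\<forall>x\<in>car X. klinear Y Z (\<lambda>y. f x y))"

lemma bilinI:
  assumes "\<And>y. y \<in> car Y \<Longrightarrow> klinear X Z (\<lambda>x. f x y)"
    and "\<And>x. x \<in> car X \<Longrightarrow> klinear Y Z (\<lambda>y. f x y)"
  shows "bilin X Y Z f"
  using assms by (simp add: bilin_def)

lemma bilin_left: "bilin X Y Z f \<Longrightarrow> y \<in> car Y \<Longrightarrow> klinear X Z (\<lambda>x. f x y)"
  and bilin_right: "bilin X Y Z f \<Longrightarrow> x \<in> car X \<Longrightarrow> klinear Y Z (\<lambda>y. f x y)"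
  by (simp_all add: bilin_def)

lemma bilin_closed: "bilin X Y Z f \<Longrightarrow> x \<in> car X \<Longrightarrow> y \<in> car Y \<Longrightarrow> f x y \<in> car Z"
  using klinear_closed[of X Z "\<lambda>x. f x y" x] bilin_left[of X Y Z f y] by simp

lemma bilin_comp_left:
  "bilin X Y Z f \<Longrightarrow> klinear W X g \<Longrightarrow> y \<in> car Y \<Longrightarrow> klinear W Z (\<lambda>w. f (g w) y)"
  using klinear_comp[of W X g Z "\<lambda>x. f x y"] bilin_left[of X Y Z f y] by simp

lemma bilin_comp_right:
  "bilin X Y Z f \<Longrightarrow> klinear W Y g \<Longrightarrow> x \<in> car X \<Longrightarrow> klinear W Z (\<lambda>w. f x (g w))"
  using klinear_comp[of W Y g Z "f x"] bilin_right[of X Y Z f x] by simp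

section \<open>Sweedler sums\<close>

lemma sw_linear:
  fixes Z :: "('k::field, 'c::ab_group_add, 'z) vsp_scheme"
    and s t :: "'a \<times> 'b \<Rightarrow>\<^sub>0 'k"
  assumes "vspace Z"
  shows sw_add: "sw Z (s + t) f = sw Z s f + sw Z t f"
    and sw_diff: "sw Z (s - t) f = sw Z s f - sw Z t f"
    and sw_fscale: "sw Z (fscale c t) f = scl Z c (sw Z t f)"
    and sw_sum: "sw Z (sum u I) f = (\<Sum>i\<in>I. sw Z (u i) f)"
proof -
  interpret Vector_Spaces.linear fscale "scl Z" "\<lambda>t. sw Z t f"
    using assms by (intro linear_sw vspace_vector_space)
  show "sw Z (s + t) f = sw Z s f + sw Z t f" "sw Z (s - t) f = sw Z s f - sw Z t f"
    "sw Z (fscale c t) f = scl Z c (sw Z t f)"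
    "sw Z (sum u I) f = (\<Sum>i\<in>I. sw Z (u i) f)"
    by (simp_all add: add diff scale sum)
qed

lemma sw_single: "vspace Z \<Longrightarrow> sw Z (gen x y) f = f x y"
  by (simp add: sw_gen vspace_vector_space)

lemma sw_cong: "(\<And>x y. (x, y) \<in> Poly_Mapping.keys t \<Longrightarrow> f x y = g x y) \<Longrightarrow> sw Z t f = sw Z t g"
  unfolding sw_def by (rule sum.cong) auto

lemma sw_scl_cong: "scl Z = scl Z' \<Longrightarrow> sw Z = sw Z'"
  by (auto simp: sw_def fun_eq_iff)

lemma sw_plus: "vspace Z \<Longrightarrow> sw Z t (\<lambda>x y. f x y + g x y) = sw Z t f + sw Z t g"
  by (simp add: sw_def vspace_scl_simps split_def sum.distrib)

lemma sw_scale: "vspace Z \<Longrightarrow> sw Z t (\<lambda>x y. scl Z c (f x y)) = scl Z c (sw Z t f)"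
proof -
  assume Z: "vspace Z"
  interpret vector_space "scl Z" using Z by (rule vspace_vector_space)
  show ?thesis by (simp add: sw_def split_def scale_sum_right mult.commute)
qed

lemma sw_zero: "vspace Z \<Longrightarrow> sw Z t (\<lambda>x y. 0) = 0"
  by (simp add: sw_def vspace_scl_simps)

lemma sw_closed:
  "vspace Z \<Longrightarrow> (\<And>x y. (x, y) \<in> Poly_Mapping.keys t \<Longrightarrow> f x y \<in> car Z) \<Longrightarrow> sw Z t f \<in> car Z"
  unfolding sw_def by (auto intro!: vspace_sum vspace_scl)

lemma sw_swap:
  assumes "vspace Z"
  shows "sw Z s (\<lambda>a b. sw Z t (\<lambda>c d. F a b c d)) = sw Z t (\<lambda>c d. sw Z s (\<lambda>a b. F a b c d))"
proof -
  interpret vector_space "scl Z" using assms by (rule vspace_vector_space)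
  show ?thesis
    unfolding sw_def split_def scale_sum_right scale_scale
    by (subst sum.swap) (simp add: mult.commute)
qed

text \<open>\<open>sw Z _ g\<close> is linear on formal sums. The Hopf and comodule axioms are
  equations between tensors written as Sweedler sums; applying \<open>sw Z _ g\<close> to both sides
  turns each of them into a rule for arbitrary multilinear expressions.\<close>

lemma sw_sw:
  assumes "vspace Z" "scl T = fscale"
  shows "sw Z (sw T t f) g = sw Z t (\<lambda>x y. sw Z (f x y) g)"
proof -
  interpret Vector_Spaces.linear fscale "scl Z" "\<lambda>t. sw Z t g"
    using assms by (intro linear_sw vspace_vector_space)
  show ?thesis by (simp add: sw_def[of T] assms(2) sum scale split_def)
      (simp add: sw_def[of Z t] split_def)
qed

lemma klinear_sw_apply:
  assumes "klinear Z Z' L" "vspace Z"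
    and "\<And>x y. (x, y) \<in> Poly_Mapping.keys t \<Longrightarrow> f x y \<in> car Z"
  shows "L (sw Z t f) = sw Z' t (\<lambda>x y. L (f x y))"
proof -
  have "L (sw Z t f) =
      (\<Sum>p\<in>Poly_Mapping.keys t. L (scl Z (Poly_Mapping.lookup t p) (case_prod f p)))"
    unfolding sw_def split_def
    by (subst klinear_sum[OF assms(1,2)]) (auto intro!: vspace_scl assms)
  also have "\<dots> = sw Z' t (\<lambda>x y. L (f x y))"
    unfolding sw_def split_def
    by (rule sum.cong) (auto intro!: klinear_scl[OF assms(1)] assms(3))
  finally show ?thesis .
qed

text \<open>A Sweedler sum runs over the generators of one particular formal sum. That these lie in
  the carriers is what congruence, closure and linearity of such sums depend on.\<close>

definition tset ::
  "('k::field, 'a::ab_group_add, 'y) vsp_scheme \<Rightarrow> ('k, 'b::ab_group_add, 'z) vsp_scheme \<Rightarrow>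
   ('a \<times> 'b \<Rightarrow>\<^sub>0 'k) set" where
  "tset X Y = {t. Poly_Mapping.keys t \<subseteq> car X \<times> car Y}"

lemma tset_keys:
  "t \<in> tset X Y \<Longrightarrow> (x, y) \<in> Poly_Mapping.keys t \<Longrightarrow> x \<in> car X"
  "t \<in> tset X Y \<Longrightarrow> (x, y) \<in> Poly_Mapping.keys t \<Longrightarrow> y \<in> car Y"
  by (auto simp: tset_def)

lemma sw_tset_cong:
  "t \<in> tset X Y \<Longrightarrow> (\<And>x y. x \<in> car X \<Longrightarrow> y \<in> car Y \<Longrightarrow> f x y = g x y) \<Longrightarrow> sw Z t f = sw Z t g"
  by (rule sw_cong) (auto dest: tset_keys)

lemma sw_tset_closed:
  "vspace Z \<Longrightarrow> t \<in> tset X Y \<Longrightarrow> (\<And>x y. x \<in> car X \<Longrightarrow> y \<in> car Y \<Longrightarrow> f x y \<in> car Z) \<Longrightarrow>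
   sw Z t f \<in> car Z"
  by (rule sw_closed) (auto dest: tset_keys)

lemma sw_tset_apply:
  "klinear Z Z' L \<Longrightarrow> vspace Z \<Longrightarrow> t \<in> tset X Y \<Longrightarrow>
   (\<And>x y. x \<in> car X \<Longrightarrow> y \<in> car Y \<Longrightarrow> f x y \<in> car Z) \<Longrightarrow>
   L (sw Z t f) = sw Z' t (\<lambda>x y. L (f x y))"
  by (rule klinear_sw_apply) (auto dest: tset_keys)

lemma klinear_sw_keys:
  assumes "vspace Z" and "\<And>x y. (x, y) \<in> Poly_Mapping.keys t \<Longrightarrow> klinear W Z (F x y)"
  shows "klinear W Z (\<lambda>w. sw Z t (\<lambda>x y. F x y w))"
proof (rule klinearI)
  fix w w' c assume w: "w \<in> car W"
  show "sw Z t (\<lambda>x y. F x y w) \<in> car Z"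
    by (rule sw_closed[OF assms(1)]) (use assms(2) w klinear_closed in blast)
  show "sw Z t (\<lambda>x y. F x y (scl W c w)) = scl Z c (sw Z t (\<lambda>x y. F x y w))"
    unfolding sw_scale[OF assms(1), symmetric]
    by (rule sw_cong) (use assms(2) w klinear_scl in blast)
  assume w': "w' \<in> car W"
  show "sw Z t (\<lambda>x y. F x y (w + w')) = sw Z t (\<lambda>x y. F x y w) + sw Z t (\<lambda>x y. F x y w')"
    unfolding sw_plus[OF assms(1), symmetric]
    by (rule sw_cong) (use assms(2) w w' klinear_add in blast)
qed

lemma klinear_sw_right:
  assumes "vspace Z" "t \<in> tset X Y"
    and "\<And>x y. x \<in> car X \<Longrightarrow> y \<in> car Y \<Longrightarrow> klinear W Z (\<lambda>w. F x y w)"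
  shows "klinear W Z (\<lambda>w. sw Z t (\<lambda>x y. F x y w))"
  by (rule klinear_sw_keys[OF assms(1) assms(3)]) (use tset_keys[OF assms(2)] in blast)+

lemma klinear_sw_left:
  assumes "klinear W T g" "scl T = fscale" "car T \<subseteq> tset X Y" "vspace Z"
    and "\<And>x y. x \<in> car X \<Longrightarrow> y \<in> car Y \<Longrightarrow> F x y \<in> car Z"
  shows "klinear W Z (\<lambda>w. sw Z (g w) F)"
proof (rule klinearI)
  fix w w' c assume w: "w \<in> car W"
  show "sw Z (g w) F \<in> car Z"
    by (rule sw_tset_closed[OF assms(4)])
      (use assms(3) klinear_closed[OF assms(1) w] in \<open>blast intro: assms(5)\<close>)+
  show "sw Z (g (scl W c w)) F = scl Z c (sw Z (g w) F)"
    by (simp add: klinear_scl[OF assms(1) w] assms(2) sw_fscale[OF assms(4)])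
  assume w': "w' \<in> car W"
  show "sw Z (g (w + w')) F = sw Z (g w) F + sw Z (g w') F"
    by (simp add: klinear_add[OF assms(1) w w'] sw_add[OF assms(4)])
qed

section \<open>Quotients of free vector spaces by bilinear relations\<close>

lemma subspace_tset:
  fixes X :: "('k::field, 'a::ab_group_add, 'y) vsp_scheme"
    and Y :: "('k, 'b::ab_group_add, 'z) vsp_scheme"
  shows "module.subspace fscale (tset X Y)"
proof -
  interpret vector_space "fscale :: 'k \<Rightarrow> ('a \<times> 'b \<Rightarrow>\<^sub>0 'k) \<Rightarrow> _" by (rule vector_space_fscale)
  show ?thesis
  proof (rule subspaceI)
    fix s t :: "'a \<times> 'b \<Rightarrow>\<^sub>0 'k" and c
    assume "s \<in> tset X Y"
    then show "fscale c s \<in> tset X Y" by (auto simp: tset_def in_keys_iff)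
    assume "t \<in> tset X Y"
    with \<open>s \<in> tset X Y\<close> show "s + t \<in> tset X Y"
      using Poly_Mapping.keys_add[of s t] by (auto simp: tset_def)
  qed (simp add: tset_def)
qed

lemma tset_gen: "x \<in> car X \<Longrightarrow> y \<in> car Y \<Longrightarrow> gen x y \<in> tset X Y"
  by (simp add: tset_def gen_def)

lemma tset_closed:
  fixes X :: "('k::field, 'a::ab_group_add, 'y) vsp_scheme"
    and Y :: "('k, 'b::ab_group_add, 'z) vsp_scheme"
  shows "s \<in> tset X Y \<Longrightarrow> t \<in> tset X Y \<Longrightarrow> s + t \<in> tset X Y"
  "s \<in> tset X Y \<Longrightarrow> t \<in> tset X Y \<Longrightarrow> s - t \<in> tset X Y"
  "s \<in> tset X Y \<Longrightarrow> fscale c s \<in> tset X Y"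
  "0 \<in> tset X Y"
proof -
  interpret vector_space "fscale :: 'k \<Rightarrow> ('a \<times> 'b \<Rightarrow>\<^sub>0 'k) \<Rightarrow> _" by (rule vector_space_fscale)
  show "s \<in> tset X Y \<Longrightarrow> t \<in> tset X Y \<Longrightarrow> s + t \<in> tset X Y"
    "s \<in> tset X Y \<Longrightarrow> t \<in> tset X Y \<Longrightarrow> s - t \<in> tset X Y"
    "s \<in> tset X Y \<Longrightarrow> fscale c s \<in> tset X Y"
    "0 \<in> tset X Y"
    by (fact subspace_add[OF subspace_tset] subspace_diff[OF subspace_tset]
        subspace_scale[OF subspace_tset] subspace_0[OF subspace_tset])+
qed

text \<open>As target of \<open>sw\<close> it produces formal sums before any quotient is taken.
  Representatives of elements of H \<otimes> Hom are built in this way.\<close>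

definition free_vsp :: "('k::field, 'p \<Rightarrow>\<^sub>0 'k) vsp" where
  "free_vsp = \<lparr> car = UNIV, scl = fscale \<rparr>"

lemma free_vsp_simps [simp]: "car free_vsp = UNIV" "scl free_vsp = fscale"
  by (simp_all add: free_vsp_def)

lemma nf_linear:
  shows nf_add: "nf R (s + t) = nf R s + nf R t"
    and nf_diff: "nf R (s - t) = nf R s - nf R t"
    and nf_fscale: "nf R (fscale c t) = fscale c (nf R t)"
    and nf_0: "nf R 0 = 0"
    and nf_sum: "nf R (sum u I) = (\<Sum>i\<in>I. nf R (u i))"
proof -
  interpret Vector_Spaces.linear fscale fscale "nf R" using nf_spec by blast
  show "nf R (s + t) = nf R s + nf R t" "nf R (s - t) = nf R s - nf R t"
    "nf R (fscale c t) = fscale c (nf R t)" "nf R 0 = 0"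
    "nf R (sum u I) = (\<Sum>i\<in>I. nf R (u i))"
    by (simp_all add: add diff scale zero sum)
qed

lemma nf_nf [simp]: "nf R (nf R t) = nf R t"
  using nf_spec[of R] by blast

lemma nf_rel: "r \<in> R \<Longrightarrow> nf R r = 0"
proof -
  interpret vector_space "fscale :: 'k::field \<Rightarrow> ('p \<Rightarrow>\<^sub>0 'k) \<Rightarrow> _" by (rule vector_space_fscale)
  show "r \<in> R \<Longrightarrow> nf R r = 0" using nf_spec[of R] span_base by blast
qed

text \<open>Both \<open>ktens X Y\<close> and \<open>htens H M N\<close> are instances, with \<open>R\<close> = \<open>krel\<close> or \<open>hrel\<close>.\<close>

definition istens ::
  "('a \<times> 'b \<Rightarrow>\<^sub>0 'k::field) set \<Rightarrow> ('k, 'a::ab_group_add, 'y) vsp_scheme \<Rightarrow>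
   ('k, 'b::ab_group_add, 'z) vsp_scheme \<Rightarrow> ('k, 'a \<times> 'b \<Rightarrow>\<^sub>0 'k, 'w) vsp_scheme \<Rightarrow> bool" where
  "istens R X Y T \<longleftrightarrow> vspace X \<and> vspace Y \<and> krel X Y \<subseteq> R \<and> R \<subseteq> tset X Y \<and>
     car T = nf R ` tset X Y \<and> scl T = fscale"

context
  fixes R :: "('a::ab_group_add \<times> 'b::ab_group_add \<Rightarrow>\<^sub>0 'k::field) set"
    and X :: "('k, 'a, 'y) vsp_scheme" and Y :: "('k, 'b, 'z) vsp_scheme"
    and T :: "('k, 'a \<times> 'b \<Rightarrow>\<^sub>0 'k, 'w) vsp_scheme"
  assumes T: "istens R X Y T"
begin

lemma istens_scl: "scl T = fscale" and istens_car: "car T = nf R ` tset X Y"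
  using T by (simp_all add: istens_def)

text \<open>The projection \<open>nf R\<close> is an arbitrary choice, but it changes t only by an
  element of the span of R, and all relations in R have their generators in the carriers. Hence the
  components of a normal form may be assumed to lie in the carriers.\<close>

lemma istens_nf_tset: "t \<in> tset X Y \<Longrightarrow> nf R t \<in> tset X Y"
proof -
  interpret vector_space "fscale :: 'k \<Rightarrow> ('a \<times> 'b \<Rightarrow>\<^sub>0 'k) \<Rightarrow> _" by (rule vector_space_fscale)
  assume t: "t \<in> tset X Y"
  have "nf R t - t \<in> span R" using nf_eq_iff[of R "nf R t" t] by simp
  moreover have "span R \<subseteq> tset X Y"
    using T by (intro span_minimal subspace_tset) (simp add: istens_def)
  ultimately have "(nf R t - t) + t \<in> tset X Y" using t by (intro tset_closed(1)) auto
  then show ?thesis by simp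
qed

lemma istens_tset: "car T \<subseteq> tset X Y"
  using istens_nf_tset by (auto simp: istens_car)

lemma istens_nf: "t \<in> car T \<Longrightarrow> nf R t = t"
  by (auto simp: istens_car)

lemma istens_vspace: "vspace T"
proof -
  interpret vector_space "fscale :: 'k \<Rightarrow> ('a \<times> 'b \<Rightarrow>\<^sub>0 'k) \<Rightarrow> _" by (rule vector_space_fscale)
  have "subspace (nf R ` tset X Y)"
  proof (rule subspaceI)
    have "nf R 0 \<in> nf R ` tset X Y" by (intro imageI tset_closed)
    then show "0 \<in> nf R ` tset X Y" by (simp add: nf_0)
    show "x + y \<in> nf R ` tset X Y" if "x \<in> nf R ` tset X Y" "y \<in> nf R ` tset X Y" for x y
      using that by (auto simp: nf_add[symmetric] intro!: imageI tset_closed)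
    show "fscale c x \<in> nf R ` tset X Y" if "x \<in> nf R ` tset X Y" for c x
      using that by (auto simp: nf_fscale[symmetric] intro!: imageI tset_closed)
  qed
  then show ?thesis by (simp add: vspace_def istens_scl istens_car vector_space_fscale)
qed

lemma istens_pure: "x \<in> car X \<Longrightarrow> y \<in> car Y \<Longrightarrow> nf R (gen x y) \<in> car T"
  by (auto simp: istens_car intro: tset_gen)

lemma istens_bilin: "bilin X Y T (\<lambda>x y. nf R (gen x y))"
proof -
  have R: "krel X Y \<subseteq> R" using T by (simp add: istens_def)
  have 1: "nf R (gen (x + x') y) = nf R (gen x y) + nf R (gen x' y)"
    if "x \<in> car X" "x' \<in> car X" "y \<in> car Y" for x x' y
  proof -
    have "gen (x + x') y - gen x y - gen x' y \<in> krel X Y"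
      unfolding krel_def using that by blast
    then have "nf R (gen (x + x') y - gen x y - gen x' y) = 0" using R nf_rel by blast
    then show ?thesis unfolding nf_diff nf_fscale by (simp add: algebra_simps)
  qed
  have 2: "nf R (gen x (y + y')) = nf R (gen x y) + nf R (gen x y')"
    if "x \<in> car X" "y \<in> car Y" "y' \<in> car Y" for x y y'
  proof -
    have "gen x (y + y') - gen x y - gen x y' \<in> krel X Y"
      unfolding krel_def using that by blast
    then have "nf R (gen x (y + y') - gen x y - gen x y') = 0" using R nf_rel by blast
    then show ?thesis unfolding nf_diff nf_fscale by (simp add: algebra_simps)
  qed
  have 3: "nf R (gen (scl X c x) y) = fscale c (nf R (gen x y))"
    if "x \<in> car X" "y \<in> car Y" for c x y
  proof -
    have "gen (scl X c x) y - fscale c (gen x y) \<in> krel X Y"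
      unfolding krel_def using that by blast
    then have "nf R (gen (scl X c x) y - fscale c (gen x y)) = 0" using R nf_rel by blast
    then show ?thesis unfolding nf_diff nf_fscale by (simp add: algebra_simps)
  qed
  have 4: "nf R (gen x (scl Y c y)) = fscale c (nf R (gen x y))"
    if "x \<in> car X" "y \<in> car Y" for c x y
  proof -
    have "gen x (scl Y c y) - fscale c (gen x y) \<in> krel X Y"
      unfolding krel_def using that by blast
    then have "nf R (gen x (scl Y c y) - fscale c (gen x y)) = 0" using R nf_rel by blast
    then show ?thesis unfolding nf_diff nf_fscale by (simp add: algebra_simps)
  qed
  show ?thesis
    apply (rule bilinI)
     apply (rule klinearI)
       apply (rule istens_pure, assumption, assumption)
      apply (rule 1, assumption+)
     apply (unfold istens_scl)[1]
     apply (rule 3, assumption+)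
    apply (rule klinearI)
      apply (rule istens_pure, assumption, assumption)
     apply (rule 2, assumption+)
    apply (unfold istens_scl)[1]
    apply (rule 4, assumption+)
    done
qed

lemma nf_expand: "nf R t = sw T t (\<lambda>x y. nf R (gen x y))"
proof -
  have t: "t = (\<Sum>p\<in>Poly_Mapping.keys t. fscale (Poly_Mapping.lookup t p) (gen (fst p) (snd p)))"
    by (rule poly_mapping_eqI)
      (simp add: gen_def lookup_sum lookup_single when_def if_distrib sum.delta in_keys_iff cong: if_cong)
  show ?thesis
    by (subst t) (simp add: nf_sum nf_fscale sw_def istens_scl split_def)
qed

lemma istens_expand: "t \<in> car T \<Longrightarrow> t = sw T t (\<lambda>x y. nf R (gen x y))"
  using nf_expand[of t] istens_nf[of t] by simp

lemma istens_apply: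
  assumes "klinear T Z f" "t \<in> car T"
  shows "f t = sw Z t (\<lambda>x y. f (nf R (gen x y)))"
proof -
  have "f t = f (sw T t (\<lambda>x y. nf R (gen x y)))" using istens_expand[OF assms(2)] by simp
  also have "\<dots> = sw Z t (\<lambda>x y. f (nf R (gen x y)))"
    using assms istens_vspace istens_tset istens_pure by (intro sw_tset_apply[where X = X and Y = Y]) auto
  finally show ?thesis .
qed

lemma istens_eqI:
  assumes "klinear T Z f" "klinear T Z g" "t \<in> car T"
    and "\<And>x y. x \<in> car X \<Longrightarrow> y \<in> car Y \<Longrightarrow> f (nf R (gen x y)) = g (nf R (gen x y))"
  shows "f t = g t"
  unfolding istens_apply[OF assms(1,3)] istens_apply[OF assms(2,3)]
  by (rule sw_tset_cong) (use assms istens_tset in auto)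

end

lemma bilin_krel:
  assumes "bilin X Y Z f" "vspace Z" "r \<in> krel X Y"
  shows "sw Z r f = 0"
  using assms(1,3) unfolding krel_def bilin_def klinear_def
  by (auto simp: sw_diff[OF assms(2)] sw_fscale[OF assms(2)] sw_single[OF assms(2)])

lemma krel_tset:
  assumes "vspace X" "vspace Y"
  shows "krel X Y \<subseteq> tset X Y"
  unfolding krel_def using assms
  by (auto intro!: tset_closed tset_gen vspace_add vspace_scl)

lemma istens_ktens:
  "vspace X \<Longrightarrow> vspace Y \<Longrightarrow> istens (krel X Y) X Y (ktens X Y)"
  by (auto simp: istens_def ktens_def krel_tset) (auto simp: tset_def)

lemma ktens_scl [simp]: "scl (ktens X Y) = fscale"
  by (simp add: ktens_def)

lemma vspace_ktens [simp]: "vspace X \<Longrightarrow> vspace Y \<Longrightarrow> vspace (ktens X Y)"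
  by (rule istens_vspace[OF istens_ktens])

lemma ktens_tset: "vspace X \<Longrightarrow> vspace Y \<Longrightarrow> car (ktens X Y) \<subseteq> tset X Y"
  by (rule istens_tset[OF istens_ktens])

lemma bilin_kpure: "vspace X \<Longrightarrow> vspace Y \<Longrightarrow> bilin X Y (ktens X Y) (kpure X Y)"
  using istens_bilin[OF istens_ktens, of X Y] by (simp add: kpure_def[abs_def])

lemma kpure_closed [simp]:
  "vspace X \<Longrightarrow> vspace Y \<Longrightarrow> x \<in> car X \<Longrightarrow> y \<in> car Y \<Longrightarrow> kpure X Y x y \<in> car (ktens X Y)"
  by (rule bilin_closed[OF bilin_kpure])

lemma klinear_kpure_left [klin]:
  "vspace X \<Longrightarrow> vspace Y \<Longrightarrow> y \<in> car Y \<Longrightarrow> klinear W X g \<Longrightarrow>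
   klinear W (ktens X Y) (\<lambda>w. kpure X Y (g w) y)"
  by (erule bilin_comp_left[OF bilin_kpure]) auto

lemma klinear_kpure_right [klin]:
  "vspace X \<Longrightarrow> vspace Y \<Longrightarrow> x \<in> car X \<Longrightarrow> klinear W Y g \<Longrightarrow>
   klinear W (ktens X Y) (\<lambda>w. kpure X Y x (g w))"
  by (erule bilin_comp_right[OF bilin_kpure]) auto

lemma sw_kpure:
  "bilin X Y Z f \<Longrightarrow> vspace Z \<Longrightarrow> sw Z (kpure X Y x y) f = f x y"
  unfolding kpure_def by (subst sw_nf) (auto intro: bilin_krel simp: vspace_vector_space sw_single)

text \<open>The coassociativity axioms and the commutation of coactions are equations in threefold
  tensor products bracketed to the left. This evaluates on such a product the linear map that a
  trilinear \<open>F\<close> induces.\<close>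

lemma sw_kpure_kpure:
  assumes X: "vspace X" and Y: "vspace Y" and V: "vspace V"
    and F1: "\<And>b c. b \<in> car Y \<Longrightarrow> c \<in> car Z \<Longrightarrow> klinear X V (\<lambda>a. F a b c)"
    and F2: "\<And>a c. a \<in> car X \<Longrightarrow> c \<in> car Z \<Longrightarrow> klinear Y V (\<lambda>b. F a b c)"
    and F3: "\<And>a b. a \<in> car X \<Longrightarrow> b \<in> car Y \<Longrightarrow> klinear Z V (\<lambda>c. F a b c)"
    and c: "c \<in> car Z"
  shows "sw V (kpure (ktens X Y) Z (kpure X Y a b) c) (\<lambda>s c. sw V s (\<lambda>a b. F a b c)) = F a b c"
proof -
  have "F a b c \<in> car V" if "a \<in> car X" "b \<in> car Y" "c \<in> car Z" for a b c
    using klinear_closed[OF F1 that(1)] that by blast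
  then have "bilin (ktens X Y) Z V (\<lambda>s c. sw V s (\<lambda>a b. F a b c))"
    by (intro bilinI klinear_sw_left[OF klinear_id] klinear_sw_right[OF V])
      (use X Y V F3 ktens_tset[of X Y] in auto)
  then have "sw V (kpure (ktens X Y) Z (kpure X Y a b) c) (\<lambda>s c. sw V s (\<lambda>a b. F a b c)) =
    sw V (kpure X Y a b) (\<lambda>a b. F a b c)"
    by (rule sw_kpure[OF _ V])
  also have "\<dots> = F a b c"
    by (rule sw_kpure[OF bilinI V]) (use F1 F2 c in auto)
  finally show ?thesis .
qed

section \<open>Hopf algebras\<close>

locale hopf_alg =
  fixes H :: "('k::field, 'h::ring_1) hopf"
  assumes hopf: "hopf_algebra H" and bij_antip: "bij (antip H)"
begin

abbreviation (input) "\<Delta> \<equiv> comult H"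
abbreviation (input) "S \<equiv> antip H"
abbreviation (input) "Sb \<equiv> inv (antip H)"
abbreviation (input) "\<epsilon> \<equiv> counit H"

lemma bialg: "bialgebra H" and coalg: "coalgebra H"
  using hopf by (simp_all add: hopf_algebra_def bialgebra_def)

lemma car_H [simp]: "car H = UNIV"
  using bialg by (simp add: bialgebra_def)

lemma k_algebra_H: "k_algebra (scl H)"
  using bialg by (simp add: bialgebra_def)

lemma vspace_H [simp]: "vspace H"
proof -
  interpret vector_space "scl H" using k_algebra_H by (simp add: k_algebra_def)
  show ?thesis using k_algebra_H by (simp add: vspace_def k_algebra_def)
qed

lemma scl_mult: "scl H c a * b = scl H c (a * b)" "a * scl H c b = scl H c (a * b)"
  using k_algebra_H unfolding k_algebra_def by metis+

lemma counit_simps: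
  "\<epsilon> (a + b) = \<epsilon> a + \<epsilon> b" "\<epsilon> (scl H c a) = c * \<epsilon> a" "\<epsilon> (a * b) = \<epsilon> a * \<epsilon> b" "\<epsilon> 1 = 1"
  using coalg bialg by (simp_all add: coalgebra_def bialgebra_def)

section \<open>Sweedler calculus in the Hopf algebra\<close>

lemma klinear_comult: "klinear H (ktens H H) \<Delta>"
  using coalg by (simp add: coalgebra_def)

lemma comult_tset: "\<Delta> h \<in> tset H H"
  by (simp add: tset_def)

lemma klinear_mult_left [klin]: "klinear W H g \<Longrightarrow> klinear W H (\<lambda>w. g w * b)"
  by (simp add: klinear_def distrib_right scl_mult)

lemma klinear_mult_right [klin]: "klinear W H g \<Longrightarrow> klinear W H (\<lambda>w. b * g w)"
  by (simp add: klinear_def distrib_left scl_mult)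

lemma klinear_antip [klin]: "klinear W H g \<Longrightarrow> klinear W H (\<lambda>w. S (g w))"
  using hopf by (auto simp: hopf_algebra_def intro: klinear_comp)

lemma klinear_sw_comult_left [klin]:
  "vspace Z \<Longrightarrow> klinear W H g \<Longrightarrow> (\<And>a b. F a b \<in> car Z) \<Longrightarrow>
   klinear W Z (\<lambda>w. sw Z (\<Delta> (g w)) F)"
  by (rule klinear_sw_left[OF klinear_comp[OF _ klinear_comult], where X = H and Y = H])
    (auto simp: tset_def)

lemma klinear_sw_comult_right [klin]:
  "vspace Z \<Longrightarrow> (\<And>a b. klinear W Z (F a b)) \<Longrightarrow>
   klinear W Z (\<lambda>w. sw Z (\<Delta> h) (\<lambda>a b. F a b w))"
  by (rule klinear_sw_right[OF _ comult_tset]) auto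

lemma sw_comult_closed [intro, simp]:
  "vspace Z \<Longrightarrow> (\<And>a b. F a b \<in> car Z) \<Longrightarrow> sw Z (\<Delta> h) F \<in> car Z"
  by (rule sw_closed) auto

lemma sw_comult_apply:
  "klinear Z Z' L \<Longrightarrow> vspace Z \<Longrightarrow> (\<And>a b. F a b \<in> car Z) \<Longrightarrow>
   L (sw Z (\<Delta> h) F) = sw Z' (\<Delta> h) (\<lambda>a b. L (F a b))"
  by (rule klinear_sw_apply) auto

text \<open>The linear map induced by the trilinear \<open>F\<close> is applied to the
  coassociativity axiom.\<close>

lemma sw_coassoc:
  assumes Z: "vspace Z"
    and "\<And>b c. klinear H Z (\<lambda>a. F a b c)" "\<And>a c. klinear H Z (\<lambda>b. F a b c)"
    and "\<And>a b. klinear H Z (\<lambda>c. F a b c)"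
  shows "sw Z (\<Delta> h) (\<lambda>x c. sw Z (\<Delta> x) (\<lambda>a b. F a b c)) =
         sw Z (\<Delta> h) (\<lambda>a x. sw Z (\<Delta> x) (\<lambda>b c. F a b c))"
proof -
  define T where "T = ktens (ktens H H) H"
  define p where "p a b c = kpure (ktens H H) H (kpure H H a b) c" for a b c
  have T: "scl T = fscale" by (simp add: T_def)
  have p: "sw Z (p a b c) (\<lambda>s c. sw Z s (\<lambda>a b. F a b c)) = F a b c" for a b c
    unfolding p_def by (rule sw_kpure_kpure) (use assms in auto)
  have "sw T (\<Delta> h) (\<lambda>a c. sw T (\<Delta> a) (\<lambda>a1 a2. p a1 a2 c)) =
        sw T (\<Delta> h) (\<lambda>a c. sw T (\<Delta> c) (\<lambda>c1 c2. p a c1 c2))"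
    using coalg unfolding coalgebra_def T_def p_def Let_def by blast
  from arg_cong[OF this, of "\<lambda>t. sw Z t (\<lambda>s c. sw Z s (\<lambda>a b. F a b c))"]
  show ?thesis by (simp add: sw_sw[OF Z T] p)
qed

lemma sw_counit_left:
  assumes "klinear H Z f" "vspace Z"
  shows "sw Z (\<Delta> h) (\<lambda>a b. scl Z (\<epsilon> a) (f b)) = f h"
proof -
  have "sw H (\<Delta> h) (\<lambda>h1 h2. scl H (\<epsilon> h1) h2) = h"
    using coalg unfolding coalgebra_def by blast
  then have "f h = f (sw H (\<Delta> h) (\<lambda>h1 h2. scl H (\<epsilon> h1) h2))" by simp
  also have "\<dots> = sw Z (\<Delta> h) (\<lambda>a b. f (scl H (\<epsilon> a) b))"
    by (rule sw_comult_apply[OF assms(1)]) auto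
  finally show ?thesis by (simp add: klinear_scl[OF assms(1)])
qed

lemma sw_counit_right:
  assumes "klinear H Z f" "vspace Z"
  shows "sw Z (\<Delta> h) (\<lambda>a b. scl Z (\<epsilon> b) (f a)) = f h"
proof -
  have "sw H (\<Delta> h) (\<lambda>h1 h2. scl H (\<epsilon> h2) h1) = h"
    using coalg unfolding coalgebra_def by blast
  then have "f h = f (sw H (\<Delta> h) (\<lambda>h1 h2. scl H (\<epsilon> h2) h1))" by simp
  also have "\<dots> = sw Z (\<Delta> h) (\<lambda>a b. f (scl H (\<epsilon> b) a))"
    by (rule sw_comult_apply[OF assms(1)]) auto
  finally show ?thesis by (simp add: klinear_scl[OF assms(1)])
qed

lemma sw_comult_mult:
  assumes "bilin H H Z F" "vspace Z"
  shows "sw Z (\<Delta> (a * b)) F =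
    sw Z (\<Delta> a) (\<lambda>a1 a2. sw Z (\<Delta> b) (\<lambda>b1 b2. F (a1 * b1) (a2 * b2)))"
proof -
  have "\<Delta> (a * b) = sw (ktens H H) (\<Delta> a) (\<lambda>a1 a2. sw (ktens H H) (\<Delta> b) (\<lambda>b1 b2.
          kpure H H (a1 * b1) (a2 * b2)))"
    using bialg unfolding bialgebra_def by blast
  then show ?thesis by (simp add: sw_sw assms(2) sw_kpure[OF assms])
qed

lemma sw_comult_1:
  assumes "bilin H H Z F" "vspace Z"
  shows "sw Z (\<Delta> 1) F = F 1 1"
  using bialg by (simp add: bialgebra_def sw_kpure[OF assms])

lemma sw_antip:
  assumes "klinear H Z f" "vspace Z"
  shows sw_antip_left: "sw Z (\<Delta> h) (\<lambda>a b. f (S a * b)) = scl Z (\<epsilon> h) (f 1)"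
    and sw_antip_right: "sw Z (\<Delta> h) (\<lambda>a b. f (a * S b)) = scl Z (\<epsilon> h) (f 1)"
proof -
  have "sw H (\<Delta> h) (\<lambda>a b. S a * b) = scl H (\<epsilon> h) 1" "sw H (\<Delta> h) (\<lambda>a b. a * S b) = scl H (\<epsilon> h) 1"
    using hopf by (auto simp: hopf_algebra_def)
  then have "f (sw H (\<Delta> h) (\<lambda>a b. S a * b)) = f (scl H (\<epsilon> h) 1)"
    "f (sw H (\<Delta> h) (\<lambda>a b. a * S b)) = f (scl H (\<epsilon> h) 1)"
    by simp_all
  then show "sw Z (\<Delta> h) (\<lambda>a b. f (S a * b)) = scl Z (\<epsilon> h) (f 1)"
    "sw Z (\<Delta> h) (\<lambda>a b. f (a * S b)) = scl Z (\<epsilon> h) (f 1)"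
    by (simp_all add: sw_comult_apply[OF assms(1)] klinear_scl[OF assms(1)])
qed

text \<open>\<open>g\<close> stands for any of the products a S(b), S(a) b and their analogues with
  the inverse antipode. All that matters is that g(h_1, h_2) sums to \<epsilon>(h) 1, after which
  the counit absorbs the remaining leg of h_1 \<otimes> h_2 \<otimes> h_3.\<close>

lemma sw_cancel_gen:
  assumes F: "bilin H H Z F" and Z: "vspace Z" and g: "bilin H H H g"
    and eps: "\<And>f h. klinear H Z f \<Longrightarrow> sw Z (\<Delta> h) (\<lambda>a b. f (g a b)) = scl Z (\<epsilon> h) (f 1)"
  shows "sw Z (\<Delta> h) (\<lambda>a x. sw Z (\<Delta> x) (\<lambda>b c. F (g a b) c)) = F 1 h"
    and "sw Z (\<Delta> h) (\<lambda>a x. sw Z (\<Delta> x) (\<lambda>b c. F a (g b c))) = F h 1"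
proof -
  note kl = bilin_comp_left[OF F] bilin_comp_right[OF F]
    bilin_comp_left[OF g, OF klinear_id] bilin_comp_right[OF g, OF klinear_id]
  have "sw Z (\<Delta> h) (\<lambda>a x. sw Z (\<Delta> x) (\<lambda>b c. F (g a b) c)) =
    sw Z (\<Delta> h) (\<lambda>x c. sw Z (\<Delta> x) (\<lambda>a b. F (g a b) c))"
    by (rule sw_coassoc[symmetric]) (auto intro!: Z kl klinear_id)
  also have "\<dots> = sw Z (\<Delta> h) (\<lambda>x c. scl Z (\<epsilon> x) (F 1 c))"
    by (subst eps) (auto intro!: kl klinear_id)
  also have "\<dots> = F 1 h" by (rule sw_counit_left) (auto intro!: kl klinear_id Z)
  finally show "sw Z (\<Delta> h) (\<lambda>a x. sw Z (\<Delta> x) (\<lambda>b c. F (g a b) c)) = F 1 h" .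
  have "sw Z (\<Delta> h) (\<lambda>a x. sw Z (\<Delta> x) (\<lambda>b c. F a (g b c))) =
      sw Z (\<Delta> h) (\<lambda>a x. scl Z (\<epsilon> x) (F a 1))"
    by (subst eps) (auto intro!: kl klinear_id)
  also have "\<dots> = F h 1" by (rule sw_counit_right) (auto intro!: kl klinear_id Z)
  finally show "sw Z (\<Delta> h) (\<lambda>a x. sw Z (\<Delta> x) (\<lambda>b c. F a (g b c))) = F h 1" .
qed

lemma sw_cancel:
  assumes F: "bilin H H Z F" and Z: "vspace Z"
  shows "sw Z (\<Delta> h) (\<lambda>a x. sw Z (\<Delta> x) (\<lambda>b c. F (a * S b) c)) = F 1 h"
    and "sw Z (\<Delta> h) (\<lambda>a x. sw Z (\<Delta> x) (\<lambda>b c. F a (b * S c))) = F h 1"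
    and "sw Z (\<Delta> h) (\<lambda>a x. sw Z (\<Delta> x) (\<lambda>b c. F (S a * b) c)) = F 1 h"
    and "sw Z (\<Delta> h) (\<lambda>a x. sw Z (\<Delta> x) (\<lambda>b c. F a (S b * c))) = F h 1"
proof -
  have 1: "bilin H H H (\<lambda>a b. a * S b)" and 2: "bilin H H H (\<lambda>a b. S a * b)"
    by (auto intro!: bilinI klin)
  show "sw Z (\<Delta> h) (\<lambda>a x. sw Z (\<Delta> x) (\<lambda>b c. F (a * S b) c)) = F 1 h"
    "sw Z (\<Delta> h) (\<lambda>a x. sw Z (\<Delta> x) (\<lambda>b c. F a (b * S c))) = F h 1"
    using sw_cancel_gen[OF F Z 1] sw_antip_right[OF _ Z] by blast+
  show "sw Z (\<Delta> h) (\<lambda>a x. sw Z (\<Delta> x) (\<lambda>b c. F (S a * b) c)) = F 1 h"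
    "sw Z (\<Delta> h) (\<lambda>a x. sw Z (\<Delta> x) (\<lambda>b c. F a (S b * c))) = F h 1"
    using sw_cancel_gen[OF F Z 2] sw_antip_left[OF _ Z] by blast+
qed

section \<open>Antipode and inverse antipode\<close>

lemma antip_1: "S 1 = 1"
proof -
  have "sw H (\<Delta> 1) (\<lambda>a b. S a * b) = scl H (\<epsilon> 1) 1"
    using hopf by (auto simp: hopf_algebra_def)
  moreover have "sw H (\<Delta> 1) (\<lambda>a b. S a * b) = S 1 * 1"
    by (rule sw_comult_1) (auto intro!: bilinI klin)
  ultimately show ?thesis by (simp add: counit_simps vspace_scl_simps)
qed

text \<open>The sum of S(a_1 b_1) a_2 b_2 S(b_3) S(a_3) is evaluated in two ways. Cancelling b_2
  S(b_3) and then a_2 S(a_3) leaves S(a b); cancelling S(a_1 b_1) a_2 b_2 leaves S(b) S(a).\<close>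

lemma antip_mult: "S (a * b) = S b * S a"
proof -
  define U where "U = sw H (\<Delta> a) (\<lambda>a1 x. sw H (\<Delta> x) (\<lambda>a2 a3. sw H (\<Delta> b) (\<lambda>b1 y.
    sw H (\<Delta> y) (\<lambda>b2 b3. S (a1 * b1) * (a2 * b2) * S b3 * S a3))))"
  have "U = sw H (\<Delta> a) (\<lambda>a1 x. sw H (\<Delta> x) (\<lambda>a2 a3. sw H (\<Delta> b) (\<lambda>b1 y.
    sw H (\<Delta> y) (\<lambda>b2 b3. S (a1 * b1) * (a2 * (b2 * S b3)) * S a3))))"
    by (simp add: U_def mult.assoc)
  also have "\<dots> = sw H (\<Delta> a) (\<lambda>a1 x. sw H (\<Delta> x) (\<lambda>a2 a3. S (a1 * b) * (a2 * 1) * S a3))"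
    by (subst sw_cancel(2)) (auto intro!: bilinI klin)
  also have "\<dots> = sw H (\<Delta> a) (\<lambda>a1 x. sw H (\<Delta> x) (\<lambda>a2 a3. S (a1 * b) * (a2 * S a3)))"
    by (simp add: mult.assoc)
  also have "\<dots> = S (a * b) * 1"
    by (rule sw_cancel(2)) (auto intro!: bilinI klin)
  finally have U1: "U = S (a * b)" by simp
  have "U = sw H (\<Delta> a) (\<lambda>x a3. sw H (\<Delta> x) (\<lambda>a1 a2. sw H (\<Delta> b) (\<lambda>b1 y.
    sw H (\<Delta> y) (\<lambda>b2 b3. S (a1 * b1) * (a2 * b2) * S b3 * S a3))))"
    unfolding U_def by (rule sw_coassoc[symmetric]) (auto intro!: klin)
  also have "\<dots> = sw H (\<Delta> a) (\<lambda>x a3. sw H (\<Delta> x) (\<lambda>a1 a2. sw H (\<Delta> b) (\<lambda>y b3.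
    sw H (\<Delta> y) (\<lambda>b1 b2. S (a1 * b1) * (a2 * b2) * S b3 * S a3))))"
    by (subst (2) sw_coassoc) (auto intro!: klin)
  also have "\<dots> = sw H (\<Delta> a) (\<lambda>x a3. sw H (\<Delta> b) (\<lambda>y b3. sw H (\<Delta> x) (\<lambda>a1 a2.
    sw H (\<Delta> y) (\<lambda>b1 b2. S (a1 * b1) * (a2 * b2) * S b3 * S a3))))"
    by (subst sw_swap) auto
  also have "\<dots> = sw H (\<Delta> a) (\<lambda>x a3. sw H (\<Delta> b) (\<lambda>y b3. sw H (\<Delta> (x * y)) (\<lambda>u v.
    S u * v * S b3 * S a3)))"
    by (subst sw_comult_mult) (auto intro!: bilinI klin)
  also have "\<dots> = sw H (\<Delta> a) (\<lambda>x a3. sw H (\<Delta> b) (\<lambda>y b3. scl H (\<epsilon> (x * y)) (1 * S b3 * S a3)))"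
    by (subst sw_antip_left[where f = "\<lambda>z. z * S _ * S _"]) (auto intro!: klin)
  also have "\<dots> = sw H (\<Delta> a) (\<lambda>x a3. scl H (\<epsilon> x) (sw H (\<Delta> b) (\<lambda>y b3. scl H (\<epsilon> y) (S b3 * S a3))))"
    by (simp add: counit_simps sw_scale[symmetric] vspace_scl_simps)
  also have "\<dots> = sw H (\<Delta> a) (\<lambda>x a3. scl H (\<epsilon> x) (S b * S a3))"
    by (subst sw_counit_left[where f = "\<lambda>z. S z * S _"]) (auto intro!: klin)
  also have "\<dots> = S b * S a"
    by (rule sw_counit_left) (auto intro!: klin)
  finally show ?thesis using U1 by simp
qed

lemma sw_comult_kpure: "sw (ktens H H) (\<Delta> h) (kpure H H) = \<Delta> h"
  using istens_expand[OF istens_ktens, of H H "\<Delta> h"] klinear_closed[OF klinear_comult, of h]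
  by (simp add: kpure_def[abs_def])

text \<open>Uniqueness of the convolution inverse of \<Delta>. \<open>E a b c\<close> is
  \<Delta>(S(a)) \<Delta>(b) (S(c_2) \<otimes> S(c_1)). In its sum over h_1, h_2, h_3 the first two
  factors collapse to leave S(h_2) \<otimes> S(h_1), or the last two to leave
  \<Delta>(S(h)).\<close>

lemma comult_antip: "\<Delta> (S h) = sw (ktens H H) (\<Delta> h) (\<lambda>a b. kpure H H (S b) (S a))"
proof -
  define T where "T = ktens H H"
  have [simp]: "vspace T" by (simp add: T_def)
  note [klin] = klinear_kpure_left[of H H, folded T_def, OF vspace_H vspace_H]
    klinear_kpure_right[of H H, folded T_def, OF vspace_H vspace_H]
  have [simp]: "kpure H H x y \<in> car T" for x y by (simp add: T_def)
  define K where "K p q u v d e = kpure H H (p * u * S e) (q * (v * S d))" for p q u v d e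
  define E where "E a b c = sw T (\<Delta> (S a)) (\<lambda>p q. sw T (\<Delta> b) (\<lambda>u v. sw T (\<Delta> c) (\<lambda>d e.
    K p q u v d e)))" for a b c
  have klE: "klinear H T (\<lambda>a. E a b c)" "klinear H T (\<lambda>b. E a b c)" "klinear H T (\<lambda>c. E a b c)"
    for a b c
    unfolding E_def K_def by (auto intro!: klin)
  define U where "U = sw T (\<Delta> h) (\<lambda>a x. sw T (\<Delta> x) (\<lambda>b c. E a b c))"
  have "U = sw T (\<Delta> h) (\<lambda>x c. sw T (\<Delta> x) (\<lambda>a b. E a b c))"
    unfolding U_def by (rule sw_coassoc[symmetric]) (auto intro!: klE)
  also have "\<dots> = sw T (\<Delta> h) (\<lambda>x c. sw T (\<Delta> x) (\<lambda>a b. sw T (\<Delta> (S a * b)) (\<lambda>r s.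
      sw T (\<Delta> c) (\<lambda>d e. kpure H H (r * S e) (s * S d)))))"
    by (subst sw_comult_mult) (auto simp: E_def K_def mult.assoc intro!: bilinI klin)
  also have "\<dots> = sw T (\<Delta> h) (\<lambda>x c. scl T (\<epsilon> x) (sw T (\<Delta> 1) (\<lambda>r s.
      sw T (\<Delta> c) (\<lambda>d e. kpure H H (r * S e) (s * S d)))))"
    by (subst sw_antip_left[where f = "\<lambda>z. sw T (\<Delta> z) (\<lambda>r s.
      sw T (\<Delta> _) (\<lambda>d e. kpure H H (r * S e) (s * S d)))"]) (auto intro!: klin)
  also have "\<dots> = sw T (\<Delta> h) (\<lambda>x c. scl T (\<epsilon> x) (sw T (\<Delta> c) (\<lambda>d e. kpure H H (S e) (S d))))"
    by (subst sw_comult_1) (auto intro!: bilinI klin)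
  also have "\<dots> = sw T (\<Delta> h) (\<lambda>d e. kpure H H (S e) (S d))"
    by (rule sw_counit_left) (auto intro!: klin)
  finally have U1: "U = sw T (\<Delta> h) (\<lambda>d e. kpure H H (S e) (S d))" .
  \<comment> \<open>The last two factors are u S(e) \<otimes> v S(d). Reassociation makes v and d
    adjacent, so v S(d) cancels first, and this leaves u next to the antipode of the remaining
    leg.\<close>
  have inner: "sw T (\<Delta> x) (\<lambda>b c. E a b c) = scl T (\<epsilon> x) (\<Delta> (S a))" for x a
  proof -
    have "sw T (\<Delta> x) (\<lambda>b c. E a b c) = sw T (\<Delta> (S a)) (\<lambda>p q. sw T (\<Delta> x) (\<lambda>b c.
        sw T (\<Delta> b) (\<lambda>u v. sw T (\<Delta> c) (\<lambda>d e. K p q u v d e))))"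
      unfolding E_def by (subst sw_swap) auto
    also have "\<dots> = sw T (\<Delta> (S a)) (\<lambda>p q. sw T (\<Delta> x) (\<lambda>u y. sw T (\<Delta> y) (\<lambda>v c.
        sw T (\<Delta> c) (\<lambda>d e. K p q u v d e))))"
      by (rule sw_cong, rule sw_coassoc) (auto simp: K_def intro!: klin)
    also have "\<dots> = sw T (\<Delta> (S a)) (\<lambda>p q. sw T (\<Delta> x) (\<lambda>u y. kpure H H (p * u * S y) (q * 1)))"
      unfolding K_def by (subst sw_cancel(1)) (auto intro!: bilinI klin)
    also have "\<dots> = sw T (\<Delta> (S a)) (\<lambda>p q. sw T (\<Delta> x) (\<lambda>u y. kpure H H (p * (u * S y)) q))"
      by (simp add: mult.assoc)
    also have "\<dots> = sw T (\<Delta> (S a)) (\<lambda>p q. scl T (\<epsilon> x) (kpure H H (p * 1) q))"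
      by (subst sw_antip_right[where f = "\<lambda>z. kpure H H (_ * z) _"]) (auto intro!: klin)
    also have "\<dots> = scl T (\<epsilon> x) (\<Delta> (S a))"
      by (simp add: sw_scale sw_comult_kpure[folded T_def])
    finally show ?thesis .
  qed
  have "klinear H T (\<lambda>a. \<Delta> (S a))"
    unfolding T_def by (intro klinear_comp[OF _ klinear_comult] klin)
  then have "U = \<Delta> (S h)"
    unfolding U_def inner by (rule sw_counit_right) auto
  then show ?thesis using U1 by (simp add: T_def)
qed

lemma sw_comult_antip:
  assumes "bilin H H Z F" "vspace Z"
  shows "sw Z (\<Delta> (S h)) F = sw Z (\<Delta> h) (\<lambda>a b. F (S b) (S a))"
  by (simp add: comult_antip sw_sw[OF assms(2)] sw_kpure[OF assms])

lemma antip_Sb [simp]: "S (Sb h) = h" "Sb (S h) = h"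
  using bij_antip by (simp_all add: bij_def surj_f_inv_f)

lemma klinear_antip_self: "klinear H H S"
  using klinear_antip[OF klinear_id] .

lemma klinear_Sb [klin]:
  assumes "klinear W H g"
  shows "klinear W H (\<lambda>w. Sb (g w))"
proof -
  have inj: "Sb x = y" if "x = S y" for x y using that by simp
  have "klinear H H Sb"
    by (auto intro!: klinearI inj simp: klinear_add[OF klinear_antip_self] klinear_scl[OF klinear_antip_self])
  with assms show ?thesis by (rule klinear_comp)
qed

lemma Sb_mult: "Sb (a * b) = Sb b * Sb a"
  by (metis antip_Sb antip_mult)

lemma Sb_1: "Sb 1 = 1"
  by (metis antip_Sb(2) antip_1)

text \<open>The inverse antipode is anti-multiplicative, so these are its images of S(a) b and a
  S(b); the order of the two legs is therefore reversed.\<close>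

lemma sw_Sb:
  assumes "klinear H Z f" "vspace Z"
  shows sw_Sb_left: "sw Z (\<Delta> h) (\<lambda>a b. f (Sb b * a)) = scl Z (\<epsilon> h) (f 1)"
    and sw_Sb_right: "sw Z (\<Delta> h) (\<lambda>a b. f (b * Sb a)) = scl Z (\<epsilon> h) (f 1)"
proof -
  have f: "klinear H Z (\<lambda>z. f (Sb z))" by (rule klinear_comp[OF _ assms(1)]) (auto intro!: klin)
  have "Sb b * a = Sb (S a * b)" "b * Sb a = Sb (a * S b)" for a b by (simp_all add: Sb_mult)
  then show "sw Z (\<Delta> h) (\<lambda>a b. f (Sb b * a)) = scl Z (\<epsilon> h) (f 1)"
    "sw Z (\<Delta> h) (\<lambda>a b. f (b * Sb a)) = scl Z (\<epsilon> h) (f 1)"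
    using sw_antip_left[OF f assms(2)] sw_antip_right[OF f assms(2)] by (simp_all add: Sb_1)
qed

lemma sw_cancel_Sb:
  assumes F: "bilin H H Z F" and Z: "vspace Z"
  shows "sw Z (\<Delta> h) (\<lambda>a x. sw Z (\<Delta> x) (\<lambda>b c. F (Sb b * a) c)) = F 1 h"
    and "sw Z (\<Delta> h) (\<lambda>a x. sw Z (\<Delta> x) (\<lambda>b c. F (b * Sb a) c)) = F 1 h"
proof -
  have 1: "bilin H H H (\<lambda>a b. Sb b * a)" and 2: "bilin H H H (\<lambda>a b. b * Sb a)"
    by (auto intro!: bilinI klin)
  show "sw Z (\<Delta> h) (\<lambda>a x. sw Z (\<Delta> x) (\<lambda>b c. F (Sb b * a) c)) = F 1 h"
    using sw_cancel_gen[OF F Z 1] sw_Sb_left[OF _ Z] by blast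
  show "sw Z (\<Delta> h) (\<lambda>a x. sw Z (\<Delta> x) (\<lambda>b c. F (b * Sb a) c)) = F 1 h"
    using sw_cancel_gen[OF F Z 2] sw_Sb_right[OF _ Z] by blast
qed

section \<open>Bimodules and their tensor products\<close>

lemma bimodule_vspace [simp]: "bimodule H M \<Longrightarrow> vspace M"
  by (simp add: bimodule_def)

lemma klinear_lact [klin]:
  "bimodule H M \<Longrightarrow> klinear W M g \<Longrightarrow> klinear W M (\<lambda>w. lact M a (g w))"
  by (rule klinear_comp) (auto simp: bimodule_def)

lemma klinear_ract [klin]:
  "bimodule H M \<Longrightarrow> klinear W M g \<Longrightarrow> klinear W M (\<lambda>w. ract M (g w) a)"
  by (rule klinear_comp[where g = "\<lambda>m. ract M m a"]) (auto simp: bimodule_def)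

lemma klinear_lact_scalar [klin]:
  "bimodule H M \<Longrightarrow> m \<in> car M \<Longrightarrow> klinear W H g \<Longrightarrow> klinear W M (\<lambda>w. lact M (g w) m)"
  by (rule klinear_comp[where g = "\<lambda>a. lact M a m"]) (auto simp: bimodule_def)

lemma klinear_ract_scalar [klin]:
  "bimodule H M \<Longrightarrow> m \<in> car M \<Longrightarrow> klinear W H g \<Longrightarrow> klinear W M (\<lambda>w. ract M m (g w))"
  by (rule klinear_comp[where g = "\<lambda>a. ract M m a"]) (auto simp: bimodule_def)

lemma act_closed [simp]:
  "bimodule H M \<Longrightarrow> m \<in> car M \<Longrightarrow> lact M a m \<in> car M"
  "bimodule H M \<Longrightarrow> m \<in> car M \<Longrightarrow> ract M m a \<in> car M"
  by (simp_all add: bimodule_def klinear_def)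

lemma act_simps [simp]:
  assumes "bimodule H M" "m \<in> car M"
  shows "lact M a (lact M b m) = lact M (a * b) m" "ract M (ract M m a) b = ract M m (a * b)"
    "lact M 1 m = m" "ract M m 1 = m"
    "ract M (lact M a m) b = lact M a (ract M m b)"
  using assms by (simp_all add: bimodule_def)

lemma hrel_tset:
  "bimodule H M \<Longrightarrow> bimodule H N \<Longrightarrow> hrel M N \<subseteq> tset M N"
  unfolding hrel_def using krel_tset[of M N]
  by (auto intro!: tset_closed(2) tset_gen)

lemma htens_scl [simp]: "scl (htens H M N) = fscale"
  by (simp add: htens_def hspace_def)

lemma istens_htens:
  "bimodule H M \<Longrightarrow> bimodule H N \<Longrightarrow> istens (hrel M N) M N (htens H M N)"
  using hrel_tset[of M N]
  by (simp add: istens_def htens_def hspace_def) (auto simp: tset_def hrel_def)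

lemma vspace_htens [simp]:
  "bimodule H M \<Longrightarrow> bimodule H N \<Longrightarrow> vspace (htens H M N)"
  by (rule istens_vspace[OF istens_htens])

lemma htens_tset: "bimodule H M \<Longrightarrow> bimodule H N \<Longrightarrow> car (htens H M N) \<subseteq> tset M N"
  by (rule istens_tset[OF istens_htens])

lemma bilin_hpure: "bimodule H M \<Longrightarrow> bimodule H N \<Longrightarrow> bilin M N (htens H M N) (hpure M N)"
  using istens_bilin[OF istens_htens, of M N] by (simp add: hpure_def[abs_def])

lemma hpure_closed [simp]:
  "bimodule H M \<Longrightarrow> bimodule H N \<Longrightarrow> m \<in> car M \<Longrightarrow> n \<in> car N \<Longrightarrow> hpure M N m n \<in> car (htens H M N)"
  by (rule bilin_closed[OF bilin_hpure])

lemma klinear_hpure_left [klin]: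
  "bimodule H M \<Longrightarrow> bimodule H N \<Longrightarrow> n \<in> car N \<Longrightarrow> klinear W M g \<Longrightarrow>
   klinear W (htens H M N) (\<lambda>w. hpure M N (g w) n)"
  by (erule bilin_comp_left[OF bilin_hpure]) auto

lemma klinear_hpure_right [klin]:
  "bimodule H M \<Longrightarrow> bimodule H N \<Longrightarrow> m \<in> car M \<Longrightarrow> klinear W N g \<Longrightarrow>
   klinear W (htens H M N) (\<lambda>w. hpure M N m (g w))"
  by (erule bilin_comp_right[OF bilin_hpure]) auto

lemma hpure_balanced:
  assumes "m \<in> car M" "n \<in> car N"
  shows "hpure M N (ract M m a) n = hpure M N m (lact N a n)"
proof -
  have "gen (ract M m a) n - gen m (lact N a n) \<in> hrel M N"
    using assms by (auto simp: hrel_def)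
  from nf_rel[OF this] show ?thesis by (simp add: hpure_def nf_diff)
qed

text \<open>The universal property of the tensor product over H. Maps out of it are defined by
  summing over a representative, and balancedness makes the sum independent of which representative
  \<open>nf\<close> has chosen.\<close>

lemma sw_hpure:
  assumes "bilin M N Z f" "vspace Z"
    and "\<And>m n a. m \<in> car M \<Longrightarrow> n \<in> car N \<Longrightarrow> f (ract M m a) n = f m (lact N a n)"
  shows "sw Z (hpure M N m n) f = f m n"
  unfolding hpure_def
  by (subst sw_nf)
    (auto simp: hrel_def vspace_vector_space sw_single sw_diff assms bilin_krel[OF assms(1,2)])

lemma htens_eqI:
  assumes "bimodule H M" "bimodule H N" "klinear (htens H M N) Z f" "klinear (htens H M N) Z g"
    and "t \<in> car (htens H M N)"
    and "\<And>x y. x \<in> car M \<Longrightarrow> y \<in> car N \<Longrightarrow> f (hpure M N x y) = g (hpure M N x y)"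
  shows "f t = g t"
  using istens_eqI[OF istens_htens, of M N Z f g t] assms by (simp add: hpure_def)

lemma klinear_sw_htens:
  "bimodule H M \<Longrightarrow> bimodule H N \<Longrightarrow> vspace Z \<Longrightarrow>
   (\<And>m n. m \<in> car M \<Longrightarrow> n \<in> car N \<Longrightarrow> F m n \<in> car Z) \<Longrightarrow>
   klinear (htens H M N) Z (\<lambda>t. sw Z t F)"
  by (rule klinear_sw_left[OF klinear_id, where X = M and Y = N]) (auto dest: htens_tset)

lemma klinear_sw_htens_right:
  "bimodule H M \<Longrightarrow> bimodule H N \<Longrightarrow> t \<in> car (htens H M N) \<Longrightarrow> vspace Z \<Longrightarrow>
   (\<And>m n. m \<in> car M \<Longrightarrow> n \<in> car N \<Longrightarrow> klinear W Z (F m n)) \<Longrightarrow>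
   klinear W Z (\<lambda>w. sw Z t (\<lambda>m n. F m n w))"
  by (rule klinear_sw_right[where X = M and Y = N]) (auto dest: htens_tset)

lemma sw_hspace: "sw (hspace M N) = sw (htens H M N)"
  by (rule sw_scl_cong) (simp add: htens_def)

lemma htens_lact:
  "lact (htens H M N) a t = sw (htens H M N) t (\<lambda>m n. hpure M N (lact M a m) n)"
  and htens_ract:
  "ract (htens H M N) t a = sw (htens H M N) t (\<lambda>m n. hpure M N m (ract N n a))"
  unfolding sw_hspace[symmetric] by (simp_all add: htens_def)

text \<open>The operations of \<open>htens H M N\<close> are defined with \<open>hspace M N\<close>,
  which has the same carrier and scaling. Since tensor products see nothing else, the two can be
  exchanged.\<close>

lemma ktens_cong:
  assumes "car X = car X'" "scl X = scl X'"
  shows "ktens X Y = ktens X' Y" "ktens Y X = ktens Y X'" "kpure X Y = kpure X' Y" "kpure Y X = kpure Y X'"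
proof -
  have "krel X Y = krel X' Y" "krel Y X = krel Y X'" using assms by (simp_all add: krel_def)
  then show "ktens X Y = ktens X' Y" "ktens Y X = ktens Y X'"
    "kpure X Y = kpure X' Y" "kpure Y X = kpure Y X'"
    using assms by (simp_all add: ktens_def kpure_def fun_eq_iff)
qed

lemma htens_rco:
  "rco (htens H M N) t = (let T = ktens (htens H M N) H in
     sw T t (\<lambda>m n. sw T (rco M m) (\<lambda>m0 m1. sw T (rco N n) (\<lambda>n0 n1.
       kpure (htens H M N) H (hpure M N m0 n0) (m1 * n1)))))"
  and htens_lco:
  "lco (htens H M N) t = (let T = ktens H (htens H M N) in
     sw T t (\<lambda>m n. sw T (lco M m) (\<lambda>m1 m0. sw T (lco N n) (\<lambda>n1 n0.
       kpure H (htens H M N) (m1 * n1) (hpure M N m0 n0)))))"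
proof -
  have *: "car (hspace M N) = car (htens H M N)" "scl (hspace M N) = scl (htens H M N)"
    by (simp_all add: htens_def)
  show "rco (htens H M N) t = (let T = ktens (htens H M N) H in
     sw T t (\<lambda>m n. sw T (rco M m) (\<lambda>m0 m1. sw T (rco N n) (\<lambda>n0 n1.
       kpure (htens H M N) H (hpure M N m0 n0) (m1 * n1)))))"
    "lco (htens H M N) t = (let T = ktens H (htens H M N) in
     sw T t (\<lambda>m n. sw T (lco M m) (\<lambda>m1 m0. sw T (lco N n) (\<lambda>n1 n0.
       kpure H (htens H M N) (m1 * n1) (hpure M N m0 n0)))))"
    unfolding ktens_cong[OF *, symmetric] by (simp_all add: htens_def)
qed

lemma htens_lact_hpure [simp]:
  assumes "bimodule H M" "bimodule H N" "m \<in> car M" "n \<in> car N"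
  shows "lact (htens H M N) a (hpure M N m n) = hpure M N (lact M a m) n"
  unfolding htens_lact using assms
  by (subst sw_hpure) (auto intro!: bilinI klin simp: hpure_balanced simp flip: act_simps(5))

lemma htens_ract_hpure [simp]:
  assumes "bimodule H M" "bimodule H N" "m \<in> car M" "n \<in> car N"
  shows "ract (htens H M N) (hpure M N m n) a = hpure M N m (ract N n a)"
  unfolding htens_ract using assms
  by (subst sw_hpure) (auto intro!: bilinI klin simp: hpure_balanced)

lemma klinear_htens_act:
  assumes "bimodule H M" "bimodule H N"
  shows "klinear (htens H M N) (htens H M N) (lact (htens H M N) a)"
    and "klinear (htens H M N) (htens H M N) (\<lambda>t. ract (htens H M N) t a)"
    and "t \<in> car (htens H M N) \<Longrightarrow> klinear H (htens H M N) (\<lambda>a. lact (htens H M N) a t)"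
    and "t \<in> car (htens H M N) \<Longrightarrow> klinear H (htens H M N) (\<lambda>a. ract (htens H M N) t a)"
  unfolding htens_lact[abs_def] htens_ract[abs_def] using assms
  by (auto intro!: klinear_sw_htens klinear_sw_htens_right klin)

lemma bimodule_htens [simp]:
  assumes M: "bimodule H M" and N: "bimodule H N"
  shows "bimodule H (htens H M N)"
proof -
  let ?T = "htens H M N"
  note kl = klinear_htens_act[OF M N]
  note [klin] = klinear_comp[OF _ kl(1)] klinear_comp[OF _ kl(2)]
  have "lact ?T (a * b) t = lact ?T a (lact ?T b t)" if "t \<in> car ?T" for t a b
    by (rule htens_eqI[OF M N _ _ that, of ?T]) (use M N in \<open>auto intro!: klin kl\<close>)
  moreover have "ract ?T t (a * b) = ract ?T (ract ?T t a) b" if "t \<in> car ?T" for t a b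
    by (rule htens_eqI[OF M N _ _ that, of ?T]) (use M N in \<open>auto intro!: klin kl\<close>)
  moreover have "lact ?T 1 t = t" if "t \<in> car ?T" for t
    by (rule htens_eqI[OF M N _ _ that, of ?T]) (use M N in \<open>auto intro!: klin kl\<close>)
  moreover have "ract ?T t 1 = t" if "t \<in> car ?T" for t
    by (rule htens_eqI[OF M N _ _ that, of ?T]) (use M N in \<open>auto intro!: klin kl\<close>)
  moreover have "lact ?T a (ract ?T t b) = ract ?T (lact ?T a t) b" if "t \<in> car ?T" for t a b
    by (rule htens_eqI[OF M N _ _ that, of ?T]) (use M N in \<open>auto intro!: klin kl\<close>)
  ultimately show ?thesis using M N kl unfolding bimodule_def[of H ?T] by simp
qed

section \<open>Coactions\<close>

text \<open>Linearity of the coaction is what makes sums over it linear in the element. Kept apart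
  from coassociativity, it is quickly available for tensor products over H.\<close>

definition rcomod :: "('k, 'h, 'm::ab_group_add) bcb \<Rightarrow> bool" where
  "rcomod M \<longleftrightarrow> vspace M \<and> klinear M (ktens M H) (rco M)"

definition lcomod :: "('k, 'h, 'm::ab_group_add) bcb \<Rightarrow> bool" where
  "lcomod M \<longleftrightarrow> vspace M \<and> klinear M (ktens H M) (lco M)"

lemma rco_tset: "rcomod M \<Longrightarrow> m \<in> car M \<Longrightarrow> rco M m \<in> tset M H"
  unfolding rcomod_def using klinear_closed ktens_tset[of M H] by fastforce

lemma lco_tset: "lcomod M \<Longrightarrow> m \<in> car M \<Longrightarrow> lco M m \<in> tset H M"
  unfolding lcomod_def using klinear_closed ktens_tset[of H M] by fastforce

lemma sw_rco_cong:
  "rcomod M \<Longrightarrow> m \<in> car M \<Longrightarrow> (\<And>x h. x \<in> car M \<Longrightarrow> F x h = G x h) \<Longrightarrow>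
   sw Z (rco M m) F = sw Z (rco M m) G"
  by (erule (1) sw_tset_cong[OF rco_tset]) auto

lemma sw_lco_cong:
  "lcomod M \<Longrightarrow> m \<in> car M \<Longrightarrow> (\<And>h x. x \<in> car M \<Longrightarrow> F h x = G h x) \<Longrightarrow>
   sw Z (lco M m) F = sw Z (lco M m) G"
  by (erule (1) sw_tset_cong[OF lco_tset]) auto

lemma sw_rco_closed [intro, simp]:
  "rcomod M \<Longrightarrow> m \<in> car M \<Longrightarrow> vspace Z \<Longrightarrow> (\<And>x h. x \<in> car M \<Longrightarrow> F x h \<in> car Z) \<Longrightarrow>
   sw Z (rco M m) F \<in> car Z"
  by (rule sw_tset_closed[OF _ rco_tset])

lemma sw_lco_closed [intro, simp]:
  "lcomod M \<Longrightarrow> m \<in> car M \<Longrightarrow> vspace Z \<Longrightarrow> (\<And>h x. x \<in> car M \<Longrightarrow> F h x \<in> car Z) \<Longrightarrow>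
   sw Z (lco M m) F \<in> car Z"
  by (rule sw_tset_closed[OF _ lco_tset])

lemma sw_rco_apply:
  "klinear Z Z' L \<Longrightarrow> vspace Z \<Longrightarrow> rcomod M \<Longrightarrow> m \<in> car M \<Longrightarrow>
   (\<And>x h. x \<in> car M \<Longrightarrow> F x h \<in> car Z) \<Longrightarrow> L (sw Z (rco M m) F) = sw Z' (rco M m) (\<lambda>x h. L (F x h))"
  by (rule sw_tset_apply[OF _ _ rco_tset])

lemma sw_lco_apply:
  "klinear Z Z' L \<Longrightarrow> vspace Z \<Longrightarrow> lcomod M \<Longrightarrow> m \<in> car M \<Longrightarrow>
   (\<And>h x. x \<in> car M \<Longrightarrow> F h x \<in> car Z) \<Longrightarrow> L (sw Z (lco M m) F) = sw Z' (lco M m) (\<lambda>h x. L (F h x))"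
  by (rule sw_tset_apply[OF _ _ lco_tset])

lemma klinear_sw_rco_left [klin]:
  "rcomod M \<Longrightarrow> vspace Z \<Longrightarrow> klinear W M g \<Longrightarrow> (\<And>x h. x \<in> car M \<Longrightarrow> F x h \<in> car Z) \<Longrightarrow>
   klinear W Z (\<lambda>w. sw Z (rco M (g w)) F)"
  by (rule klinear_sw_left[where X = M and Y = H and T = "ktens M H"])
    (simp_all add: rcomod_def ktens_tset klinear_comp[where g = "rco M"])

lemma klinear_sw_lco_left [klin]:
  "lcomod M \<Longrightarrow> vspace Z \<Longrightarrow> klinear W M g \<Longrightarrow> (\<And>h x. x \<in> car M \<Longrightarrow> F h x \<in> car Z) \<Longrightarrow>
   klinear W Z (\<lambda>w. sw Z (lco M (g w)) F)"
  by (rule klinear_sw_left[where X = H and Y = M and T = "ktens H M"])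
    (simp_all add: lcomod_def ktens_tset klinear_comp[where g = "lco M"])

lemma klinear_sw_rco_right [klin]:
  "rcomod M \<Longrightarrow> vspace Z \<Longrightarrow> m \<in> car M \<Longrightarrow> (\<And>x h. x \<in> car M \<Longrightarrow> klinear W Z (F x h)) \<Longrightarrow>
   klinear W Z (\<lambda>w. sw Z (rco M m) (\<lambda>x h. F x h w))"
  by (rule klinear_sw_right[OF _ rco_tset])

lemma klinear_sw_lco_right [klin]:
  "lcomod M \<Longrightarrow> vspace Z \<Longrightarrow> m \<in> car M \<Longrightarrow> (\<And>h x. x \<in> car M \<Longrightarrow> klinear W Z (F h x)) \<Longrightarrow>
   klinear W Z (\<lambda>w. sw Z (lco M m) (\<lambda>h x. F h x w))"
  by (rule klinear_sw_right[OF _ lco_tset])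

lemma sw_rco_kpure: "rcomod M \<Longrightarrow> m \<in> car M \<Longrightarrow> sw (ktens M H) (rco M m) (kpure M H) = rco M m"
  using istens_expand[OF istens_ktens, of M H "rco M m"] klinear_closed[of M "ktens M H" "rco M" m]
  by (simp add: kpure_def[abs_def] rcomod_def)

lemma sw_lco_kpure: "lcomod M \<Longrightarrow> m \<in> car M \<Longrightarrow> sw (ktens H M) (lco M m) (kpure H M) = lco M m"
  using istens_expand[OF istens_ktens, of H M "lco M m"] klinear_closed[of M "ktens H M" "lco M" m]
  by (simp add: kpure_def[abs_def] lcomod_def)

section \<open>The bicomodule axioms as rules for Sweedler sums\<close>

context
  fixes M :: "('k, 'h, 'm::ab_group_add) bcb"
  assumes bicom: "bicomodule H M"
begin

lemma bicomodule_comod: "rcomod M" "lcomod M"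
  using bicom by (simp_all add: bicomodule_def rcomod_def lcomod_def)

lemma bicomodule_vspace: "vspace M"
  using bicom by (simp add: bicomodule_def)

lemma sw_rco_coassoc:
  assumes Z: "vspace Z" and m: "m \<in> car M"
    and F1: "\<And>b c. klinear M Z (\<lambda>a. F a b c)"
    and F2: "\<And>a c. a \<in> car M \<Longrightarrow> klinear H Z (\<lambda>b. F a b c)"
    and F3: "\<And>a b. a \<in> car M \<Longrightarrow> klinear H Z (\<lambda>c. F a b c)"
  shows "sw Z (rco M m) (\<lambda>x c. sw Z (rco M x) (\<lambda>a b. F a b c)) =
         sw Z (rco M m) (\<lambda>a x. sw Z (\<Delta> x) (\<lambda>b c. F a b c))"
proof -
  note [simp] = bicomodule_vspace bicomodule_comod m
  define T where "T = ktens (ktens M H) H"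
  define p where "p a b c = kpure (ktens M H) H (kpure M H a b) c" for a b c
  define G where "G = (\<lambda>s c. sw Z s (\<lambda>a b. F a b c))"
  have T: "scl T = fscale" by (simp add: T_def)
  have p: "sw Z (p a b c) G = F a b c" if "a \<in> car M" for a b c
    unfolding p_def G_def by (rule sw_kpure_kpure) (use assms that in auto)
  have "sw T (rco M m) (\<lambda>x c. sw T (rco M x) (\<lambda>a b. p a b c)) =
        sw T (rco M m) (\<lambda>a x. sw T (\<Delta> x) (\<lambda>b c. p a b c))"
    using bicom m unfolding bicomodule_def T_def p_def Let_def by blast
  from arg_cong[OF this, of "\<lambda>t. sw Z t G"]
  have "sw Z (rco M m) (\<lambda>x c. sw Z (rco M x) (\<lambda>a b. sw Z (p a b c) G)) =
    sw Z (rco M m) (\<lambda>a x. sw Z (\<Delta> x) (\<lambda>b c. sw Z (p a b c) G))"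
    by (simp only: sw_sw[OF Z T])
  moreover have "sw Z (rco M m) (\<lambda>x c. sw Z (rco M x) (\<lambda>a b. sw Z (p a b c) G)) =
    sw Z (rco M m) (\<lambda>x c. sw Z (rco M x) (\<lambda>a b. F a b c))"
    by (intro sw_rco_cong) (simp_all add: p)
  moreover have "sw Z (rco M m) (\<lambda>a x. sw Z (\<Delta> x) (\<lambda>b c. sw Z (p a b c) G)) =
    sw Z (rco M m) (\<lambda>a x. sw Z (\<Delta> x) (\<lambda>b c. F a b c))"
    by (intro sw_rco_cong sw_cong) (simp_all add: p)
  ultimately show ?thesis by simp
qed

lemma sw_lco_coassoc:
  assumes Z: "vspace Z" and m: "m \<in> car M"
    and F1: "\<And>b c. c \<in> car M \<Longrightarrow> klinear H Z (\<lambda>a. F a b c)"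
    and F2: "\<And>a c. c \<in> car M \<Longrightarrow> klinear H Z (\<lambda>b. F a b c)"
    and F3: "\<And>a b. klinear M Z (\<lambda>c. F a b c)"
  shows "sw Z (lco M m) (\<lambda>a x. sw Z (lco M x) (\<lambda>b c. F a b c)) =
         sw Z (lco M m) (\<lambda>x c. sw Z (\<Delta> x) (\<lambda>a b. F a b c))"
proof -
  note [simp] = bicomodule_vspace bicomodule_comod m
  define T where "T = ktens (ktens H H) M"
  define p where "p a b c = kpure (ktens H H) M (kpure H H a b) c" for a b c
  define G where "G = (\<lambda>s c. sw Z s (\<lambda>a b. F a b c))"
  have T: "scl T = fscale" by (simp add: T_def)
  have p: "sw Z (p a b c) G = F a b c" if "c \<in> car M" for a b c
    unfolding p_def G_def by (rule sw_kpure_kpure) (use assms that in auto)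
  have "sw T (lco M m) (\<lambda>a x. sw T (lco M x) (\<lambda>b c. p a b c)) =
        sw T (lco M m) (\<lambda>x c. sw T (\<Delta> x) (\<lambda>a b. p a b c))"
    using bicom m unfolding bicomodule_def T_def p_def Let_def by blast
  from arg_cong[OF this, of "\<lambda>t. sw Z t G"]
  have "sw Z (lco M m) (\<lambda>a x. sw Z (lco M x) (\<lambda>b c. sw Z (p a b c) G)) =
    sw Z (lco M m) (\<lambda>x c. sw Z (\<Delta> x) (\<lambda>a b. sw Z (p a b c) G))"
    by (simp only: sw_sw[OF Z T])
  moreover have "sw Z (lco M m) (\<lambda>a x. sw Z (lco M x) (\<lambda>b c. sw Z (p a b c) G)) =
    sw Z (lco M m) (\<lambda>a x. sw Z (lco M x) (\<lambda>b c. F a b c))"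
    by (intro sw_lco_cong) (simp_all add: p)
  moreover have "sw Z (lco M m) (\<lambda>x c. sw Z (\<Delta> x) (\<lambda>a b. sw Z (p a b c) G)) =
    sw Z (lco M m) (\<lambda>x c. sw Z (\<Delta> x) (\<lambda>a b. F a b c))"
    by (intro sw_lco_cong sw_cong) (simp_all add: p)
  ultimately show ?thesis by simp
qed

lemma sw_rco_lco:
  assumes Z: "vspace Z" and m: "m \<in> car M"
    and F1: "\<And>b c. b \<in> car M \<Longrightarrow> klinear H Z (\<lambda>a. F a b c)"
    and F2: "\<And>a c. klinear M Z (\<lambda>b. F a b c)"
    and F3: "\<And>a b. b \<in> car M \<Longrightarrow> klinear H Z (\<lambda>c. F a b c)"
  shows "sw Z (rco M m) (\<lambda>x c. sw Z (lco M x) (\<lambda>a b. F a b c)) =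
         sw Z (lco M m) (\<lambda>a x. sw Z (rco M x) (\<lambda>b c. F a b c))"
proof -
  note [simp] = bicomodule_vspace bicomodule_comod m
  define T where "T = ktens (ktens H M) H"
  define p where "p a b c = kpure (ktens H M) H (kpure H M a b) c" for a b c
  define G where "G = (\<lambda>s c. sw Z s (\<lambda>a b. F a b c))"
  have T: "scl T = fscale" by (simp add: T_def)
  have p: "sw Z (p a b c) G = F a b c" if "b \<in> car M" for a b c
    unfolding p_def G_def by (rule sw_kpure_kpure) (use assms that in auto)
  have "sw T (rco M m) (\<lambda>x c. sw T (lco M x) (\<lambda>a b. p a b c)) =
        sw T (lco M m) (\<lambda>a x. sw T (rco M x) (\<lambda>b c. p a b c))"
    using bicom m unfolding bicomodule_def T_def p_def Let_def by blast
  from arg_cong[OF this, of "\<lambda>t. sw Z t G"]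
  have "sw Z (rco M m) (\<lambda>x c. sw Z (lco M x) (\<lambda>a b. sw Z (p a b c) G)) =
    sw Z (lco M m) (\<lambda>a x. sw Z (rco M x) (\<lambda>b c. sw Z (p a b c) G))"
    by (simp only: sw_sw[OF Z T])
  moreover have "sw Z (rco M m) (\<lambda>x c. sw Z (lco M x) (\<lambda>a b. sw Z (p a b c) G)) =
    sw Z (rco M m) (\<lambda>x c. sw Z (lco M x) (\<lambda>a b. F a b c))"
    by (intro sw_rco_cong sw_lco_cong) (simp_all add: p)
  moreover have "sw Z (lco M m) (\<lambda>a x. sw Z (rco M x) (\<lambda>b c. sw Z (p a b c) G)) =
    sw Z (lco M m) (\<lambda>a x. sw Z (rco M x) (\<lambda>b c. F a b c))"
    by (intro sw_rco_cong sw_lco_cong) (simp_all add: p)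
  ultimately show ?thesis by simp
qed

lemma sw_rco_counit:
  assumes "klinear M Z f" "vspace Z" "m \<in> car M"
  shows "sw Z (rco M m) (\<lambda>x h. scl Z (\<epsilon> h) (f x)) = f m"
proof -
  have "sw M (rco M m) (\<lambda>x h. scl M (\<epsilon> h) x) = m"
    using bicom assms(3) unfolding bicomodule_def by blast
  then have "f m = f (sw M (rco M m) (\<lambda>x h. scl M (\<epsilon> h) x))" by simp
  also have "\<dots> = sw Z (rco M m) (\<lambda>x h. f (scl M (\<epsilon> h) x))"
    by (rule sw_rco_apply[OF assms(1)])
      (auto intro: assms bicomodule_comod bicomodule_vspace vspace_scl)
  also have "\<dots> = sw Z (rco M m) (\<lambda>x h. scl Z (\<epsilon> h) (f x))"
    by (intro sw_rco_cong[OF bicomodule_comod(1)] assms klinear_scl[OF assms(1)])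
  finally show ?thesis by simp
qed

lemma sw_lco_counit:
  assumes "klinear M Z f" "vspace Z" "m \<in> car M"
  shows "sw Z (lco M m) (\<lambda>h x. scl Z (\<epsilon> h) (f x)) = f m"
proof -
  have "sw M (lco M m) (\<lambda>h x. scl M (\<epsilon> h) x) = m"
    using bicom assms(3) unfolding bicomodule_def by blast
  then have "f m = f (sw M (lco M m) (\<lambda>h x. scl M (\<epsilon> h) x))" by simp
  also have "\<dots> = sw Z (lco M m) (\<lambda>h x. f (scl M (\<epsilon> h) x))"
    by (rule sw_lco_apply[OF assms(1)])
      (auto intro: assms bicomodule_comod bicomodule_vspace vspace_scl)
  also have "\<dots> = sw Z (lco M m) (\<lambda>h x. scl Z (\<epsilon> h) (f x))"
    by (intro sw_lco_cong[OF bicomodule_comod(2)] assms klinear_scl[OF assms(1)])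
  finally show ?thesis by simp
qed

end

section \<open>Bicovariant bimodules and coinvariants\<close>

lemma bicov_bimodule_simps [simp]:
  assumes "bicov_bimodule H M"
  shows "bimodule H M" "bicomodule H M" "rcomod M" "lcomod M"
  using assms bicomodule_comod by (auto simp: bicov_bimodule_def)

context
  fixes M :: "('k, 'h, 'm::ab_group_add) bcb"
  assumes M: "bicov_bimodule H M"
begin

lemma sw_rco_act:
  assumes "bilin M H Z F" "vspace Z" "m \<in> car M"
  shows "sw Z (rco M (lact M a (ract M m b))) F =
    sw Z (\<Delta> a) (\<lambda>a1 a2. sw Z (rco M m) (\<lambda>m0 m1. sw Z (\<Delta> b) (\<lambda>b1 b2.
      F (lact M a1 (ract M m0 b1)) (a2 * m1 * b2))))"
  using M assms(3) unfolding bicov_bimodule_def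
  by (simp add: Let_def sw_sw assms(2) sw_kpure[OF assms(1,2)] del: act_simps(5))

lemma sw_lco_act:
  assumes "bilin H M Z F" "vspace Z" "m \<in> car M"
  shows "sw Z (lco M (lact M a (ract M m b))) F =
    sw Z (\<Delta> a) (\<lambda>a1 a2. sw Z (lco M m) (\<lambda>m1 m0. sw Z (\<Delta> b) (\<lambda>b1 b2.
      F (a1 * m1 * b1) (lact M a2 (ract M m0 b2)))))"
  using M assms(3) unfolding bicov_bimodule_def
  by (simp add: Let_def sw_sw assms(2) sw_kpure[OF assms(1,2)] del: act_simps(5))

lemma sw_rco_ract:
  assumes F: "bilin M H Z F" and Z: "vspace Z" and m: "m \<in> car M"
  shows "sw Z (rco M (ract M m b)) F =
    sw Z (rco M m) (\<lambda>m0 m1. sw Z (\<Delta> b) (\<lambda>b1 b2. F (ract M m0 b1) (m1 * b2)))"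
proof -
  note [klin] = bilin_comp_left[OF F] bilin_comp_right[OF F]
  have "sw Z (rco M (ract M m b)) F = sw Z (rco M (lact M 1 (ract M m b))) F"
    using M m by simp
  also have "\<dots> = sw Z (rco M m) (\<lambda>m0 m1. sw Z (\<Delta> b) (\<lambda>b1 b2.
      F (lact M 1 (ract M m0 b1)) (1 * m1 * b2)))"
    unfolding sw_rco_act[OF assms]
    by (rule sw_comult_1[OF _ Z]) (use M m Z in \<open>auto intro!: bilinI klin simp del: act_simps\<close>)
  also have "\<dots> = sw Z (rco M m) (\<lambda>m0 m1. sw Z (\<Delta> b) (\<lambda>b1 b2. F (ract M m0 b1) (m1 * b2)))"
    by (rule sw_rco_cong) (use M m in auto)
  finally show ?thesis .
qed

lemma sw_rco_lact:
  assumes F: "bilin M H Z F" and Z: "vspace Z" and m: "m \<in> car M"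
  shows "sw Z (rco M (lact M a m)) F =
    sw Z (\<Delta> a) (\<lambda>a1 a2. sw Z (rco M m) (\<lambda>m0 m1. F (lact M a1 m0) (a2 * m1)))"
proof -
  note [klin] = bilin_comp_left[OF F] bilin_comp_right[OF F]
  have "sw Z (rco M (lact M a m)) F = sw Z (rco M (lact M a (ract M m 1))) F"
    using M m by simp
  also have "\<dots> = sw Z (\<Delta> a) (\<lambda>a1 a2. sw Z (rco M m) (\<lambda>m0 m1.
      F (lact M a1 (ract M m0 1)) (a2 * m1 * 1)))"
    unfolding sw_rco_act[OF assms]
    by (intro sw_cong sw_rco_cong sw_comult_1[OF _ Z])
      (use M m Z in \<open>auto intro!: bilinI klin simp del: act_simps\<close>)
  also have "\<dots> = sw Z (\<Delta> a) (\<lambda>a1 a2. sw Z (rco M m) (\<lambda>m0 m1. F (lact M a1 m0) (a2 * m1)))"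
    by (intro sw_cong sw_rco_cong) (use M m in auto)
  finally show ?thesis .
qed

lemma sw_lco_ract:
  assumes F: "bilin H M Z F" and Z: "vspace Z" and m: "m \<in> car M"
  shows "sw Z (lco M (ract M m b)) F =
    sw Z (lco M m) (\<lambda>m1 m0. sw Z (\<Delta> b) (\<lambda>b1 b2. F (m1 * b1) (ract M m0 b2)))"
proof -
  note [klin] = bilin_comp_left[OF F] bilin_comp_right[OF F]
  have "sw Z (lco M (ract M m b)) F = sw Z (lco M (lact M 1 (ract M m b))) F"
    using M m by simp
  also have "\<dots> = sw Z (lco M m) (\<lambda>m1 m0. sw Z (\<Delta> b) (\<lambda>b1 b2.
      F (1 * m1 * b1) (lact M 1 (ract M m0 b2))))"
    unfolding sw_lco_act[OF assms]
    by (rule sw_comult_1[OF _ Z]) (use M m Z in \<open>auto intro!: bilinI klin simp del: act_simps\<close>)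
  also have "\<dots> = sw Z (lco M m) (\<lambda>m1 m0. sw Z (\<Delta> b) (\<lambda>b1 b2. F (m1 * b1) (ract M m0 b2)))"
    by (rule sw_lco_cong) (use M m in auto)
  finally show ?thesis .
qed

lemma sw_lco_lact:
  assumes F: "bilin H M Z F" and Z: "vspace Z" and m: "m \<in> car M"
  shows "sw Z (lco M (lact M a m)) F =
    sw Z (\<Delta> a) (\<lambda>a1 a2. sw Z (lco M m) (\<lambda>m1 m0. F (a1 * m1) (lact M a2 m0)))"
proof -
  note [klin] = bilin_comp_left[OF F] bilin_comp_right[OF F]
  have "sw Z (lco M (lact M a m)) F = sw Z (lco M (lact M a (ract M m 1))) F"
    using M m by simp
  also have "\<dots> = sw Z (\<Delta> a) (\<lambda>a1 a2. sw Z (lco M m) (\<lambda>m1 m0.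
      F (a1 * m1 * 1) (lact M a2 (ract M m0 1))))"
    unfolding sw_lco_act[OF assms]
    by (intro sw_cong sw_lco_cong sw_comult_1[OF _ Z])
      (use M m Z in \<open>auto intro!: bilinI klin simp del: act_simps\<close>)
  also have "\<dots> = sw Z (\<Delta> a) (\<lambda>a1 a2. sw Z (lco M m) (\<lambda>m1 m0. F (a1 * m1) (lact M a2 m0)))"
    by (intro sw_cong sw_lco_cong) (use M m in auto)
  finally show ?thesis .
qed

end

text \<open>For a right covariant \<open>M\<close> this is equivalent to \<open>\<delta>(m) = m \<otimes> 1\<close>.\<close>

definition coinv :: "('k, 'h, 'm::ab_group_add) bcb \<Rightarrow> 'm \<Rightarrow> bool" where
  "coinv M m \<longleftrightarrow> m \<in> car M \<and> (\<forall>b. rco M (ract M m b) =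
     sw (ktens M H) (\<Delta> b) (\<lambda>b1 b2. kpure M H (ract M m b1) b2))"

text \<open>The projection onto right coinvariants from the fundamental theorem of Hopf
  modules.\<close>

definition rproj :: "('k, 'h, 'm::ab_group_add) bcb \<Rightarrow> 'm \<Rightarrow> 'm" where
  "rproj M m = sw M (rco M m) (\<lambda>m0 m1. ract M m0 (S m1))"

text \<open>The left adjoint action h \<triangleright> m of the overview.\<close>

definition ad :: "('k, 'h, 'm::ab_group_add) bcb \<Rightarrow> 'h \<Rightarrow> 'm \<Rightarrow> 'm" where
  "ad M h m = sw M (\<Delta> h) (\<lambda>a b. lact M a (ract M m (S b)))"

lemma coinv_car [simp]: "coinv M m \<Longrightarrow> m \<in> car M"
  by (simp add: coinv_def)

lemma sw_rco_coinv:
  assumes "coinv M m" "bilin M H Z F" "vspace Z"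
  shows "sw Z (rco M (ract M m b)) F = sw Z (\<Delta> b) (\<lambda>b1 b2. F (ract M m b1) b2)"
  using assms(1) by (simp add: coinv_def sw_sw assms(3) sw_kpure[OF assms(2,3)])

lemma sw_rco_coinv_1:
  assumes "bimodule H M" "coinv M m" "bilin M H Z F" "vspace Z"
  shows "sw Z (rco M m) F = F m 1"
proof -
  note [klin] = bilin_comp_left[OF assms(3)] bilin_comp_right[OF assms(3)]
  have "sw Z (rco M m) F = sw Z (rco M (ract M m 1)) F" using assms(1,2) by simp
  also have "\<dots> = sw Z (\<Delta> 1) (\<lambda>b1 b2. F (ract M m b1) b2)"
    by (rule sw_rco_coinv[OF assms(2-4)])
  also have "\<dots> = F (ract M m 1) 1"
    by (rule sw_comult_1) (use assms in \<open>auto intro!: bilinI klin simp del: act_simps\<close>)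
  finally show ?thesis using assms(1,2) by simp
qed

lemma ad_closed [simp]: "bimodule H M \<Longrightarrow> m \<in> car M \<Longrightarrow> ad M h m \<in> car M"
  unfolding ad_def by auto

lemma klinear_ad [klin]:
  "bimodule H M \<Longrightarrow> klinear W M g \<Longrightarrow> klinear W M (\<lambda>w. ad M h (g w))"
  "bimodule H M \<Longrightarrow> m \<in> car M \<Longrightarrow> klinear W H u \<Longrightarrow> klinear W M (\<lambda>w. ad M (u w) m)"
  unfolding ad_def by (auto intro!: klin)

lemma sw_comult_antip_mult:
  assumes F: "bilin H H Z F" and Z: "vspace Z"
  shows "sw Z (\<Delta> (S h * b)) F =
    sw Z (\<Delta> h) (\<lambda>c d. sw Z (\<Delta> b) (\<lambda>b1 b2. F (S d * b1) (S c * b2)))"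
proof -
  note [klin] = bilin_comp_left[OF F] bilin_comp_right[OF F]
  show ?thesis
    unfolding sw_comult_mult[OF assms]
    by (rule sw_comult_antip) (auto intro!: bilinI klin Z)
qed

lemma ad_1:
  assumes "bimodule H M" "m \<in> car M"
  shows "ad M 1 m = m"
proof -
  have "ad M 1 m = lact M 1 (ract M m (S 1))"
    unfolding ad_def by (rule sw_comult_1) (use assms in \<open>auto intro!: bilinI klin simp del: act_simps\<close>)
  then show ?thesis using assms by (simp add: antip_1)
qed

lemma ad_mult:
  assumes M: "bimodule H M" and m: "m \<in> car M"
  shows "ad M (g * h) m = ad M g (ad M h m)"
proof -
  have "ad M (g * h) m = sw M (\<Delta> g) (\<lambda>a1 a2. sw M (\<Delta> h) (\<lambda>b1 b2.
      lact M (a1 * b1) (ract M m (S (a2 * b2)))))"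
    unfolding ad_def by (rule sw_comult_mult) (use M m in \<open>auto intro!: bilinI klin\<close>)
  also have "\<dots> = sw M (\<Delta> g) (\<lambda>a1 a2. lact M a1 (ract M (ad M h m) (S a2)))"
    unfolding ad_def
    by (subst sw_comult_apply[where Z = M and Z' = M and L = "\<lambda>x. lact M _ (ract M x (S _))"])
      (use M m in \<open>auto intro!: klin simp: antip_mult\<close>)
  finally show ?thesis by (simp add: ad_def)
qed

text \<open>a_1 m S(a_2) a_3 = a m. Coinvariants generate only as a right module, so every left
  action has to be rewritten as a right action on adjoint translates.\<close>

lemma sw_ad_ract:
  assumes M: "bimodule H M" and m: "m \<in> car M"
  shows "sw M (\<Delta> a) (\<lambda>a1 a2. ract M (ad M a1 m) a2) = lact M a m"
proof -
  have "sw M (\<Delta> a) (\<lambda>a1 a2. ract M (ad M a1 m) a2) =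
    sw M (\<Delta> a) (\<lambda>x c. sw M (\<Delta> x) (\<lambda>a b. lact M a (ract M m (S b * c))))"
    unfolding ad_def
    by (subst sw_comult_apply[where Z = M and Z' = M and L = "\<lambda>x. ract M x _"])
      (use M m in \<open>auto intro!: klin\<close>)
  also have "\<dots> = sw M (\<Delta> a) (\<lambda>a x. sw M (\<Delta> x) (\<lambda>b c. lact M a (ract M m (S b * c))))"
    by (rule sw_coassoc) (use M m in \<open>auto intro!: klin\<close>)
  also have "\<dots> = lact M a (ract M m 1)"
    by (rule sw_cancel(4)) (use M m in \<open>auto intro!: bilinI klin simp del: act_simps\<close>)
  finally show ?thesis using M m by simp
qed

lemma sw_ad_lact:
  assumes M: "bimodule H M" and N: "bimodule H N" and m: "m \<in> car M" and n: "n \<in> car N"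
    and F: "bilin M N Z F" and Z: "vspace Z"
    and bal: "\<And>m n a. m \<in> car M \<Longrightarrow> n \<in> car N \<Longrightarrow> F (ract M m a) n = F m (lact N a n)"
  shows "sw Z (\<Delta> a) (\<lambda>a1 a2. F (ad M a1 m) (lact N a2 n)) = F (lact M a m) n"
proof -
  have "F (lact M a m) n = F (sw M (\<Delta> a) (\<lambda>a1 a2. ract M (ad M a1 m) a2)) n"
    using sw_ad_ract[OF M m] by simp
  also have "\<dots> = sw Z (\<Delta> a) (\<lambda>a1 a2. F (ract M (ad M a1 m) a2) n)"
    by (rule sw_comult_apply[OF bilin_left[OF F n]]) (use M m in auto)
  finally show ?thesis using M m n by (simp add: bal)
qed

text \<open>The consequence of right covariance by which equalities of linear maps are reduced to
  coinvariants. It is proved separately for tensor products over H.\<close>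

definition cogen :: "('k, 'h, 'm::ab_group_add) bcb \<Rightarrow> bool" where
  "cogen M \<longleftrightarrow> bimodule H M \<and> rcomod M \<and>
     car M \<subseteq> module.span (scl M) {ract M m b | m b. coinv M m}"

lemma cogen_simps [simp]: "cogen M \<Longrightarrow> bimodule H M" "cogen M \<Longrightarrow> rcomod M"
  by (simp_all add: cogen_def)

lemma span_eqI:
  assumes X: "vspace X" and Z: "vspace Z" and "klinear X Z f" "klinear X Z g"
    and G: "car X \<subseteq> module.span (scl X) G" "G \<subseteq> car X"
    and eq: "\<And>x. x \<in> G \<Longrightarrow> f x = g x" and x: "x \<in> car X"
  shows "f x = g x"
proof -
  interpret vector_space "scl X" using X by (rule vspace_vector_space)
  have "subspace {x \<in> car X. f x = g x}"
    by (rule subspaceI)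
      (auto simp: vspace_zero[OF X] vspace_add[OF X] vspace_scl[OF X] klinear_add[OF assms(3)]
        klinear_add[OF assms(4)] klinear_scl[OF assms(3)] klinear_scl[OF assms(4)]
        klinear_zero[OF assms(3) X] klinear_zero[OF assms(4) X])
  then have "span G \<subseteq> {x \<in> car X. f x = g x}"
    by (rule span_minimal[rotated]) (use G eq in auto)
  then show ?thesis using G x by auto
qed

lemma cogen_eqI:
  assumes M: "cogen M" and Z: "vspace Z" and fg: "klinear M Z f" "klinear M Z g"
    and eq: "\<And>m b. coinv M m \<Longrightarrow> f (ract M m b) = g (ract M m b)" and x: "x \<in> car M"
  shows "f x = g x"
proof (rule span_eqI[OF _ Z fg _ _ _ x])
  show "vspace M" using M by simp
  show "car M \<subseteq> module.span (scl M) {ract M m b | m b. coinv M m}"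
    using M unfolding cogen_def by blast
  show "{ract M m b | m b. coinv M m} \<subseteq> car M" using M by auto
qed (use eq in blast)

lemma htens_eqI_left:
  assumes M: "cogen M" and N: "bimodule H N" and Z: "vspace Z"
    and fg: "klinear (htens H M N) Z f" "klinear (htens H M N) Z g" and t: "t \<in> car (htens H M N)"
    and eq: "\<And>m n. coinv M m \<Longrightarrow> n \<in> car N \<Longrightarrow> f (hpure M N m n) = g (hpure M N m n)"
  shows "f t = g t"
proof (rule htens_eqI[OF _ N fg t])
  note [klin] = klinear_comp[OF _ fg(1)] klinear_comp[OF _ fg(2)]
  fix x y assume x: "x \<in> car M" and y: "y \<in> car N"
  show "f (hpure M N x y) = g (hpure M N x y)"
    by (rule cogen_eqI[OF M Z _ _ _ x, where f = "\<lambda>x. f (hpure M N x y)"])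
      (use M N y in \<open>auto intro!: klin eq simp: hpure_balanced\<close>)
qed (use M in simp)

lemma htens_eqI_right:
  assumes M: "bimodule H M" and N: "cogen N" and Z: "vspace Z"
    and fg: "klinear (htens H M N) Z f" "klinear (htens H M N) Z g" and t: "t \<in> car (htens H M N)"
    and eq: "\<And>m n b. m \<in> car M \<Longrightarrow> coinv N n \<Longrightarrow>
      f (hpure M N m (ract N n b)) = g (hpure M N m (ract N n b))"
  shows "f t = g t"
proof (rule htens_eqI[OF M _ fg t])
  note [klin] = klinear_comp[OF _ fg(1)] klinear_comp[OF _ fg(2)]
  fix x y assume x: "x \<in> car M" and y: "y \<in> car N"
  show "f (hpure M N x y) = g (hpure M N x y)"
    by (rule cogen_eqI[OF N Z _ _ _ y, where f = "\<lambda>y. f (hpure M N x y)"])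
      (use M N x in \<open>auto intro!: klin eq\<close>)
qed (use N in simp)

lemma htens_eqI_coinv:
  assumes M: "cogen M" and N: "cogen N" and Z: "vspace Z"
    and fg: "klinear (htens H M N) Z f" "klinear (htens H M N) Z g" and t: "t \<in> car (htens H M N)"
    and eq: "\<And>m n b. coinv M m \<Longrightarrow> coinv N n \<Longrightarrow>
      f (hpure M N m (ract N n b)) = g (hpure M N m (ract N n b))"
  shows "f t = g t"
proof (rule htens_eqI_left[OF M _ Z fg t])
  note [klin] = klinear_comp[OF _ fg(1)] klinear_comp[OF _ fg(2)]
  fix x y assume x: "coinv M x" and y: "y \<in> car N"
  show "f (hpure M N x y) = g (hpure M N x y)"
    by (rule cogen_eqI[OF N Z _ _ _ y, where f = "\<lambda>y. f (hpure M N x y)"])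
      (use M N x in \<open>auto intro!: klin eq\<close>)
qed (use N in simp)

section \<open>Coinvariants of a bicovariant bimodule\<close>

context
  fixes M :: "('k, 'h, 'm::ab_group_add) bcb"
  assumes M: "bicov_bimodule H M"
begin

lemma rproj_closed: "m \<in> car M \<Longrightarrow> rproj M m \<in> car M"
  unfolding rproj_def using M by auto

lemma klinear_rco: "klinear M (ktens M H) (rco M)"
  using bicov_bimodule_simps(3)[OF M] by (simp add: rcomod_def)

text \<open>The coaction of m_0 S(m_1) b is m_0 S(m_3) b_1 \<otimes> m_1 S(m_2) b_2, because S
  reverses \<Delta>; then m_1 S(m_2) cancels.\<close>

lemma coinv_rproj:
  assumes m: "m \<in> car M"
  shows "coinv M (rproj M m)"
  unfolding coinv_def
proof (intro conjI allI)
  show "rproj M m \<in> car M" using m by (rule rproj_closed)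
  fix b
  define T where "T = ktens M H"
  have [simp]: "vspace T" using M by (simp add: T_def)
  note [klin] = klinear_kpure_left[of M H, folded T_def] klinear_kpure_right[of M H, folded T_def]
  have [simp]: "x \<in> car M \<Longrightarrow> kpure M H x y \<in> car T" for x y using M by (simp add: T_def)
  define K where "K x y q = sw T (\<Delta> q) (\<lambda>c d. sw T (\<Delta> b) (\<lambda>b1 b2.
    kpure M H (ract M x (S d * b1)) ((y * S c) * b2)))" for x y q
  have "ract M (rproj M m) b = sw M (rco M m) (\<lambda>p q. ract M (ract M p (S q)) b)"
    unfolding rproj_def
    by (rule sw_rco_apply[where Z = M and L = "\<lambda>x. ract M x b"]) (use M m in \<open>auto intro!: klin\<close>)
  also have "\<dots> = sw M (rco M m) (\<lambda>p q. ract M p (S q * b))"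
    by (rule sw_rco_cong) (use M m in auto)
  finally have "rco M (ract M (rproj M m) b) = sw T (rco M m) (\<lambda>p q. rco M (ract M p (S q * b)))"
    using sw_rco_apply[OF klinear_rco, of M m "\<lambda>p q. ract M p (S q * b)"] M m by (simp add: T_def)
  also have "\<dots> = sw T (rco M m) (\<lambda>p q. sw T (rco M p) (\<lambda>x y. K x y q))"
  proof (rule sw_rco_cong)
    fix p q assume p: "p \<in> car M"
    have "rco M (ract M p (S q * b)) = sw T (rco M (ract M p (S q * b))) (kpure M H)"
      using sw_rco_kpure[of M] M p by (simp add: T_def)
    also have "\<dots> = sw T (rco M p) (\<lambda>x y. sw T (\<Delta> (S q * b)) (\<lambda>u v. kpure M H (ract M x u) (y * v)))"
      by (rule sw_rco_ract[OF M]) (use M p in \<open>auto intro!: bilinI klin\<close>)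
    also have "\<dots> = sw T (rco M p) (\<lambda>x y. K x y q)"
      by (rule sw_rco_cong, use M p in simp, use M p in simp, subst sw_comult_antip_mult)
        (use M p in \<open>auto intro!: bilinI klin simp: K_def mult.assoc\<close>)
    finally show "rco M (ract M p (S q * b)) = sw T (rco M p) (\<lambda>x y. K x y q)" .
  qed (use M m in auto)
  also have "\<dots> = sw T (rco M m) (\<lambda>x z. sw T (\<Delta> z) (\<lambda>y q. K x y q))"
    by (rule sw_rco_coassoc) (use M m in \<open>auto intro!: klin simp: K_def\<close>)
  also have "\<dots> = sw T (rco M m) (\<lambda>x z. sw T (\<Delta> b) (\<lambda>b1 b2. kpure M H (ract M x (S z * b1)) (1 * b2)))"
    unfolding K_def
    by (rule sw_rco_cong, use M m in simp, use M m in simp, rule sw_cancel(1))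
      (use M in \<open>auto intro!: bilinI klin\<close>)
  also have "\<dots> = sw T (\<Delta> b) (\<lambda>b1 b2. sw T (rco M m) (\<lambda>x z. kpure M H (ract M x (S z * b1)) (1 * b2)))"
    by (rule sw_swap) simp
  also have "\<dots> = sw T (\<Delta> b) (\<lambda>b1 b2. kpure M H (ract M (rproj M m) b1) b2)"
  proof (rule sw_cong)
    fix b1 b2
    have "kpure M H (ract M (rproj M m) b1) b2 =
      sw T (rco M m) (\<lambda>x z. kpure M H (ract M (ract M x (S z)) b1) b2)"
      unfolding rproj_def
      by (rule sw_rco_apply[where Z = M and L = "\<lambda>x. kpure M H (ract M x b1) b2"])
        (use M m in \<open>auto intro!: klin simp del: act_simps\<close>)
    also have "\<dots> = sw T (rco M m) (\<lambda>x z. kpure M H (ract M x (S z * b1)) (1 * b2))"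
      by (rule sw_rco_cong) (use M m in auto)
    finally show "sw T (rco M m) (\<lambda>x z. kpure M H (ract M x (S z * b1)) (1 * b2)) =
      kpure M H (ract M (rproj M m) b1) b2" ..
  qed
  finally show "rco M (ract M (rproj M m) b) =
    sw (ktens M H) (\<Delta> b) (\<lambda>b1 b2. kpure M H (ract M (rproj M m) b1) b2)"
    by (simp add: T_def)
qed

text \<open>m_0 S(m_1) m_2 = m. With \<open>coinv_rproj\<close> this shows that the coinvariants
  generate.\<close>

lemma rproj_expand:
  assumes m: "m \<in> car M"
  shows "m = sw M (rco M m) (\<lambda>m0 m1. ract M (rproj M m0) m1)"
proof -
  have "sw M (rco M m) (\<lambda>m0 m1. ract M (rproj M m0) m1) =
    sw M (rco M m) (\<lambda>m0 m1. sw M (rco M m0) (\<lambda>x y. ract M (ract M x (S y)) m1))"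
    unfolding rproj_def
    by (rule sw_rco_cong, use M m in simp, use M m in simp,
        rule sw_rco_apply[where L = "\<lambda>x. ract M x _"]) (use M m in \<open>auto intro!: klin\<close>)
  also have "\<dots> = sw M (rco M m) (\<lambda>m0 m1. sw M (rco M m0) (\<lambda>x y. ract M x (S y * m1)))"
    by (intro sw_rco_cong) (use M m in auto)
  also have "\<dots> = sw M (rco M m) (\<lambda>x z. sw M (\<Delta> z) (\<lambda>y m1. ract M x (S y * m1)))"
    by (rule sw_rco_coassoc) (use M m in \<open>auto intro!: klin\<close>)
  also have "\<dots> = sw M (rco M m) (\<lambda>x z. scl M (\<epsilon> z) (ract M x 1))"
    by (rule sw_rco_cong, use M m in simp, use M m in simp, rule sw_antip_left)
      (use M m in \<open>auto intro!: klin\<close>)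
  also have "\<dots> = ract M m 1"
    by (rule sw_rco_counit) (use M m in \<open>auto intro!: klin simp del: act_simps\<close>)
  finally show ?thesis using M m by simp
qed

lemma cogen_bicov: "cogen M"
proof -
  interpret vector_space "scl M" using M by (intro vspace_vector_space) simp
  have "m \<in> span {ract M m b | m b. coinv M m}" if m: "m \<in> car M" for m
  proof -
    have "sw M (rco M m) (\<lambda>m0 m1. ract M (rproj M m0) m1) \<in> span {ract M m b | m b. coinv M m}"
      unfolding sw_def
    proof (rule span_sum, clarify)
      fix x y assume "(x, y) \<in> Poly_Mapping.keys (rco M m)"
      then have "x \<in> car M"
        using tset_keys(1)[OF rco_tset[OF bicov_bimodule_simps(3)[OF M] m]] by simp
      then have "coinv M (rproj M x)" by (rule coinv_rproj)
      then show "scl M (Poly_Mapping.lookup (rco M m) (x, y)) (ract M (rproj M x) y)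
        \<in> span {ract M m b | m b. coinv M m}"
        by (intro span_scale span_base) blast
    qed
    then show ?thesis using rproj_expand[OF m] by simp
  qed
  then show ?thesis using M by (auto simp: cogen_def)
qed

text \<open>The coaction of h_1 m S(h_2) b is h_1 m S(h_4) b_1 \<otimes> h_2 S(h_3) b_2, where h_2
  S(h_3) cancels. This lets braidings and rational products be iterated within coinvariant
  arguments.\<close>

lemma coinv_ad:
  assumes m: "coinv M m"
  shows "coinv M (ad M h m)"
  unfolding coinv_def
proof (intro conjI allI)
  show "ad M h m \<in> car M" using M m by simp
  fix b
  define T where "T = ktens M H"
  have [simp]: "vspace T" using M by (simp add: T_def)
  note [klin] = klinear_kpure_left[of M H, folded T_def] klinear_kpure_right[of M H, folded T_def]
  have [simp]: "x \<in> car M \<Longrightarrow> kpure M H x y \<in> car T" for x y using M by (simp add: T_def)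
  define G where "G = (\<lambda>c u f. sw T (\<Delta> b) (\<lambda>b1 b2.
    kpure M H (lact M c (ract M m (S f * b1))) (u * b2)))"
  have "ract M (ad M h m) b = sw M (\<Delta> h) (\<lambda>c d. ract M (lact M c (ract M m (S d))) b)"
    unfolding ad_def
    by (rule sw_comult_apply[where Z = M and L = "\<lambda>x. ract M x b"]) (use M m in \<open>auto intro!: klin\<close>)
  also have "\<dots> = sw M (\<Delta> h) (\<lambda>c d. lact M c (ract M m (S d * b)))"
    using M m by simp
  finally have "rco M (ract M (ad M h m) b) =
      sw T (\<Delta> h) (\<lambda>c d. rco M (lact M c (ract M m (S d * b))))"
    using sw_comult_apply[OF klinear_rco, of "\<lambda>c d. lact M c (ract M m (S d * b))"] M m
    by (simp add: T_def)
  also have "\<dots> = sw T (\<Delta> h) (\<lambda>x d. sw T (\<Delta> x) (\<lambda>c1 c2. sw T (\<Delta> d) (\<lambda>e f. G c1 (c2 * S e) f)))"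
  proof (rule sw_cong)
    fix c d
    let ?m = "ract M m (S d * b)"
    have "rco M (lact M c ?m) = sw T (rco M (lact M c ?m)) (kpure M H)"
      using sw_rco_kpure[of M "lact M c ?m"] M m by (simp add: T_def)
    also have "\<dots> = sw T (\<Delta> c) (\<lambda>c1 c2. sw T (rco M ?m) (\<lambda>x y. kpure M H (lact M c1 x) (c2 * y)))"
      by (rule sw_rco_lact[OF M]) (use M m in \<open>auto intro!: bilinI klin\<close>)
    also have "\<dots> = sw T (\<Delta> c) (\<lambda>c1 c2. sw T (\<Delta> (S d * b)) (\<lambda>u v. kpure M H (lact M c1 (ract M m u)) (c2 * v)))"
      by (intro sw_cong sw_rco_coinv[OF m]) (use M m in \<open>auto intro!: bilinI klin\<close>)
    also have "\<dots> = sw T (\<Delta> c) (\<lambda>c1 c2. sw T (\<Delta> d) (\<lambda>e f. G c1 (c2 * S e) f))"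
      by (rule sw_cong, subst sw_comult_antip_mult)
        (use M m in \<open>auto intro!: bilinI klin simp: G_def mult.assoc\<close>)
    finally show "rco M (lact M c ?m) =
      sw T (\<Delta> c) (\<lambda>c1 c2. sw T (\<Delta> d) (\<lambda>e f. G c1 (c2 * S e) f))" .
  qed
  also have "\<dots> = sw T (\<Delta> h) (\<lambda>c1 x. sw T (\<Delta> x) (\<lambda>c2 d. sw T (\<Delta> d) (\<lambda>e f. G c1 (c2 * S e) f)))"
    by (rule sw_coassoc) (use M m in \<open>auto intro!: klin simp: G_def\<close>)
  also have "\<dots> = sw T (\<Delta> h) (\<lambda>c1 x. G c1 1 x)"
    by (intro sw_cong sw_cancel(1)) (use M m in \<open>auto intro!: bilinI klin simp: G_def\<close>)
  also have "\<dots> = sw T (\<Delta> b) (\<lambda>b1 b2. sw T (\<Delta> h) (\<lambda>c f. kpure M H (lact M c (ract M m (S f * b1))) b2))"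
    unfolding G_def by (subst sw_swap) auto
  also have "\<dots> = sw T (\<Delta> b) (\<lambda>b1 b2. kpure M H (ract M (ad M h m) b1) b2)"
    unfolding ad_def
    by (subst sw_comult_apply[where Z = M and Z' = T and L = "\<lambda>x. kpure M H (ract M x _) _"])
      (use M m in \<open>auto intro!: klin\<close>)
  finally show "rco M (ract M (ad M h m) b) =
    sw (ktens M H) (\<Delta> b) (\<lambda>b1 b2. kpure M H (ract M (ad M h m) b1) b2)"
    by (simp add: T_def)
qed

end

text \<open>Both \<open>\<phi> \<otimes>\<^sub>\<sigma> \<psi>\<close> and the sum of connections are, before passing to \<open>M \<otimes>\<^sub>H N\<close>, of the form \<open>twist G\<close>.\<close>

definition twist ::
  "('k, 'c::ab_group_add, 'z) vsp_scheme \<Rightarrow> ('k, 'h, 'm::ab_group_add) bcb \<Rightarrow>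
   ('k, 'h, 'n::ab_group_add) bcb \<Rightarrow> ('m \<Rightarrow> 'n \<Rightarrow> 'c) \<Rightarrow> 'm \<Rightarrow> 'n \<Rightarrow> 'c" where
  "twist Z M N G m n = sw Z (rco M m) (\<lambda>m0 h. sw Z (\<Delta> h) (\<lambda>m1 m2.
     G (ract M m0 (S m1)) (lact N m2 n)))"

context
  fixes M :: "('k, 'h, 'm::ab_group_add) bcb" and N :: "('k, 'h, 'n::ab_group_add) bcb"
    and Z :: "('k, 'c::ab_group_add, 'z) vsp_scheme" and G
  assumes M: "cogen M" and N: "bimodule H N" and Z: "vspace Z" and G: "bilin M N Z G"
begin

lemma bilin_twist: "bilin M N Z (twist Z M N G)"
proof -
  note [klin] = bilin_comp_left[OF G] bilin_comp_right[OF G]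
  show ?thesis unfolding twist_def
    by (rule bilinI) (use M N Z in \<open>auto intro!: klin bilin_closed[OF G]\<close>)
qed

text \<open>At m b the twist is the sum of G(m b_1 S(b_2), b_3 n), and b_1 S(b_2) cancels.\<close>

lemma twist_coinv:
  assumes m: "coinv M m" and n: "n \<in> car N"
  shows "twist Z M N G (ract M m b) n = G m (lact N b n)"
proof -
  note [klin] = bilin_comp_left[OF G] bilin_comp_right[OF G]
  note [simp] = bilin_closed[OF G]
  have "twist Z M N G (ract M m b) n = sw Z (\<Delta> b) (\<lambda>x h. sw Z (\<Delta> h) (\<lambda>m1 m2.
      G (ract M (ract M m x) (S m1)) (lact N m2 n)))"
    unfolding twist_def
    by (rule sw_rco_coinv[OF m _ Z]) (use M N Z n in \<open>auto intro!: bilinI klin simp del: act_simps\<close>)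
  also have "\<dots> = sw Z (\<Delta> b) (\<lambda>x h. sw Z (\<Delta> h) (\<lambda>m1 m2. G (ract M m (x * S m1)) (lact N m2 n)))"
    using M m by simp
  also have "\<dots> = G (ract M m 1) (lact N b n)"
    by (rule sw_cancel(1)) (use M N Z n m in \<open>auto intro!: bilinI klin simp del: act_simps\<close>)
  finally show ?thesis using M m by simp
qed

text \<open>\<open>G\<close> itself is not assumed to be balanced. At m b with m coinvariant both
  sides equal G(m, b a n), and such elements span M.\<close>

lemma twist_balanced:
  assumes m: "m \<in> car M" and n: "n \<in> car N"
  shows "twist Z M N G (ract M m a) n = twist Z M N G m (lact N a n)"
proof -
  note [klin] = bilin_comp_left[OF bilin_twist]
  show ?thesis
    by (rule cogen_eqI[OF M Z _ _ _ m, where f = "\<lambda>m. twist Z M N G (ract M m a) n"])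
      (use M N Z n in \<open>auto intro!: klin simp: twist_coinv\<close>)
qed

lemma sw_twist:
  assumes "m \<in> car M" "n \<in> car N"
  shows "sw Z (hpure M N m n) (twist Z M N G) = twist Z M N G m n"
  by (rule sw_hpure[OF bilin_twist Z]) (use assms twist_balanced in auto)

lemma sw_twist_coinv:
  assumes "coinv M m" "n \<in> car N"
  shows "sw Z (hpure M N m n) (twist Z M N G) = G m n"
  using sw_twist[of m n] twist_coinv[OF assms, of 1] M N assms by simp

end

section \<open>Coactions on tensor products\<close>

context
  fixes M :: "('k, 'h, 'm::ab_group_add) bcb" and N :: "('k, 'h, 'n::ab_group_add) bcb"
  assumes M: "bicov_bimodule H M" and N: "bicov_bimodule H N"
begin

lemma bilin_htens_rco:
  "bilin M N (ktens (htens H M N) H) (\<lambda>m n. sw (ktens (htens H M N) H) (rco M m) (\<lambda>m0 m1.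
     sw (ktens (htens H M N) H) (rco N n) (\<lambda>n0 n1.
       kpure (htens H M N) H (hpure M N m0 n0) (m1 * n1))))"
  using M N by (auto intro!: bilinI klin)

lemma bilin_htens_lco:
  "bilin M N (ktens H (htens H M N)) (\<lambda>m n. sw (ktens H (htens H M N)) (lco M m) (\<lambda>m1 m0.
     sw (ktens H (htens H M N)) (lco N n) (\<lambda>n1 n0.
       kpure H (htens H M N) (m1 * n1) (hpure M N m0 n0))))"
  using M N by (auto intro!: bilinI klin)

text \<open>The diagonal coaction is well defined over H: by covariance m a \<otimes> n and m
  \<otimes> a n both give m_0 a_1 \<otimes> n_0 \<otimes> m_1 a_2 n_1, once a_1 has crossed the
  tensor sign.\<close>

lemma rco_htens_hpure:
  assumes "m \<in> car M" "n \<in> car N"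
  shows "rco (htens H M N) (hpure M N m n) = sw (ktens (htens H M N) H) (rco M m) (\<lambda>m0 m1.
     sw (ktens (htens H M N) H) (rco N n) (\<lambda>n0 n1.
       kpure (htens H M N) H (hpure M N m0 n0) (m1 * n1)))"
  unfolding htens_rco Let_def
proof (rule sw_hpure[OF bilin_htens_rco])
  let ?T = "ktens (htens H M N) H"
  show "vspace ?T" using M N by simp
  fix m n a assume m: "m \<in> car M" and n: "n \<in> car N"
  have "sw ?T (rco M (ract M m a)) (\<lambda>m0 m1. sw ?T (rco N n) (\<lambda>n0 n1.
          kpure (htens H M N) H (hpure M N m0 n0) (m1 * n1))) =
    sw ?T (rco M m) (\<lambda>m0 m1. sw ?T (\<Delta> a) (\<lambda>a1 a2. sw ?T (rco N n) (\<lambda>n0 n1.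
          kpure (htens H M N) H (hpure M N (ract M m0 a1) n0) (m1 * a2 * n1))))"
    by (rule sw_rco_ract[OF M]) (use M N m n in \<open>auto intro!: bilinI klin\<close>)
  also have "\<dots> = sw ?T (rco M m) (\<lambda>m0 m1. sw ?T (\<Delta> a) (\<lambda>a1 a2. sw ?T (rco N n) (\<lambda>n0 n1.
          kpure (htens H M N) H (hpure M N m0 (lact N a1 n0)) (m1 * (a2 * n1)))))"
    by (intro sw_cong sw_rco_cong) (use M N m n in \<open>auto simp: hpure_balanced mult.assoc\<close>)
  also have "\<dots> = sw ?T (rco M m) (\<lambda>m0 m1. sw ?T (rco N (lact N a n)) (\<lambda>n0 n1.
          kpure (htens H M N) H (hpure M N m0 n0) (m1 * n1)))"
    by (intro sw_rco_cong sw_rco_lact[OF N, symmetric])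
      (use M N m n in \<open>auto intro!: bilinI klin\<close>)
  finally show "sw ?T (rco M (ract M m a)) (\<lambda>m0 m1. sw ?T (rco N n) (\<lambda>n0 n1.
          kpure (htens H M N) H (hpure M N m0 n0) (m1 * n1))) =
      sw ?T (rco M m) (\<lambda>m0 m1. sw ?T (rco N (lact N a n)) (\<lambda>n0 n1.
          kpure (htens H M N) H (hpure M N m0 n0) (m1 * n1)))" .
qed

lemma lco_htens_hpure:
  assumes "m \<in> car M" "n \<in> car N"
  shows "lco (htens H M N) (hpure M N m n) = sw (ktens H (htens H M N)) (lco M m) (\<lambda>m1 m0.
     sw (ktens H (htens H M N)) (lco N n) (\<lambda>n1 n0.
       kpure H (htens H M N) (m1 * n1) (hpure M N m0 n0)))"
  unfolding htens_lco Let_def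
proof (rule sw_hpure[OF bilin_htens_lco])
  let ?T = "ktens H (htens H M N)"
  show "vspace ?T" using M N by simp
  fix m n a assume m: "m \<in> car M" and n: "n \<in> car N"
  have "sw ?T (lco M (ract M m a)) (\<lambda>m1 m0. sw ?T (lco N n) (\<lambda>n1 n0.
          kpure H (htens H M N) (m1 * n1) (hpure M N m0 n0))) =
    sw ?T (lco M m) (\<lambda>m1 m0. sw ?T (\<Delta> a) (\<lambda>a1 a2. sw ?T (lco N n) (\<lambda>n1 n0.
          kpure H (htens H M N) (m1 * a1 * n1) (hpure M N (ract M m0 a2) n0))))"
    by (rule sw_lco_ract[OF M]) (use M N m n in \<open>auto intro!: bilinI klin\<close>)
  also have "\<dots> = sw ?T (lco M m) (\<lambda>m1 m0. sw ?T (\<Delta> a) (\<lambda>a1 a2. sw ?T (lco N n) (\<lambda>n1 n0.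
          kpure H (htens H M N) (m1 * (a1 * n1)) (hpure M N m0 (lact N a2 n0)))))"
    by (intro sw_cong sw_lco_cong) (use M N m n in \<open>auto simp: hpure_balanced mult.assoc\<close>)
  also have "\<dots> = sw ?T (lco M m) (\<lambda>m1 m0. sw ?T (lco N (lact N a n)) (\<lambda>n1 n0.
          kpure H (htens H M N) (m1 * n1) (hpure M N m0 n0)))"
    by (intro sw_lco_cong sw_lco_lact[OF N, symmetric])
      (use M N m n in \<open>auto intro!: bilinI klin\<close>)
  finally show "sw ?T (lco M (ract M m a)) (\<lambda>m1 m0. sw ?T (lco N n) (\<lambda>n1 n0.
          kpure H (htens H M N) (m1 * n1) (hpure M N m0 n0))) =
      sw ?T (lco M m) (\<lambda>m1 m0. sw ?T (lco N (lact N a n)) (\<lambda>n1 n0.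
          kpure H (htens H M N) (m1 * n1) (hpure M N m0 n0)))" .
qed

lemma rcomod_htens: "rcomod (htens H M N)"
  unfolding rcomod_def htens_rco[abs_def] Let_def
  using M N by (auto intro!: klinear_sw_htens bilin_closed[OF bilin_htens_rco])

lemma lcomod_htens: "lcomod (htens H M N)"
  unfolding lcomod_def htens_lco[abs_def] Let_def
  using M N by (auto intro!: klinear_sw_htens bilin_closed[OF bilin_htens_lco])

lemma coinv_hpure:
  assumes m: "coinv M m" and n: "coinv N n"
  shows "coinv (htens H M N) (hpure M N m n)"
  unfolding coinv_def
proof (intro conjI allI)
  let ?T = "ktens (htens H M N) H"
  show "hpure M N m n \<in> car (htens H M N)" using M N m n by simp
  fix b
  have "rco (htens H M N) (ract (htens H M N) (hpure M N m n) b) =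
    sw ?T (rco M m) (\<lambda>m0 m1. sw ?T (rco N (ract N n b)) (\<lambda>n0 n1.
       kpure (htens H M N) H (hpure M N m0 n0) (m1 * n1)))"
    using M N m n by (simp add: rco_htens_hpure)
  also have "\<dots> = sw ?T (rco N (ract N n b)) (\<lambda>n0 n1.
       kpure (htens H M N) H (hpure M N m n0) (1 * n1))"
    by (rule sw_rco_coinv_1[OF _ m]) (use M N n in \<open>auto intro!: bilinI klin\<close>)
  also have "\<dots> = sw ?T (\<Delta> b) (\<lambda>b1 b2. kpure (htens H M N) H (hpure M N m (ract N n b1)) (1 * b2))"
    by (rule sw_rco_coinv[OF n]) (use M N m in \<open>auto intro!: bilinI klin\<close>)
  finally show "rco (htens H M N) (ract (htens H M N) (hpure M N m n) b) =
    sw ?T (\<Delta> b) (\<lambda>b1 b2. kpure (htens H M N) H (ract (htens H M N) (hpure M N m n) b1) b2)"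
    using M N m n by simp
qed

lemma cogen_htens: "cogen (htens H M N)"
proof -
  let ?T = "htens H M N"
  let ?G = "{ract ?T t b | t b. coinv ?T t}"
  interpret vector_space "scl ?T" using M N by (intro vspace_vector_space) simp
  have "hpure M N x y \<in> span ?G" if x: "x \<in> car M" and y: "y \<in> car N" for x y
  proof -
    \<comment> \<open>Only the first factor is coinvariant here, and m \<otimes> n b = (m \<otimes>
      n) b is already in the required form. A general first factor m b reduces to this case through
      m b \<otimes> y = m \<otimes> b y.\<close>
    have *: "hpure M N m y \<in> span ?G" if m: "coinv M m" and y: "y \<in> car N" for m y
    proof -
      interpret N: vector_space "scl N" using N by (intro vspace_vector_space) simp
      have kl: "klinear N ?T (\<lambda>y. hpure M N m y)" using M N m by (auto intro!: klin)
      have "N.subspace {y \<in> car N. hpure M N m y \<in> span ?G}"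
        by (rule N.subspaceI)
          (use N in \<open>auto simp: klinear_add[OF kl] klinear_scl[OF kl] klinear_zero[OF kl]
            vspace_zero vspace_add vspace_scl intro: span_zero span_add span_scale simp del: htens_scl\<close>)
      moreover have "{ract N n b | n b. coinv N n} \<subseteq> {y \<in> car N. hpure M N m y \<in> span ?G}"
      proof clarify
        fix n b assume n: "coinv N n"
        have "hpure M N m (ract N n b) = ract ?T (hpure M N m n) b" using M N m n by simp
        then have "hpure M N m (ract N n b) \<in> span ?G"
          by (intro span_base) (use coinv_hpure[OF m n] in blast)
        then show "ract N n b \<in> car N \<and> hpure M N m (ract N n b) \<in> span ?G" using N n by simp
      qed
      ultimately have "N.span {ract N n b | n b. coinv N n} \<subseteq> {y \<in> car N. hpure M N m y \<in> span ?G}"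
        by (rule N.span_minimal[rotated])
      then show ?thesis using y cogen_bicov[OF N] unfolding cogen_def by blast
    qed
    interpret M: vector_space "scl M" using M by (intro vspace_vector_space) simp
    have kl: "klinear M ?T (\<lambda>x. hpure M N x y)" using M N y by (auto intro!: klin)
    have "M.subspace {x \<in> car M. hpure M N x y \<in> span ?G}"
      by (rule M.subspaceI)
        (use M in \<open>auto simp: klinear_add[OF kl] klinear_scl[OF kl] klinear_zero[OF kl]
          vspace_zero vspace_add vspace_scl intro: span_zero span_add span_scale simp del: htens_scl\<close>)
    moreover have "{ract M m b | m b. coinv M m} \<subseteq> {x \<in> car M. hpure M N x y \<in> span ?G}"
    proof clarify
      fix m b assume m: "coinv M m"
      have "hpure M N (ract M m b) y = hpure M N m (lact N b y)"
        using m y by (simp add: hpure_balanced)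
      then show "ract M m b \<in> car M \<and> hpure M N (ract M m b) y \<in> span ?G"
        using *[OF m, of "lact N b y"] M N m y by simp
    qed
    ultimately have "M.span {ract M m b | m b. coinv M m} \<subseteq> {x \<in> car M. hpure M N x y \<in> span ?G}"
      by (rule M.span_minimal[rotated])
    then show ?thesis using x cogen_bicov[OF M] unfolding cogen_def by blast
  qed
  moreover have "t = sw ?T t (hpure M N)" if "t \<in> car ?T" for t
    using istens_expand[OF istens_htens that] M N by (simp add: hpure_def[abs_def])
  ultimately have "t \<in> span ?G" if "t \<in> car ?T" for t
  proof -
    have "sw ?T t (hpure M N) \<in> span ?G"
      unfolding sw_def
    proof (rule span_sum, clarify)
      fix x y assume "(x, y) \<in> Poly_Mapping.keys t"
      then have "x \<in> car M" "y \<in> car N" using tset_keys[of t M N] htens_tset[of M N] that M N by auto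
      then show "scl ?T (Poly_Mapping.lookup t (x, y)) (hpure M N x y) \<in> span ?G"
        by (intro span_scale) fact
    qed
    then show ?thesis using \<open>t \<in> car ?T \<Longrightarrow> t = sw ?T t (hpure M N)\<close> that by simp
  qed
  then have 1: "car ?T \<subseteq> span ?G" by (rule subsetI)
  show ?thesis
    unfolding cogen_def by (intro conjI 1 rcomod_htens bimodule_htens) (use M N in simp_all)
qed

end

text \<open>The half of left covariance that concerns the right action. It is asked of the target of
  a right linear rational map, and such targets are often tensor products.\<close>

definition lcov :: "('k, 'h, 'm::ab_group_add) bcb \<Rightarrow> bool" where
  "lcov M \<longleftrightarrow> bimodule H M \<and> lcomod M \<and>
     (\<forall>m\<in>car M. \<forall>a. lco M (ract M m a) = sw (ktens H M) (lco M m) (\<lambda>m1 m0.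
        sw (ktens H M) (\<Delta> a) (\<lambda>a1 a2. kpure H M (m1 * a1) (ract M m0 a2))))"

lemma lcov_simps [simp]: "lcov M \<Longrightarrow> bimodule H M" "lcov M \<Longrightarrow> lcomod M"
  by (simp_all add: lcov_def)

lemma sw_lcov:
  assumes "lcov M" "m \<in> car M" "bilin H M Z F" "vspace Z"
  shows "sw Z (lco M (ract M m a)) F =
    sw Z (lco M m) (\<lambda>m1 m0. sw Z (\<Delta> a) (\<lambda>a1 a2. F (m1 * a1) (ract M m0 a2)))"
proof -
  have "lco M (ract M m a) = sw (ktens H M) (lco M m) (\<lambda>m1 m0.
        sw (ktens H M) (\<Delta> a) (\<lambda>a1 a2. kpure H M (m1 * a1) (ract M m0 a2)))"
    using assms(1,2) unfolding lcov_def by blast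
  then show ?thesis by (simp add: sw_sw assms(4) sw_kpure[OF assms(3,4)])
qed

lemma lcov_bicov:
  assumes M: "bicov_bimodule H M"
  shows "lcov M"
proof -
  have "lco M (ract M m a) = sw (ktens H M) (lco M m) (\<lambda>m1 m0.
        sw (ktens H M) (\<Delta> a) (\<lambda>a1 a2. kpure H M (m1 * a1) (ract M m0 a2)))"
    if m: "m \<in> car M" for m a
    using sw_lco_ract[OF M bilin_kpure, of m a] sw_lco_kpure[of M "ract M m a"] M m by simp
  then show ?thesis unfolding lcov_def using M by simp
qed

lemma lcov_htens:
  assumes M: "bicov_bimodule H M" and N: "bicov_bimodule H N"
  shows "lcov (htens H M N)"
proof -
  let ?U = "htens H M N" and ?T = "ktens H (htens H M N)"
  have [simp]: "lcomod ?U" by (rule lcomod_htens[OF M N])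
  have kl: "klinear ?U ?T (lco ?U)" using lcomod_htens[OF M N] by (simp add: lcomod_def)
  have [simp]: "vspace ?T" using M N by simp
  have "lco ?U (ract ?U t a) = sw ?T (lco ?U t) (\<lambda>m1 m0.
      sw ?T (\<Delta> a) (\<lambda>a1 a2. kpure H ?U (m1 * a1) (ract ?U m0 a2)))" if t: "t \<in> car ?U" for t a
  proof (rule htens_eqI[OF _ _ _ _ t, where f = "\<lambda>t. lco ?U (ract ?U t a)" and Z = ?T])
    show "klinear ?U ?T (\<lambda>t. lco ?U (ract ?U t a))"
      by (rule klinear_comp[OF _ kl]) (use M N in \<open>auto intro!: klin\<close>)
    show "klinear ?U ?T (\<lambda>t. sw ?T (lco ?U t) (\<lambda>m1 m0.
      sw ?T (\<Delta> a) (\<lambda>a1 a2. kpure H ?U (m1 * a1) (ract ?U m0 a2))))"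
      using M N by (auto intro!: klin)
    fix m n assume m: "m \<in> car M" and n: "n \<in> car N"
    have G: "bilin H ?U ?T (\<lambda>m1 m0. sw ?T (\<Delta> a) (\<lambda>a1 a2. kpure H ?U (m1 * a1) (ract ?U m0 a2)))"
      using M N by (auto intro!: bilinI klin)
    have "lco ?U (ract ?U (hpure M N m n) a) = sw ?T (lco M m) (\<lambda>m1 m0. sw ?T (lco N (ract N n a))
        (\<lambda>n1 n0. kpure H ?U (m1 * n1) (hpure M N m0 n0)))"
      using M N m n by (simp add: lco_htens_hpure)
    also have "\<dots> = sw ?T (lco M m) (\<lambda>m1 m0. sw ?T (lco N n) (\<lambda>n1 n0. sw ?T (\<Delta> a) (\<lambda>a1 a2.
        kpure H ?U (m1 * (n1 * a1)) (hpure M N m0 (ract N n0 a2)))))"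
      by (intro sw_lco_cong sw_lco_ract[OF N]) (use M N m n in \<open>auto intro!: bilinI klin\<close>)
    also have "\<dots> = sw ?T (lco M m) (\<lambda>m1 m0. sw ?T (lco N n) (\<lambda>n1 n0. sw ?T (\<Delta> a) (\<lambda>a1 a2.
        kpure H ?U (m1 * n1 * a1) (ract ?U (hpure M N m0 n0) a2))))"
      by (intro sw_lco_cong sw_cong) (use M N m n in \<open>auto simp: mult.assoc\<close>)
    also have "\<dots> = sw ?T (lco ?U (hpure M N m n)) (\<lambda>m1 m0.
      sw ?T (\<Delta> a) (\<lambda>a1 a2. kpure H ?U (m1 * a1) (ract ?U m0 a2)))"
      using M N m n by (simp add: lco_htens_hpure sw_sw sw_kpure[OF G])
    finally show "lco ?U (ract ?U (hpure M N m n) a) = sw ?T (lco ?U (hpure M N m n)) (\<lambda>m1 m0.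
      sw ?T (\<Delta> a) (\<lambda>a1 a2. kpure H ?U (m1 * a1) (ract ?U m0 a2)))" .
  qed (use M N in auto)
  then show ?thesis unfolding lcov_def using M N by simp
qed

section \<open>Maps between tensor products\<close>

definition left_linear ::
  "('k, 'h, 'm::ab_group_add) bcb \<Rightarrow> ('k, 'h, 'n::ab_group_add) bcb \<Rightarrow> ('m \<Rightarrow> 'n) \<Rightarrow> bool" where
  "left_linear M N f \<longleftrightarrow>
     klinear M N f \<and> (\<forall>m\<in>car M. \<forall>a. f (lact M a m) = lact N a (f m))"

lemma right_linear_klinear: "right_linear M N f \<Longrightarrow> klinear M N f"
  by (simp add: right_linear_def)

lemma right_linear_closed: "right_linear M N f \<Longrightarrow> m \<in> car M \<Longrightarrow> f m \<in> car N"
  by (simp add: right_linear_def klinear_def)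

lemma right_linear_ract: "right_linear M N f \<Longrightarrow> m \<in> car M \<Longrightarrow> f (ract M m a) = ract N (f m) a"
  by (simp add: right_linear_def)

lemma left_linear_klinear: "left_linear M N f \<Longrightarrow> klinear M N f"
  by (simp add: left_linear_def)

lemma right_linear_id: "right_linear M M id"
  by (simp add: right_linear_def klinear_def)

lemma left_linear_id: "left_linear M M id"
  by (simp add: left_linear_def klinear_def)

lemma right_linear_comp: "right_linear M N f \<Longrightarrow> right_linear N P g \<Longrightarrow> right_linear M P (g \<circ> f)"
  by (simp add: right_linear_def klinear_def)

lemma right_linear_htensI:
  assumes M: "bimodule H M" and N: "bimodule H N" and Z: "bimodule H Z"
    and f: "klinear (htens H M N) Z f"
    and eq: "\<And>m n a. m \<in> car M \<Longrightarrow> n \<in> car N \<Longrightarrow>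
      f (hpure M N m (ract N n a)) = ract Z (f (hpure M N m n)) a"
  shows "right_linear (htens H M N) Z f"
  unfolding right_linear_def
proof (intro conjI ballI allI f)
  fix t a assume t: "t \<in> car (htens H M N)"
  note [klin] = klinear_comp[OF _ f]
  show "f (ract (htens H M N) t a) = ract Z (f t) a"
    by (rule htens_eqI[OF M N _ _ t, where f = "\<lambda>t. f (ract (htens H M N) t a)" and Z = Z])
      (use M N Z in \<open>auto intro!: klin simp: eq\<close>)
qed

lemma hmap_props:
  assumes M: "bimodule H M" and N: "bimodule H N" and M': "bimodule H M'" and N': "bimodule H N'"
    and f: "right_linear M M' f" and g: "left_linear N N' g"
  shows klinear_hmap: "klinear (htens H M N) (htens H M' N') (hmap H M' N' f g)"
    and hmap_hpure: "m \<in> car M \<Longrightarrow> n \<in> car N \<Longrightarrow>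
      hmap H M' N' f g (hpure M N m n) = hpure M' N' (f m) (g n)"
    and right_linear_hmap: "right_linear N N' g \<Longrightarrow>
      right_linear (htens H M N) (htens H M' N') (hmap H M' N' f g)"
proof -
  note kf = right_linear_klinear[OF f] and kg = left_linear_klinear[OF g]
  note [klin] = klinear_comp[OF _ kf] klinear_comp[OF _ kg]
  note [simp] = klinear_closed[OF kf] klinear_closed[OF kg]
  show 1: "klinear (htens H M N) (htens H M' N') (hmap H M' N' f g)"
    unfolding hmap_def[abs_def] using assms by (auto intro!: klinear_sw_htens)
  show 2: "hmap H M' N' f g (hpure M N m n) = hpure M' N' (f m) (g n)"
    if "m \<in> car M" "n \<in> car N" for m n
    unfolding hmap_def
    by (rule sw_hpure) (use assms in \<open>auto intro!: bilinI klin
      simp: right_linear_def left_linear_def hpure_balanced\<close>)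
  assume "right_linear N N' g"
  then show "right_linear (htens H M N) (htens H M' N') (hmap H M' N' f g)"
    by (intro right_linear_htensI[OF M N _ 1]) (use assms in \<open>auto simp: 2 right_linear_ract\<close>)
qed

context
  fixes X :: "('k, 'h, 'x::ab_group_add) bcb" and Y :: "('k, 'h, 'y::ab_group_add) bcb"
    and Z :: "('k, 'h, 'z::ab_group_add) bcb"
  assumes X: "bimodule H X" and Y: "bimodule H Y" and Z: "bimodule H Z"
begin

lemma klinear_sw_var_left:
  "bimodule H A \<Longrightarrow> bimodule H B \<Longrightarrow> vspace V \<Longrightarrow> klinear W (htens H A B) g \<Longrightarrow>
   (\<And>m n. m \<in> car A \<Longrightarrow> n \<in> car B \<Longrightarrow> F m n \<in> car V) \<Longrightarrow> klinear W V (\<lambda>w. sw V (g w) F)"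
  by (rule klinear_comp[OF _ klinear_sw_htens]) auto

lemma bilin_assoc:
  "bilin (htens H X Y) Z (htens H X (htens H Y Z))
    (\<lambda>s z. sw (htens H X (htens H Y Z)) s (\<lambda>x y. hpure X (htens H Y Z) x (hpure Y Z y z)))"
  by (rule bilinI) (use X Y Z in \<open>auto intro!: klinear_sw_htens klinear_sw_htens_right klin\<close>)

lemma sw_assoc_hpure:
  assumes "x \<in> car X" "y \<in> car Y" "z \<in> car Z"
  shows "sw (htens H X (htens H Y Z)) (hpure X Y x y)
    (\<lambda>x y. hpure X (htens H Y Z) x (hpure Y Z y z)) = hpure X (htens H Y Z) x (hpure Y Z y z)"
  by (rule sw_hpure) (use X Y Z assms in \<open>auto intro!: bilinI klin simp: hpure_balanced\<close>)

lemma klinear_hassoc: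
  "klinear (htens H (htens H X Y) Z) (htens H X (htens H Y Z)) (hassoc H X Y Z)"
  unfolding hassoc_def[abs_def] Let_def
  using X Y Z by (auto intro!: klinear_sw_htens bilin_closed[OF bilin_assoc])

lemma hassoc_hpure:
  assumes "x \<in> car X" "y \<in> car Y" "z \<in> car Z"
  shows "hassoc H X Y Z (hpure (htens H X Y) Z (hpure X Y x y) z) =
    hpure X (htens H Y Z) x (hpure Y Z y z)"
proof -
  have "hassoc H X Y Z (hpure (htens H X Y) Z (hpure X Y x y) z) =
    sw (htens H X (htens H Y Z)) (hpure X Y x y) (\<lambda>x y. hpure X (htens H Y Z) x (hpure Y Z y z))"
    unfolding hassoc_def Let_def
  proof (rule sw_hpure[OF bilin_assoc])
    fix s z a assume s: "s \<in> car (htens H X Y)" and z: "z \<in> car Z"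
    let ?T = "htens H X (htens H Y Z)"
    show "sw ?T (ract (htens H X Y) s a) (\<lambda>x y. hpure X (htens H Y Z) x (hpure Y Z y z)) =
      sw ?T s (\<lambda>x y. hpure X (htens H Y Z) x (hpure Y Z y (lact Z a z)))"
      by (rule htens_eqI[OF X Y _ _ s, where Z = ?T and
          f = "\<lambda>s. sw ?T (ract (htens H X Y) s a) (\<lambda>x y. hpure X (htens H Y Z) x (hpure Y Z y z))"])
        (use X Y Z z in \<open>auto intro!: klinear_sw_htens klinear_sw_var_left[of X Y] klin
          simp: sw_assoc_hpure hpure_balanced\<close>)
  qed (use X Y Z in auto)
  then show ?thesis using sw_assoc_hpure[OF assms] by simp
qed

lemma bilin_assoc_inv:
  "bilin X (htens H Y Z) (htens H (htens H X Y) Z)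
    (\<lambda>x s. sw (htens H (htens H X Y) Z) s (\<lambda>y z. hpure (htens H X Y) Z (hpure X Y x y) z))"
  by (rule bilinI) (use X Y Z in \<open>auto intro!: klinear_sw_htens klinear_sw_htens_right klin\<close>)

lemma sw_assoc_inv_hpure:
  assumes "x \<in> car X" "y \<in> car Y" "z \<in> car Z"
  shows "sw (htens H (htens H X Y) Z) (hpure Y Z y z)
    (\<lambda>y z. hpure (htens H X Y) Z (hpure X Y x y) z) = hpure (htens H X Y) Z (hpure X Y x y) z"
  by (rule sw_hpure) (use X Y Z assms in \<open>auto intro!: bilinI klin simp flip: hpure_balanced\<close>)

lemma klinear_hassoc_inv:
  "klinear (htens H X (htens H Y Z)) (htens H (htens H X Y) Z) (hassoc_inv H X Y Z)"
  unfolding hassoc_inv_def[abs_def] Let_def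
  using X Y Z by (auto intro!: klinear_sw_htens bilin_closed[OF bilin_assoc_inv])

lemma hassoc_inv_hpure:
  assumes "x \<in> car X" "y \<in> car Y" "z \<in> car Z"
  shows "hassoc_inv H X Y Z (hpure X (htens H Y Z) x (hpure Y Z y z)) =
    hpure (htens H X Y) Z (hpure X Y x y) z"
proof -
  have "hassoc_inv H X Y Z (hpure X (htens H Y Z) x (hpure Y Z y z)) =
    sw (htens H (htens H X Y) Z) (hpure Y Z y z) (\<lambda>y z. hpure (htens H X Y) Z (hpure X Y x y) z)"
    unfolding hassoc_inv_def Let_def
  proof (rule sw_hpure[OF bilin_assoc_inv])
    fix x s a assume x: "x \<in> car X" and s: "s \<in> car (htens H Y Z)"
    let ?T = "htens H (htens H X Y) Z"
    show "sw ?T s (\<lambda>y z. hpure (htens H X Y) Z (hpure X Y (ract X x a) y) z) =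
      sw ?T (lact (htens H Y Z) a s) (\<lambda>y z. hpure (htens H X Y) Z (hpure X Y x y) z)"
      by (rule htens_eqI[OF Y Z _ _ s, where Z = ?T and
          f = "\<lambda>s. sw ?T s (\<lambda>y z. hpure (htens H X Y) Z (hpure X Y (ract X x a) y) z)"])
        (use X Y Z x in \<open>auto intro!: klinear_sw_htens klinear_sw_var_left[of Y Z] klin
          simp: sw_assoc_inv_hpure hpure_balanced\<close>)
  qed (use X Y Z in auto)
  then show ?thesis using sw_assoc_inv_hpure[OF assms] by simp
qed

lemma right_linear_hassoc:
  "right_linear (htens H (htens H X Y) Z) (htens H X (htens H Y Z)) (hassoc H X Y Z)"
proof (rule right_linear_htensI[OF _ Z _ klinear_hassoc])
  fix s z a assume s: "s \<in> car (htens H X Y)" and z: "z \<in> car Z"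
  let ?T = "htens H X (htens H Y Z)"
  note [klin] = klinear_comp[OF _ klinear_hassoc]
  show "hassoc H X Y Z (hpure (htens H X Y) Z s (ract Z z a)) =
    ract ?T (hassoc H X Y Z (hpure (htens H X Y) Z s z)) a"
    by (rule htens_eqI[OF X Y _ _ s, where Z = ?T and
        f = "\<lambda>s. hassoc H X Y Z (hpure (htens H X Y) Z s (ract Z z a))"])
      (use X Y Z z in \<open>auto intro!: klin simp: hassoc_hpure\<close>)
qed (use X Y Z in auto)

lemma right_linear_hassoc_inv:
  "right_linear (htens H X (htens H Y Z)) (htens H (htens H X Y) Z) (hassoc_inv H X Y Z)"
proof (rule right_linear_htensI[OF X _ _ klinear_hassoc_inv])
  fix x s a assume x: "x \<in> car X" and s: "s \<in> car (htens H Y Z)"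
  let ?T = "htens H (htens H X Y) Z"
  note [klin] = klinear_comp[OF _ klinear_hassoc_inv]
  show "hassoc_inv H X Y Z (hpure X (htens H Y Z) x (ract (htens H Y Z) s a)) =
    ract ?T (hassoc_inv H X Y Z (hpure X (htens H Y Z) x s)) a"
    by (rule htens_eqI[OF Y Z _ _ s, where Z = ?T and
        f = "\<lambda>s. hassoc_inv H X Y Z (hpure X (htens H Y Z) x (ract (htens H Y Z) s a))"])
      (use X Y Z x in \<open>auto intro!: klin simp: hassoc_inv_hpure\<close>)
qed (use X Y Z in auto)

end

section \<open>The Woronowicz braiding\<close>

context
  fixes W :: "('k, 'h, 'w::ab_group_add) bcb" and N :: "('k, 'h, 'n::ab_group_add) bcb"
  assumes W: "bicov_bimodule H W" and N: "bicov_bimodule H N"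
begin

text \<open>The summand of \<open>woronowicz\<close>, isolated as a bilinear map so that its
  balancedness can be stated.\<close>

definition braid :: "'w \<Rightarrow> 'n \<Rightarrow> ('n \<times> 'w \<Rightarrow>\<^sub>0 'k)" where
  "braid \<omega> n = sw (htens H N W) (lco W \<omega>) (\<lambda>g \<omega>0. sw (htens H N W) (\<Delta> g) (\<lambda>m2 m1.
     sw (htens H N W) (rco N n) (\<lambda>n0 h. sw (htens H N W) (\<Delta> h) (\<lambda>n1 n2.
       hpure N W (ract N (lact N m2 n0) (S n1)) (ract W (lact W (S m1) \<omega>0) n2)))))"

lemma bilin_braid: "bilin W N (htens H N W) braid"
  unfolding braid_def[abs_def] using W N by (auto intro!: bilinI klin simp del: act_simps)

text \<open>In n b_1 S(b_2) \<otimes> b_3 the antipode cancels. The factor S(m_1) of the second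
  tensor factor then crosses the tensor sign, where together with m_2 it forms the adjoint action on
  n.\<close>

lemma braid_coinv:
  assumes n: "coinv N n" and w: "\<omega> \<in> car W"
  shows "braid \<omega> (ract N n b) =
    sw (htens H N W) (lco W \<omega>) (\<lambda>g \<omega>0. hpure N W (ad N g n) (ract W \<omega>0 b))"
  unfolding braid_def
proof (rule sw_lco_cong)
  let ?T = "htens H N W"
  fix g \<omega>0 assume w0: "\<omega>0 \<in> car W"
  have "sw ?T (rco N (ract N n b)) (\<lambda>n0 h. sw ?T (\<Delta> h) (\<lambda>n1 n2.
       hpure N W (ract N (lact N m2 n0) (S n1)) (ract W (lact W (S m1) \<omega>0) n2))) =
    hpure N W (lact N m2 (ract N n (S m1))) (ract W \<omega>0 b)" for m1 m2
  proof -
    have "sw ?T (rco N (ract N n b)) (\<lambda>n0 h. sw ?T (\<Delta> h) (\<lambda>n1 n2.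
         hpure N W (ract N (lact N m2 n0) (S n1)) (ract W (lact W (S m1) \<omega>0) n2))) =
      sw ?T (\<Delta> b) (\<lambda>x h. sw ?T (\<Delta> h) (\<lambda>n1 n2.
         hpure N W (ract N (lact N m2 (ract N n x)) (S n1)) (ract W (lact W (S m1) \<omega>0) n2)))"
      by (rule sw_rco_coinv[OF n]) (use W N w0 in \<open>auto intro!: bilinI klin simp del: act_simps\<close>)
    also have "\<dots> = sw ?T (\<Delta> b) (\<lambda>x h. sw ?T (\<Delta> h) (\<lambda>n1 n2.
         hpure N W (lact N m2 (ract N n (x * S n1))) (ract W (lact W (S m1) \<omega>0) n2)))"
      using W N w0 n by simp
    also have "\<dots> = hpure N W (lact N m2 (ract N n 1)) (ract W (lact W (S m1) \<omega>0) b)"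
      by (rule sw_cancel(1)) (use W N w0 n in \<open>auto intro!: bilinI klin simp del: act_simps\<close>)
    also have "\<dots> = hpure N W (ract N (lact N m2 n) (S m1)) (ract W \<omega>0 b)"
      using W N w0 n by (simp add: hpure_balanced del: act_simps(5)) simp
    finally show ?thesis using N n by simp
  qed
  then have "sw ?T (\<Delta> g) (\<lambda>m2 m1. sw ?T (rco N (ract N n b)) (\<lambda>n0 h. sw ?T (\<Delta> h) (\<lambda>n1 n2.
       hpure N W (ract N (lact N m2 n0) (S n1)) (ract W (lact W (S m1) \<omega>0) n2)))) =
    sw ?T (\<Delta> g) (\<lambda>m2 m1. hpure N W (lact N m2 (ract N n (S m1))) (ract W \<omega>0 b))"
    by simp
  also have "\<dots> = hpure N W (ad N g n) (ract W \<omega>0 b)"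
    unfolding ad_def
    by (rule sw_comult_apply[where L = "\<lambda>x. hpure N W x (ract W \<omega>0 b)", symmetric])
      (use W N w0 n in \<open>auto intro!: klin\<close>)
  finally show "sw ?T (\<Delta> g) (\<lambda>m2 m1. sw ?T (rco N (ract N n b)) (\<lambda>n0 h. sw ?T (\<Delta> h) (\<lambda>n1 n2.
       hpure N W (ract N (lact N m2 n0) (S n1)) (ract W (lact W (S m1) \<omega>0) n2)))) =
    hpure N W (ad N g n) (ract W \<omega>0 b)" .
qed (use W w in auto)

text \<open>Puts a n b into the form of coinvariants multiplied from the right, to which
  \<open>braid_coinv\<close> applies.\<close>

lemma lact_expand:
  assumes "bimodule H N" "coinv N n"
  shows "lact N a (ract N n b) = sw N (\<Delta> a) (\<lambda>a1 a2. ract N (ad N a1 n) (a2 * b))"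
proof -
  have "lact N a (ract N n b) = ract N (lact N a n) b" using assms by simp
  also have "\<dots> = ract N (sw N (\<Delta> a) (\<lambda>a1 a2. ract N (ad N a1 n) a2)) b"
    using sw_ad_ract[of N n a] assms by simp
  also have "\<dots> = sw N (\<Delta> a) (\<lambda>a1 a2. ract N (ract N (ad N a1 n) a2) b)"
    by (rule sw_comult_apply[where L = "\<lambda>x. ract N x b"])
      (use assms in \<open>auto intro!: klin\<close>)
  finally show ?thesis using assms by simp
qed

text \<open>At n b both sides are (\<omega>_{-1} a_1) \<triangleright> n \<otimes> \<omega>_0 a_2 b:
  on the left by covariance of the coaction, on the right by \<open>lact_expand\<close>, since each
  a_1 \<triangleright> n is again coinvariant and \<triangleright> is an action.\<close>

lemma braid_balanced:
  assumes w: "\<omega> \<in> car W" and n: "n \<in> car N"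
  shows "braid (ract W \<omega> a) n = braid \<omega> (lact N a n)"
proof -
  let ?T = "htens H N W"
  note [klin] = bilin_comp_right[OF bilin_braid]
  have eq: "braid (ract W \<omega> a) (ract N n b) = braid \<omega> (lact N a (ract N n b))"
    if n: "coinv N n" for n b
  proof -
    have "braid (ract W \<omega> a) (ract N n b) =
      sw ?T (lco W (ract W \<omega> a)) (\<lambda>g \<omega>0. hpure N W (ad N g n) (ract W \<omega>0 b))"
      by (rule braid_coinv[OF n]) (use W w in auto)
    also have "\<dots> = sw ?T (lco W \<omega>) (\<lambda>g \<omega>0. sw ?T (\<Delta> a) (\<lambda>a1 a2.
        hpure N W (ad N (g * a1) n) (ract W (ract W \<omega>0 a2) b)))"
      by (rule sw_lco_ract[OF W]) (use W N n w in \<open>auto intro!: bilinI klin simp del: act_simps\<close>)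
    also have "\<dots> = sw ?T (lco W \<omega>) (\<lambda>g \<omega>0. sw ?T (\<Delta> a) (\<lambda>a1 a2.
        hpure N W (ad N g (ad N a1 n)) (ract W \<omega>0 (a2 * b))))"
      by (intro sw_lco_cong sw_cong) (use W N n w in \<open>auto simp: ad_mult\<close>)
    also have "\<dots> = sw ?T (\<Delta> a) (\<lambda>a1 a2. sw ?T (lco W \<omega>) (\<lambda>g \<omega>0.
        hpure N W (ad N g (ad N a1 n)) (ract W \<omega>0 (a2 * b))))"
      by (rule sw_swap) (use W N in auto)
    also have "\<dots> = sw ?T (\<Delta> a) (\<lambda>a1 a2. braid \<omega> (ract N (ad N a1 n) (a2 * b)))"
      by (intro sw_cong braid_coinv[symmetric] coinv_ad[OF N] n w)
    also have "\<dots> = braid \<omega> (sw N (\<Delta> a) (\<lambda>a1 a2. ract N (ad N a1 n) (a2 * b)))"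
      by (rule sw_comult_apply[OF bilin_right[OF bilin_braid w], symmetric]) (use N n in auto)
    also have "\<dots> = braid \<omega> (lact N a (ract N n b))"
      using N n by (simp add: lact_expand del: act_simps)
    finally show ?thesis .
  qed
  show ?thesis
  proof (rule cogen_eqI[OF cogen_bicov[OF N] _ _ _ _ n])
    show "klinear N ?T (braid (ract W \<omega> a))" "klinear N ?T (\<lambda>n. braid \<omega> (lact N a n))"
      using W N w by (auto intro!: klin klinear_lact[OF _ klinear_id] bilin_right[OF bilin_braid])
  qed (use W N eq in auto)
qed

lemma woronowicz_eq: "woronowicz H W N t = sw (htens H N W) t braid"
  unfolding woronowicz_def braid_def[abs_def] Let_def ..

lemma klinear_woronowicz: "klinear (htens H W N) (htens H N W) (woronowicz H W N)"
  unfolding woronowicz_eq[abs_def]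
  by (rule klinear_sw_htens) (use W N in \<open>auto intro!: bilin_closed[OF bilin_braid]\<close>)

lemma woronowicz_coinv:
  assumes n: "coinv N n" and w: "\<omega> \<in> car W"
  shows "woronowicz H W N (hpure W N \<omega> (ract N n b)) =
    sw (htens H N W) (lco W \<omega>) (\<lambda>g \<omega>0. hpure N W (ad N g n) (ract W \<omega>0 b))"
proof -
  have "woronowicz H W N (hpure W N \<omega> (ract N n b)) = braid \<omega> (ract N n b)"
    unfolding woronowicz_eq
    by (rule sw_hpure[OF bilin_braid]) (use W N braid_balanced in auto)
  then show ?thesis by (simp add: braid_coinv[OF assms])
qed

lemma right_linear_woronowicz: "right_linear (htens H W N) (htens H N W) (woronowicz H W N)"
  unfolding right_linear_def
proof (intro conjI ballI allI klinear_woronowicz)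
  let ?T = "htens H N W"
  fix t a assume t: "t \<in> car (htens H W N)"
  note [klin] = klinear_comp[OF _ klinear_woronowicz]
  show "woronowicz H W N (ract (htens H W N) t a) = ract ?T (woronowicz H W N t) a"
  proof (rule htens_eqI_right[OF _ cogen_bicov[OF N] _ _ _ t,
        where f = "\<lambda>t. woronowicz H W N (ract (htens H W N) t a)" and Z = ?T])
    fix \<omega> n b assume w: "\<omega> \<in> car W" and n: "coinv N n"
    have "ract ?T (woronowicz H W N (hpure W N \<omega> (ract N n b))) a =
      sw ?T (lco W \<omega>) (\<lambda>g \<omega>0. ract ?T (hpure N W (ad N g n) (ract W \<omega>0 b)) a)"
      unfolding woronowicz_coinv[OF n w]
      by (rule sw_lco_apply[where L = "\<lambda>x. ract ?T x a"])
        (use W N w n in \<open>auto intro!: klin\<close>)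
    also have "\<dots> = sw ?T (lco W \<omega>) (\<lambda>g \<omega>0. hpure N W (ad N g n) (ract W \<omega>0 (b * a)))"
      by (rule sw_lco_cong) (use W N w n in auto)
    also have "\<dots> = woronowicz H W N (ract (htens H W N) (hpure W N \<omega> (ract N n b)) a)"
      using W N w n by (simp add: woronowicz_coinv)
    finally show "woronowicz H W N (ract (htens H W N) (hpure W N \<omega> (ract N n b)) a) =
      ract ?T (woronowicz H W N (hpure W N \<omega> (ract N n b))) a" ..
  qed (use W N in \<open>auto intro!: klin\<close>)
qed

text \<open>Left linearity makes id_X \<otimes> \<sigma> in \<open>sigma23\<close> well defined over
  H. At n b it reduces to (a_1 \<omega>_{-1}) \<triangleright> n \<otimes> a_2 \<omega>_0 = a
  (\<omega>_{-1} \<triangleright> n) \<otimes> \<omega>_0, where a_2 crosses the tensor sign and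
  \<open>sw_ad_ract\<close> applies.\<close>

lemma left_linear_woronowicz: "left_linear (htens H W N) (htens H N W) (woronowicz H W N)"
  unfolding left_linear_def
proof (intro conjI ballI allI klinear_woronowicz)
  let ?T = "htens H N W"
  fix t a assume t: "t \<in> car (htens H W N)"
  note [klin] = klinear_comp[OF _ klinear_woronowicz]
  show "woronowicz H W N (lact (htens H W N) a t) = lact ?T a (woronowicz H W N t)"
  proof (rule htens_eqI_right[OF _ cogen_bicov[OF N] _ _ _ t,
        where f = "\<lambda>t. woronowicz H W N (lact (htens H W N) a t)" and Z = ?T])
    fix \<omega> n b assume w: "\<omega> \<in> car W" and n: "coinv N n"
    have "woronowicz H W N (lact (htens H W N) a (hpure W N \<omega> (ract N n b))) =
      sw ?T (lco W (lact W a \<omega>)) (\<lambda>g \<omega>0. hpure N W (ad N g n) (ract W \<omega>0 b))"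
      using W N w n by (simp add: woronowicz_coinv)
    also have "\<dots> = sw ?T (\<Delta> a) (\<lambda>a1 a2. sw ?T (lco W \<omega>) (\<lambda>g \<omega>0.
        hpure N W (ad N (a1 * g) n) (ract W (lact W a2 \<omega>0) b)))"
      by (rule sw_lco_lact[OF W]) (use W N n w in \<open>auto intro!: bilinI klin simp del: act_simps\<close>)
    also have "\<dots> = sw ?T (lco W \<omega>) (\<lambda>g \<omega>0. sw ?T (\<Delta> a) (\<lambda>a1 a2.
        hpure N W (ad N (a1 * g) n) (ract W (lact W a2 \<omega>0) b)))"
      by (rule sw_swap) (use W N in auto)
    also have "\<dots> = sw ?T (lco W \<omega>) (\<lambda>g \<omega>0. hpure N W (lact N a (ad N g n)) (ract W \<omega>0 b))"
    proof (rule sw_lco_cong)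
      fix g \<omega>0 assume w0: "\<omega>0 \<in> car W"
      have "sw ?T (\<Delta> a) (\<lambda>a1 a2. hpure N W (ad N a1 (ad N g n)) (lact W a2 (ract W \<omega>0 b))) =
        hpure N W (lact N a (ad N g n)) (ract W \<omega>0 b)"
        by (rule sw_ad_lact[where F = "hpure N W"])
          (use W N n w0 in \<open>auto intro!: bilin_hpure simp: hpure_balanced\<close>)
      then show "sw ?T (\<Delta> a) (\<lambda>a1 a2. hpure N W (ad N (a1 * g) n) (ract W (lact W a2 \<omega>0) b)) =
        hpure N W (lact N a (ad N g n)) (ract W \<omega>0 b)"
        using W N n w0 by (simp add: ad_mult)
    qed (use W w in auto)
    also have "\<dots> = sw ?T (lco W \<omega>) (\<lambda>g \<omega>0. lact ?T a (hpure N W (ad N g n) (ract W \<omega>0 b)))"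
      by (rule sw_lco_cong) (use W N w n in auto)
    also have "\<dots> = lact ?T a (woronowicz H W N (hpure W N \<omega> (ract N n b)))"
      unfolding woronowicz_coinv[OF n w]
      by (rule sw_lco_apply[where L = "lact ?T a", symmetric])
        (use W N w n in \<open>auto intro!: klinear_lact[OF _ klinear_id]\<close>)
    finally show "woronowicz H W N (lact (htens H W N) a (hpure W N \<omega> (ract N n b))) =
      lact ?T a (woronowicz H W N (hpure W N \<omega> (ract N n b)))" .
  qed (use W N in \<open>auto intro!: klin\<close>)
qed

context
  fixes X :: "('k, 'h, 'x::ab_group_add) bcb"
  assumes X: "bimodule H X"
begin

lemma right_linear_sigma23:
  "right_linear (htens H (htens H X W) N) (htens H (htens H X N) W) (sigma23 H X W N)"
  unfolding sigma23_def using X W N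
  by (intro right_linear_comp[OF right_linear_hassoc right_linear_comp[OF right_linear_hmap
      right_linear_hassoc_inv]] right_linear_id left_linear_woronowicz right_linear_woronowicz) auto

lemma sigma23_coinv:
  assumes x: "x \<in> car X" and w: "\<omega> \<in> car W" and n: "coinv N n"
  shows "sigma23 H X W N (hpure (htens H X W) N (hpure X W x \<omega>) (ract N n b)) =
    sw (htens H (htens H X N) W) (lco W \<omega>) (\<lambda>g \<omega>0.
      hpure (htens H X N) W (hpure X N x (ad N g n)) (ract W \<omega>0 b))"
proof -
  let ?T = "htens H (htens H X N) W" and ?U = "htens H X (htens H N W)"
  note facts = X W N x w n
  have "sigma23 H X W N (hpure (htens H X W) N (hpure X W x \<omega>) (ract N n b)) =
    hassoc_inv H X N W (hpure X (htens H N W) x (woronowicz H W N (hpure W N \<omega> (ract N n b))))"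
    using facts by (simp add: sigma23_def hassoc_hpure hmap_hpure[OF _ _ _ _ right_linear_id left_linear_woronowicz])
  also have "\<dots> = hassoc_inv H X N W (sw ?U (lco W \<omega>) (\<lambda>g \<omega>0.
      hpure X (htens H N W) x (hpure N W (ad N g n) (ract W \<omega>0 b))))"
    unfolding woronowicz_coinv[OF n w]
    by (subst sw_lco_apply[where L = "hpure X (htens H N W) x" and Z' = ?U])
      (use facts in \<open>auto intro!: klinear_hpure_right[OF _ _ _ klinear_id]\<close>)
  also have "\<dots> = sw ?T (lco W \<omega>) (\<lambda>g \<omega>0.
      hassoc_inv H X N W (hpure X (htens H N W) x (hpure N W (ad N g n) (ract W \<omega>0 b))))"
    by (rule sw_lco_apply[OF klinear_hassoc_inv]) (use facts in auto)
  also have "\<dots> = sw ?T (lco W \<omega>) (\<lambda>g \<omega>0.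
      hpure (htens H X N) W (hpure X N x (ad N g n)) (ract W \<omega>0 b))"
    by (rule sw_lco_cong) (use facts in \<open>auto simp: hassoc_inv_hpure\<close>)
  finally show ?thesis .
qed

lemma sigma23_coinv_1:
  assumes "x \<in> car X" "\<omega> \<in> car W" "coinv N n"
  shows "sigma23 H X W N (hpure (htens H X W) N (hpure X W x \<omega>) n) =
    sw (htens H (htens H X N) W) (lco W \<omega>) (\<lambda>g \<omega>0.
      hpure (htens H X N) W (hpure X N x (ad N g n)) \<omega>0)"
proof -
  have "sigma23 H X W N (hpure (htens H X W) N (hpure X W x \<omega>) n) =
    sw (htens H (htens H X N) W) (lco W \<omega>) (\<lambda>g \<omega>0.
      hpure (htens H X N) W (hpure X N x (ad N g n)) (ract W \<omega>0 1))"
    using sigma23_coinv[OF assms, of 1] N assms by simp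
  also have "\<dots> = sw (htens H (htens H X N) W) (lco W \<omega>) (\<lambda>g \<omega>0.
      hpure (htens H X N) W (hpure X N x (ad N g n)) \<omega>0)"
    by (rule sw_lco_cong) (use W assms in auto)
  finally show ?thesis .
qed

end

end

end

section \<open>Rational morphisms\<close>

lemma sw_nf_krel:
  assumes "bilin X Y Z f" "vspace Z"
  shows "sw Z (nf (krel X Y) t) f = sw Z t f"
  by (rule sw_nf[OF vspace_vector_space[OF assms(2)] bilin_krel[OF assms]])

lemma sw_free_vsp_tset:
  fixes X :: "('k::field, 'a::ab_group_add, 'y) vsp_scheme"
    and Y :: "('k, 'b::ab_group_add, 'z) vsp_scheme"
  assumes "\<And>x y. (x, y) \<in> Poly_Mapping.keys u \<Longrightarrow> G x y \<in> tset X Y"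
  shows "sw free_vsp u G \<in> tset X Y"
proof -
  interpret vector_space "fscale :: 'k \<Rightarrow> ('a \<times> 'b \<Rightarrow>\<^sub>0 'k) \<Rightarrow> _" by (rule vector_space_fscale)
  show ?thesis unfolding sw_def
    using assms by (auto intro!: subspace_sum[OF subspace_tset] tset_closed(3))
qed

lemma vspace_khom [simp]:
  assumes "vspace X" "vspace Y"
  shows "vspace (khom X Y)"
proof -
  have "vector_space (scl (khom X Y))"
    by unfold_locales (auto simp: khom_def fun_eq_iff vspace_scl_simps[OF assms(2)])
  then interpret vector_space "scl (khom X Y)" .
  have "subspace (car (khom X Y))"
  proof (rule subspaceI)
    show "0 \<in> car (khom X Y)" by (simp add: khom_def zero_fun_def klinear_const_0[OF assms(2)])
    show "f + g \<in> car (khom X Y)" if "f \<in> car (khom X Y)" "g \<in> car (khom X Y)" for f g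
      using that klinear_plus[OF assms(2), of X f g] by (simp add: khom_def plus_fun_def)
    show "scl (khom X Y) c f \<in> car (khom X Y)" if "f \<in> car (khom X Y)" for f c
      using that klinear_scale[OF assms(2), of X f c] by (simp add: khom_def vspace_scl_simps[OF assms(2)])
  qed
  then show ?thesis by (simp add: vspace_def vector_space_axioms)
qed

lemma khom_klinear: "f \<in> car (khom X Y) \<Longrightarrow> klinear X Y f"
  by (simp add: khom_def)

lemma khom_ext: "f \<in> car (khom X Y) \<Longrightarrow> x \<notin> car X \<Longrightarrow> f x = 0"
  by (simp add: khom_def)

lemma klinear_khom_eval [klin]:
  "x \<in> car X \<Longrightarrow> klinear (khom X Y) Y (\<lambda>f. f x)"
  by (simp add: klinear_def khom_def)

text \<open>Elements of \<open>khom X Y\<close> must vanish outside the carrier, so maps are cut off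
  before they enter a representative.\<close>

definition restr :: "('k::field, 'a::ab_group_add, 'z) vsp_scheme \<Rightarrow> ('a \<Rightarrow> 'b::ab_group_add) \<Rightarrow> 'a \<Rightarrow> 'b" where
  "restr X f = (\<lambda>x. if x \<in> car X then f x else 0)"

lemma restr_eq [simp]: "x \<in> car X \<Longrightarrow> restr X f x = f x"
  by (simp add: restr_def)

lemma restr_khom: "vspace X \<Longrightarrow> klinear X Y f \<Longrightarrow> restr X f \<in> car (khom X Y)"
  using klinear_cong[of X Y f "restr X f"] by (simp add: khom_def restr_def)

context hopf_alg
begin

lemma right_linear_restr:
  assumes "bimodule H M" "right_linear M N f"
  shows "right_linear M N (restr M f)"
  using assms klinear_cong[of M N f "restr M f"] by (simp add: right_linear_def)

text \<open>
  The equation \<open>\<lambda>\<^sup>A\<^sup>d(\<phi>) = t\<close>, multiplied by \<open>x\<^sub>-\<^sub>1\<close> to remove the inverse antipode; in this form it is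
  immediately compatible with composition.
\<close>

definition lrep ::
  "('k, 'h, 'm::ab_group_add) bcb \<Rightarrow> ('k, 'h, 'n::ab_group_add) bcb \<Rightarrow>
   ('h \<times> ('m \<Rightarrow> 'n) \<Rightarrow>\<^sub>0 'k) \<Rightarrow> ('m \<Rightarrow> 'n) \<Rightarrow> bool" where
  "lrep X Y t \<phi> \<longleftrightarrow> t \<in> tset H (khom X Y) \<and>
     (\<forall>x\<in>car X. lco Y (\<phi> x) = sw (ktens H Y) t (\<lambda>h f. sw (ktens H Y) (lco X x) (\<lambda>x1 x0.
        kpure H Y (h * x1) (f x0))))"

lemma lrep_tset: "lrep X Y t \<phi> \<Longrightarrow> t \<in> tset H (khom X Y)"
  by (simp add: lrep_def)

lemma sw_lrep:
  assumes "lrep X Y t \<phi>" "x \<in> car X" "bilin H Y Z F" "vspace Z"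
  shows "sw Z (lco Y (\<phi> x)) F = sw Z t (\<lambda>h f. sw Z (lco X x) (\<lambda>x1 x0. F (h * x1) (f x0)))"
  using assms(1,2) by (simp add: lrep_def sw_sw assms(4) sw_kpure[OF assms(3,4)])

text \<open>Coordinates in a basis of \<open>H\<close>; \<open>e b\<close> is zero for all \<open>b\<close> outside the basis.\<close>

lemma coordinates:
  obtains e :: "'h \<Rightarrow> 'h \<Rightarrow> 'k" where
    "\<And>b x y. e b (x + y) = e b x + e b y" "\<And>b c x. e b (scl H c x) = c * e b x"
    "\<And>x. finite {b. e b x \<noteq> 0}" "\<And>x. (\<Sum>b | e b x \<noteq> 0. scl H (e b x) b) = x"
proof -
  interpret vector_space "scl H" using vspace_H by (rule vspace_vector_space)
  obtain B where B: "independent B" "UNIV \<subseteq> span B"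
    using maximal_independent_subset[of UNIV] by auto
  then have sp: "x \<in> span B" for x by auto
  show thesis
  proof (rule that[of "\<lambda>b x. representation B x b"])
    show "(\<Sum>b | representation B x b \<noteq> 0. scl H (representation B x b) b) = x" for x
      by (rule sum_nonzero_representation_eq[OF B(1) sp])
  qed (simp_all add: representation_add[OF B(1) sp sp] representation_scale[OF B(1) sp]
      finite_representation)
qed

text \<open>The slice map e \<otimes> id from H \<otimes> X to X, for a functional e on H.\<close>

definition coord ::
  "('k, 'a::ab_group_add, 'z) vsp_scheme \<Rightarrow> ('h \<Rightarrow> 'k) \<Rightarrow> ('h \<times> 'a \<Rightarrow>\<^sub>0 'k) \<Rightarrow> 'a" where
  "coord X e y = sw X y (\<lambda>h x. scl X (e h) x)"

context
  fixes e :: "'h \<Rightarrow> 'h \<Rightarrow> 'k"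
  assumes e_add: "\<And>b x y. e b (x + y) = e b x + e b y" and e_scl: "\<And>b c x. e b (scl H c x) = c * e b x"
    and e_finite: "\<And>x. finite {b. e b x \<noteq> 0}" and e_sum: "\<And>x. (\<Sum>b | e b x \<noteq> 0. scl H (e b x) b) = x"
begin

lemma bilin_coord: "vspace X \<Longrightarrow> bilin H X X (\<lambda>h x. scl X (e b h) x)"
  by (auto intro!: bilinI klinearI klinear_scale klinear_id
      simp: e_add e_scl vspace_scl vspace_scl_simps)

lemma klinear_coord:
  assumes "vspace X"
  shows "klinear (ktens H X) X (coord X (e b))"
  unfolding coord_def[abs_def]
  by (rule klinear_sw_left[OF klinear_id, where X = H and Y = X])
    (use assms ktens_tset[of H X] in \<open>auto simp: vspace_scl\<close>)

text \<open>y is the sum of b \<otimes> (e_b \<otimes> id)(y) over the basis. The expansion is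
  stated for every finite superset of the support, so that several tensors can be expanded over one
  common index set.\<close>

lemma coord_expand:
  assumes X: "vspace X" and y: "y \<in> car (ktens H X)"
  obtains F where "finite F"
    "\<And>F'. finite F' \<Longrightarrow> F \<subseteq> F' \<Longrightarrow> y = (\<Sum>b\<in>F'. kpure H X b (coord X (e b) y))"
proof -
  let ?T = "ktens H X"
  \<comment> \<open>All basis vectors that occur in some first component of the representative
    y.\<close>
  define F where "F = (\<Union>p\<in>Poly_Mapping.keys y. {b. e b (fst p) \<noteq> 0})"
  have yt: "y \<in> tset H X" using y ktens_tset[of H X] X by auto
  have "y = (\<Sum>b\<in>F'. kpure H X b (coord X (e b) y))" if F': "finite F'" "F \<subseteq> F'" for F'
  proof -
    have kl: "klinear X ?T (\<lambda>z. kpure H X b z)" for b using X by (auto intro!: klin)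
    have pure: "kpure H X h x = (\<Sum>b\<in>F'. kpure H X b (scl X (e b h) x))"
      if hx: "(h, x) \<in> Poly_Mapping.keys y" for h x
    proof -
      have x: "x \<in> car X" using tset_keys(2)[OF yt hx] .
      have sub: "{b. e b h \<noteq> 0} \<subseteq> F'" using hx F'(2) by (force simp: F_def)
      have k2: "klinear H ?T (\<lambda>h. kpure H X h x)" using X x by (auto intro!: klin)
      have "kpure H X h x = kpure H X (\<Sum>b | e b h \<noteq> 0. scl H (e b h) b) x" by (simp add: e_sum)
      also have "(\<Sum>b | e b h \<noteq> 0. scl H (e b h) b) = (\<Sum>b\<in>F'. scl H (e b h) b)"
        by (rule sum.mono_neutral_left) (use F' sub in \<open>auto simp: vspace_scl_simps\<close>)
      also have "kpure H X \<dots> x = (\<Sum>b\<in>F'. kpure H X (scl H (e b h) b) x)"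
        by (rule klinear_sum[OF k2]) auto
      also have "\<dots> = (\<Sum>b\<in>F'. kpure H X b (scl X (e b h) x))"
        using klinear_scl[OF k2] klinear_scl[OF kl x] by simp
      finally show ?thesis .
    qed
    have "y = sw ?T y (kpure H X)"
      using istens_expand[OF istens_ktens y] X by (simp add: kpure_def[abs_def])
    also have "\<dots> = sw ?T y (\<lambda>h x. \<Sum>b\<in>F'. kpure H X b (scl X (e b h) x))"
      by (rule sw_cong) (rule pure)
    also have "\<dots> = (\<Sum>b\<in>F'. sw ?T y (\<lambda>h x. kpure H X b (scl X (e b h) x)))"
      using F'(1)
    proof (induction F' rule: finite_induct)
      case empty
      then show ?case using X by (simp add: sw_zero)
    next
      case (insert b F')
      then show ?case using X by (simp add: sw_plus)
    qed
    also have "\<dots> = (\<Sum>b\<in>F'. kpure H X b (coord X (e b) y))"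
      unfolding coord_def
      by (rule sum.cong[OF refl], rule sw_tset_apply[OF kl X yt, symmetric]) (rule vspace_scl[OF X])
    finally show ?thesis .
  qed
  moreover have "finite F" by (simp add: F_def e_finite)
  ultimately show thesis by (rule that[rotated])
qed

end

text \<open>The map from H \<otimes> Hom(X, Y) to Hom(X, H \<otimes> Y) is injective: the slices of
  t are morphisms, their values at x are slices of the value of t at x, and t is recovered from its
  slices. Uniqueness in the definition of \<open>ad_left\<close> rests on this.\<close>

lemma ktens_khom_inject:
  assumes X: "vspace X" and Y: "vspace Y"
    and t: "t1 \<in> car (ktens H (khom X Y))" "t2 \<in> car (ktens H (khom X Y))"
    and eq: "\<And>x. x \<in> car X \<Longrightarrow> sw (ktens H Y) t1 (\<lambda>h f. kpure H Y h (f x)) =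
      sw (ktens H Y) t2 (\<lambda>h f. kpure H Y h (f x))"
  shows "t1 = t2"
proof -
  obtain e :: "'h \<Rightarrow> 'h \<Rightarrow> 'k" where
    e: "\<And>b x y. e b (x + y) = e b x + e b y" "\<And>b c x. e b (scl H c x) = c * e b x"
    "\<And>x. finite {b. e b x \<noteq> 0}" "\<And>x. (\<Sum>b | e b x \<noteq> 0. scl H (e b x) b) = x"
    using coordinates by blast
  let ?K = "khom X Y"
  have K: "vspace ?K" using X Y by simp
  have tt: "t \<in> tset H ?K" if "t \<in> car (ktens H ?K)" for t using that ktens_tset[of H ?K] K by auto
  have cK: "coord ?K (e b) t \<in> car ?K" if "t \<in> car (ktens H ?K)" for t b
    using klinear_closed[OF klinear_coord[OF e K] that] .
  have ev: "coord ?K (e b) t x = coord Y (e b) (sw (ktens H Y) t (\<lambda>h f. kpure H Y h (f x)))"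
    if x: "x \<in> car X" and t: "t \<in> car (ktens H ?K)" for b t x
  proof -
    have "coord ?K (e b) t x = sw Y t (\<lambda>h f. (scl ?K (e b h) f) x)"
      unfolding coord_def
      by (rule sw_tset_apply[OF klinear_khom_eval[OF x] K tt[OF t]]) (rule vspace_scl[OF K])
    also have "\<dots> = sw Y t (\<lambda>h f. sw Y (kpure H Y h (f x)) (\<lambda>h y. scl Y (e b h) y))"
      by (simp add: sw_kpure[OF bilin_coord[OF e Y] Y]) (simp add: khom_def)
    also have "\<dots> = coord Y (e b) (sw (ktens H Y) t (\<lambda>h f. kpure H Y h (f x)))"
      by (simp add: coord_def sw_sw[OF Y])
    finally show ?thesis .
  qed
  have "coord ?K (e b) t1 x = coord ?K (e b) t2 x" for b x
    by (cases "x \<in> car X") (simp_all add: ev t eq khom_ext[OF cK])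
  then have "coord ?K (e b) t1 = coord ?K (e b) t2" for b by auto
  note same = this
  obtain F1 where F1: "finite F1"
    "\<And>F'. finite F' \<Longrightarrow> F1 \<subseteq> F' \<Longrightarrow> t1 = (\<Sum>b\<in>F'. kpure H ?K b (coord ?K (e b) t1))"
    using coord_expand[OF e K t(1)] by blast
  obtain F2 where F2: "finite F2"
    "\<And>F'. finite F' \<Longrightarrow> F2 \<subseteq> F' \<Longrightarrow> t2 = (\<Sum>b\<in>F'. kpure H ?K b (coord ?K (e b) t2))"
    using coord_expand[OF e K t(2)] by blast
  have "t1 = (\<Sum>b\<in>F1 \<union> F2. kpure H ?K b (coord ?K (e b) t1))"
    by (rule F1(2)) (use F1(1) F2(1) in auto)
  also have "\<dots> = t2"
    unfolding same by (rule F2(2)[symmetric]) (use F1(1) F2(1) in auto)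
  finally show ?thesis .
qed

text \<open>The factor x_{-1} built into \<open>lrep\<close> is removed again by x_{-1} Sb(x_{-2}) =
  \<epsilon>, with Sb the inverse antipode. Here \<open>t\<close> is just a formal sum; it is its
  class in H \<otimes> Hom that equals \<open>ad_left\<close>.\<close>

lemma lrep_ad_left:
  assumes X: "bicomodule H X" and Y: "lcomod Y" and \<phi>: "klinear X Y \<phi>" and t: "lrep X Y t \<phi>"
  shows "ad_left H X Y \<phi> = nf (krel H (khom X Y)) t"
    and "nf (krel H (khom X Y)) t \<in> car (ktens H (khom X Y))"
proof -
  let ?K = "khom X Y" and ?T = "ktens H Y"
  let ?t = "nf (krel H ?K) t"
  note [simp] = bicomodule_vspace[OF X] bicomodule_comod[OF X] Y klinear_closed[OF \<phi>]
  have VY [simp]: "vspace Y" using Y by (simp add: lcomod_def)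
  have tt: "t \<in> tset H ?K" using t by (rule lrep_tset)
  show tc: "?t \<in> car (ktens H ?K)"
    using tt istens_car[OF istens_ktens[of H ?K]] by auto
  have "sw ?T ?t (\<lambda>h f. kpure H Y h (f m)) =
      sw ?T (lco X m) (\<lambda>m1 m0. sw ?T (lco Y (\<phi> m0)) (\<lambda>n1 n0. kpure H Y (n1 * Sb m1) n0))"
    if m: "m \<in> car X" for m
  proof -
    have "bilin H ?K ?T (\<lambda>h f. kpure H Y h (f m))"
    proof (rule bilinI)
      fix f assume "f \<in> car ?K"
      then have "f m \<in> car Y" using klinear_closed[OF khom_klinear _] m by blast
      then show "klinear H ?T (\<lambda>h. kpure H Y h (f m))" by (auto intro!: klin)
    qed (use m in \<open>auto intro!: klin\<close>)
    then have "sw ?T ?t (\<lambda>h f. kpure H Y h (f m)) = sw ?T t (\<lambda>h f. kpure H Y h (f m))"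
      by (rule sw_nf_krel) simp
    also have "\<dots> = sw ?T t (\<lambda>h f. sw ?T (lco X m) (\<lambda>m1 m0. sw ?T (lco X m0) (\<lambda>x1 x0.
        kpure H Y (h * x1 * Sb m1) (f x0))))"
    proof (rule sw_tset_cong[OF tt])
      fix h f assume f: "f \<in> car ?K"
      note [klin] = klinear_comp[OF _ khom_klinear[OF f]]
      note [simp] = klinear_closed[OF khom_klinear[OF f]]
      have "sw ?T (lco X m) (\<lambda>m1 m0. sw ?T (lco X m0) (\<lambda>x1 x0. kpure H Y (h * x1 * Sb m1) (f x0))) =
        sw ?T (lco X m) (\<lambda>z x0. sw ?T (\<Delta> z) (\<lambda>m1 x1. kpure H Y (h * x1 * Sb m1) (f x0)))"
        by (rule sw_lco_coassoc[OF X]) (use m in \<open>auto intro!: klin\<close>)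
      also have "\<dots> = sw ?T (lco X m) (\<lambda>z x0. sw ?T (\<Delta> z) (\<lambda>m1 x1. kpure H Y (h * (x1 * Sb m1)) (f x0)))"
        by (simp add: mult.assoc)
      also have "\<dots> = sw ?T (lco X m) (\<lambda>z x0. scl ?T (\<epsilon> z) (kpure H Y (h * 1) (f x0)))"
        by (rule sw_lco_cong, simp, rule m, rule sw_Sb_right) (auto intro!: klin)
      also have "\<dots> = kpure H Y (h * 1) (f m)"
        by (rule sw_lco_counit[OF X]) (use m in \<open>auto intro!: klin\<close>)
      finally show "kpure H Y h (f m) =
        sw ?T (lco X m) (\<lambda>m1 m0. sw ?T (lco X m0) (\<lambda>x1 x0. kpure H Y (h * x1 * Sb m1) (f x0)))"
        by simp
    qed
    also have "\<dots> = sw ?T (lco X m) (\<lambda>m1 m0. sw ?T t (\<lambda>h f. sw ?T (lco X m0) (\<lambda>x1 x0.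
        kpure H Y (h * x1 * Sb m1) (f x0))))"
      by (rule sw_swap) simp
    also have "\<dots> = sw ?T (lco X m) (\<lambda>m1 m0. sw ?T (lco Y (\<phi> m0)) (\<lambda>n1 n0. kpure H Y (n1 * Sb m1) n0))"
      by (rule sw_lco_cong, simp, rule m, rule sw_lrep[OF t, symmetric]) (auto intro!: bilinI klin)
    finally show ?thesis .
  qed
  then have rep: "represents_left H X Y \<phi> ?t"
    using tc by (simp add: represents_left_def)
  show "ad_left H X Y \<phi> = ?t"
    unfolding ad_left_def
  proof (rule the_equality)
    show "represents_left H X Y \<phi> ?t" by (rule rep)
    fix s assume "represents_left H X Y \<phi> s"
    then show "s = ?t"
      using rep by (intro ktens_khom_inject[of X Y]) (auto simp: represents_left_def Let_def)
  qed
qed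

text \<open>For a left colinear map, \<lambda>^Ad(\<phi>) = 1 \<otimes> \<phi>. The identity, d^N
  and the extension of d^N are represented in this way.\<close>

lemma lrep_gen_1:
  assumes X: "bimodule H X" "lcomod X" and Y: "bimodule H Y" and \<phi>: "klinear X Y \<phi>"
    and co: "\<And>x. x \<in> car X \<Longrightarrow> lco Y (\<phi> x) = sw (ktens H Y) (lco X x) (\<lambda>x1 x0. kpure H Y x1 (\<phi> x0))"
  shows "lrep X Y (gen 1 (restr X \<phi>)) \<phi>"
  unfolding lrep_def
proof (intro conjI ballI)
  show "gen 1 (restr X \<phi>) \<in> tset H (khom X Y)" using X \<phi> by (intro tset_gen restr_khom) auto
  fix x assume x: "x \<in> car X"
  have "lco Y (\<phi> x) = sw (ktens H Y) (lco X x) (\<lambda>x1 x0. kpure H Y (1 * x1) (restr X \<phi> x0))"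
    unfolding co[OF x] by (rule sw_lco_cong[OF X(2) x]) simp
  then show "lco Y (\<phi> x) = sw (ktens H Y) (gen 1 (restr X \<phi>)) (\<lambda>h f. sw (ktens H Y) (lco X x) (\<lambda>x1 x0.
        kpure H Y (h * x1) (f x0)))"
    using Y by (simp add: sw_single)
qed

lemma lrep_id:
  assumes "bimodule H X" "lcomod X"
  shows "lrep X X (gen 1 (restr X id)) id"
  using assms sw_lco_kpure[of X] by (intro lrep_gen_1) (auto simp: klinear_def)

lemma lrep_add:
  assumes Y: "lcomod Y" "vspace X" and "klinear X Y \<phi>" "klinear X Y \<psi>"
    and s: "lrep X Y s \<phi>" and t: "lrep X Y t \<psi>"
  shows "lrep X Y (s + t) (\<lambda>x. \<phi> x + \<psi> x)"
proof -
  have kl: "klinear Y (ktens H Y) (lco Y)" "vspace Y" using Y by (auto simp: lcomod_def)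
  show ?thesis
    using s t kl(2) unfolding lrep_def
    by (auto simp: tset_closed sw_add klinear_add[OF kl(1)] klinear_closed[OF assms(3)]
        klinear_closed[OF assms(4)])
qed

text \<open>The product \<psi>_{-1} \<phi>_{-1} \<otimes> \<psi>_0 \<circ> \<phi>_0 of
  representatives, where \<open>s\<close> belongs to the inner map \<phi> and \<open>t\<close> to
  the outer map \<psi>.\<close>

definition hcomp :: "('h \<times> ('m \<Rightarrow> 'n) \<Rightarrow>\<^sub>0 'k) \<Rightarrow> ('h \<times> ('n \<Rightarrow> 'p) \<Rightarrow>\<^sub>0 'k) \<Rightarrow> ('h \<times> ('m \<Rightarrow> 'p) \<Rightarrow>\<^sub>0 'k)" where
  "hcomp s t = sw (free_vsp) s (\<lambda>h f. sw free_vsp t (\<lambda>h' f'. gen (h' * h) (f' \<circ> f)))"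

lemma sw_hcomp:
  "vspace Z \<Longrightarrow> sw Z (hcomp s t) G = sw Z s (\<lambda>h f. sw Z t (\<lambda>h' f'. G (h' * h) (f' \<circ> f)))"
  by (simp add: hcomp_def sw_sw sw_single)

lemma lrep_comp:
  assumes X: "lcomod X" and Y: "lcomod Y" and Z: "bimodule H Z" and \<phi>: "klinear X Y \<phi>"
    and s: "lrep X Y s \<phi>" and t: "lrep Y Z t \<psi>"
  shows "lrep X Z (hcomp s t) (\<psi> \<circ> \<phi>)"
  unfolding lrep_def
proof (intro conjI ballI)
  let ?T = "ktens H Z"
  have [simp]: "vspace Z" using Z by simp
  note st = lrep_tset[OF s] lrep_tset[OF t]
  have VX: "vspace X" "vspace Y" using X Y by (simp_all add: lcomod_def)
  show "hcomp s t \<in> tset H (khom X Z)"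
  proof -
    have "f' \<circ> f \<in> car (khom X Z)" if "f \<in> car (khom X Y)" "f' \<in> car (khom Y Z)" for f f'
      using klinear_comp[OF khom_klinear[OF that(1)] khom_klinear[OF that(2)]]
        khom_ext[OF that(1)] klinear_zero[OF khom_klinear[OF that(2)] VX(2)]
      by (simp add: khom_def comp_def)
    then show ?thesis unfolding hcomp_def
      by (auto intro!: sw_free_vsp_tset tset_gen dest: tset_keys[OF st(1)] tset_keys[OF st(2)])
  qed
  fix x assume x: "x \<in> car X"
  have kf: "klinear Y Z f" if "f \<in> car (khom Y Z)" for f using that by (rule khom_klinear)
  have "lco Z ((\<psi> \<circ> \<phi>) x) = sw ?T t (\<lambda>h' f'. sw ?T (lco Y (\<phi> x)) (\<lambda>y1 y0. kpure H Z (h' * y1) (f' y0)))"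
    using t klinear_closed[OF \<phi> x] by (simp add: lrep_def)
  also have "\<dots> = sw ?T t (\<lambda>h' f'. sw ?T s (\<lambda>h f. sw ?T (lco X x) (\<lambda>x1 x0.
      kpure H Z (h' * (h * x1)) (f' (f x0)))))"
  proof (rule sw_tset_cong[OF st(2)], rule sw_lrep[OF s x])
    fix h' f' assume f': "f' \<in> car (khom Y Z)"
    note [klin] = klinear_comp[OF _ kf[OF f']]
    show "bilin H Y ?T (\<lambda>y1 y0. kpure H Z (h' * y1) (f' y0))"
      using klinear_closed[OF kf[OF f']] VX by (auto intro!: bilinI klin)
  qed simp
  also have "\<dots> = sw ?T s (\<lambda>h f. sw ?T t (\<lambda>h' f'. sw ?T (lco X x) (\<lambda>x1 x0.
      kpure H Z (h' * (h * x1)) (f' (f x0)))))"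
    by (rule sw_swap) simp
  also have "\<dots> = sw ?T (hcomp s t) (\<lambda>h f. sw ?T (lco X x) (\<lambda>x1 x0. kpure H Z (h * x1) (f x0)))"
    by (simp add: sw_hcomp mult.assoc)
  finally show "lco Z ((\<psi> \<circ> \<phi>) x) =
    sw ?T (hcomp s t) (\<lambda>h f. sw ?T (lco X x) (\<lambda>x1 x0. kpure H Z (h * x1) (f x0)))" .
qed

lemma sw_sum_fun:
  assumes "vspace Z"
  shows "sw Z t (\<lambda>x y. \<Sum>i\<in>I. f i x y) = (\<Sum>i\<in>I. sw Z t (f i))"
proof (induction I rule: infinite_finite_induct)
  case (insert i I)
  then show ?case using sw_plus[OF assms, of t "f i" "\<lambda>x y. \<Sum>i\<in>I. f i x y"] by simp
qed (use sw_zero[OF assms] in auto)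

text \<open>\<open>\<lambda>\<^sup>A\<^sup>d(\<phi>)\<close> is right linear for the action on the second factor, so on a finitely
  generated module all its values lie in \<open>V \<otimes> Y\<close> for one finite-dimensional \<open>V \<subseteq> H\<close>.\<close>

lemma lrep_exists:
  fixes X :: "('k, 'h, 'x::ab_group_add) bcb" and Y :: "('k, 'h, 'y::ab_group_add) bcb"
  assumes X: "bicov_bimodule H X" and fin: "fin_gen_right X" and Y: "lcov Y"
    and \<phi>: "right_linear X Y \<phi>"
  obtains t where "lrep X Y t \<phi>" "\<And>h f. (h, f) \<in> Poly_Mapping.keys t \<Longrightarrow> right_linear X Y f"
proof -
  let ?T = "ktens H Y"
  note X' = bicov_bimodule_simps[OF X]
  note [simp] = X' Y
  note kl = right_linear_klinear[OF \<phi>]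
  note [klin] = klinear_comp[OF _ kl]
  note [simp] = klinear_closed[OF kl]
  \<comment> \<open>\<open>L\<close> is \<lambda>^Ad(\<phi>) as a map into H \<otimes> Y, and
    \<open>R a\<close> is right multiplication by a on the second factor. In L(x a) the extra legs
    of a meet as a_2 Sb(a_1) and cancel, which gives L(x a) = R a (L x).\<close>
  define L where "L x = sw ?T (lco X x) (\<lambda>x1 x0. sw ?T (lco Y (\<phi> x0)) (\<lambda>p q. kpure H Y (p * Sb x1) q))" for x
  define R where "R a y = sw ?T y (\<lambda>h q. kpure H Y h (ract Y q a))" for a y
  have klL: "klinear X ?T L" unfolding L_def[abs_def] by (auto intro!: klin)
  have klR: "klinear ?T ?T (R a)" for a
    unfolding R_def[abs_def]
    by (rule klinear_sw_left[OF klinear_id, where X = H and Y = Y]) (use ktens_tset[of H Y] in auto)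
  have bR: "bilin H Y ?T (\<lambda>h q. kpure H Y h (ract Y q a))" for a by (auto intro!: bilinI klin)
  have R_kpure: "R a (kpure H Y h q) = kpure H Y h (ract Y q a)" for a h q
    unfolding R_def by (rule sw_kpure[OF bR]) simp
  have LR: "L (ract X x a) = R a (L x)" if x: "x \<in> car X" for x a
  proof -
    have "L (ract X x a) = sw ?T (lco X x) (\<lambda>x1 x0. sw ?T (\<Delta> a) (\<lambda>a1 a2.
        sw ?T (lco Y (\<phi> (ract X x0 a2))) (\<lambda>p q. kpure H Y (p * Sb (x1 * a1)) q)))"
      unfolding L_def by (rule sw_lco_ract[OF X]) (use x in \<open>auto intro!: bilinI klin\<close>)
    also have "\<dots> = sw ?T (lco X x) (\<lambda>x1 x0. sw ?T (lco Y (\<phi> x0)) (\<lambda>p q. kpure H Y (p * Sb x1) (ract Y q a)))"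
    proof (rule sw_lco_cong[OF X'(4) x])
      fix x1 x0 assume x0: "x0 \<in> car X"
      have "sw ?T (\<Delta> a) (\<lambda>a1 a2. sw ?T (lco Y (\<phi> (ract X x0 a2))) (\<lambda>p q. kpure H Y (p * Sb (x1 * a1)) q)) =
        sw ?T (\<Delta> a) (\<lambda>a1 a2. sw ?T (lco Y (\<phi> x0)) (\<lambda>p q. sw ?T (\<Delta> a2) (\<lambda>b c.
          kpure H Y (p * b * Sb (x1 * a1)) (ract Y q c))))"
        unfolding right_linear_ract[OF \<phi> x0]
        by (intro sw_cong sw_lcov) (use x0 in \<open>auto intro!: bilinI klin\<close>)
      also have "\<dots> = sw ?T (lco Y (\<phi> x0)) (\<lambda>p q. sw ?T (\<Delta> a) (\<lambda>a1 a2. sw ?T (\<Delta> a2) (\<lambda>b c.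
          kpure H Y (p * b * Sb (x1 * a1)) (ract Y q c))))"
        by (rule sw_swap) simp
      also have "\<dots> = sw ?T (lco Y (\<phi> x0)) (\<lambda>p q. sw ?T (\<Delta> a) (\<lambda>a1 a2. sw ?T (\<Delta> a2) (\<lambda>b c.
          kpure H Y (p * (b * Sb a1) * Sb x1) (ract Y q c))))"
        by (simp add: Sb_mult mult.assoc)
      also have "\<dots> = sw ?T (lco Y (\<phi> x0)) (\<lambda>p q. kpure H Y (p * 1 * Sb x1) (ract Y q a))"
        by (rule sw_lco_cong, simp, simp add: x0, rule sw_cancel_Sb(2)) (auto intro!: bilinI klin)
      finally show "sw ?T (\<Delta> a) (\<lambda>a1 a2. sw ?T (lco Y (\<phi> (ract X x0 a2)))
          (\<lambda>p q. kpure H Y (p * Sb (x1 * a1)) q)) =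
        sw ?T (lco Y (\<phi> x0)) (\<lambda>p q. kpure H Y (p * Sb x1) (ract Y q a))" by simp
    qed
    also have "\<dots> = R a (L x)" unfolding L_def
    proof (subst sw_lco_apply[OF klR])
      show "sw ?T (lco X x) (\<lambda>x1 x0. sw ?T (lco Y (\<phi> x0)) (\<lambda>p q. kpure H Y (p * Sb x1) (ract Y q a))) =
        sw ?T (lco X x) (\<lambda>x1 x0. R a (sw ?T (lco Y (\<phi> x0)) (\<lambda>p q. kpure H Y (p * Sb x1) q)))"
        by (rule sw_lco_cong[OF X'(4) x], subst sw_lco_apply[OF klR]) (auto simp: R_kpure)
    qed (use x in auto)
    finally show ?thesis .
  qed
  obtain e :: "'h \<Rightarrow> 'h \<Rightarrow> 'k" where
    e: "\<And>b x y. e b (x + y) = e b x + e b y" "\<And>b c x. e b (scl H c x) = c * e b x"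
    "\<And>x. finite {b. e b x \<noteq> 0}" "\<And>x. (\<Sum>b | e b x \<noteq> 0. scl H (e b x) b) = x"
    using coordinates by blast
  have VY: "vspace Y" by simp
  note klc = klinear_coord[OF e VY]
  \<comment> \<open>The coefficients of \<lambda>^Ad(\<phi>) in the basis of H. They are right
    linear because slicing the first factor commutes with \<open>R a\<close>, and they will be the
    components of the representative.\<close>
  define \<psi> where "\<psi> b x = coord Y (e b) (L x)" for b x
  have coordR: "coord Y (e b) (R a y) = ract Y (coord Y (e b) y) a" if y: "y \<in> car ?T" for a b y
  proof -
    have yt: "y \<in> tset H Y" using y ktens_tset[of H Y] by auto
    have "coord Y (e b) (R a y) = sw Y y (\<lambda>h q. scl Y (e b h) (ract Y q a))"
      unfolding coord_def R_def by (simp add: sw_sw sw_kpure[OF bilin_coord[OF e VY]])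
    also have "\<dots> = sw Y y (\<lambda>h q. ract Y (scl Y (e b h) q) a)"
      by (rule sw_tset_cong[OF yt]) (simp add: klinear_scl[OF klinear_ract[OF _ klinear_id, of Y a]])
    also have "\<dots> = ract Y (coord Y (e b) y) a"
      unfolding coord_def
      by (rule sw_tset_apply[OF klinear_ract[OF _ klinear_id, of Y a] VY yt, symmetric])
        (simp_all add: vspace_scl[OF VY])
    finally show ?thesis .
  qed
  have kl\<psi>: "klinear X Y (\<psi> b)" for b
    unfolding \<psi>_def[abs_def] by (rule klinear_comp[OF klL klc])
  have rl\<psi>: "right_linear X Y (\<psi> b)" for b
    unfolding right_linear_def using kl\<psi> coordR klinear_closed[OF klL] by (simp add: \<psi>_def LR)
  obtain A where A: "finite A" "A \<subseteq> car X" "\<And>x. x \<in> car X \<Longrightarrow> \<exists>c. x = (\<Sum>s\<in>A. ract X s (c s))"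
    using fin unfolding fin_gen_right_def by blast
  have "\<exists>F. finite F \<and> (\<forall>F'. finite F' \<longrightarrow> F \<subseteq> F' \<longrightarrow> L s = (\<Sum>b\<in>F'. kpure H Y b (\<psi> b s)))"
    if s: "s \<in> car X" for s
    unfolding \<psi>_def
    by (rule coord_expand[OF e VY klinear_closed[OF klL s]]) blast
  then obtain F where F: "\<And>s. s \<in> car X \<Longrightarrow> finite (F s)"
    "\<And>s F'. s \<in> car X \<Longrightarrow> finite F' \<Longrightarrow> F s \<subseteq> F' \<Longrightarrow> L s = (\<Sum>b\<in>F'. kpure H Y b (\<psi> b s))"
    by metis
  \<comment> \<open>Finite generation enters here: G contains the support at each generator, and
    right linearity of L carries this one finite set over to all of X.\<close>
  define G where "G = (\<Union>s\<in>A. F s)"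
  have G: "finite G" "\<And>s. s \<in> A \<Longrightarrow> F s \<subseteq> G" using A F by (auto simp: G_def)
  have klk: "klinear Y ?T (kpure H Y b)" for b by (auto intro!: klinear_kpure_right klinear_id)
  have L_exp: "L x = (\<Sum>b\<in>G. kpure H Y b (\<psi> b x))" if x: "x \<in> car X" for x
  proof -
    obtain c where c: "x = (\<Sum>s\<in>A. ract X s (c s))" using A(3)[OF x] by blast
    have sA: "s \<in> A \<Longrightarrow> s \<in> car X" for s using A(2) by auto
    have \<psi>c: "\<psi> b s \<in> car Y" if "s \<in> A" for b s using klinear_closed[OF kl\<psi> sA[OF that]] .
    have "L x = (\<Sum>s\<in>A. R (c s) (L s))"
      unfolding c by (subst klinear_sum[OF klL]) (auto simp: sA LR intro!: sum.cong)
    also have "\<dots> = (\<Sum>s\<in>A. \<Sum>b\<in>G. kpure H Y b (\<psi> b (ract X s (c s))))"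
    proof (rule sum.cong[OF refl])
      fix s assume s: "s \<in> A"
      have "R (c s) (L s) = R (c s) (\<Sum>b\<in>G. kpure H Y b (\<psi> b s))"
        using F(2)[OF sA[OF s] G(1) G(2)[OF s]] by simp
      also have "\<dots> = (\<Sum>b\<in>G. R (c s) (kpure H Y b (\<psi> b s)))"
        by (rule klinear_sum[OF klR]) (use \<psi>c s in auto)
      also have "\<dots> = (\<Sum>b\<in>G. kpure H Y b (\<psi> b (ract X s (c s))))"
        by (simp add: R_kpure right_linear_ract[OF rl\<psi> sA[OF s]])
      finally show "R (c s) (L s) = (\<Sum>b\<in>G. kpure H Y b (\<psi> b (ract X s (c s))))" .
    qed
    also have "\<dots> = (\<Sum>b\<in>G. kpure H Y b (\<Sum>s\<in>A. \<psi> b (ract X s (c s))))"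
      by (subst sum.swap) (simp add: klinear_sum[OF klk] sA klinear_closed[OF kl\<psi>])
    also have "\<dots> = (\<Sum>b\<in>G. kpure H Y b (\<psi> b x))"
      unfolding c by (simp add: klinear_sum[OF kl\<psi>] sA)
    finally show ?thesis .
  qed
  define t :: "'h \<times> ('x \<Rightarrow> 'y) \<Rightarrow>\<^sub>0 'k" where "t = (\<Sum>b\<in>G. gen b (restr X (\<psi> b)))"
  have sw_t: "sw Z t K = (\<Sum>b\<in>G. K b (restr X (\<psi> b)))" if "vspace Z"
    for Z :: "('k, 'u::ab_group_add, 'v) vsp_scheme" and K
    using that by (simp add: t_def sw_sum sw_single)
  have keys: "\<exists>b. f = restr X (\<psi> b)" if "(h, f) \<in> Poly_Mapping.keys t" for h f
  proof -
    have "Poly_Mapping.keys t \<subseteq> (\<Union>b\<in>G. Poly_Mapping.keys (gen b (restr X (\<psi> b)) :: 'h \<times> ('x \<Rightarrow> 'y) \<Rightarrow>\<^sub>0 'k))"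
      unfolding t_def by (rule keys_sum)
    then have "(h, f) \<in> (\<Union>b\<in>G. Poly_Mapping.keys (gen b (restr X (\<psi> b)) :: 'h \<times> ('x \<Rightarrow> 'y) \<Rightarrow>\<^sub>0 'k))" using that by blast
    then show ?thesis by (auto simp: gen_def split: if_splits)
  qed
  have "lrep X Y t \<phi>"
    unfolding lrep_def
  proof (intro conjI ballI)
    show "t \<in> tset H (khom X Y)"
      using keys restr_khom[OF _ kl\<psi>] by (fastforce simp: tset_def)
    fix x assume x: "x \<in> car X"
    have "sw ?T t (\<lambda>h f. sw ?T (lco X x) (\<lambda>x1 x0. kpure H Y (h * x1) (f x0))) =
      sw ?T (lco X x) (\<lambda>x1 x0. \<Sum>b\<in>G. kpure H Y (b * x1) (restr X (\<psi> b) x0))"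
      by (simp add: sw_t sw_sum_fun)
    also have "\<dots> = sw ?T (lco X x) (\<lambda>x1 x0. sw ?T (L x0) (\<lambda>p q. kpure H Y (p * x1) q))"
    proof (rule sw_lco_cong[OF X'(4) x])
      fix x1 x0 assume x0: "x0 \<in> car X"
      have "bilin H Y ?T (\<lambda>p q. kpure H Y (p * x1) q)"
        by (auto intro!: bilinI klin klinear_kpure_right[OF _ _ _ klinear_id])
      then show "(\<Sum>b\<in>G. kpure H Y (b * x1) (restr X (\<psi> b) x0)) = sw ?T (L x0) (\<lambda>p q. kpure H Y (p * x1) q)"
        unfolding L_exp[OF x0] by (simp add: sw_sum sw_kpure x0)
    qed
    \<comment> \<open>Unfolding \<open>L\<close> brings in the inverse antipode of a leg of x right
      before the factor x_{-1} of \<open>lrep\<close>; after coassociativity these two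
      cancel.\<close>
    also have "\<dots> = sw ?T (lco X x) (\<lambda>x1 x0. sw ?T (lco X x0) (\<lambda>u v. sw ?T (lco Y (\<phi> v)) (\<lambda>p q.
        kpure H Y (p * Sb u * x1) q)))"
    proof (rule sw_lco_cong[OF X'(4) x])
      fix x1 x0 assume x0: "x0 \<in> car X"
      have "bilin H Y ?T (\<lambda>p q. kpure H Y (p * x1) q)"
        by (auto intro!: bilinI klin klinear_kpure_right[OF _ _ _ klinear_id])
      then show "sw ?T (L x0) (\<lambda>p q. kpure H Y (p * x1) q) =
        sw ?T (lco X x0) (\<lambda>u v. sw ?T (lco Y (\<phi> v)) (\<lambda>p q. kpure H Y (p * Sb u * x1) q))"
        by (simp add: L_def sw_sw sw_kpure)
    qed
    also have "\<dots> = sw ?T (lco X x) (\<lambda>z v. sw ?T (\<Delta> z) (\<lambda>x1 u. sw ?T (lco Y (\<phi> v)) (\<lambda>p q.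
        kpure H Y (p * Sb u * x1) q)))"
      by (rule sw_lco_coassoc[OF X'(2)]) (use x in \<open>auto intro!: klin\<close>)
    also have "\<dots> = sw ?T (lco X x) (\<lambda>z v. sw ?T (\<Delta> z) (\<lambda>x1 u. sw ?T (lco Y (\<phi> v)) (\<lambda>p q.
        kpure H Y (p * (Sb u * x1)) q)))"
      by (simp add: mult.assoc)
    also have "\<dots> = sw ?T (lco X x) (\<lambda>z v. scl ?T (\<epsilon> z) (sw ?T (lco Y (\<phi> v)) (\<lambda>p q. kpure H Y (p * 1) q)))"
      by (rule sw_lco_cong[OF X'(4) x], rule sw_Sb_left) (auto intro!: klin)
    also have "\<dots> = sw ?T (lco Y (\<phi> x)) (\<lambda>p q. kpure H Y (p * 1) q)"
      by (rule sw_lco_counit[OF X'(2)]) (use x in \<open>auto intro!: klin\<close>)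
    also have "\<dots> = lco Y (\<phi> x)" using sw_lco_kpure[of Y "\<phi> x"] x by simp
    finally show "lco Y (\<phi> x) = sw ?T t (\<lambda>h f. sw ?T (lco X x) (\<lambda>x1 x0. kpure H Y (h * x1) (f x0)))" ..
  qed
  moreover have "right_linear X Y f" if "(h, f) \<in> Poly_Mapping.keys t" for h f
    using keys[OF that] right_linear_restr[OF X'(1) rl\<psi>] by auto
  ultimately show thesis by (rule that)
qed

section \<open>The tensor product of rational morphisms\<close>

lemma right_linear_htensI_left:
  assumes M: "cogen M" and N: "bimodule H N" and Z: "bimodule H Z"
    and f: "klinear (htens H M N) Z f"
    and eq: "\<And>m n a. coinv M m \<Longrightarrow> n \<in> car N \<Longrightarrow>
      f (hpure M N m (ract N n a)) = ract Z (f (hpure M N m n)) a"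
  shows "right_linear (htens H M N) Z f"
  unfolding right_linear_def
proof (intro conjI ballI allI f)
  fix t a assume t: "t \<in> car (htens H M N)"
  note [klin] = klinear_comp[OF _ f]
  show "f (ract (htens H M N) t a) = ract Z (f t) a"
    by (rule htens_eqI_left[OF M N _ _ _ t, where f = "\<lambda>t. f (ract (htens H M N) t a)" and Z = Z])
      (use M N Z in \<open>auto intro!: klin simp: eq\<close>)
qed

text \<open>The definitions sum over the legs of \<psi> outermost, whereas \<open>twist\<close> has
  the coaction of m outermost.\<close>

lemma sw_swap_block:
  assumes "vspace Z"
  shows "sw Z s (\<lambda>a b. sw Z (t a b) (\<lambda>c d. sw Z u (\<lambda>p q. sw Z (v p q) (\<lambda>x y. F a b c d p q x y)))) =
    sw Z u (\<lambda>p q. sw Z (v p q) (\<lambda>x y. sw Z s (\<lambda>a b. sw Z (t a b) (\<lambda>c d. F a b c d p q x y))))"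
proof -
  have "sw Z s (\<lambda>a b. sw Z (t a b) (\<lambda>c d. sw Z u (\<lambda>p q. sw Z (v p q) (\<lambda>x y. F a b c d p q x y)))) =
    sw Z s (\<lambda>a b. sw Z u (\<lambda>p q. sw Z (t a b) (\<lambda>c d. sw Z (v p q) (\<lambda>x y. F a b c d p q x y))))"
    by (rule sw_cong, rule sw_swap[OF assms])
  also have "\<dots> = sw Z s (\<lambda>a b. sw Z u (\<lambda>p q. sw Z (v p q) (\<lambda>x y. sw Z (t a b) (\<lambda>c d. F a b c d p q x y))))"
    by (rule sw_cong, rule sw_cong, rule sw_swap[OF assms])
  also have "\<dots> = sw Z u (\<lambda>p q. sw Z s (\<lambda>a b. sw Z (v p q) (\<lambda>x y. sw Z (t a b) (\<lambda>c d. F a b c d p q x y))))"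
    by (rule sw_swap[OF assms])
  also have "\<dots> = sw Z u (\<lambda>p q. sw Z (v p q) (\<lambda>x y. sw Z s (\<lambda>a b. sw Z (t a b) (\<lambda>c d. F a b c d p q x y))))"
    by (rule sw_cong, rule sw_swap[OF assms])
  finally show ?thesis .
qed

context
  fixes M :: "('k, 'h, 'm::ab_group_add) bcb" and N :: "('k, 'h, 'n::ab_group_add) bcb"
    and M' :: "('k, 'h, 'm2::ab_group_add) bcb" and N' :: "('k, 'h, 'n2::ab_group_add) bcb"
    and \<phi> \<psi> t
  assumes M: "cogen M" and N: "bicov_bimodule H N" and M': "bimodule H M'" and N': "lcov N'"
    and \<phi>: "right_linear M M' \<phi>" and \<psi>: "klinear N N' \<psi>" and t: "lrep N N' t \<psi>"
begin

text \<open>With G(m, n) = \<phi>(\<psi>_{-1} \<triangleright> m) \<otimes> \<psi>_0(n) the product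
  is \<open>twist\<close> of G, which gives both that it is well defined and its value at
  coinvariant m. Since G is the value of a bilinear map on \<lambda>^Ad(\<psi>), any representative
  \<open>t\<close> computes it.\<close>

lemma tsigma_props:
  shows klinear_tsigma: "klinear (htens H M N) (htens H M' N') (tsigma H M N M' N' \<phi> \<psi>)"
    and tsigma_coinv: "coinv M m \<Longrightarrow> n \<in> car N \<Longrightarrow>
      tsigma H M N M' N' \<phi> \<psi> (hpure M N m n) =
      sw (htens H M' N') t (\<lambda>g f. hpure M' N' (\<phi> (ad M g m)) (f n))"
proof -
  let ?T = "htens H M' N'" and ?K = "khom N N'"
  note [simp] = M bicov_bimodule_simps[OF N] M' N'
  note kl = right_linear_klinear[OF \<phi>]
  note [klin] = klinear_comp[OF _ kl]
  note [simp] = klinear_closed[OF kl]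
  define a where "a = ad_left H N N' \<psi>"
  have a: "a = nf (krel H ?K) t" "a \<in> car (ktens H ?K)"
    unfolding a_def using lrep_ad_left[OF _ _ \<psi> t] by simp_all
  have at: "a \<in> tset H ?K" using a(2) ktens_tset[of H ?K] by auto
  have khc [simp]: "f y \<in> car N'" if "f \<in> car ?K" "y \<in> car N" for f y
    using klinear_closed[OF khom_klinear[OF that(1)] that(2)] .
  define G where "G m n = sw ?T a (\<lambda>g f. hpure M' N' (\<phi> (ad M g m)) (f n))" for m n
  \<comment> \<open>The form in which the definition has it: S(\<psi>_{-1}) acts on the second
    tensor factor. It crosses the tensor sign, and right linearity of \<phi> takes it inside to
    complete the adjoint action.\<close>
  define G' where "G' m n = sw ?T a (\<lambda>g f. sw ?T (\<Delta> g) (\<lambda>p q.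
    hpure M' N' (\<phi> (lact M p m)) (lact N' (S q) (f n))))" for m n
  have klG: "klinear N ?T (\<lambda>n. hpure M' N' x (f n))" if "f \<in> car ?K" "x \<in> car M'" for f x
    by (rule klinear_hpure_right[OF M' _ that(2) khom_klinear[OF that(1)]]) simp
  have bG: "bilin M N ?T G"
    unfolding G_def
    by (rule bilinI; rule klinear_sw_right[OF _ at]) (auto intro!: klin klG)
  have GG': "G' m n = G m n" if m: "m \<in> car M" and n: "n \<in> car N" for m n
    unfolding G_def G'_def
  proof (rule sw_tset_cong[OF at])
    fix g f assume f: "f \<in> car ?K"
    have "hpure M' N' (\<phi> (ad M g m)) (f n) =
      sw ?T (\<Delta> g) (\<lambda>p q. hpure M' N' (\<phi> (lact M p (ract M m (S q)))) (f n))"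
      unfolding ad_def
      by (rule sw_comult_apply[where Z = M and L = "\<lambda>x. hpure M' N' (\<phi> x) (f n)"])
        (use m n f in \<open>auto intro!: klin\<close>)
    also have "\<dots> = sw ?T (\<Delta> g) (\<lambda>p q. hpure M' N' (ract M' (\<phi> (lact M p m)) (S q)) (f n))"
      using m by (simp add: right_linear_ract[OF \<phi>, symmetric])
    finally show "sw ?T (\<Delta> g) (\<lambda>p q. hpure M' N' (\<phi> (lact M p m)) (lact N' (S q) (f n))) =
        hpure M' N' (\<phi> (ad M g m)) (f n)"
      using m n f by (simp add: hpure_balanced)
  qed
  have eq: "tsigma H M N M' N' \<phi> \<psi> s = sw ?T s (twist ?T M N G)" if s: "s \<in> car (htens H M N)" for s
    unfolding tsigma_def Let_def
  proof (rule sw_tset_cong)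
    show "s \<in> tset M N" using s htens_tset[of M N] by auto
    fix m n assume m: "m \<in> car M" and n: "n \<in> car N"
    have "twist ?T M N G m n = sw ?T (rco M m) (\<lambda>m0 h. sw ?T (\<Delta> h) (\<lambda>m1 m2.
        G' (ract M m0 (S m1)) (lact N m2 n)))"
      unfolding twist_def by (rule sw_rco_cong, simp, rule m) (simp add: GG' n)
    also have "\<dots> = sw ?T (rco M m) (\<lambda>m0 h. sw ?T (\<Delta> h) (\<lambda>m1 m2. sw ?T a (\<lambda>g f. sw ?T (\<Delta> g) (\<lambda>p q.
        hpure M' N' (\<phi> (ract M (lact M p m0) (S m1))) (lact N' (S q) (f (lact N m2 n)))))))"
      unfolding G'_def by (rule sw_rco_cong, simp, rule m) simp
    also have "\<dots> = sw ?T a (\<lambda>g f. sw ?T (\<Delta> g) (\<lambda>p q. sw ?T (rco M m) (\<lambda>m0 h. sw ?T (\<Delta> h) (\<lambda>m1 m2.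
        hpure M' N' (\<phi> (ract M (lact M p m0) (S m1))) (lact N' (S q) (f (lact N m2 n)))))))"
      by (rule sw_swap_block) simp
    finally show "sw ?T (ad_left H N N' \<psi>) (\<lambda>g f. sw ?T (\<Delta> g) (\<lambda>p q. sw ?T (rco M m) (\<lambda>m0 h. sw ?T (\<Delta> h) (\<lambda>m1 m2.
        hpure M' N' (\<phi> (ract M (lact M p m0) (S m1))) (lact N' (S q) (f (lact N m2 n))))))) =
      twist ?T M N G m n"
      unfolding a_def ..
  qed
  have "klinear (htens H M N) ?T (\<lambda>s. sw ?T s (twist ?T M N G))"
    by (rule klinear_sw_htens) (use bilin_closed[OF bilin_twist[OF M _ _ bG]] in auto)
  then show "klinear (htens H M N) ?T (tsigma H M N M' N' \<phi> \<psi>)"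
    by (rule klinear_cong) (auto simp: eq)
  assume m: "coinv M m" and n: "n \<in> car N"
  then have "tsigma H M N M' N' \<phi> \<psi> (hpure M N m n) = G m n"
    using sw_twist_coinv[OF M _ _ bG m n] by (simp add: eq)
  also have "\<dots> = sw ?T t (\<lambda>g f. hpure M' N' (\<phi> (ad M g m)) (f n))"
    unfolding G_def a(1)
    by (rule sw_nf_krel) (use m n in \<open>auto intro!: bilinI klin\<close>)
  finally show "tsigma H M N M' N' \<phi> \<psi> (hpure M N m n) =
      sw ?T t (\<lambda>g f. hpure M' N' (\<phi> (ad M g m)) (f n))" .
qed

text \<open>At coinvariant m the argument n occurs only inside the components of \<open>t\<close>,
  so their right linearity passes to the product. Components of the normal form
  \<open>ad_left\<close> would not provide this.\<close>

lemma right_linear_tsigma: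
  assumes "\<And>h f. (h, f) \<in> Poly_Mapping.keys t \<Longrightarrow> right_linear N N' f"
  shows "right_linear (htens H M N) (htens H M' N') (tsigma H M N M' N' \<phi> \<psi>)"
proof (rule right_linear_htensI_left[OF M _ _ klinear_tsigma])
  let ?T = "htens H M' N'"
  note [simp] = M bicov_bimodule_simps[OF N] M' N'
  fix m n a assume m: "coinv M m" and n: "n \<in> car N"
  have c: "\<phi> (ad M g m) \<in> car M'" for g using right_linear_closed[OF \<phi>] m by simp
  have f: "f n \<in> car N'" if "(h, f) \<in> Poly_Mapping.keys t" for h f
    using right_linear_closed[OF assms[OF that] n] .
  have "ract ?T (sw ?T t (\<lambda>g f. hpure M' N' (\<phi> (ad M g m)) (f n))) a =
    sw ?T t (\<lambda>g f. ract ?T (hpure M' N' (\<phi> (ad M g m)) (f n)) a)"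
    by (rule klinear_sw_apply[OF klinear_ract[OF _ klinear_id]]) (use c f in auto)
  also have "\<dots> = sw ?T t (\<lambda>g f. hpure M' N' (\<phi> (ad M g m)) (f (ract N n a)))"
    by (rule sw_cong) (use c f n in \<open>auto simp: right_linear_ract[OF assms]\<close>)
  finally show "tsigma H M N M' N' \<phi> \<psi> (hpure M N m (ract N n a)) =
    ract ?T (tsigma H M N M' N' \<phi> \<psi> (hpure M N m n)) a"
    using m n by (simp add: tsigma_coinv)
qed (use M N M' N' in auto)

end

context
  fixes M :: "('k, 'h, 'm::ab_group_add) bcb" and N :: "('k, 'h, 'n::ab_group_add) bcb"
    and M' :: "('k, 'h, 'm2::ab_group_add) bcb" and \<phi>
  assumes M: "cogen M" and N: "bicov_bimodule H N" and M': "bimodule H M'"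
    and \<phi>: "right_linear M M' \<phi>"
begin

lemma klinear_id': "klinear N N id"
  by (simp add: klinear_def)

lemma right_linear_tsigma_id:
  "right_linear (htens H M N) (htens H M' N) (tsigma H M N M' N \<phi> id)"
  by (rule right_linear_tsigma[OF M N M' lcov_bicov[OF N] \<phi> klinear_id' lrep_id])
    (use N right_linear_restr[OF _ right_linear_id, of N] in \<open>auto simp: gen_def split: if_splits\<close>)

lemma tsigma_id:
  assumes "coinv M m" "n \<in> car N"
  shows "tsigma H M N M' N \<phi> id (hpure M N m n) = hpure M' N (\<phi> m) n"
  using tsigma_coinv[OF M N M' lcov_bicov[OF N] \<phi> klinear_id' lrep_id assms] assms M N M'
  by (simp add: sw_single ad_1)

end

end

section \<open>Bicovariant differential calculi\<close>

text \<open>Otherwise the simplifier turns \<open>forms \<Omega> 1\<close> into \<open>forms \<Omega> (Suc 0)\<close>.\<close>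

declare One_nat_def [simp del]

locale bicov_calc = hopf_alg H
  for H :: "('k::field, 'h::ring_1) hopf" +
  fixes \<Omega> :: "('k, 'h, 'w::ring_1) calculus"
  assumes calc: "bicov_calculus H \<Omega>"
begin

abbreviation "F k \<equiv> forms \<Omega> k"
abbreviation "dd a \<equiv> dif \<Omega> (emb \<Omega> a)"

lemma diff_calc: "diff_calculus H \<Omega>"
  using calc by (simp add: bicov_calculus_def)

lemma forms_simps:
  "car (F k) = deg \<Omega> k" "scl (F k) = wscl \<Omega>" "lact (F k) a \<omega> = emb \<Omega> a * \<omega>"
  "ract (F k) \<omega> a = \<omega> * emb \<Omega> a" "rco (F k) = wrco \<Omega> k" "lco (F k) = wlco \<Omega> k"
  by (simp_all add: forms_def)

lemma wscl_mult: "wscl \<Omega> c (a * b) = wscl \<Omega> c a * b" "wscl \<Omega> c (a * b) = a * wscl \<Omega> c b"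
proof -
  have "k_algebra (wscl \<Omega>)" using diff_calc by (simp add: diff_calculus_def)
  then show "wscl \<Omega> c (a * b) = wscl \<Omega> c a * b" "wscl \<Omega> c (a * b) = a * wscl \<Omega> c b"
    unfolding k_algebra_def by metis+
qed

lemma vspace_forms [simp]: "vspace (F k)"
  using diff_calc unfolding vspace_def forms_simps diff_calculus_def k_algebra_def by blast

lemma mult_deg: "\<omega> \<in> car (F k) \<Longrightarrow> \<eta> \<in> car (F l) \<Longrightarrow> \<omega> * \<eta> \<in> car (F (k + l))"
  using diff_calc unfolding diff_calculus_def forms_simps by blast

lemma emb_props:
  shows emb_1: "emb \<Omega> 1 = 1" and emb_mult: "emb \<Omega> (a * b) = emb \<Omega> a * emb \<Omega> b"
    and emb_deg: "emb \<Omega> a \<in> car (F 0)"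
  using diff_calc by (auto simp: diff_calculus_def forms_simps)

lemma klinear_emb: "klinear H (F 0) (emb \<Omega>)"
proof -
  have "Vector_Spaces.linear (scl H) (wscl \<Omega>) (emb \<Omega>)"
    using diff_calc unfolding diff_calculus_def by blast
  then interpret Vector_Spaces.linear "scl H" "wscl \<Omega>" "emb \<Omega>" .
  show ?thesis using emb_deg by (auto simp: klinear_def add scale forms_simps)
qed

lemma klinear_dif: "klinear (F k) (F (Suc k)) (dif \<Omega>)"
proof -
  have "Vector_Spaces.linear (wscl \<Omega>) (wscl \<Omega>) (dif \<Omega>)"
    using diff_calc unfolding diff_calculus_def by blast
  then interpret Vector_Spaces.linear "wscl \<Omega>" "wscl \<Omega>" "dif \<Omega>" .
  have "\<forall>\<omega>\<in>deg \<Omega> k. dif \<Omega> \<omega> \<in> deg \<Omega> (Suc k)"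
    using diff_calc unfolding diff_calculus_def by blast
  then show ?thesis by (auto simp: klinear_def add scale forms_simps)
qed

lemma klinear_wedge_left: "\<eta> \<in> car (F l) \<Longrightarrow> klinear (F k) (F (k + l)) (\<lambda>\<omega>. \<omega> * \<eta>)"
  by (rule klinearI) (auto simp: mult_deg distrib_right wscl_mult(1) forms_simps(2))

lemma klinear_wedge_right: "\<omega> \<in> car (F k) \<Longrightarrow> klinear (F l) (F (k + l)) (\<lambda>\<eta>. \<omega> * \<eta>)"
  by (rule klinearI) (auto simp: mult_deg distrib_left wscl_mult(2) forms_simps(2))

lemma bimodule_forms [simp]: "bimodule H (F k)"
  unfolding bimodule_def
proof (intro conjI allI ballI)
  show "klinear (F k) (F k) (lact (F k) a)" for a
    using klinear_wedge_right[OF emb_deg, of k a] by (simp add: forms_simps(3)[abs_def])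
  show "klinear (F k) (F k) (\<lambda>m. ract (F k) m a)" for a
    using klinear_wedge_left[OF emb_deg, of k a] by (simp add: forms_simps(4)[abs_def])
  fix \<omega> assume w: "\<omega> \<in> car (F k)"
  show "klinear H (F k) (\<lambda>a. lact (F k) a \<omega>)"
    using klinear_comp[OF klinear_emb klinear_wedge_left[OF w, of 0]] by (simp add: forms_simps(3))
  show "klinear H (F k) (\<lambda>a. ract (F k) \<omega> a)"
    using klinear_comp[OF klinear_emb klinear_wedge_right[OF w, of 0]] by (simp add: forms_simps(4))
qed (auto simp: forms_simps emb_mult emb_1 mult.assoc)

lemma bicomodule_forms: "bicomodule H (F k)"
  using calc by (simp add: bicov_calculus_def)

lemma forms_comod [simp]: "rcomod (F k)" "lcomod (F k)"
  using bicomodule_comod[OF bicomodule_forms] by auto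

context
  fixes k l :: nat and \<omega> \<eta> and Z :: "('k, 'z::ab_group_add, 'y) vsp_scheme"
  assumes w: "\<omega> \<in> car (F k)" and e: "\<eta> \<in> car (F l)" and Z: "vspace Z"
begin

lemma sw_rco_wedge:
  assumes "bilin (F (k + l)) H Z G"
  shows "sw Z (rco (F (k + l)) (\<omega> * \<eta>)) G = sw Z (rco (F k) \<omega>) (\<lambda>\<omega>0 \<omega>1.
    sw Z (rco (F l) \<eta>) (\<lambda>\<eta>0 \<eta>1. G (\<omega>0 * \<eta>0) (\<omega>1 * \<eta>1)))"
proof -
  let ?T = "ktens (F (k + l)) H"
  have "wrco \<Omega> (k + l) (\<omega> * \<eta>) = sw ?T (wrco \<Omega> k \<omega>) (\<lambda>\<omega>0 \<omega>1.
      sw ?T (wrco \<Omega> l \<eta>) (\<lambda>\<eta>0 \<eta>1. kpure (F (k + l)) H (\<omega>0 * \<eta>0) (\<omega>1 * \<eta>1)))"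
    using calc w e unfolding bicov_calculus_def Let_def forms_simps by blast
  then show ?thesis by (simp add: forms_simps(5) sw_sw Z sw_kpure[OF assms Z])
qed

lemma sw_lco_wedge:
  assumes "bilin H (F (k + l)) Z G"
  shows "sw Z (lco (F (k + l)) (\<omega> * \<eta>)) G = sw Z (lco (F k) \<omega>) (\<lambda>\<omega>1 \<omega>0.
    sw Z (lco (F l) \<eta>) (\<lambda>\<eta>1 \<eta>0. G (\<omega>1 * \<eta>1) (\<omega>0 * \<eta>0)))"
proof -
  let ?T = "ktens H (F (k + l))"
  have "wlco \<Omega> (k + l) (\<omega> * \<eta>) = sw ?T (wlco \<Omega> k \<omega>) (\<lambda>\<omega>1 \<omega>0.
      sw ?T (wlco \<Omega> l \<eta>) (\<lambda>\<eta>1 \<eta>0. kpure H (F (k + l)) (\<omega>1 * \<eta>1) (\<omega>0 * \<eta>0)))"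
    using calc w e unfolding bicov_calculus_def Let_def forms_simps by blast
  then show ?thesis by (simp add: forms_simps(6) sw_sw Z sw_kpure[OF assms Z])
qed

end

lemma sw_lco_dif:
  assumes w: "\<omega> \<in> car (F k)" and Z: "vspace Z" and G: "bilin H (F (Suc k)) Z G"
  shows "sw Z (lco (F (Suc k)) (dif \<Omega> \<omega>)) G = sw Z (lco (F k) \<omega>) (\<lambda>\<omega>1 \<omega>0. G \<omega>1 (dif \<Omega> \<omega>0))"
proof -
  let ?T = "ktens H (F (Suc k))"
  have "wlco \<Omega> (Suc k) (dif \<Omega> \<omega>) = sw ?T (wlco \<Omega> k \<omega>) (\<lambda>\<omega>1 \<omega>0. kpure H (F (Suc k)) \<omega>1 (dif \<Omega> \<omega>0))"
    using calc w unfolding bicov_calculus_def Let_def forms_simps by blast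
  then show ?thesis by (simp add: forms_simps(6) sw_sw Z sw_kpure[OF G Z])
qed

lemma sw_rco_emb:
  assumes "bilin (F 0) H Z G" "vspace Z"
  shows "sw Z (rco (F 0) (emb \<Omega> a)) G = sw Z (\<Delta> a) (\<lambda>a1 a2. G (emb \<Omega> a1) a2)"
proof -
  have "wrco \<Omega> 0 (emb \<Omega> a) = sw (ktens (F 0) H) (\<Delta> a) (\<lambda>a1 a2. kpure (F 0) H (emb \<Omega> a1) a2)"
    using calc unfolding bicov_calculus_def Let_def by blast
  then show ?thesis by (simp add: forms_simps(5) sw_sw assms(2) sw_kpure[OF assms])
qed

lemma sw_lco_emb:
  assumes "bilin H (F 0) Z G" "vspace Z"
  shows "sw Z (lco (F 0) (emb \<Omega> a)) G = sw Z (\<Delta> a) (\<lambda>a1 a2. G a1 (emb \<Omega> a2))"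
proof -
  have "wlco \<Omega> 0 (emb \<Omega> a) = sw (ktens H (F 0)) (\<Delta> a) (\<lambda>a1 a2. kpure H (F 0) a1 (emb \<Omega> a2))"
    using calc unfolding bicov_calculus_def Let_def by blast
  then show ?thesis by (simp add: forms_simps(6) sw_sw assms(2) sw_kpure[OF assms])
qed

text \<open>H acts on forms by multiplication with \<Omega>^0, so covariance of the actions is
  multiplicativity of the coactions with one factor in degree zero.\<close>

lemma bicov_forms [simp]: "bicov_bimodule H (F k)"
proof -
  note w0 = klinear_comp[OF _ klinear_wedge_left[where k = 0 and l = k, simplified]]
    klinear_comp[OF _ klinear_wedge_right[where k = 0 and l = k, simplified]]
    klinear_comp[OF _ klinear_wedge_right[where k = k and l = 0, simplified]]
  note mem = mult_deg[where k = k and l = 0, simplified] mult_deg[where k = 0 and l = k, simplified] emb_deg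
  have r: "rco (F k) (lact (F k) a (ract (F k) m b)) = (let T = ktens (F k) H in
      sw T (\<Delta> a) (\<lambda>a1 a2. sw T (rco (F k) m) (\<lambda>m0 m1. sw T (\<Delta> b) (\<lambda>b1 b2.
        kpure (F k) H (lact (F k) a1 (ract (F k) m0 b1)) (a2 * m1 * b2)))))"
    if m: "m \<in> car (F k)" for a b m
  proof -
    let ?T = "ktens (F k) H" and ?m = "m * emb \<Omega> b"
    have mb: "?m \<in> car (F k)" using mem m by simp
    have "rco (F k) (emb \<Omega> a * ?m) = sw ?T (rco (F k) (emb \<Omega> a * ?m)) (kpure (F k) H)"
      using sw_rco_kpure[of "F k"] mem mb by simp
    also have "\<dots> = sw ?T (rco (F 0) (emb \<Omega> a)) (\<lambda>x y. sw ?T (rco (F k) ?m) (\<lambda>u v.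
        kpure (F k) H (x * u) (y * v)))"
      using sw_rco_wedge[OF emb_deg mb, of ?T "kpure (F k) H" a] by (simp add: bilin_kpure)
    also have "\<dots> = sw ?T (\<Delta> a) (\<lambda>a1 a2. sw ?T (rco (F k) ?m) (\<lambda>u v.
        kpure (F k) H (emb \<Omega> a1 * u) (a2 * v)))"
      by (rule sw_rco_emb) (use mb in \<open>auto intro!: bilinI klin intro: w0 mem\<close>)
    also have "\<dots> = sw ?T (\<Delta> a) (\<lambda>a1 a2. sw ?T (rco (F k) m) (\<lambda>m0 m1. sw ?T (rco (F 0) (emb \<Omega> b)) (\<lambda>u v.
        kpure (F k) H (emb \<Omega> a1 * (m0 * u)) (a2 * (m1 * v)))))"
    proof (rule sw_cong)
      fix a1 a2
      have "bilin (F k) H ?T (\<lambda>u v. kpure (F k) H (emb \<Omega> a1 * u) (a2 * v))"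
        by (auto intro!: bilinI klin intro: w0 mem)
      then show "sw ?T (rco (F k) ?m) (\<lambda>u v. kpure (F k) H (emb \<Omega> a1 * u) (a2 * v)) =
        sw ?T (rco (F k) m) (\<lambda>m0 m1. sw ?T (rco (F 0) (emb \<Omega> b)) (\<lambda>u v.
        kpure (F k) H (emb \<Omega> a1 * (m0 * u)) (a2 * (m1 * v))))"
        using sw_rco_wedge[OF m emb_deg, of ?T "\<lambda>u v. kpure (F k) H (emb \<Omega> a1 * u) (a2 * v)" b] by simp
    qed
    also have "\<dots> = sw ?T (\<Delta> a) (\<lambda>a1 a2. sw ?T (rco (F k) m) (\<lambda>m0 m1. sw ?T (\<Delta> b) (\<lambda>b1 b2.
        kpure (F k) H (emb \<Omega> a1 * (m0 * emb \<Omega> b1)) (a2 * (m1 * b2)))))"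
      by (rule sw_cong, rule sw_rco_cong[OF _ m], simp, rule sw_rco_emb)
        (auto intro!: bilinI klin intro: w0 mem)
    finally show ?thesis by (simp add: forms_simps(3,4) mult.assoc Let_def)
  qed
  have l: "lco (F k) (lact (F k) a (ract (F k) m b)) = (let T = ktens H (F k) in
      sw T (\<Delta> a) (\<lambda>a1 a2. sw T (lco (F k) m) (\<lambda>m1 m0. sw T (\<Delta> b) (\<lambda>b1 b2.
        kpure H (F k) (a1 * m1 * b1) (lact (F k) a2 (ract (F k) m0 b2))))))"
    if m: "m \<in> car (F k)" for a b m
  proof -
    let ?T = "ktens H (F k)" and ?m = "m * emb \<Omega> b"
    have mb: "?m \<in> car (F k)" using mem m by simp
    have "lco (F k) (emb \<Omega> a * ?m) = sw ?T (lco (F k) (emb \<Omega> a * ?m)) (kpure H (F k))"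
      using sw_lco_kpure[of "F k"] mem mb by simp
    also have "\<dots> = sw ?T (lco (F 0) (emb \<Omega> a)) (\<lambda>y x. sw ?T (lco (F k) ?m) (\<lambda>v u.
        kpure H (F k) (y * v) (x * u)))"
      using sw_lco_wedge[OF emb_deg mb, of ?T "kpure H (F k)" a] by (simp add: bilin_kpure)
    also have "\<dots> = sw ?T (\<Delta> a) (\<lambda>a1 a2. sw ?T (lco (F k) ?m) (\<lambda>v u.
        kpure H (F k) (a1 * v) (emb \<Omega> a2 * u)))"
      by (rule sw_lco_emb) (use mb in \<open>auto intro!: bilinI klin intro: w0 mem\<close>)
    also have "\<dots> = sw ?T (\<Delta> a) (\<lambda>a1 a2. sw ?T (lco (F k) m) (\<lambda>m1 m0. sw ?T (lco (F 0) (emb \<Omega> b)) (\<lambda>v u.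
        kpure H (F k) (a1 * (m1 * v)) (emb \<Omega> a2 * (m0 * u)))))"
    proof (rule sw_cong)
      fix a1 a2
      have "bilin H (F k) ?T (\<lambda>v u. kpure H (F k) (a1 * v) (emb \<Omega> a2 * u))"
        by (auto intro!: bilinI klin intro: w0 mem)
      then show "sw ?T (lco (F k) ?m) (\<lambda>v u. kpure H (F k) (a1 * v) (emb \<Omega> a2 * u)) =
        sw ?T (lco (F k) m) (\<lambda>m1 m0. sw ?T (lco (F 0) (emb \<Omega> b)) (\<lambda>v u.
        kpure H (F k) (a1 * (m1 * v)) (emb \<Omega> a2 * (m0 * u))))"
        using sw_lco_wedge[OF m emb_deg, of ?T "\<lambda>v u. kpure H (F k) (a1 * v) (emb \<Omega> a2 * u)" b] by simp
    qed
    also have "\<dots> = sw ?T (\<Delta> a) (\<lambda>a1 a2. sw ?T (lco (F k) m) (\<lambda>m1 m0. sw ?T (\<Delta> b) (\<lambda>b1 b2.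
        kpure H (F k) (a1 * (m1 * b1)) (emb \<Omega> a2 * (m0 * emb \<Omega> b2)))))"
      by (rule sw_cong, rule sw_lco_cong[OF _ m], simp, rule sw_lco_emb)
        (auto intro!: bilinI klin intro: w0 mem)
    finally show ?thesis by (simp add: forms_simps(3,4) mult.assoc Let_def)
  qed
  show ?thesis
    unfolding bicov_bimodule_def
    by (intro conjI allI ballI bimodule_forms bicomodule_forms r l)
qed

text \<open>General facts about degrees k and k + l arrive with \<open>Suc 0\<close>,
  \<open>Suc 1\<close> and \<open>1 + 1\<close>; these equations bring them to the degrees 1 and 2
  in which everything below is stated.\<close>

lemma Suc_1_2: "Suc 1 = 2" "1 + 1 = (2::nat)" "Suc 0 = 1"
  by simp_all

lemma klinear_dif_1 [klin]: "klinear W (F 1) g \<Longrightarrow> klinear W (F 2) (\<lambda>w. dif \<Omega> (g w))"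
  by (rule klinear_comp[OF _ klinear_dif[of 1, unfolded Suc_1_2]])

lemma klinear_dd [klin]: "klinear W H g \<Longrightarrow> klinear W (F 1) (\<lambda>w. dd (g w))"
  by (rule klinear_comp[OF klinear_comp[OF _ klinear_emb] klinear_dif[of 0, unfolded Suc_1_2]])

lemma dif_closed_1 [simp]: "\<omega> \<in> car (F 1) \<Longrightarrow> dif \<Omega> \<omega> \<in> car (F 2)"
  by (rule klinear_closed[OF klinear_dif[of 1, unfolded Suc_1_2]])

lemma dd_closed [simp]: "dd a \<in> car (F 1)"
  by (rule klinear_closed[OF klinear_dif[of 0, unfolded Suc_1_2]]) (rule emb_deg)

lemma mult_closed_1 [simp]: "\<omega> \<in> car (F 1) \<Longrightarrow> \<eta> \<in> car (F 1) \<Longrightarrow> \<omega> * \<eta> \<in> car (F 2)"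
  using mult_deg[of \<omega> 1 \<eta> 1] by (simp only: Suc_1_2)

lemma klinear_mult_1 [klin]:
  "\<eta> \<in> car (F 1) \<Longrightarrow> klinear W (F 1) g \<Longrightarrow> klinear W (F 2) (\<lambda>w. g w * \<eta>)"
  "\<omega> \<in> car (F 1) \<Longrightarrow> klinear W (F 1) g \<Longrightarrow> klinear W (F 2) (\<lambda>w. \<omega> * g w)"
  using klinear_comp[of W "F 1" g "F 2" "\<lambda>\<omega>. \<omega> * \<eta>"] klinear_wedge_left[of \<eta> 1 1]
    klinear_comp[of W "F 1" g "F 2" "\<lambda>\<eta>. \<omega> * \<eta>"] klinear_wedge_right[of \<omega> 1 1]
  by (simp_all only: Suc_1_2)

lemma leibniz: "\<omega> \<in> car (F k) \<Longrightarrow> dif \<Omega> (\<omega> * \<eta>) = dif \<Omega> \<omega> * \<eta> + (- 1) ^ k * (\<omega> * dif \<Omega> \<eta>)"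
  using diff_calc unfolding diff_calculus_def forms_simps by blast

lemma dif_dif: "dif \<Omega> (dif \<Omega> \<omega>) = 0"
  using diff_calc unfolding diff_calculus_def by blast

lemma leibniz_emb: "dif \<Omega> (emb \<Omega> a * \<eta>) = dd a * \<eta> + emb \<Omega> a * dif \<Omega> \<eta>"
  using leibniz[OF emb_deg, of a \<eta>] by simp

lemma leibniz_1: "\<omega> \<in> car (F 1) \<Longrightarrow> dif \<Omega> (\<omega> * \<eta>) = dif \<Omega> \<omega> * \<eta> - \<omega> * dif \<Omega> \<eta>"
  using leibniz[of \<omega> 1 \<eta>] by simp

lemma dd_mult: "dd (a * b) = ract (F 1) (dd a) b + lact (F 1) a (dd b)"
  by (simp add: emb_mult leibniz_emb forms_simps)

lemma dd_1 [simp]: "dd 1 = 0"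
  using leibniz_emb[of 1 1] by (simp add: emb_1)

lemma sw_lco_dd:
  assumes G: "bilin H (F 1) Z G" and Z: "vspace Z"
  shows "sw Z (lco (F 1) (dd a)) G = sw Z (\<Delta> a) (\<lambda>a1 a2. G a1 (dd a2))"
proof -
  have "sw Z (lco (F 1) (dd a)) G = sw Z (lco (F 0) (emb \<Omega> a)) (\<lambda>x y. G x (dif \<Omega> y))"
    using sw_lco_dif[OF emb_deg Z, of G a] G by (simp only: Suc_1_2)
  also have "\<dots> = sw Z (\<Delta> a) (\<lambda>a1 a2. G a1 (dd a2))"
    by (rule sw_lco_emb[OF bilinI Z])
      (auto intro!: bilin_comp_left[OF G] bilin_comp_right[OF G] klinear_id
        klinear_dif[of 0, unfolded Suc_1_2] klinear_closed[OF klinear_dif[of 0, unfolded Suc_1_2]])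
  finally show ?thesis .
qed

lemma sw_lco_dif_1:
  assumes "\<omega> \<in> car (F 1)" "bilin H (F 2) Z G" "vspace Z"
  shows "sw Z (lco (F 2) (dif \<Omega> \<omega>)) G = sw Z (lco (F 1) \<omega>) (\<lambda>\<omega>1 \<omega>0. G \<omega>1 (dif \<Omega> \<omega>0))"
  using sw_lco_dif[OF assms(1,3), of G] assms(2) by (simp only: Suc_1_2)

lemma sw_lco_mult_1:
  assumes "\<omega> \<in> car (F 1)" "\<eta> \<in> car (F 1)" "bilin H (F 2) Z G" "vspace Z"
  shows "sw Z (lco (F 2) (\<omega> * \<eta>)) G = sw Z (lco (F 1) \<omega>) (\<lambda>\<omega>1 \<omega>0.
    sw Z (lco (F 1) \<eta>) (\<lambda>\<eta>1 \<eta>0. G (\<omega>1 * \<eta>1) (\<omega>0 * \<eta>0)))"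
  using sw_lco_wedge[OF assms(1,2,4), of G] assms(3) by (simp only: Suc_1_2)

lemma wedge_props:
  shows left_linear_wedge: "left_linear (htens H (F 1) (F 1)) (F 2) (wedge \<Omega> 1 1)"
    and right_linear_wedge: "right_linear (htens H (F 1) (F 1)) (F 2) (wedge \<Omega> 1 1)"
    and wedge_hpure: "\<omega> \<in> car (F 1) \<Longrightarrow> \<eta> \<in> car (F 1) \<Longrightarrow> wedge \<Omega> 1 1 (hpure (F 1) (F 1) \<omega> \<eta>) = \<omega> * \<eta>"
proof -
  have eq: "wedge \<Omega> 1 1 = (\<lambda>t. sw (F 2) t (*))"
    by (simp add: wedge_def[abs_def] Suc_1_2)
  have 1: "klinear (htens H (F 1) (F 1)) (F 2) (wedge \<Omega> 1 1)"
    unfolding eq by (rule klinear_sw_htens) auto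
  have 2: "wedge \<Omega> 1 1 (hpure (F 1) (F 1) \<omega> \<eta>) = \<omega> * \<eta>" if "\<omega> \<in> car (F 1)" "\<eta> \<in> car (F 1)" for \<omega> \<eta>
    unfolding eq
    by (rule sw_hpure)
      (auto intro!: bilinI klin simp: forms_simps(3,4) mult.assoc klinear_mult_1(2)[OF _ klinear_id])
  note [klin] = klinear_comp[OF _ 1]
  show "right_linear (htens H (F 1) (F 1)) (F 2) (wedge \<Omega> 1 1)"
    by (rule right_linear_htensI[OF _ _ _ 1]) (auto simp: 2, auto simp: forms_simps mult.assoc)
  have "wedge \<Omega> 1 1 (lact (htens H (F 1) (F 1)) a t) = lact (F 2) a (wedge \<Omega> 1 1 t)"
    if t: "t \<in> car (htens H (F 1) (F 1))" for a t
    by (rule htens_eqI[OF _ _ _ _ t, where f = "\<lambda>t. wedge \<Omega> 1 1 (lact (htens H (F 1) (F 1)) a t)" and Z = "F 2"])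
      (auto intro!: klin simp: 2, auto simp: forms_simps mult.assoc)
  then show "left_linear (htens H (F 1) (F 1)) (F 2) (wedge \<Omega> 1 1)"
    using 1 by (simp add: left_linear_def)
  show "\<omega> \<in> car (F 1) \<Longrightarrow> \<eta> \<in> car (F 1) \<Longrightarrow> wedge \<Omega> 1 1 (hpure (F 1) (F 1) \<omega> \<eta>) = \<omega> * \<eta>" by (rule 2)
qed

text \<open>The product y \<and> \<eta> of y in X \<otimes> \<Omega>^1 with a one-form.\<close>

definition wl :: "('k, 'h, 'x::ab_group_add) bcb \<Rightarrow> ('x \<times> 'w \<Rightarrow>\<^sub>0 'k) \<Rightarrow> 'w \<Rightarrow> ('x \<times> 'w \<Rightarrow>\<^sub>0 'k)" where
  "wl X y \<eta> = wedge_last H \<Omega> X 1 1 (hpure (htens H X (F 1)) (F 1) y \<eta>)"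

context
  fixes X :: "('k, 'h, 'x::ab_group_add) bcb"
  assumes X [simp]: "bimodule H X"
begin

lemma right_linear_wedge_last:
  "right_linear (htens H (htens H X (F 1)) (F 1)) (htens H X (F 2)) (wedge_last H \<Omega> X 1 1)"
  unfolding wedge_last_def Suc_1_2
  by (rule right_linear_comp[OF right_linear_hassoc right_linear_hmap])
    (auto intro!: right_linear_id left_linear_wedge right_linear_wedge)

lemma wedge_last_hpure:
  assumes "x \<in> car X" "\<omega> \<in> car (F 1)" "\<eta> \<in> car (F 1)"
  shows "wl X (hpure X (F 1) x \<omega>) \<eta> = hpure X (F 2) x (\<omega> * \<eta>)"
  using assms unfolding wl_def wedge_last_def Suc_1_2
  by (simp add: hassoc_hpure hmap_hpure[OF _ _ _ _ right_linear_id left_linear_wedge] wedge_hpure)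

lemma klinear_wl:
  "\<eta> \<in> car (F 1) \<Longrightarrow> klinear W (htens H X (F 1)) g \<Longrightarrow> klinear W (htens H X (F 2)) (\<lambda>w. wl X (g w) \<eta>)"
  "y \<in> car (htens H X (F 1)) \<Longrightarrow> klinear W (F 1) u \<Longrightarrow> klinear W (htens H X (F 2)) (\<lambda>w. wl X y (u w))"
  unfolding wl_def
  by (auto intro!: klin klinear_comp[OF _ right_linear_klinear[OF right_linear_wedge_last]])

lemma wl_closed [simp]:
  "y \<in> car (htens H X (F 1)) \<Longrightarrow> \<eta> \<in> car (F 1) \<Longrightarrow> wl X y \<eta> \<in> car (htens H X (F 2))"
  unfolding wl_def using right_linear_closed[OF right_linear_wedge_last] by simp

lemma wl_balanced:
  "y \<in> car (htens H X (F 1)) \<Longrightarrow> \<eta> \<in> car (F 1) \<Longrightarrow>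
   wl X (ract (htens H X (F 1)) y a) \<eta> = wl X y (lact (F 1) a \<eta>)"
  unfolding wl_def by (simp add: hpure_balanced)

lemma wl_ract:
  "y \<in> car (htens H X (F 1)) \<Longrightarrow> \<eta> \<in> car (F 1) \<Longrightarrow>
   wl X y (ract (F 1) \<eta> a) = ract (htens H X (F 2)) (wl X y \<eta>) a"
  unfolding wl_def by (simp add: right_linear_ract[OF right_linear_wedge_last, symmetric])

end

lemmas [klin] = klinear_wl

end

section \<open>Connections and curvature\<close>

context bicov_calc
begin

lemma connectionD:
  assumes "D \<in> connections H \<Omega> M"
  shows connection_klinear: "klinear M (htens H M (F 1)) D"
    and connection_ract: "m \<in> car M \<Longrightarrow>
      D (ract M m a) = ract (htens H M (F 1)) (D m) a + hpure M (F 1) m (dd a)"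
  using assms by (simp_all add: connections_def)

text \<open>The extension of a right linear map to forms, without the term in d. The extension of
  \<nabla>^N is that of d^N plus this one for \<nabla>^N - d^N, see
  \<open>ext_DN_eq\<close>.\<close>

definition flat_ext :: "('k, 'h, 'm::ab_group_add) bcb \<Rightarrow> ('m \<Rightarrow> ('m \<times> 'w \<Rightarrow>\<^sub>0 'k)) \<Rightarrow>
    ('m \<times> 'w \<Rightarrow>\<^sub>0 'k) \<Rightarrow> ('m \<times> 'w \<Rightarrow>\<^sub>0 'k)" where
  "flat_ext M f y = sw (htens H M (F 2)) y (\<lambda>m \<omega>. wl M (f m) \<omega>)"

context
  fixes M :: "('k, 'h, 'm::ab_group_add) bcb"
  assumes M [simp]: "bimodule H M"
begin

lemma flat_ext_props:
  assumes f: "right_linear M (htens H M (F 1)) f"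
  shows klinear_flat_ext: "klinear (htens H M (F 1)) (htens H M (F 2)) (flat_ext M f)"
    and flat_ext_hpure: "m \<in> car M \<Longrightarrow> \<omega> \<in> car (F 1) \<Longrightarrow> flat_ext M f (hpure M (F 1) m \<omega>) = wl M (f m) \<omega>"
proof -
  note [klin] = klinear_comp[OF _ right_linear_klinear[OF f]]
  note [simp] = right_linear_closed[OF f]
  show "klinear (htens H M (F 1)) (htens H M (F 2)) (flat_ext M f)"
    unfolding flat_ext_def[abs_def] by (rule klinear_sw_htens) auto
  show "m \<in> car M \<Longrightarrow> \<omega> \<in> car (F 1) \<Longrightarrow> flat_ext M f (hpure M (F 1) m \<omega>) = wl M (f m) \<omega>"
    unfolding flat_ext_def
    by (rule sw_hpure)
      (auto intro!: bilinI klin klinear_wl(2)[OF M _ klinear_id] simp: right_linear_ract[OF f] wl_balanced)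
qed

context
  fixes D
  assumes D: "D \<in> connections H \<Omega> M"
begin

lemma connection_ext_eq:
  "connection_ext H \<Omega> M D 1 t =
    sw (htens H M (F 2)) t (\<lambda>m \<omega>. wl M (D m) \<omega> + hpure M (F 2) m (dif \<Omega> \<omega>))"
  by (simp add: connection_ext_def wl_def Suc_1_2)

lemma bilin_connection_ext:
  "bilin M (F 1) (htens H M (F 2)) (\<lambda>m \<omega>. wl M (D m) \<omega> + hpure M (F 2) m (dif \<Omega> \<omega>))"
  using klinear_closed[OF connection_klinear[OF D]]
  by (auto intro!: bilinI klin klinear_wl(2)[OF M _ klinear_id] klinear_comp[OF _ connection_klinear[OF D]])

lemma klinear_connection_ext: "klinear (htens H M (F 1)) (htens H M (F 2)) (connection_ext H \<Omega> M D 1)"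
  unfolding connection_ext_eq[abs_def]
  by (rule klinear_sw_htens) (auto intro!: bilin_closed[OF bilin_connection_ext])

text \<open>Balancedness is the Leibniz rule: the term m \<otimes> da \<and> \<omega> that
  \<nabla>(m a) produces is the one that d(a \<omega>) produces on the other side.\<close>

lemma connection_ext_hpure:
  assumes m: "m \<in> car M" and w: "\<omega> \<in> car (F 1)"
  shows "connection_ext H \<Omega> M D 1 (hpure M (F 1) m \<omega>) = wl M (D m) \<omega> + hpure M (F 2) m (dif \<Omega> \<omega>)"
  unfolding connection_ext_eq
proof (rule sw_hpure[OF bilin_connection_ext])
  fix m \<omega> a assume m: "m \<in> car M" and w: "\<omega> \<in> car (F 1)"
  note [simp] = klinear_closed[OF connection_klinear[OF D]]
  have "wl M (D (ract M m a)) \<omega> = wl M (ract (htens H M (F 1)) (D m) a) \<omega> + wl M (hpure M (F 1) m (dd a)) \<omega>"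
    unfolding connection_ract[OF D m] using m w
    by (intro klinear_add[OF klinear_wl(1)[OF M w klinear_id]]) auto
  also have "\<dots> = wl M (D m) (lact (F 1) a \<omega>) + hpure M (F 2) m (dd a * \<omega>)"
    using m w by (simp add: wl_balanced wedge_last_hpure)
  finally have 1: "wl M (D (ract M m a)) \<omega> = wl M (D m) (lact (F 1) a \<omega>) + hpure M (F 2) m (dd a * \<omega>)" .
  have "dif \<Omega> (lact (F 1) a \<omega>) = dd a * \<omega> + lact (F 2) a (dif \<Omega> \<omega>)"
    by (simp add: forms_simps leibniz_emb)
  then have "hpure M (F 2) m (dif \<Omega> (lact (F 1) a \<omega>)) =
      hpure M (F 2) m (dd a * \<omega>) + hpure M (F 2) m (lact (F 2) a (dif \<Omega> \<omega>))"
    using klinear_add[OF klinear_hpure_right[OF M bimodule_forms m klinear_id]] w by simp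
  with 1 show "wl M (D (ract M m a)) \<omega> + hpure M (F 2) (ract M m a) (dif \<Omega> \<omega>) =
    wl M (D m) (lact (F 1) a \<omega>) + hpure M (F 2) m (dif \<Omega> (lact (F 1) a \<omega>))"
    using m w by (simp add: hpure_balanced add.assoc)
qed simp

text \<open>The minus sign is the graded Leibniz rule in degree one, d(\<omega> a) = d\<omega> a -
  \<omega> \<and> da.\<close>

lemma connection_ext_ract:
  assumes y: "y \<in> car (htens H M (F 1))"
  shows "connection_ext H \<Omega> M D 1 (ract (htens H M (F 1)) y a) =
    ract (htens H M (F 2)) (connection_ext H \<Omega> M D 1 y) a - wl M y (dd a)"
proof -
  let ?T = "htens H M (F 2)"
  note [klin] = klinear_comp[OF _ klinear_connection_ext]
  note [simp] = klinear_closed[OF connection_klinear[OF D]]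
  show ?thesis
  proof (rule htens_eqI[OF M _ _ _ y, where Z = ?T and
        f = "\<lambda>y. connection_ext H \<Omega> M D 1 (ract (htens H M (F 1)) y a)"])
    show "klinear (htens H M (F 1)) ?T (\<lambda>y. ract ?T (connection_ext H \<Omega> M D 1 y) a - wl M y (dd a))"
      by (auto intro!: klin)
    fix m \<omega> assume m: "m \<in> car M" and w: "\<omega> \<in> car (F 1)"
    have "dif \<Omega> (ract (F 1) \<omega> a) = ract (F 2) (dif \<Omega> \<omega>) a - \<omega> * dd a"
      using leibniz_1[OF w, of "emb \<Omega> a"] by (simp add: forms_simps)
    then have "connection_ext H \<Omega> M D 1 (hpure M (F 1) m (ract (F 1) \<omega> a)) =
      ract ?T (wl M (D m) \<omega>) a + (hpure M (F 2) m (ract (F 2) (dif \<Omega> \<omega>) a) - hpure M (F 2) m (\<omega> * dd a))"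
      using m w klinear_diff[OF klinear_hpure_right[OF M bimodule_forms[of 2] m klinear_id]]
      by (simp add: connection_ext_hpure wl_ract)
    also have "\<dots> = ract ?T (wl M (D m) \<omega> + hpure M (F 2) m (dif \<Omega> \<omega>)) a - hpure M (F 2) m (\<omega> * dd a)"
      using m w klinear_add[OF klinear_ract[OF bimodule_htens[OF M bimodule_forms[of 2]] klinear_id]] by simp
    finally show "connection_ext H \<Omega> M D 1 (ract (htens H M (F 1)) (hpure M (F 1) m \<omega>) a) =
      ract ?T (connection_ext H \<Omega> M D 1 (hpure M (F 1) m \<omega>)) a - wl M (hpure M (F 1) m \<omega>) (dd a)"
      using m w by (simp add: connection_ext_hpure wedge_last_hpure)
  qed (auto intro!: klin)
qed

text \<open>The extension of \<nabla>(m) a leaves -\<nabla>(m) \<and> da and that of m \<otimes> da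
  leaves \<nabla>(m) \<and> da + m \<otimes> d(da); the first two cancel and the last
  vanishes.\<close>

lemma right_linear_curvature: "right_linear M (htens H M (F 2)) (curvature H \<Omega> M D)"
  unfolding right_linear_def curvature_def comp_def
proof (intro conjI ballI allI)
  show "klinear M (htens H M (F 2)) (\<lambda>x. connection_ext H \<Omega> M D 1 (D x))"
    by (rule klinear_comp[OF connection_klinear[OF D] klinear_connection_ext])
  note [simp] = klinear_closed[OF connection_klinear[OF D]]
  fix m a assume m: "m \<in> car M"
  have "connection_ext H \<Omega> M D 1 (D (ract M m a)) =
    connection_ext H \<Omega> M D 1 (ract (htens H M (F 1)) (D m) a) +
    connection_ext H \<Omega> M D 1 (hpure M (F 1) m (dd a))"
    unfolding connection_ract[OF D m] using m
    by (intro klinear_add[OF klinear_connection_ext]) auto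
  moreover have "hpure M (F 2) m 0 = 0"
    using klinear_zero[OF klinear_hpure_right[OF M bimodule_forms m klinear_id]] by simp
  ultimately show "connection_ext H \<Omega> M D 1 (D (ract M m a)) =
    ract (htens H M (F 2)) (connection_ext H \<Omega> M D 1 (D m)) a"
    using m by (simp add: connection_ext_ract connection_ext_hpure dif_dif)
qed

end

end

section \<open>The canonical connection\<close>

abbreviation "can M \<equiv> canonical_connection H \<Omega> M"

context
  fixes M :: "('k, 'h, 'm::ab_group_add) bcb"
  assumes M [simp]: "cogen M"
begin

lemma klinear_canonical: "klinear M (htens H M (F 1)) (can M)"
  unfolding canonical_connection_def[abs_def] Let_def by (auto intro!: klin)

text \<open>m b_1 S(b_2) \<otimes> db_3 = m \<otimes> db, so d^M differentiates only the
  coefficients with respect to coinvariant generators.\<close>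

lemma canonical_coinv:
  assumes m: "coinv M m"
  shows "can M (ract M m b) = hpure M (F 1) m (dd b)"
proof -
  let ?T = "htens H M (F 1)"
  have "can M (ract M m b) = sw ?T (\<Delta> b) (\<lambda>x h. sw ?T (\<Delta> h) (\<lambda>m1 m2.
      hpure M (F 1) (ract M (ract M m x) (S m1)) (dd m2)))"
    unfolding canonical_connection_def Let_def
    by (rule sw_rco_coinv[OF m]) (use m in \<open>auto intro!: bilinI klin simp del: act_simps\<close>)
  also have "\<dots> = sw ?T (\<Delta> b) (\<lambda>x h. sw ?T (\<Delta> h) (\<lambda>m1 m2. hpure M (F 1) (ract M m (x * S m1)) (dd m2)))"
    using m by simp
  also have "\<dots> = hpure M (F 1) (ract M m 1) (dd b)"
    by (rule sw_cancel(1)) (use m in \<open>auto intro!: bilinI klin simp del: act_simps\<close>)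
  finally show ?thesis using m by simp
qed

lemma hpure_zero_right: "m \<in> car M \<Longrightarrow> hpure M (F k) m 0 = 0"
  using klinear_zero[OF klinear_hpure_right[OF cogen_simps(1)[OF M] bimodule_forms _ klinear_id]]
  by simp

lemma canonical_coinv_1:
  assumes m: "coinv M m"
  shows "can M m = 0"
  using canonical_coinv[OF m, of 1] m by (simp add: hpure_zero_right)

lemma canonical_connection: "can M \<in> connections H \<Omega> M"
proof -
  let ?T = "htens H M (F 1)"
  note [klin] = klinear_comp[OF _ klinear_canonical]
  have "can M (ract M m a) = ract ?T (can M m) a + hpure M (F 1) m (dd a)" if m: "m \<in> car M" for m a
  proof (rule cogen_eqI[OF M _ _ _ _ m, where f = "\<lambda>m. can M (ract M m a)" and Z = ?T])
    fix m b assume m: "coinv M m"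
    have "can M (ract M (ract M m b) a) = hpure M (F 1) m (dd (b * a))"
      using m by (simp add: canonical_coinv)
    also have "\<dots> = hpure M (F 1) m (ract (F 1) (dd b) a) + hpure M (F 1) m (lact (F 1) b (dd a))"
      unfolding dd_mult
      by (rule klinear_add[OF klinear_hpure_right[OF _ _ _ klinear_id]]) (use m in auto)
    finally show "can M (ract M (ract M m b) a) =
      ract ?T (can M (ract M m b)) a + hpure M (F 1) (ract M m b) (dd a)"
      using m by (simp add: canonical_coinv hpure_balanced)
  qed (auto intro!: klin)
  then show ?thesis using klinear_canonical by (simp add: connections_def)
qed

lemma right_linear_connection_diff:
  assumes D: "D \<in> connections H \<Omega> M"
  shows "right_linear M (htens H M (F 1)) (D - can M)"
proof -
  note kD = connection_klinear[OF D] and kc = klinear_canonical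
  have "klinear M (htens H M (F 1)) (\<lambda>x. D x - can M x)" by (intro klinear_minus kD kc) simp
  moreover have "D (ract M m a) - can M (ract M m a) = ract (htens H M (F 1)) (D m - can M m) a"
    if m: "m \<in> car M" for m a
    using klinear_diff[OF klinear_ract[OF bimodule_htens[OF cogen_simps(1)[OF M] bimodule_forms[of 1]] klinear_id],
        of "D m" "can M m" a] klinear_closed[OF kD m] klinear_closed[OF kc m]
    by (simp add: connection_ract[OF D m] connection_ract[OF canonical_connection m])
  ultimately show ?thesis by (simp add: right_linear_def fun_diff_def)
qed

lemma connection_coinv:
  assumes "coinv M m"
  shows "D m = (D - can M) m"
  using canonical_coinv_1[OF assms] by simp

end

section \<open>Left colinearity and representatives on N and its forms\<close>

context
  fixes N :: "('k, 'h, 'n::ab_group_add) bcb"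
  assumes N: "bicov_bimodule H N"
begin

lemma N_simps [simp]: "bicov_bimodule H N" "cogen N" "lcomod (htens H N (F k))" "lcov (htens H N (F k))"
  using N cogen_bicov[OF N] lcomod_htens[OF N bicov_forms] lcov_htens[OF N bicov_forms] by auto

lemma klinear_lco_htens [klin]:
  "klinear W (htens H N (F k)) g \<Longrightarrow>
   klinear W (ktens H (htens H N (F k))) (\<lambda>w. lco (htens H N (F k)) (g w))"
  using lcomod_htens[OF N bicov_forms, of k] by (auto simp: lcomod_def intro: klinear_comp)

lemma sw_lco_hpure:
  assumes n: "n \<in> car N" and w: "\<omega> \<in> car (F k)" and G: "bilin H (htens H N (F k)) Z G" and Z: "vspace Z"
  shows "sw Z (lco (htens H N (F k)) (hpure N (F k) n \<omega>)) G =
    sw Z (lco N n) (\<lambda>n1 n0. sw Z (lco (F k) \<omega>) (\<lambda>\<omega>1 \<omega>0. G (n1 * \<omega>1) (hpure N (F k) n0 \<omega>0)))"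
  using n w by (simp add: lco_htens_hpure sw_sw Z sw_kpure[OF G Z])

text \<open>At n b the left side is n_{-1} b_1 \<otimes> n_0 \<otimes> db_2. The right side has in
  addition n_{-1} b_1 \<otimes> d^N(n_0) b_2, which vanishes because the left coaction preserves
  coinvariance. The single components n_0 of a representative need not be coinvariant, so only the
  whole sum can be shown to vanish.\<close>

lemma canonical_colinear:
  assumes n: "n \<in> car N"
  shows "lco (htens H N (F 1)) (can N n) =
    sw (ktens H (htens H N (F 1))) (lco N n) (\<lambda>n1 n0. kpure H (htens H N (F 1)) n1 (can N n0))"
proof -
  let ?T = "htens H N (F 1)" and ?K = "ktens H (htens H N (F 1))"
  note [klin] = klinear_comp[OF _ klinear_canonical[OF N_simps(2)]]
  note [simp] = klinear_closed[OF klinear_canonical[OF N_simps(2)]]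
  show ?thesis
  proof (rule cogen_eqI[OF _ _ _ _ _ n, where f = "\<lambda>n. lco ?T (can N n)" and Z = ?K])
    show "klinear N ?K (\<lambda>n. lco ?T (can N n))" by (auto intro!: klin)
    show "klinear N ?K (\<lambda>n. sw ?K (lco N n) (\<lambda>n1 n0. kpure H ?T n1 (can N n0)))"
      by (auto intro!: klin)
    fix n b assume n: "coinv N n"
    let ?c = "\<lambda>n1 n0. sw ?K (\<Delta> b) (\<lambda>b1 b2. kpure H ?T (n1 * b1) (hpure N (F 1) n0 (dd b2)))"
    have "lco ?T (can N (ract N n b)) = sw ?K (lco ?T (hpure N (F 1) n (dd b))) (kpure H ?T)"
      using n sw_lco_kpure[of ?T "hpure N (F 1) n (dd b)"] by (simp add: canonical_coinv)
    also have "\<dots> = sw ?K (lco N n) (\<lambda>n1 n0. sw ?K (lco (F 1) (dd b)) (\<lambda>\<omega>1 \<omega>0.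
        kpure H ?T (n1 * \<omega>1) (hpure N (F 1) n0 \<omega>0)))"
      by (rule sw_lco_hpure) (use n in \<open>auto intro!: bilin_kpure\<close>)
    also have "\<dots> = sw ?K (lco N n) ?c"
      by (rule sw_lco_cong, simp, use n in simp, rule sw_lco_dd) (auto intro!: bilinI klin)
    finally have lhs: "lco ?T (can N (ract N n b)) = sw ?K (lco N n) ?c" .
    \<comment> \<open>The summand of d^N, so that d^N(x) is the sum of g(x_0, x_1). It vanishes at h
      = 1 since d 1 = 0, and this is how coinvariance of n is used.\<close>
    define g where "g x h = sw ?T (\<Delta> h) (\<lambda>m1 m2. hpure N (F 1) (ract N x (S m1)) (dd m2))" for x h
    have g [simp]: "x \<in> car N \<Longrightarrow> g x h \<in> car ?T" for x h by (auto simp: g_def)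
    have klg: "klinear N ?T (\<lambda>x. g x h)" "x \<in> car N \<Longrightarrow> klinear H ?T (\<lambda>h. g x h)" for x h
      by (auto simp: g_def intro!: klin)
    note [klin] = klinear_comp[OF _ klg(1)] klinear_comp[OF _ klg(2)]
    define K where "K n1 x h = sw ?K (\<Delta> b) (\<lambda>b1 b2. kpure H ?T (n1 * b1) (ract ?T (g x h) b2))" for n1 x h
    have "g x 1 = hpure N (F 1) (ract N x (S 1)) (dd 1)" if "x \<in> car N" for x
      unfolding g_def by (rule sw_comult_1) (use that in \<open>auto intro!: bilinI klin\<close>)
    then have g1: "g x 1 = 0" if "x \<in> car N" for x
      using that by (simp add: hpure_zero_right)
    have z: "ract ?T 0 b2 = 0" for b2
      using klinear_zero[OF klinear_ract[OF bimodule_htens[OF cogen_simps(1)[OF N_simps(2)]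
          bimodule_forms[of 1]] klinear_id]] by simp
    have z': "kpure H ?T h 0 = 0" for h
      using klinear_zero[OF klinear_kpure_right[OF _ _ _ klinear_id], of H ?T h] by simp
    have K1: "K n1 x 1 = 0" if "x \<in> car N" for n1 x
      using that by (simp add: K_def g1 z z' sw_zero)
    have Kg: "sw ?K (\<Delta> b) (\<lambda>b1 b2. kpure H ?T (n1 * b1) (ract ?T (can N x) b2)) =
        sw ?K (rco N x) (\<lambda>y h. K n1 y h)" if x: "x \<in> car N" for n1 x
    proof -
      have c: "can N x = sw ?T (rco N x) g"
        unfolding canonical_connection_def Let_def g_def[abs_def] ..
      have "klinear ?T ?K (\<lambda>z. sw ?K (\<Delta> b) (\<lambda>b1 b2. kpure H ?T (n1 * b1) (ract ?T z b2)))"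
        by (auto intro!: klin)
      from sw_rco_apply[OF this, of N x g] show ?thesis
        unfolding c K_def using x by simp
    qed
    have "sw ?K (lco N n) (\<lambda>n1 n0. sw ?K (\<Delta> b) (\<lambda>b1 b2. kpure H ?T (n1 * b1) (ract ?T (can N n0) b2))) =
      sw ?K (lco N n) (\<lambda>n1 n0. sw ?K (rco N n0) (\<lambda>y h. K n1 y h))"
      by (rule sw_lco_cong, simp, use n in simp, rule Kg)
    \<comment> \<open>The coactions commute, so the right coaction of n_0 becomes that of the
      coinvariant n itself, which is trivial.\<close>
    also have "\<dots> = sw ?K (rco N n) (\<lambda>y h. sw ?K (lco N y) (\<lambda>n1 n0. K n1 n0 h))"
      by (rule sw_rco_lco[symmetric]) (use n in \<open>auto simp: K_def intro!: klin\<close>)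
    also have "\<dots> = sw ?K (lco N n) (\<lambda>n1 n0. K n1 n0 1)"
      by (rule sw_rco_coinv_1[OF _ n]) (auto simp: K_def intro!: bilinI klin)
    also have "\<dots> = sw ?K (lco N n) (\<lambda>n1 n0. 0)"
      by (rule sw_lco_cong) (use n K1 in auto)
    also have "\<dots> = 0" by (rule sw_zero) simp
    finally have zero: "sw ?K (lco N n) (\<lambda>n1 n0. sw ?K (\<Delta> b) (\<lambda>b1 b2.
      kpure H ?T (n1 * b1) (ract ?T (can N n0) b2))) = 0" .
    have "sw ?K (lco N (ract N n b)) (\<lambda>n1 n0. kpure H ?T n1 (can N n0)) =
      sw ?K (lco N n) (\<lambda>n1 n0. sw ?K (\<Delta> b) (\<lambda>b1 b2. kpure H ?T (n1 * b1) (can N (ract N n0 b2))))"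
      by (rule sw_lco_ract[OF N]) (use n in \<open>auto intro!: bilinI klin\<close>)
    also have "\<dots> = sw ?K (lco N n) (\<lambda>n1 n0. sw ?K (\<Delta> b) (\<lambda>b1 b2.
        kpure H ?T (n1 * b1) (ract ?T (can N n0) b2)) + ?c n1 n0)"
    proof (rule sw_lco_cong)
      fix n1 n0 assume n0: "n0 \<in> car N"
      have "kpure H ?T (n1 * b1) (can N (ract N n0 b2)) = kpure H ?T (n1 * b1) (ract ?T (can N n0) b2) +
        kpure H ?T (n1 * b1) (hpure N (F 1) n0 (dd b2))" for b1 b2
        unfolding connection_ract[OF canonical_connection[OF N_simps(2)] n0]
        by (rule klinear_add[OF klinear_kpure_right[OF _ _ _ klinear_id]]) (use n0 in auto)
      then show "sw ?K (\<Delta> b) (\<lambda>b1 b2. kpure H ?T (n1 * b1) (can N (ract N n0 b2))) =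
        sw ?K (\<Delta> b) (\<lambda>b1 b2. kpure H ?T (n1 * b1) (ract ?T (can N n0) b2)) + ?c n1 n0"
        by (simp add: sw_plus)
    qed (use n in auto)
    also have "\<dots> = sw ?K (lco N n) ?c"
      by (simp add: sw_plus zero)
    finally show "lco ?T (can N (ract N n b)) =
      sw ?K (lco N (ract N n b)) (\<lambda>n1 n0. kpure H ?T n1 (can N n0))"
      using lhs by simp
  qed auto
qed

text \<open>Multiplicativity of the left coaction on forms, carried over to N \<otimes>
  \<Omega>.\<close>

lemma sw_lco_wl:
  assumes y: "y \<in> car (htens H N (F 1))" and e: "\<eta> \<in> car (F 1)"
    and G: "bilin H (htens H N (F 2)) Z G" and Z: "vspace Z"
  shows "sw Z (lco (htens H N (F 2)) (wl N y \<eta>)) G = sw Z (lco (htens H N (F 1)) y) (\<lambda>y1 y0.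
    sw Z (lco (F 1) \<eta>) (\<lambda>\<eta>1 \<eta>0. G (y1 * \<eta>1) (wl N y0 \<eta>0)))"
proof -
  note [klin] = bilin_comp_left[OF G] bilin_comp_right[OF G]
  note [simp] = bilin_closed[OF G] Z
  have B: "bilin H (htens H N (F 1)) Z (\<lambda>y1 y0. sw Z (lco (F 1) \<eta>) (\<lambda>\<eta>1 \<eta>0. G (y1 * \<eta>1) (wl N y0 \<eta>0)))"
    using e by (auto intro!: bilinI klin)
  have B': "bilin H (F 2) Z (\<lambda>h \<omega>. G (n1 * h) (hpure N (F 2) n0 \<omega>))" if "n0 \<in> car N" for n1 n0
    using that by (auto intro!: bilinI klin)
  show ?thesis
  proof (rule htens_eqI[OF _ _ _ _ y, where f = "\<lambda>y. sw Z (lco (htens H N (F 2)) (wl N y \<eta>)) G"])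
    show "klinear (htens H N (F 1)) Z (\<lambda>y. sw Z (lco (htens H N (F 2)) (wl N y \<eta>)) G)"
      "klinear (htens H N (F 1)) Z (\<lambda>y. sw Z (lco (htens H N (F 1)) y) (\<lambda>y1 y0.
        sw Z (lco (F 1) \<eta>) (\<lambda>\<eta>1 \<eta>0. G (y1 * \<eta>1) (wl N y0 \<eta>0))))"
      using e by (auto intro!: klin)
    fix n \<omega> assume n: "n \<in> car N" and w: "\<omega> \<in> car (F 1)"
    have "sw Z (lco (htens H N (F 2)) (wl N (hpure N (F 1) n \<omega>) \<eta>)) G =
      sw Z (lco N n) (\<lambda>n1 n0. sw Z (lco (F 2) (\<omega> * \<eta>)) (\<lambda>h \<omega>0. G (n1 * h) (hpure N (F 2) n0 \<omega>0)))"
      using n w e G by (simp add: wedge_last_hpure sw_lco_hpure)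
    also have "\<dots> = sw Z (lco N n) (\<lambda>n1 n0. sw Z (lco (F 1) \<omega>) (\<lambda>\<omega>1 \<omega>0. sw Z (lco (F 1) \<eta>) (\<lambda>\<eta>1 \<eta>0.
        G (n1 * (\<omega>1 * \<eta>1)) (hpure N (F 2) n0 (\<omega>0 * \<eta>0)))))"
      by (rule sw_lco_cong, simp, rule n, rule sw_lco_mult_1[OF w e]) (auto intro!: B')
    also have "\<dots> = sw Z (lco N n) (\<lambda>n1 n0. sw Z (lco (F 1) \<omega>) (\<lambda>\<omega>1 \<omega>0. sw Z (lco (F 1) \<eta>) (\<lambda>\<eta>1 \<eta>0.
        G (n1 * \<omega>1 * \<eta>1) (wl N (hpure N (F 1) n0 \<omega>0) \<eta>0))))"
      by (intro sw_lco_cong) (use n w e in \<open>auto simp: wedge_last_hpure mult.assoc\<close>)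
    also have "\<dots> = sw Z (lco (htens H N (F 1)) (hpure N (F 1) n \<omega>)) (\<lambda>y1 y0.
        sw Z (lco (F 1) \<eta>) (\<lambda>\<eta>1 \<eta>0. G (y1 * \<eta>1) (wl N y0 \<eta>0)))"
      by (rule sw_lco_hpure[OF n w B Z, symmetric])
    finally show "sw Z (lco (htens H N (F 2)) (wl N (hpure N (F 1) n \<omega>) \<eta>)) G =
      sw Z (lco (htens H N (F 1)) (hpure N (F 1) n \<omega>)) (\<lambda>y1 y0.
        sw Z (lco (F 1) \<eta>) (\<lambda>\<eta>1 \<eta>0. G (y1 * \<eta>1) (wl N y0 \<eta>0)))" .
  qed auto
qed

text \<open>Each ingredient of the extension is left colinear: d^N, the wedge product and d. Hence
  \<open>lrep_gen_1\<close> represents it by a single generator.\<close>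

lemma canonical_ext_colinear:
  assumes y: "y \<in> car (htens H N (F 1))"
  shows "lco (htens H N (F 2)) (connection_ext H \<Omega> N (can N) 1 y) =
    sw (ktens H (htens H N (F 2))) (lco (htens H N (F 1)) y) (\<lambda>y1 y0.
      kpure H (htens H N (F 2)) y1 (connection_ext H \<Omega> N (can N) 1 y0))"
proof -
  let ?T1 = "htens H N (F 1)" and ?T = "htens H N (F 2)" and ?K = "ktens H (htens H N (F 2))"
  let ?D = "connection_ext H \<Omega> N (can N) 1"
  have con: "can N \<in> connections H \<Omega> N" by (rule canonical_connection) simp
  have bN: "bimodule H N" by simp
  note klD = klinear_connection_ext[OF bN con] and klc = klinear_canonical[OF N_simps(2)]
  note [klin] = klinear_comp[OF _ klD] klinear_comp[OF _ klc]
  note [simp] = klinear_closed[OF klD] klinear_closed[OF klc]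
  have BK: "bilin H ?T1 ?K (\<lambda>y1 y0. kpure H ?T y1 (?D y0))" by (auto intro!: bilinI klin)
  show ?thesis
  proof (rule htens_eqI[OF _ _ _ _ y, where f = "\<lambda>y. lco ?T (?D y)"])
    show "klinear ?T1 ?K (\<lambda>y. lco ?T (?D y))"
      "klinear ?T1 ?K (\<lambda>y. sw ?K (lco ?T1 y) (\<lambda>y1 y0. kpure H ?T y1 (?D y0)))"
      by (auto intro!: klin)
    fix n \<eta> assume n: "n \<in> car N" and e: "\<eta> \<in> car (F 1)"
    have "lco ?T (?D (hpure N (F 1) n \<eta>)) = lco ?T (wl N (can N n) \<eta>) + lco ?T (hpure N (F 2) n (dif \<Omega> \<eta>))"
      unfolding connection_ext_hpure[OF bN con n e]
      by (rule klinear_add[OF klinear_lco_htens[OF klinear_id]]) (use n e in auto)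
    also have "lco ?T (wl N (can N n) \<eta>) = sw ?K (lco ?T (wl N (can N n) \<eta>)) (kpure H ?T)"
      using n e by (simp add: sw_lco_kpure)
    also have "\<dots> = sw ?K (lco ?T1 (can N n)) (\<lambda>y1 y0. sw ?K (lco (F 1) \<eta>) (\<lambda>\<eta>1 \<eta>0.
        kpure H ?T (y1 * \<eta>1) (wl N y0 \<eta>0)))"
      by (rule sw_lco_wl) (use n e in \<open>auto intro!: bilin_kpure\<close>)
    also have "\<dots> = sw ?K (lco N n) (\<lambda>n1 n0. sw ?K (lco (F 1) \<eta>) (\<lambda>\<eta>1 \<eta>0.
        kpure H ?T (n1 * \<eta>1) (wl N (can N n0) \<eta>0)))"
    proof -
      have B: "bilin H ?T1 ?K (\<lambda>y1 y0. sw ?K (lco (F 1) \<eta>) (\<lambda>\<eta>1 \<eta>0. kpure H ?T (y1 * \<eta>1) (wl N y0 \<eta>0)))"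
        using e by (auto intro!: bilinI klin)
      show ?thesis
        unfolding canonical_colinear[OF n] by (simp add: sw_sw sw_kpure[OF B])
    qed
    also have "lco ?T (hpure N (F 2) n (dif \<Omega> \<eta>)) = sw ?K (lco ?T (hpure N (F 2) n (dif \<Omega> \<eta>))) (kpure H ?T)"
      using n e by (simp add: sw_lco_kpure)
    also have "\<dots> = sw ?K (lco N n) (\<lambda>n1 n0. sw ?K (lco (F 2) (dif \<Omega> \<eta>)) (\<lambda>\<eta>1 \<eta>0.
        kpure H ?T (n1 * \<eta>1) (hpure N (F 2) n0 \<eta>0)))"
      by (rule sw_lco_hpure) (use n e in \<open>auto intro!: bilin_kpure\<close>)
    also have "\<dots> = sw ?K (lco N n) (\<lambda>n1 n0. sw ?K (lco (F 1) \<eta>) (\<lambda>\<eta>1 \<eta>0.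
        kpure H ?T (n1 * \<eta>1) (hpure N (F 2) n0 (dif \<Omega> \<eta>0))))"
      by (rule sw_lco_cong, simp, rule n, rule sw_lco_dif_1[OF e]) (auto intro!: bilinI klin)
    also have "sw ?K (lco N n) (\<lambda>n1 n0. sw ?K (lco (F 1) \<eta>) (\<lambda>\<eta>1 \<eta>0.
        kpure H ?T (n1 * \<eta>1) (wl N (can N n0) \<eta>0))) + \<dots> =
      sw ?K (lco N n) (\<lambda>n1 n0. sw ?K (lco (F 1) \<eta>) (\<lambda>\<eta>1 \<eta>0.
        kpure H ?T (n1 * \<eta>1) (wl N (can N n0) \<eta>0) + kpure H ?T (n1 * \<eta>1) (hpure N (F 2) n0 (dif \<Omega> \<eta>0))))"
      by (simp add: sw_plus)
    also have "\<dots> = sw ?K (lco N n) (\<lambda>n1 n0. sw ?K (lco (F 1) \<eta>) (\<lambda>\<eta>1 \<eta>0.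
        kpure H ?T (n1 * \<eta>1) (?D (hpure N (F 1) n0 \<eta>0))))"
    proof (intro sw_lco_cong)
      fix n1 n0 \<eta>1 \<eta>0 assume n0: "n0 \<in> car N" and e0: "\<eta>0 \<in> car (F 1)"
      show "kpure H ?T (n1 * \<eta>1) (wl N (can N n0) \<eta>0) + kpure H ?T (n1 * \<eta>1) (hpure N (F 2) n0 (dif \<Omega> \<eta>0)) =
        kpure H ?T (n1 * \<eta>1) (?D (hpure N (F 1) n0 \<eta>0))"
        unfolding connection_ext_hpure[OF bN con n0 e0]
        by (rule klinear_add[OF klinear_kpure_right[OF _ _ _ klinear_id], symmetric])
          (use n0 e0 in auto)
    qed (use n e in auto)
    also have "\<dots> = sw ?K (lco ?T1 (hpure N (F 1) n \<eta>)) (\<lambda>y1 y0. kpure H ?T y1 (?D y0))"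
      by (rule sw_lco_hpure[OF n e BK, symmetric]) simp
    finally show "lco ?T (?D (hpure N (F 1) n \<eta>)) =
      sw ?K (lco ?T1 (hpure N (F 1) n \<eta>)) (\<lambda>y1 y0. kpure H ?T y1 (?D y0))" .
  qed auto
qed

text \<open>\<lambda>^Ad of the extended map is B_{-1} \<otimes> (extension of B_0), component by
  component. The extension of a component f is well defined over H because f is right
  linear.\<close>

lemma flat_ext_lrep:
  assumes B: "right_linear N (htens H N (F 1)) B" and t: "lrep N (htens H N (F 1)) t B"
    and rl: "\<And>h f. (h, f) \<in> Poly_Mapping.keys t \<Longrightarrow> right_linear N (htens H N (F 1)) f"
  shows "lrep (htens H N (F 1)) (htens H N (F 2))
    (sw free_vsp t (\<lambda>h f. gen h (restr (htens H N (F 1)) (flat_ext N f)))) (flat_ext N B)"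
    (is "lrep ?T1 ?T ?t _")
  unfolding lrep_def
proof (intro conjI ballI)
  let ?K = "ktens H (htens H N (F 2))"
  have bN: "bimodule H N" by simp
  note klf = klinear_flat_ext[OF bN]
  note klB = klf[OF B]
  note [klin] = klinear_comp[OF _ klB]
  note [simp] = klinear_closed[OF klB] right_linear_closed[OF B]
  show "?t \<in> tset H (khom ?T1 ?T)"
    by (auto intro!: sw_free_vsp_tset tset_gen restr_khom klf rl)
  have closed: "f n \<in> car ?T1" if "(h, f) \<in> Poly_Mapping.keys t" "n \<in> car N" for h f n
    using right_linear_closed[OF rl[OF that(1)] that(2)] .
  fix y assume y: "y \<in> car ?T1"
  show "lco ?T (flat_ext N B y) = sw ?K ?t (\<lambda>h f. sw ?K (lco ?T1 y) (\<lambda>y1 y0. kpure H ?T (h * y1) (f y0)))"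
  proof (rule htens_eqI[OF _ _ _ _ y, where f = "\<lambda>y. lco ?T (flat_ext N B y)"])
    show "klinear ?T1 ?K (\<lambda>y. lco ?T (flat_ext N B y))" by (auto intro!: klin)
    show "klinear ?T1 ?K (\<lambda>y. sw ?K ?t (\<lambda>h f. sw ?K (lco ?T1 y) (\<lambda>y1 y0. kpure H ?T (h * y1) (f y0))))"
    proof (rule klinear_sw_right[OF _ \<open>?t \<in> tset H (khom ?T1 ?T)\<close>])
      fix h f assume f: "f \<in> car (khom ?T1 ?T)"
      note [klin] = klinear_comp[OF _ khom_klinear[OF f]]
      note [simp] = klinear_closed[OF khom_klinear[OF f]]
      show "klinear ?T1 ?K (\<lambda>y. sw ?K (lco ?T1 y) (\<lambda>y1 y0. kpure H ?T (h * y1) (f y0)))"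
        by (auto intro!: klin)
    qed simp
    fix n \<eta> assume n: "n \<in> car N" and e: "\<eta> \<in> car (F 1)"
    have G: "bilin H ?T1 ?K (\<lambda>y1 y0. sw ?K (lco (F 1) \<eta>) (\<lambda>\<eta>1 \<eta>0. kpure H ?T (y1 * \<eta>1) (wl N y0 \<eta>0)))"
      using e by (auto intro!: bilinI klin)
    have "lco ?T (flat_ext N B (hpure N (F 1) n \<eta>)) = sw ?K (lco ?T (wl N (B n) \<eta>)) (kpure H ?T)"
      using n e by (simp add: flat_ext_hpure[OF bN B] sw_lco_kpure)
    also have "\<dots> = sw ?K (lco ?T1 (B n)) (\<lambda>y1 y0. sw ?K (lco (F 1) \<eta>) (\<lambda>\<eta>1 \<eta>0.
        kpure H ?T (y1 * \<eta>1) (wl N y0 \<eta>0)))"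
      by (rule sw_lco_wl) (use n e in \<open>auto intro!: bilin_kpure\<close>)
    also have "\<dots> = sw ?K t (\<lambda>h f. sw ?K (lco N n) (\<lambda>n1 n0. sw ?K (lco (F 1) \<eta>) (\<lambda>\<eta>1 \<eta>0.
        kpure H ?T (h * n1 * \<eta>1) (wl N (f n0) \<eta>0))))"
      by (rule sw_lrep[OF t n G]) simp
    also have "\<dots> = sw ?K t (\<lambda>h f. sw ?K (lco ?T1 (hpure N (F 1) n \<eta>)) (\<lambda>y1 y0.
        kpure H ?T (h * y1) (restr ?T1 (flat_ext N f) y0)))"
    proof (rule sw_cong)
      fix h f assume hf: "(h, f) \<in> Poly_Mapping.keys t"
      note f = rl[OF hf]
      note [klin] = klinear_comp[OF _ klf[OF f]]
      note [simp] = klinear_closed[OF klf[OF f]] right_linear_closed[OF f]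
      have G': "bilin H ?T1 ?K (\<lambda>y1 y0. kpure H ?T (h * y1) (flat_ext N f y0))"
        by (auto intro!: bilinI klin)
      have "sw ?K (lco ?T1 (hpure N (F 1) n \<eta>)) (\<lambda>y1 y0. kpure H ?T (h * y1) (restr ?T1 (flat_ext N f) y0)) =
        sw ?K (lco ?T1 (hpure N (F 1) n \<eta>)) (\<lambda>y1 y0. kpure H ?T (h * y1) (flat_ext N f y0))"
        by (rule sw_lco_cong) (use n e in auto)
      also have "\<dots> = sw ?K (lco N n) (\<lambda>n1 n0. sw ?K (lco (F 1) \<eta>) (\<lambda>\<eta>1 \<eta>0.
          kpure H ?T (h * (n1 * \<eta>1)) (flat_ext N f (hpure N (F 1) n0 \<eta>0))))"
        by (rule sw_lco_hpure[OF n e G']) simp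
      also have "\<dots> = sw ?K (lco N n) (\<lambda>n1 n0. sw ?K (lco (F 1) \<eta>) (\<lambda>\<eta>1 \<eta>0.
          kpure H ?T (h * n1 * \<eta>1) (wl N (f n0) \<eta>0)))"
        by (intro sw_lco_cong) (use n e in \<open>auto simp: flat_ext_hpure[OF bN f] mult.assoc\<close>)
      finally show "sw ?K (lco N n) (\<lambda>n1 n0. sw ?K (lco (F 1) \<eta>) (\<lambda>\<eta>1 \<eta>0.
          kpure H ?T (h * n1 * \<eta>1) (wl N (f n0) \<eta>0))) =
        sw ?K (lco ?T1 (hpure N (F 1) n \<eta>)) (\<lambda>y1 y0. kpure H ?T (h * y1) (restr ?T1 (flat_ext N f) y0))" ..
    qed
    also have "\<dots> = sw ?K ?t (\<lambda>h f. sw ?K (lco ?T1 (hpure N (F 1) n \<eta>)) (\<lambda>y1 y0. kpure H ?T (h * y1) (f y0)))"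
      by (simp add: sw_sw sw_single)
    finally show "lco ?T (flat_ext N B (hpure N (F 1) n \<eta>)) =
      sw ?K ?t (\<lambda>h f. sw ?K (lco ?T1 (hpure N (F 1) n \<eta>)) (\<lambda>y1 y0. kpure H ?T (h * y1) (f y0)))" .
  qed auto
qed

end

end

section \<open>The curvature of a sum of connections\<close>

text \<open>\<open>tB\<close> is one representative of \<lambda>^Ad(\<nabla>^N - d^N) with right
  linear components. It is fixed once so that the curvature and the addends involving \<nabla>^N -
  d^N are all expressed through the same sum.\<close>

locale connection_pair = bicov_calc H \<Omega>
  for H :: "('k::field, 'h::ring_1) hopf" and \<Omega> :: "('k, 'h, 'w::ring_1) calculus" +
  fixes M :: "('k, 'h, 'm::ab_group_add) bcb" and N :: "('k, 'h, 'n::ab_group_add) bcb"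
    and DM :: "'m \<Rightarrow> ('m \<times> 'w \<Rightarrow>\<^sub>0 'k)" and DN :: "'n \<Rightarrow> ('n \<times> 'w \<Rightarrow>\<^sub>0 'k)"
    and tB :: "'h \<times> ('n \<Rightarrow> ('n \<times> 'w \<Rightarrow>\<^sub>0 'k)) \<Rightarrow>\<^sub>0 'k"
  assumes M [simp]: "bicov_bimodule H M" and N [simp]: "bicov_bimodule H N"
    and fin_N: "fin_gen_right N"
    and DM: "DM \<in> connections H \<Omega> M" and DN: "DN \<in> connections H \<Omega> N"
    and tB: "lrep N (htens H N (F 1)) tB (DN - can N)"
    and tB_right: "\<And>h f. (h, f) \<in> Poly_Mapping.keys tB \<Longrightarrow> right_linear N (htens H N (F 1)) f"
begin

abbreviation "MN \<equiv> htens H M N"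
abbreviation "MF k \<equiv> htens H M (F k)"
abbreviation "NF k \<equiv> htens H N (F k)"
abbreviation "T k \<equiv> htens H MN (F k)"
abbreviation "A \<equiv> DM - can M"
abbreviation "B \<equiv> DN - can N"
abbreviation "\<sigma> k \<equiv> sigma23 H M (F k) N"
abbreviation "\<alpha> k \<equiv> hassoc_inv H M N (F k)"
abbreviation "D \<equiv> connection_sum H \<Omega> M N DM DN"
abbreviation "ext X E \<equiv> connection_ext H \<Omega> X E 1"

lemma setup_simps [simp]:
  "cogen M" "cogen N" "cogen MN" "lcomod (NF k)" "lcov (NF k)" "bimodule H M" "bimodule H N"
  using cogen_bicov cogen_htens[OF M N] lcomod_htens[OF N bicov_forms] lcov_htens[OF N bicov_forms]
  by auto

lemma can_N: "can N \<in> connections H \<Omega> N" and can_M: "can M \<in> connections H \<Omega> M"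
  by (rule canonical_connection, simp)+

lemma A_right: "right_linear M (MF 1) A" and B_right: "right_linear N (NF 1) B"
  by (rule right_linear_connection_diff; simp add: DM DN)+

lemma \<sigma>_right: "right_linear (htens H (MF k) N) (T k) (\<sigma> k)"
  by (rule right_linear_sigma23) auto

lemma \<alpha>_right: "right_linear (htens H M (NF k)) (T k) (\<alpha> k)"
  by (rule right_linear_hassoc_inv) auto

lemmas DM_lin = connection_klinear[OF DM] and DN_lin = connection_klinear[OF DN]
lemmas can_lin = connection_klinear[OF can_N]
lemmas \<sigma>_lin = right_linear_klinear[OF \<sigma>_right] and \<alpha>_lin = right_linear_klinear[OF \<alpha>_right]
lemmas A_lin = right_linear_klinear[OF A_right] and B_lin = right_linear_klinear[OF B_right]

lemmas [klin] = klinear_comp[OF _ DM_lin] klinear_comp[OF _ A_lin] klinear_comp[OF _ \<sigma>_lin]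
  klinear_comp[OF _ \<alpha>_lin] klinear_comp[OF _ B_lin] klinear_comp[OF _ DN_lin] klinear_comp[OF _ can_lin]

lemmas [simp] = klinear_closed[OF DM_lin] klinear_closed[OF \<sigma>_lin] klinear_closed[OF \<alpha>_lin]
  klinear_closed[OF A_lin, unfolded fun_diff_def] klinear_closed[OF A_lin] klinear_closed[OF B_lin]
  klinear_closed[OF DN_lin] klinear_closed[OF can_lin]

lemma tB_closed: "(h, f) \<in> Poly_Mapping.keys tB \<Longrightarrow> n \<in> car N \<Longrightarrow> f n \<in> car (NF 1)"
  using right_linear_closed[OF tB_right] .

text \<open>\<open>tB\<close>, \<open>tN\<close> and \<open>tE\<close> below represent \<open>\<lambda>\<^sup>A\<^sup>d\<close> of \<open>B\<close>, of \<open>\<nabla>\<^sup>N\<close> and of its extension to \<open>N \<otimes>\<^sub>H \<Omega>\<^sup>1\<close>.\<close>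

definition tN :: "'h \<times> ('n \<Rightarrow> ('n \<times> 'w \<Rightarrow>\<^sub>0 'k)) \<Rightarrow>\<^sub>0 'k" where
  "tN = gen 1 (restr N (can N)) + tB"

lemma lrep_can: "lrep N (NF 1) (gen 1 (restr N (can N))) (can N)"
  by (rule lrep_gen_1) (auto simp: can_lin canonical_colinear[OF N])

lemma lrep_tN: "lrep N (NF 1) tN DN"
proof -
  have "lrep N (NF 1) tN (\<lambda>x. can N x + B x)"
    unfolding tN_def by (rule lrep_add[OF _ _ can_lin B_lin lrep_can tB]) auto
  then show ?thesis by simp
qed

lemma hpure_zero: "bimodule H X \<Longrightarrow> bimodule H Y \<Longrightarrow> x \<in> car X \<Longrightarrow> hpure X Y x 0 = 0"
  by (rule klinear_zero[OF klinear_hpure_right[OF _ _ _ klinear_id]]) auto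

text \<open>As in \<open>tsigma_props\<close>, the sum is a \<open>twist\<close>, and its bilinear
  dependence on \<lambda>^Ad(\<nabla>^N) lets the representative \<open>tN\<close> replace
  \<open>ad_left\<close>. Rationality of \<nabla>^N is what counts; a connection is in general not
  right linear.\<close>

lemma sum_props:
  shows D_lin: "klinear MN (T 1) D"
    and D_coinv: "coinv M m \<Longrightarrow> n \<in> car N \<Longrightarrow> D (hpure M N m n) =
      \<sigma> 1 (hpure (MF 1) N (DM m) n) + sw (T 1) tN (\<lambda>g f. \<alpha> 1 (hpure M (NF 1) (ad M g m) (f n)))"
proof -
  let ?T = "T 1" and ?K = "khom N (NF 1)"
  define a where "a = ad_left H N (NF 1) DN"
  have a: "a = nf (krel H ?K) tN" "a \<in> car (ktens H ?K)"
    unfolding a_def using lrep_ad_left[OF _ _ DN_lin lrep_tN] by simp_all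
  have at: "a \<in> tset H ?K" using a(2) ktens_tset[of H ?K] by auto
  have khc [simp]: "f y \<in> car (NF 1)" if "f \<in> car ?K" "y \<in> car N" for f y
    using klinear_closed[OF khom_klinear[OF that(1)] that(2)] .
  define G2 where "G2 m n = sw ?T a (\<lambda>g f. \<alpha> 1 (hpure M (NF 1) (ad M g m) (f n)))" for m n
  define G where "G m n = \<sigma> 1 (hpure (MF 1) N (DM m) n) + G2 m n" for m n
  have klf: "klinear N ?T (\<lambda>n. \<alpha> 1 (hpure M (NF 1) x (f n)))" if f: "f \<in> car ?K" and x: "x \<in> car M" for f x
    using klinear_hpure_right[OF _ _ x khom_klinear[OF f]] by (auto intro!: klin)
  have bG2: "bilin M N ?T G2"
    unfolding G2_def
    by (rule bilinI; rule klinear_sw_right[OF _ at]) (auto intro!: klin klf intro: khom_klinear)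
  note [klin] = bilin_comp_left[OF bG2] bilin_comp_right[OF bG2]
  note [simp] = bilin_closed[OF bG2]
  have bG: "bilin M N ?T G" unfolding G_def by (auto intro!: bilinI klin)
  have G2_ad: "G2 m n = sw ?T a (\<lambda>g f. sw ?T (\<Delta> g) (\<lambda>p q.
      \<alpha> 1 (hpure M (NF 1) (ract M (lact M p m) (S q)) (f n))))" if m: "m \<in> car M" and n: "n \<in> car N" for m n
    unfolding G2_def ad_def
  proof (rule sw_tset_cong[OF at])
    fix g f assume f: "f \<in> car ?K"
    have "\<alpha> 1 (hpure M (NF 1) (sw M (\<Delta> g) (\<lambda>p q. lact M p (ract M m (S q)))) (f n)) =
      sw ?T (\<Delta> g) (\<lambda>p q. \<alpha> 1 (hpure M (NF 1) (lact M p (ract M m (S q))) (f n)))"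
      by (rule sw_comult_apply[where Z = M and L = "\<lambda>x. \<alpha> 1 (hpure M (NF 1) x (f n))"])
        (use m n f in \<open>auto intro!: klin\<close>)
    then show "\<alpha> 1 (hpure M (NF 1) (sw M (\<Delta> g) (\<lambda>p q. lact M p (ract M m (S q)))) (f n)) =
      sw ?T (\<Delta> g) (\<lambda>p q. \<alpha> 1 (hpure M (NF 1) (ract M (lact M p m) (S q)) (f n)))"
      using m by simp
  qed
  have eq: "D s = sw ?T s (twist ?T M N G)" if s: "s \<in> car MN" for s
    unfolding connection_sum_def Let_def
  proof (rule sw_tset_cong)
    show "s \<in> tset M N" using s htens_tset[of M N] by auto
    fix m n assume m: "m \<in> car M" and n: "n \<in> car N"
    \<comment> \<open>S(q m_1) = S(m_1) S(q): the antipode of a product in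
      \<open>connection_sum\<close> hides the right half of the adjoint action, applied to m_0
      S(m_1).\<close>
    have "sw ?T (rco M m) (\<lambda>m0 h. sw ?T (\<Delta> h) (\<lambda>m1 m2. G2 (ract M m0 (S m1)) (lact N m2 n))) =
      sw ?T (rco M m) (\<lambda>m0 h. sw ?T (\<Delta> h) (\<lambda>m1 m2. sw ?T a (\<lambda>g f. sw ?T (\<Delta> g) (\<lambda>p q.
        \<alpha> 1 (hpure M (NF 1) (ract M (lact M p m0) (S (q * m1))) (f (lact N m2 n)))))))"
      by (rule sw_rco_cong, simp, rule m) (use n in \<open>simp add: G2_ad antip_mult\<close>)
    also have "\<dots> = sw ?T a (\<lambda>g f. sw ?T (\<Delta> g) (\<lambda>p q. sw ?T (rco M m) (\<lambda>m0 h. sw ?T (\<Delta> h) (\<lambda>m1 m2.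
        \<alpha> 1 (hpure M (NF 1) (ract M (lact M p m0) (S (q * m1))) (f (lact N m2 n)))))))"
      by (rule sw_swap_block) simp
    finally show "sw ?T (rco M m) (\<lambda>m0 h. sw ?T (\<Delta> h) (\<lambda>m1 m2.
          \<sigma> 1 (hpure (MF 1) N (DM (ract M m0 (S m1))) (lact N m2 n)))) +
        sw ?T (ad_left H N (NF 1) DN) (\<lambda>g f. sw ?T (\<Delta> g) (\<lambda>p q. sw ?T (rco M m) (\<lambda>m0 h. sw ?T (\<Delta> h) (\<lambda>m1 m2.
        \<alpha> 1 (hpure M (NF 1) (ract M (lact M p m0) (S (q * m1))) (f (lact N m2 n))))))) =
      twist ?T M N G m n"
      unfolding a_def[symmetric] twist_def G_def by (simp add: sw_plus)
  qed
  have "klinear MN ?T (\<lambda>s. sw ?T s (twist ?T M N G))"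
    by (rule klinear_sw_htens) (use bilin_closed[OF bilin_twist[OF _ _ _ bG]] in auto)
  then show "klinear MN ?T D"
    by (rule klinear_cong) (auto simp: eq)
  assume m: "coinv M m" and n: "n \<in> car N"
  then have "D (hpure M N m n) = G m n"
    using sw_twist_coinv[OF _ _ _ bG m n] by (simp add: eq)
  moreover have "G2 m n = sw ?T tN (\<lambda>g f. \<alpha> 1 (hpure M (NF 1) (ad M g m) (f n)))"
    unfolding G2_def a(1)
    by (rule sw_nf_krel) (use m n in \<open>auto intro!: bilinI klin\<close>)
  ultimately show "D (hpure M N m n) =
      \<sigma> 1 (hpure (MF 1) N (DM m) n) + sw ?T tN (\<lambda>g f. \<alpha> 1 (hpure M (NF 1) (ad M g m) (f n)))"
    by (simp add: G_def)
qed

lemma D_coinv_left: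
  assumes m: "coinv M m" and n: "n \<in> car N"
  shows "D (hpure M N m n) = \<sigma> 1 (hpure (MF 1) N (A m) n) + \<alpha> 1 (hpure M (NF 1) m (can N n)) +
    sw (T 1) tB (\<lambda>g f. \<alpha> 1 (hpure M (NF 1) (ad M g m) (f n)))"
  using D_coinv[OF m n] m n canonical_coinv_1[of M m]
  by (simp add: tN_def sw_add sw_single ad_1 add.assoc)

lemma D_coinv_both:
  assumes m: "coinv M m" and n: "coinv N n"
  shows "D (hpure M N m n) = \<sigma> 1 (hpure (MF 1) N (A m) n) +
    sw (T 1) tB (\<lambda>g f. \<alpha> 1 (hpure M (NF 1) (ad M g m) (f n)))"
  using D_coinv_left[OF m, of n] n m canonical_coinv_1[of N n]
    klinear_zero[OF \<alpha>_lin[of 1]] hpure_zero[of M "NF 1" m] by simp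

text \<open>In \<open>D_coinv_left\<close> the terms with A and with \<open>tB\<close> are right
  linear in n. The remaining one is d^N in the second factor, and its Leibniz rule supplies m
  \<otimes> n \<otimes> da.\<close>

lemma D_connection: "D \<in> connections H \<Omega> MN"
proof -
  note [klin] = klinear_comp[OF _ D_lin]
  have "D (ract MN t a) = ract (T 1) (D t) a + hpure MN (F 1) t (dd a)" if t: "t \<in> car MN" for t a
  proof (rule htens_eqI_left[OF _ _ _ _ _ t, where f = "\<lambda>t. D (ract MN t a)" and Z = "T 1"])
    fix m n assume m: "coinv M m" and n: "n \<in> car N"
    note kr = klinear_ract[OF bimodule_htens[OF bimodule_htens[OF setup_simps(6,7)] bimodule_forms[of 1]]
        klinear_id, of a]
    let ?U = "sw (T 1) tB (\<lambda>g f. \<alpha> 1 (hpure M (NF 1) (ad M g m) (f n)))"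
    have U: "?U \<in> car (T 1)"
      by (rule sw_closed) (use m n tB_closed in auto)
    have "\<sigma> 1 (hpure (MF 1) N (A m) (ract N n a)) = ract (T 1) (\<sigma> 1 (hpure (MF 1) N (A m) n)) a"
      using m n right_linear_ract[OF \<sigma>_right, of "hpure (MF 1) N (A m) n" 1 a] by simp
    moreover have "\<alpha> 1 (hpure M (NF 1) m (can N (ract N n a))) =
      ract (T 1) (\<alpha> 1 (hpure M (NF 1) m (can N n))) a + hpure MN (F 1) (hpure M N m n) (dd a)"
    proof -
      have "klinear (NF 1) (T 1) (\<lambda>y. \<alpha> 1 (hpure M (NF 1) m y))" using m by (auto intro!: klin)
      from klinear_add[OF this, of "ract (NF 1) (can N n) a" "hpure N (F 1) n (dd a)"] show ?thesis
        using m n right_linear_ract[OF \<alpha>_right, of "hpure M (NF 1) m (can N n)" 1 a]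
        by (simp add: connection_ract[OF can_N n] hassoc_inv_hpure)
    qed
    moreover have "sw (T 1) tB (\<lambda>g f. \<alpha> 1 (hpure M (NF 1) (ad M g m) (f (ract N n a)))) = ract (T 1) ?U a"
    proof -
      have "ract (T 1) ?U a = sw (T 1) tB (\<lambda>g f. ract (T 1) (\<alpha> 1 (hpure M (NF 1) (ad M g m) (f n))) a)"
        by (rule klinear_sw_apply[OF kr]) (use m n tB_closed in auto)
      also have "\<dots> = sw (T 1) tB (\<lambda>g f. \<alpha> 1 (hpure M (NF 1) (ad M g m) (f (ract N n a))))"
      proof (rule sw_cong)
        fix g f assume gf: "(g, f) \<in> Poly_Mapping.keys tB"
        show "ract (T 1) (\<alpha> 1 (hpure M (NF 1) (ad M g m) (f n))) a =
          \<alpha> 1 (hpure M (NF 1) (ad M g m) (f (ract N n a)))"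
          using m n tB_closed[OF gf n] right_linear_ract[OF tB_right[OF gf] n, of a]
            right_linear_ract[OF \<alpha>_right, of "hpure M (NF 1) (ad M g m) (f n)" 1 a] by simp
      qed
      finally show ?thesis ..
    qed
    ultimately show "D (ract MN (hpure M N m n) a) =
      ract (T 1) (D (hpure M N m n)) a + hpure MN (F 1) (hpure M N m n) (dd a)"
      using m n U by (simp add: D_coinv_left klinear_add[OF kr] vspace_add algebra_simps)
  qed (auto intro!: klin)
  then show ?thesis using D_lin by (simp add: connections_def)
qed

text \<open>A hexagon-type compatibility of the braiding with the product of forms: the coaction of
  \<eta> \<and> \<omega> begins with \<eta>_{-1} \<omega>_{-1}, so n passes first \<omega> and then
  the one-form contained in z.\<close>

lemma sigma_wl:
  assumes z: "z \<in> car (MF 1)" and w: "\<omega> \<in> car (F 1)" and n: "coinv N n"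
  shows "\<sigma> 2 (hpure (MF 2) N (wl M z \<omega>) n) = sw (T 2) (lco (F 1) \<omega>) (\<lambda>g \<omega>0.
    wl MN (\<sigma> 1 (hpure (MF 1) N z (ad N g n))) \<omega>0)"
proof (rule htens_eqI[OF _ _ _ _ z, where f = "\<lambda>z. \<sigma> 2 (hpure (MF 2) N (wl M z \<omega>) n)" and Z = "T 2"])
  show "klinear (MF 1) (T 2) (\<lambda>z. \<sigma> 2 (hpure (MF 2) N (wl M z \<omega>) n))"
    using w n by (auto intro!: klin)
  show "klinear (MF 1) (T 2) (\<lambda>z. sw (T 2) (lco (F 1) \<omega>) (\<lambda>g \<omega>0.
    wl MN (\<sigma> 1 (hpure (MF 1) N z (ad N g n))) \<omega>0))"
    using w n by (auto intro!: klin)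
  fix m \<eta> assume m: "m \<in> car M" and e: "\<eta> \<in> car (F 1)"
  have "\<sigma> 2 (hpure (MF 2) N (wl M (hpure M (F 1) m \<eta>) \<omega>) n) =
    sw (T 2) (lco (F 2) (\<eta> * \<omega>)) (\<lambda>g \<omega>0. hpure MN (F 2) (hpure M N m (ad N g n)) \<omega>0)"
    using m e w n by (simp add: wedge_last_hpure sigma23_coinv_1)
  also have "\<dots> = sw (T 2) (lco (F 1) \<eta>) (\<lambda>h \<eta>0. sw (T 2) (lco (F 1) \<omega>) (\<lambda>g \<omega>0.
      hpure MN (F 2) (hpure M N m (ad N (h * g) n)) (\<eta>0 * \<omega>0)))"
    by (rule sw_lco_mult_1[OF e w]) (use m n in \<open>auto intro!: bilinI klin klinear_hpure_right[OF _ _ _ klinear_id]\<close>)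
  also have "\<dots> = sw (T 2) (lco (F 1) \<omega>) (\<lambda>g \<omega>0. sw (T 2) (lco (F 1) \<eta>) (\<lambda>h \<eta>0.
      hpure MN (F 2) (hpure M N m (ad N (h * g) n)) (\<eta>0 * \<omega>0)))"
    by (rule sw_swap) simp
  also have "\<dots> = sw (T 2) (lco (F 1) \<omega>) (\<lambda>g \<omega>0.
      wl MN (\<sigma> 1 (hpure (MF 1) N (hpure M (F 1) m \<eta>) (ad N g n))) \<omega>0)"
  proof (rule sw_lco_cong)
    fix g \<omega>0 assume w0: "\<omega>0 \<in> car (F 1)"
    have "wl MN (\<sigma> 1 (hpure (MF 1) N (hpure M (F 1) m \<eta>) (ad N g n))) \<omega>0 =
      wl MN (sw (T 1) (lco (F 1) \<eta>) (\<lambda>h \<eta>0. hpure MN (F 1) (hpure M N m (ad N h (ad N g n))) \<eta>0)) \<omega>0"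
      using m e n coinv_ad[OF N n] by (simp add: sigma23_coinv_1)
    also have "\<dots> = sw (T 2) (lco (F 1) \<eta>) (\<lambda>h \<eta>0.
        wl MN (hpure MN (F 1) (hpure M N m (ad N h (ad N g n))) \<eta>0) \<omega>0)"
      by (rule sw_lco_apply[where Z = "T 1" and L = "\<lambda>y. wl MN y \<omega>0"])
        (use m n e w0 in \<open>auto intro!: klin\<close>)
    also have "\<dots> = sw (T 2) (lco (F 1) \<eta>) (\<lambda>h \<eta>0.
        hpure MN (F 2) (hpure M N m (ad N (h * g) n)) (\<eta>0 * \<omega>0))"
      by (rule sw_lco_cong) (use m n e w0 in \<open>auto simp: wedge_last_hpure ad_mult\<close>)
    finally show "sw (T 2) (lco (F 1) \<eta>) (\<lambda>h \<eta>0.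
        hpure MN (F 2) (hpure M N m (ad N (h * g) n)) (\<eta>0 * \<omega>0)) =
      wl MN (\<sigma> 1 (hpure (MF 1) N (hpure M (F 1) m \<eta>) (ad N g n))) \<omega>0" ..
  qed (use w in auto)
  finally show "\<sigma> 2 (hpure (MF 2) N (wl M (hpure M (F 1) m \<eta>) \<omega>) n) =
    sw (T 2) (lco (F 1) \<omega>) (\<lambda>g \<omega>0. wl MN (\<sigma> 1 (hpure (MF 1) N (hpure M (F 1) m \<eta>) (ad N g n))) \<omega>0)" .
qed auto

lemma assoc_wl:
  assumes x: "x \<in> car M" and z: "z \<in> car (NF 1)" and e: "\<eta> \<in> car (F 1)"
  shows "\<alpha> 2 (hpure M (NF 2) x (wl N z \<eta>)) = wl MN (\<alpha> 1 (hpure M (NF 1) x z)) \<eta>"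
  by (rule htens_eqI[OF _ _ _ _ z, where f = "\<lambda>z. \<alpha> 2 (hpure M (NF 2) x (wl N z \<eta>))" and Z = "T 2"])
    (use x e in \<open>auto intro!: klin simp: wedge_last_hpure hassoc_inv_hpure\<close>)

text \<open>The wedge and braiding that follow A \<otimes>_\<sigma> B in the addend with both
  differences.\<close>

definition W3 :: "(('m \<times> 'w \<Rightarrow>\<^sub>0 'k) \<times> ('n \<times> 'w \<Rightarrow>\<^sub>0 'k) \<Rightarrow>\<^sub>0 'k) \<Rightarrow> (('m \<times> 'n \<Rightarrow>\<^sub>0 'k) \<times> 'w \<Rightarrow>\<^sub>0 'k)" where
  "W3 = wedge_last H \<Omega> MN 1 1 \<circ> (hmap H (T 1) (F 1) (\<sigma> 1) id \<circ> hassoc_inv H (MF 1) N (F 1))"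

text \<open>The maps that follow \<sigma>_23 in the last addend. On m \<otimes> n \<otimes> \<eta>
  this is the wedge product of (id \<otimes>_\<sigma> B)(m \<otimes> n) with \<eta>.\<close>

definition W4 :: "(('m \<times> 'n \<Rightarrow>\<^sub>0 'k) \<times> 'w \<Rightarrow>\<^sub>0 'k) \<Rightarrow> (('m \<times> 'n \<Rightarrow>\<^sub>0 'k) \<times> 'w \<Rightarrow>\<^sub>0 'k)" where
  "W4 = wedge_last H \<Omega> MN 1 1 \<circ> hmap H (T 1) (F 1) (\<alpha> 1) id \<circ>
     tsigma H MN (F 1) (htens H M (NF 1)) (F 1) (tsigma H M N M (NF 1) id B) id"

lemma W3_right: "right_linear (htens H (MF 1) (NF 1)) (T 2) W3"
  unfolding W3_def
  by (rule right_linear_comp[OF right_linear_comp[OF right_linear_hassoc_inv right_linear_hmap]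
      right_linear_wedge_last])
    (auto intro!: \<sigma>_right left_linear_id right_linear_id)

lemma idB_right: "right_linear MN (htens H M (NF 1)) (tsigma H M N M (NF 1) id B)"
  by (rule right_linear_tsigma[OF _ _ _ _ right_linear_id B_lin tB tB_right]) auto

lemma W4_right: "right_linear (T 1) (T 2) W4"
  unfolding W4_def comp_assoc
  by (rule right_linear_comp[OF right_linear_comp[OF right_linear_tsigma_id right_linear_hmap]
      right_linear_wedge_last])
    (auto intro!: \<alpha>_right left_linear_id right_linear_id idB_right)

lemma W3_hpure:
  assumes "y \<in> car (MF 1)" "n \<in> car N" "\<eta> \<in> car (F 1)"
  shows "W3 (hpure (MF 1) (NF 1) y (hpure N (F 1) n \<eta>)) = wl MN (\<sigma> 1 (hpure (MF 1) N y n)) \<eta>"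
  using assms by (simp add: W3_def hassoc_inv_hpure hmap_hpure[OF _ _ _ _ \<sigma>_right left_linear_id] wl_def)

lemma W4_hpure:
  assumes m: "coinv M m" and n: "coinv N n" and e: "\<eta> \<in> car (F 1)"
  shows "W4 (hpure MN (F 1) (hpure M N m n) \<eta>) =
    wl MN (sw (T 1) tB (\<lambda>h f. \<alpha> 1 (hpure M (NF 1) (ad M h m) (f n)))) \<eta>"
proof -
  let ?\<phi> = "tsigma H M N M (NF 1) id B"
  have "?\<phi> (hpure M N m n) = sw (htens H M (NF 1)) tB (\<lambda>h f. hpure M (NF 1) (id (ad M h m)) (f n))"
    by (rule tsigma_coinv[OF _ _ _ _ right_linear_id B_lin tB m]) (use n in auto)
  then have "\<alpha> 1 (?\<phi> (hpure M N m n)) = \<alpha> 1 (sw (htens H M (NF 1)) tB (\<lambda>h f. hpure M (NF 1) (ad M h m) (f n)))"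
    by simp
  also have "\<dots> = sw (T 1) tB (\<lambda>h f. \<alpha> 1 (hpure M (NF 1) (ad M h m) (f n)))"
    by (rule klinear_sw_apply[OF \<alpha>_lin]) (use m n tB_closed in auto)
  finally have 1: "\<alpha> 1 (?\<phi> (hpure M N m n)) = sw (T 1) tB (\<lambda>h f. \<alpha> 1 (hpure M (NF 1) (ad M h m) (f n)))" .
  have "tsigma H MN (F 1) (htens H M (NF 1)) (F 1) ?\<phi> id (hpure MN (F 1) (hpure M N m n) \<eta>) =
    hpure (htens H M (NF 1)) (F 1) (?\<phi> (hpure M N m n)) \<eta>"
    by (rule tsigma_id[OF _ _ _ idB_right coinv_hpure[OF M N m n] e]) auto
  then show ?thesis
    using m n e right_linear_closed[OF idB_right, of "hpure M N m n"]
    by (simp add: W4_def hmap_hpure[OF _ _ _ _ \<alpha>_right left_linear_id] wl_def 1)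
qed

section \<open>The extension of the sum, applied to its two terms\<close>

lemmas [klin] = klinear_comp[OF _ right_linear_klinear[OF W3_right]]
  klinear_comp[OF _ right_linear_klinear[OF W4_right]]
  klinear_comp[OF _ klinear_connection_ext[OF bimodule_htens[OF setup_simps(6,7)] D_connection]]
  klinear_comp[OF _ klinear_connection_ext[OF setup_simps(6) DM]]
  klinear_comp[OF _ klinear_connection_ext[OF setup_simps(7) can_N]]

lemmas ext_D = connection_ext_hpure[OF bimodule_htens[OF setup_simps(6,7)] D_connection]
lemmas ext_D_lin = klinear_connection_ext[OF bimodule_htens[OF setup_simps(6,7)] D_connection]
lemmas ext_can_lin = klinear_connection_ext[OF setup_simps(7) can_N]

lemmas [simp] = klinear_closed[OF D_lin] klinear_closed[OF ext_D_lin] klinear_closed[OF klinear_connection_ext[OF setup_simps(6) DM]]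
  klinear_closed[OF ext_can_lin] right_linear_closed[OF W3_right] right_linear_closed[OF W4_right]

lemma tB_sum_closed:
  "coinv M m \<Longrightarrow> n \<in> car N \<Longrightarrow> sw (T 1) tB (\<lambda>h f. \<alpha> 1 (hpure M (NF 1) (ad M h m) (f n))) \<in> car (T 1)"
  by (rule sw_closed) (use tB_closed in auto)

lemma ext_D_coinv:
  assumes m: "coinv M m" and n: "coinv N n" and e: "\<eta> \<in> car (F 1)"
  shows "ext MN D (hpure MN (F 1) (hpure M N m n) \<eta>) = wl MN (\<sigma> 1 (hpure (MF 1) N (A m) n)) \<eta> +
    wl MN (sw (T 1) tB (\<lambda>h f. \<alpha> 1 (hpure M (NF 1) (ad M h m) (f n)))) \<eta> +
    hpure MN (F 2) (hpure M N m n) (dif \<Omega> \<eta>)"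
  using m n e tB_sum_closed[OF m, of n]
    klinear_add[OF klinear_wl(1)[OF bimodule_htens[OF setup_simps(6,7)] e klinear_id]]
  by (simp add: ext_D D_coinv_both del: fun_diff_def minus_apply)

text \<open>It suffices to take z = m \<otimes> \<omega> with m coinvariant, where \<nabla>^M(m) =
  A(m). The braiding gives m \<otimes> (\<omega>_{-1} \<triangleright> n) \<otimes> \<omega>_0, to
  which \<open>ext_D_coinv\<close> applies. Its A-term recombines by \<open>sigma_wl\<close> and its
  d-term by colinearity of d; together they are the braided extension of \<nabla>^M. Its B-term is
  \<open>W4\<close>.\<close>

lemma ext_D_sigma:
  assumes z: "z \<in> car (MF 1)" and n: "coinv N n"
  shows "ext MN D (\<sigma> 1 (hpure (MF 1) N z n)) =
    \<sigma> 2 (hpure (MF 2) N (ext M DM z) n) + W4 (\<sigma> 1 (hpure (MF 1) N z n))"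
proof (rule htens_eqI_left[OF _ _ _ _ _ z, where f = "\<lambda>z. ext MN D (\<sigma> 1 (hpure (MF 1) N z n))" and Z = "T 2"])
  show "klinear (MF 1) (T 2) (\<lambda>z. ext MN D (\<sigma> 1 (hpure (MF 1) N z n)))"
    "klinear (MF 1) (T 2) (\<lambda>z. \<sigma> 2 (hpure (MF 2) N (ext M DM z) n) + W4 (\<sigma> 1 (hpure (MF 1) N z n)))"
    using n by (auto intro!: klin)
  fix m \<omega> assume m: "coinv M m" and w: "\<omega> \<in> car (F 1)"
  let ?s = "\<lambda>n. sw (T 1) tB (\<lambda>h f. \<alpha> 1 (hpure M (NF 1) (ad M h m) (f n)))"
  have s: "\<sigma> 1 (hpure (MF 1) N (hpure M (F 1) m \<omega>) n) =
    sw (T 1) (lco (F 1) \<omega>) (\<lambda>g \<omega>0. hpure MN (F 1) (hpure M N m (ad N g n)) \<omega>0)"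
    using m w n by (simp add: sigma23_coinv_1)
  note adn = coinv_ad[OF N n]
  have "ext MN D (\<sigma> 1 (hpure (MF 1) N (hpure M (F 1) m \<omega>) n)) =
    sw (T 2) (lco (F 1) \<omega>) (\<lambda>g \<omega>0. ext MN D (hpure MN (F 1) (hpure M N m (ad N g n)) \<omega>0))"
    unfolding s by (rule sw_lco_apply[OF ext_D_lin]) (use m w n in auto)
  also have "\<dots> = sw (T 2) (lco (F 1) \<omega>) (\<lambda>g \<omega>0. wl MN (\<sigma> 1 (hpure (MF 1) N (A m) (ad N g n))) \<omega>0 +
      wl MN (?s (ad N g n)) \<omega>0 + hpure MN (F 2) (hpure M N m (ad N g n)) (dif \<Omega> \<omega>0))"
    by (rule sw_lco_cong[OF _ w]) (simp, rule ext_D_coinv[OF m adn])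
  also have "\<dots> = sw (T 2) (lco (F 1) \<omega>) (\<lambda>g \<omega>0. wl MN (\<sigma> 1 (hpure (MF 1) N (A m) (ad N g n))) \<omega>0) +
      sw (T 2) (lco (F 1) \<omega>) (\<lambda>g \<omega>0. wl MN (?s (ad N g n)) \<omega>0) +
      sw (T 2) (lco (F 1) \<omega>) (\<lambda>g \<omega>0. hpure MN (F 2) (hpure M N m (ad N g n)) (dif \<Omega> \<omega>0))"
    by (simp add: sw_plus)
  also have "sw (T 2) (lco (F 1) \<omega>) (\<lambda>g \<omega>0. wl MN (\<sigma> 1 (hpure (MF 1) N (A m) (ad N g n))) \<omega>0) =
      \<sigma> 2 (hpure (MF 2) N (wl M (A m) \<omega>) n)"
    by (rule sigma_wl[OF _ w n, symmetric]) (use m in simp)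
  also have "sw (T 2) (lco (F 1) \<omega>) (\<lambda>g \<omega>0. wl MN (?s (ad N g n)) \<omega>0) =
      W4 (\<sigma> 1 (hpure (MF 1) N (hpure M (F 1) m \<omega>) n))"
  proof -
    have "W4 (\<sigma> 1 (hpure (MF 1) N (hpure M (F 1) m \<omega>) n)) =
      sw (T 2) (lco (F 1) \<omega>) (\<lambda>g \<omega>0. W4 (hpure MN (F 1) (hpure M N m (ad N g n)) \<omega>0))"
      unfolding s by (rule sw_lco_apply[OF right_linear_klinear[OF W4_right]]) (use m w n in auto)
    also have "\<dots> = sw (T 2) (lco (F 1) \<omega>) (\<lambda>g \<omega>0. wl MN (?s (ad N g n)) \<omega>0)"
      by (rule sw_lco_cong[OF _ w]) (simp, rule W4_hpure[OF m adn])
    finally show ?thesis ..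
  qed
  also have "sw (T 2) (lco (F 1) \<omega>) (\<lambda>g \<omega>0. hpure MN (F 2) (hpure M N m (ad N g n)) (dif \<Omega> \<omega>0)) =
      sw (T 2) (lco (F 2) (dif \<Omega> \<omega>)) (\<lambda>g \<omega>0. hpure MN (F 2) (hpure M N m (ad N g n)) \<omega>0)"
    by (rule sw_lco_dif_1[OF w, symmetric])
      (use m n in \<open>auto intro!: bilinI klin klinear_hpure_right[OF _ _ _ klinear_id]\<close>)
  also have "\<dots> = \<sigma> 2 (hpure (MF 2) N (hpure M (F 2) m (dif \<Omega> \<omega>)) n)"
    by (rule sigma23_coinv_1[symmetric]) (use m n w in auto)
  finally have "ext MN D (\<sigma> 1 (hpure (MF 1) N (hpure M (F 1) m \<omega>) n)) =
    \<sigma> 2 (hpure (MF 2) N (wl M (A m) \<omega>) n) + W4 (\<sigma> 1 (hpure (MF 1) N (hpure M (F 1) m \<omega>) n)) +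
    \<sigma> 2 (hpure (MF 2) N (hpure M (F 2) m (dif \<Omega> \<omega>)) n)" .
  moreover have "ext M DM (hpure M (F 1) m \<omega>) = wl M (A m) \<omega> + hpure M (F 2) m (dif \<Omega> \<omega>)"
    using m w connection_coinv[of M m DM] by (simp add: connection_ext_hpure[OF setup_simps(6) DM] del: minus_apply)
  moreover have "klinear (MF 2) (T 2) (\<lambda>z. \<sigma> 2 (hpure (MF 2) N z n))"
    using n by (auto intro!: klin)
  ultimately show "ext MN D (\<sigma> 1 (hpure (MF 1) N (hpure M (F 1) m \<omega>) n)) =
    \<sigma> 2 (hpure (MF 2) N (ext M DM (hpure M (F 1) m \<omega>)) n) +
    W4 (\<sigma> 1 (hpure (MF 1) N (hpure M (F 1) m \<omega>) n))"
    using m w klinear_add[of "MF 2" "T 2" "\<lambda>z. \<sigma> 2 (hpure (MF 2) N z n)"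
        "wl M (A m) \<omega>" "hpure M (F 2) m (dif \<Omega> \<omega>)"]
    by (simp add: add.assoc add.commute del: minus_apply)
qed auto

lemma flat_closed: "(h, f) \<in> Poly_Mapping.keys tB \<Longrightarrow> y \<in> car (NF 1) \<Longrightarrow> flat_ext N f y \<in> car (NF 2)"
  using klinear_closed[OF klinear_flat_ext[OF setup_simps(7) tB_right]] .

text \<open>Stated for arbitrary y because it is applied to the values f(n) of components of B. At y
  = n \<otimes> \<eta> with n coinvariant d^N(n) = 0, so the extension of d^N is n \<otimes>
  d\<eta>, and \<open>assoc_wl\<close> moves the wedge into the sum over \<open>tB\<close>.\<close>

lemma ext_D_assoc:
  assumes m: "coinv M m" and y: "y \<in> car (NF 1)"
  shows "ext MN D (\<alpha> 1 (hpure M (NF 1) m y)) = W3 (hpure (MF 1) (NF 1) (A m) y) +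
    \<alpha> 2 (hpure M (NF 2) m (ext N (can N) y)) +
    sw (T 2) tB (\<lambda>h f. \<alpha> 2 (hpure M (NF 2) (ad M h m) (flat_ext N f y)))"
proof (rule htens_eqI_left[OF _ _ _ _ _ y, where f = "\<lambda>y. ext MN D (\<alpha> 1 (hpure M (NF 1) m y))" and Z = "T 2"])
  show "klinear (NF 1) (T 2) (\<lambda>y. ext MN D (\<alpha> 1 (hpure M (NF 1) m y)))"
    using m by (auto intro!: klin)
  have "klinear (NF 1) (T 2) (\<lambda>y. sw (T 2) tB (\<lambda>h f. \<alpha> 2 (hpure M (NF 2) (ad M h m) (flat_ext N f y))))"
  proof (rule klinear_sw_keys)
    fix h f assume hf: "(h, f) \<in> Poly_Mapping.keys tB"
    note [klin] = klinear_comp[OF _ klinear_flat_ext[OF setup_simps(7) tB_right[OF hf]]]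
    show "klinear (NF 1) (T 2) (\<lambda>y. \<alpha> 2 (hpure M (NF 2) (ad M h m) (flat_ext N f y)))"
      using m by (auto intro!: klin)
  qed simp
  then show "klinear (NF 1) (T 2) (\<lambda>y. W3 (hpure (MF 1) (NF 1) (A m) y) +
    \<alpha> 2 (hpure M (NF 2) m (ext N (can N) y)) +
    sw (T 2) tB (\<lambda>h f. \<alpha> 2 (hpure M (NF 2) (ad M h m) (flat_ext N f y))))"
    using m by (auto intro!: klin simp del: minus_apply fun_diff_def)
  fix n \<eta> assume n: "coinv N n" and e: "\<eta> \<in> car (F 1)"
  have "wl N 0 \<eta> = 0"
    using klinear_zero[OF klinear_wl(1)[OF setup_simps(7) e klinear_id]] by simp
  then have can: "ext N (can N) (hpure N (F 1) n \<eta>) = hpure N (F 2) n (dif \<Omega> \<eta>)"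
    using n e canonical_coinv_1[of N n] by (simp add: connection_ext_hpure[OF setup_simps(7) can_N])
  have "wl MN (sw (T 1) tB (\<lambda>h f. \<alpha> 1 (hpure M (NF 1) (ad M h m) (f n)))) \<eta> =
    sw (T 2) tB (\<lambda>h f. wl MN (\<alpha> 1 (hpure M (NF 1) (ad M h m) (f n))) \<eta>)"
    by (rule klinear_sw_apply[where Z = "T 1" and L = "\<lambda>z. wl MN z \<eta>"])
      (use m n e tB_closed in \<open>auto intro!: klin\<close>)
  also have "\<dots> = sw (T 2) tB (\<lambda>h f. \<alpha> 2 (hpure M (NF 2) (ad M h m) (flat_ext N f (hpure N (F 1) n \<eta>))))"
    by (rule sw_cong)
      (use m n e tB_closed in \<open>auto simp: assoc_wl flat_ext_hpure[OF setup_simps(7) tB_right]\<close>)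
  finally show "ext MN D (\<alpha> 1 (hpure M (NF 1) m (hpure N (F 1) n \<eta>))) =
    W3 (hpure (MF 1) (NF 1) (A m) (hpure N (F 1) n \<eta>)) +
    \<alpha> 2 (hpure M (NF 2) m (ext N (can N) (hpure N (F 1) n \<eta>))) +
    sw (T 2) tB (\<lambda>h f. \<alpha> 2 (hpure M (NF 2) (ad M h m) (flat_ext N f (hpure N (F 1) n \<eta>))))"
    using m n e by (simp add: hassoc_inv_hpure ext_D_coinv W3_hpure can add.assoc add.commute
        del: minus_apply fun_diff_def)
qed auto

text \<open>\<open>ext_D_sigma\<close> treats the first term of \<open>D_coinv_both\<close>. For the
  second, each g \<triangleright> m is again coinvariant, so \<open>ext_D_assoc\<close> applies to
  every summand; it uses \<open>tB\<close> a second time, whence the nested sum.\<close>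

lemma curvature_D_coinv:
  assumes m: "coinv M m" and n: "coinv N n"
  shows "curvature H \<Omega> MN D (hpure M N m n) =
    \<sigma> 2 (hpure (MF 2) N (ext M DM (A m)) n) + W4 (\<sigma> 1 (hpure (MF 1) N (A m) n)) +
    (sw (T 2) tB (\<lambda>g f. W3 (hpure (MF 1) (NF 1) (A (ad M g m)) (f n))) +
     sw (T 2) tB (\<lambda>g f. \<alpha> 2 (hpure M (NF 2) (ad M g m) (ext N (can N) (f n))) +
       sw (T 2) tB (\<lambda>h f'. \<alpha> 2 (hpure M (NF 2) (ad M h (ad M g m)) (flat_ext N f' (f n))))))"
proof -
  let ?s = "sw (T 1) tB (\<lambda>g f. \<alpha> 1 (hpure M (NF 1) (ad M g m) (f n)))"
  have "curvature H \<Omega> MN D (hpure M N m n) = ext MN D (\<sigma> 1 (hpure (MF 1) N (A m) n)) + ext MN D ?s"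
    using m n tB_sum_closed[OF m, of n]
    by (simp add: curvature_def D_coinv_both klinear_add[OF ext_D_lin] del: minus_apply fun_diff_def)
  also have "ext MN D (\<sigma> 1 (hpure (MF 1) N (A m) n)) =
      \<sigma> 2 (hpure (MF 2) N (ext M DM (A m)) n) + W4 (\<sigma> 1 (hpure (MF 1) N (A m) n))"
    by (rule ext_D_sigma[OF _ n]) (use m in simp)
  also have "ext MN D ?s = sw (T 2) tB (\<lambda>g f. ext MN D (\<alpha> 1 (hpure M (NF 1) (ad M g m) (f n))))"
    by (rule klinear_sw_apply[OF ext_D_lin]) (use m n tB_closed in auto)
  also have "\<dots> = sw (T 2) tB (\<lambda>g f. W3 (hpure (MF 1) (NF 1) (A (ad M g m)) (f n)) +
     (\<alpha> 2 (hpure M (NF 2) (ad M g m) (ext N (can N) (f n))) +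
       sw (T 2) tB (\<lambda>h f'. \<alpha> 2 (hpure M (NF 2) (ad M h (ad M g m)) (flat_ext N f' (f n))))))"
  proof (rule sw_cong)
    fix g f assume "(g, f) \<in> Poly_Mapping.keys tB"
    then have "f n \<in> car (NF 1)" using tB_closed n by simp
    from ext_D_assoc[OF coinv_ad[OF M m] this]
    show "ext MN D (\<alpha> 1 (hpure M (NF 1) (ad M g m) (f n))) = W3 (hpure (MF 1) (NF 1) (A (ad M g m)) (f n)) +
     (\<alpha> 2 (hpure M (NF 2) (ad M g m) (ext N (can N) (f n))) +
       sw (T 2) tB (\<lambda>h f'. \<alpha> 2 (hpure M (NF 2) (ad M h (ad M g m)) (flat_ext N f' (f n)))))"
      by (simp add: add.assoc del: minus_apply fun_diff_def)
  qed
  also have "\<dots> = sw (T 2) tB (\<lambda>g f. W3 (hpure (MF 1) (NF 1) (A (ad M g m)) (f n))) +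
     sw (T 2) tB (\<lambda>g f. \<alpha> 2 (hpure M (NF 2) (ad M g m) (ext N (can N) (f n))) +
       sw (T 2) tB (\<lambda>h f'. \<alpha> 2 (hpure M (NF 2) (ad M h (ad M g m)) (flat_ext N f' (f n)))))"
    by (simp add: sw_plus del: minus_apply fun_diff_def)
  finally show ?thesis .
qed

section \<open>The addend with the curvature of the second connection\<close>

lemma ext_DN_eq:
  assumes y: "y \<in> car (NF 1)"
  shows "ext N DN y = ext N (can N) y + flat_ext N B y"
proof (rule htens_eqI[OF _ _ _ _ y, where f = "ext N DN" and Z = "NF 2"])
  show "klinear (NF 1) (NF 2) (ext N DN)" by (rule klinear_connection_ext[OF setup_simps(7) DN])
  show "klinear (NF 1) (NF 2) (\<lambda>y. ext N (can N) y + flat_ext N B y)"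
    by (intro klinear_plus ext_can_lin klinear_flat_ext B_right) auto
  fix n \<omega> assume n: "n \<in> car N" and w: "\<omega> \<in> car (F 1)"
  have "wl N (can N n + B n) \<omega> = wl N (can N n) \<omega> + wl N (B n) \<omega>"
    by (rule klinear_add[OF klinear_wl(1)[OF setup_simps(7) w klinear_id]])
      (use n in \<open>auto intro!: vspace_diff\<close>)
  then show "ext N DN (hpure N (F 1) n \<omega>) =
    ext N (can N) (hpure N (F 1) n \<omega>) + flat_ext N B (hpure N (F 1) n \<omega>)"
    using n w by (simp add: connection_ext_hpure[OF setup_simps(7) DN]
        connection_ext_hpure[OF setup_simps(7) can_N] flat_ext_hpure[OF setup_simps(7) B_right])
qed auto

definition tE :: "'h \<times> (('n \<times> 'w \<Rightarrow>\<^sub>0 'k) \<Rightarrow> ('n \<times> 'w \<Rightarrow>\<^sub>0 'k)) \<Rightarrow>\<^sub>0 'k" where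
  "tE = gen 1 (restr (NF 1) (ext N (can N))) +
     sw free_vsp tB (\<lambda>h f. gen h (restr (NF 1) (flat_ext N f)))"

text \<open>The extension of d^N is left colinear and contributes 1 \<otimes> itself;
  \<open>flat_ext_lrep\<close> provides the rest.\<close>

lemma lrep_tE: "lrep (NF 1) (NF 2) tE (\<lambda>y. ext N (can N) y + flat_ext N B y)"
  unfolding tE_def
proof (rule lrep_add[OF _ _ ext_can_lin klinear_flat_ext[OF _ B_right]])
  show "lrep (NF 1) (NF 2) (gen 1 (restr (NF 1) (ext N (can N)))) (ext N (can N))"
    by (rule lrep_gen_1[OF _ _ _ ext_can_lin canonical_ext_colinear[OF N]]) auto
  show "lrep (NF 1) (NF 2) (sw free_vsp tB (\<lambda>h f. gen h (restr (NF 1) (flat_ext N f)))) (flat_ext N B)"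
    by (rule flat_ext_lrep[OF N B_right tB tB_right])
qed auto

lemma lrep_curvature: "lrep N (NF 2) (hcomp tN tE) (curvature H \<Omega> N DN)"
proof -
  have "lrep N (NF 2) (hcomp tN tE) ((\<lambda>y. ext N (can N) y + flat_ext N B y) \<circ> DN)"
    by (rule lrep_comp[OF _ _ _ DN_lin lrep_tN lrep_tE]) auto
  then show ?thesis
    by (simp add: lrep_def curvature_def ext_DN_eq)
qed

definition R2 :: "('m \<times> 'n \<Rightarrow>\<^sub>0 'k) \<Rightarrow> (('m \<times> 'n \<Rightarrow>\<^sub>0 'k) \<times> 'w \<Rightarrow>\<^sub>0 'k)" where
  "R2 = \<alpha> 2 \<circ> tsigma H M N M (NF 2) id (curvature H \<Omega> N DN)"

lemma curvature_N_lin: "klinear N (NF 2) (curvature H \<Omega> N DN)"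
  by (rule right_linear_klinear[OF right_linear_curvature[OF setup_simps(7) DN]])

text \<open>The components of the product representative in \<open>lrep_curvature\<close> are
  composites that need not be right linear, since d^N is among the factors. Right linearity is taken
  from a second representative, which exists because the curvature itself is right linear and N is
  finitely generated; values are computed with the first.\<close>

lemma R2_right: "right_linear MN (T 2) R2"
proof -
  obtain t where t: "lrep N (NF 2) t (curvature H \<Omega> N DN)"
    and rl: "\<And>h f. (h, f) \<in> Poly_Mapping.keys t \<Longrightarrow> right_linear N (NF 2) f"
    using lrep_exists[OF N fin_N setup_simps(5) right_linear_curvature[OF setup_simps(7) DN]] by blast
  show ?thesis
    unfolding R2_def
    by (rule right_linear_comp[OF right_linear_tsigma[OF _ _ _ _ right_linear_id curvature_N_lin t rl] \<alpha>_right])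
      auto
qed

text \<open>The part of \<open>tN\<close> that comes from d^N contributes nothing at coinvariant n.
  In the rest, (h g) \<triangleright> m = h \<triangleright> (g \<triangleright> m) turns the
  product of representatives into the nested sum of \<open>curvature_D_coinv\<close>.\<close>

lemma R2_coinv:
  assumes m: "coinv M m" and n: "coinv N n"
  shows "R2 (hpure M N m n) =
    sw (T 2) tB (\<lambda>g f. \<alpha> 2 (hpure M (NF 2) (ad M g m) (ext N (can N) (f n))) +
       sw (T 2) tB (\<lambda>h f'. \<alpha> 2 (hpure M (NF 2) (ad M h (ad M g m)) (flat_ext N f' (f n)))))"
proof -
  let ?U = "htens H M (NF 2)"
  have z: "hpure M (NF 2) (ad M g m) 0 = 0" for g
    using m by (simp add: hpure_zero)
  \<comment> \<open>Components of \<open>tE\<close> are linear, so composed with d^N they vanish at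
    coinvariant n, where d^N(n) = 0.\<close>
  have E0: "f 0 = 0" if "(h, f) \<in> Poly_Mapping.keys tE" for h f
    using tset_keys(2)[OF lrep_tset[OF lrep_tE] that] klinear_zero[OF khom_klinear] by force
  have "tsigma H M N M (NF 2) id (curvature H \<Omega> N DN) (hpure M N m n) =
    sw ?U (hcomp tN tE) (\<lambda>g f. hpure M (NF 2) (id (ad M g m)) (f n))"
    by (rule tsigma_coinv[OF _ _ _ _ right_linear_id curvature_N_lin lrep_curvature m]) (use n in auto)
  also have "\<dots> = sw ?U tN (\<lambda>g f. sw ?U tE (\<lambda>h f'. hpure M (NF 2) (ad M (h * g) m) (f' (f n))))"
    by (simp add: sw_hcomp)
  also have "\<dots> = sw ?U tE (\<lambda>h f'. hpure M (NF 2) (ad M (h * 1) m) (f' (restr N (can N) n))) +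
      sw ?U tB (\<lambda>g f. sw ?U tE (\<lambda>h f'. hpure M (NF 2) (ad M (h * g) m) (f' (f n))))"
    by (simp add: tN_def sw_add sw_single)
  also have "sw ?U tE (\<lambda>h f'. hpure M (NF 2) (ad M (h * 1) m) (f' (restr N (can N) n))) =
      sw ?U tE (\<lambda>h f'. 0)"
    by (rule sw_cong) (use n in \<open>simp add: canonical_coinv_1 E0 z\<close>)
  also have "\<dots> = 0" by (rule sw_zero) simp
  also have "sw ?U tB (\<lambda>g f. sw ?U tE (\<lambda>h f'. hpure M (NF 2) (ad M (h * g) m) (f' (f n)))) =
      sw ?U tB (\<lambda>g f. hpure M (NF 2) (ad M g m) (ext N (can N) (f n)) +
        sw ?U tB (\<lambda>h f'. hpure M (NF 2) (ad M h (ad M g m)) (flat_ext N f' (f n))))"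
    by (rule sw_cong) (use m n tB_closed in \<open>simp add: tE_def sw_add sw_single sw_sw ad_mult ad_1\<close>)
  finally have "R2 (hpure M N m n) =
    \<alpha> 2 (sw ?U tB (\<lambda>g f. hpure M (NF 2) (ad M g m) (ext N (can N) (f n)) +
        sw ?U tB (\<lambda>h f'. hpure M (NF 2) (ad M h (ad M g m)) (flat_ext N f' (f n)))))"
    by (simp only: R2_def comp_apply add_0_left)
  also have "\<dots> = sw (T 2) tB (\<lambda>g f. \<alpha> 2 (hpure M (NF 2) (ad M g m) (ext N (can N) (f n)) +
        sw ?U tB (\<lambda>h f'. hpure M (NF 2) (ad M h (ad M g m)) (flat_ext N f' (f n)))))"
    by (rule klinear_sw_apply[OF \<alpha>_lin])
      (use m n tB_closed flat_closed in \<open>auto intro!: vspace_add sw_closed\<close>)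
  also have "\<dots> = sw (T 2) tB (\<lambda>g f. \<alpha> 2 (hpure M (NF 2) (ad M g m) (ext N (can N) (f n))) +
       sw (T 2) tB (\<lambda>h f'. \<alpha> 2 (hpure M (NF 2) (ad M h (ad M g m)) (flat_ext N f' (f n)))))"
  proof (rule sw_cong)
    fix g f assume "(g, f) \<in> Poly_Mapping.keys tB"
    then have f: "f n \<in> car (NF 1)" using tB_closed n by simp
    let ?V = "sw ?U tB (\<lambda>h f'. hpure M (NF 2) (ad M h (ad M g m)) (flat_ext N f' (f n)))"
    have V: "?V \<in> car ?U" by (rule sw_closed) (use m f flat_closed in auto)
    have "\<alpha> 2 ?V = sw (T 2) tB (\<lambda>h f'. \<alpha> 2 (hpure M (NF 2) (ad M h (ad M g m)) (flat_ext N f' (f n))))"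
      by (rule klinear_sw_apply[OF \<alpha>_lin]) (use m f flat_closed in auto)
    then show "\<alpha> 2 (hpure M (NF 2) (ad M g m) (ext N (can N) (f n)) + ?V) =
      \<alpha> 2 (hpure M (NF 2) (ad M g m) (ext N (can N) (f n))) +
       sw (T 2) tB (\<lambda>h f'. \<alpha> 2 (hpure M (NF 2) (ad M h (ad M g m)) (flat_ext N f' (f n))))"
      using m f V by (simp add: klinear_add[OF \<alpha>_lin])
  qed
  finally show ?thesis .
qed

section \<open>The remaining addends and the curvature formula\<close>

definition R1 :: "('m \<times> 'n \<Rightarrow>\<^sub>0 'k) \<Rightarrow> (('m \<times> 'n \<Rightarrow>\<^sub>0 'k) \<times> 'w \<Rightarrow>\<^sub>0 'k)" where
  "R1 = \<sigma> 2 \<circ> tsigma H M N (MF 2) N (curvature H \<Omega> M DM) id"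

definition R3 :: "('m \<times> 'n \<Rightarrow>\<^sub>0 'k) \<Rightarrow> (('m \<times> 'n \<Rightarrow>\<^sub>0 'k) \<times> 'w \<Rightarrow>\<^sub>0 'k)" where
  "R3 = W3 \<circ> tsigma H M N (MF 1) (NF 1) A B"

definition R4 :: "('m \<times> 'n \<Rightarrow>\<^sub>0 'k) \<Rightarrow> (('m \<times> 'n \<Rightarrow>\<^sub>0 'k) \<times> 'w \<Rightarrow>\<^sub>0 'k)" where
  "R4 = W4 \<circ> \<sigma> 1 \<circ> tsigma H M N (MF 1) N A id"

lemma R1_right: "right_linear MN (T 2) R1"
  unfolding R1_def
  by (rule right_linear_comp[OF right_linear_tsigma_id \<sigma>_right])
    (auto intro!: right_linear_curvature DM)

lemma R3_right: "right_linear MN (T 2) R3"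
  unfolding R3_def
  by (rule right_linear_comp[OF right_linear_tsigma[OF _ _ _ _ A_right B_lin tB tB_right] W3_right]) auto

lemma R4_right: "right_linear MN (T 2) R4"
  unfolding R4_def comp_assoc
  by (rule right_linear_comp[OF right_linear_comp[OF right_linear_tsigma_id[OF _ _ _ A_right] \<sigma>_right] W4_right])
    auto

lemma R1_coinv:
  assumes m: "coinv M m" and n: "coinv N n"
  shows "R1 (hpure M N m n) = \<sigma> 2 (hpure (MF 2) N (ext M DM (A m)) n)"
  using tsigma_id[OF _ N _ right_linear_curvature[OF setup_simps(6) DM] m, of n] n connection_coinv[OF _ m, of DM]
  by (simp add: R1_def curvature_def del: minus_apply fun_diff_def)

lemma R4_coinv:
  assumes m: "coinv M m" and n: "coinv N n"
  shows "R4 (hpure M N m n) = W4 (\<sigma> 1 (hpure (MF 1) N (A m) n))"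
  using tsigma_id[OF _ N _ A_right m, of n] n by (simp add: R4_def del: minus_apply fun_diff_def)

lemma R3_coinv:
  assumes m: "coinv M m" and n: "coinv N n"
  shows "R3 (hpure M N m n) = sw (T 2) tB (\<lambda>g f. W3 (hpure (MF 1) (NF 1) (A (ad M g m)) (f n)))"
proof -
  have "tsigma H M N (MF 1) (NF 1) A B (hpure M N m n) =
    sw (htens H (MF 1) (NF 1)) tB (\<lambda>g f. hpure (MF 1) (NF 1) (A (ad M g m)) (f n))"
    by (rule tsigma_coinv[OF _ _ _ _ A_right B_lin tB m]) (use n in auto)
  then have "R3 (hpure M N m n) =
    W3 (sw (htens H (MF 1) (NF 1)) tB (\<lambda>g f. hpure (MF 1) (NF 1) (A (ad M g m)) (f n)))"
    by (simp add: R3_def del: minus_apply fun_diff_def)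
  also have "\<dots> = sw (T 2) tB (\<lambda>g f. W3 (hpure (MF 1) (NF 1) (A (ad M g m)) (f n)))"
    by (rule klinear_sw_apply[OF right_linear_klinear[OF W3_right]]) (use m n tB_closed in auto)
  finally show ?thesis .
qed

theorem curvature_sum:
  assumes t: "t \<in> car MN"
  shows "curvature H \<Omega> MN D t = R1 t + R2 t + R3 t + R4 t"
proof -
  have C: "right_linear MN (T 2) (curvature H \<Omega> MN D)"
    by (rule right_linear_curvature[OF bimodule_htens[OF setup_simps(6,7)] D_connection])
  note R = R1_right R2_right R3_right R4_right
  have klR: "klinear MN (T 2) (\<lambda>t. R1 t + R2 t + R3 t + R4 t)"
    by (intro klinear_plus R[THEN right_linear_klinear]) auto
  show ?thesis
  proof (rule htens_eqI_coinv[OF _ _ _ right_linear_klinear[OF C] klR t])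
    fix m n b assume m: "coinv M m" and n: "coinv N n"
    let ?t = "hpure M N m n"
    have t: "?t \<in> car MN" using m n by simp
    have tb: "hpure M N m (ract N n b) = ract MN ?t b" using m n by simp
    have *: "curvature H \<Omega> MN D ?t = R1 ?t + R2 ?t + R3 ?t + R4 ?t"
      using curvature_D_coinv[OF m n] R1_coinv[OF m n] R2_coinv[OF m n] R3_coinv[OF m n] R4_coinv[OF m n]
      by (simp only: add.assoc add.commute add.left_commute)
    have kl: "klinear (T 2) (T 2) (\<lambda>y. ract (T 2) y b)" by (auto intro!: klin)
    show "curvature H \<Omega> MN D (hpure M N m (ract N n b)) =
      R1 (hpure M N m (ract N n b)) + R2 (hpure M N m (ract N n b)) + R3 (hpure M N m (ract N n b)) +
      R4 (hpure M N m (ract N n b))"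
      unfolding tb right_linear_ract[OF C t] * R[THEN right_linear_ract, OF t]
      using R[THEN right_linear_closed, OF t] by (simp add: klinear_add[OF kl] vspace_add)
  qed auto
qed

end

theorem theorem4p23:
  fixes H :: "('k::field, 'h::ring_1) hopf"
    and \<Omega> :: "('k, 'h, 'w::ring_1) calculus"
    and M :: "('k, 'h, 'm::ab_group_add) bcb"
    and N :: "('k, 'h, 'n::ab_group_add) bcb"
    and DM :: "'m \<Rightarrow> ('m \<times> 'w \<Rightarrow>\<^sub>0 'k)"
    and DN :: "'n \<Rightarrow> ('n \<times> 'w \<Rightarrow>\<^sub>0 'k)"
  assumes "hopf_algebra H" and "bij (antip H)"
    and "bicov_calculus H \<Omega>"
    and "bicov_bimodule H M" and "fin_gen_right M"
    and "bicov_bimodule H N" and "fin_gen_right N"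
    and "DM \<in> connections H \<Omega> M" and "DN \<in> connections H \<Omega> N"
  shows
    "let \<Omega>1 = forms \<Omega> 1; \<Omega>2 = forms \<Omega> 2; MN = M \<otimes>\<^bsub>H\<^esub> N;
         Dsum = connection_sum H \<Omega> M N DM DN;
         A = DM - canonical_connection H \<Omega> M;
         B = DN - canonical_connection H \<Omega> N;
         R1 = sigma23 H M \<Omega>2 N \<circ> tsigma H M N (M \<otimes>\<^bsub>H\<^esub> \<Omega>2) N (curvature H \<Omega> M DM) id;
         R2 = hassoc_inv H M N \<Omega>2 \<circ> tsigma H M N M (N \<otimes>\<^bsub>H\<^esub> \<Omega>2) id (curvature H \<Omega> N DN);
         R3 = wedge_last H \<Omega> MN 1 1
              \<circ> (hmap H (MN \<otimes>\<^bsub>H\<^esub> \<Omega>1) \<Omega>1 (sigma23 H M \<Omega>1 N) id \<circ> hassoc_inv H (M \<otimes>\<^bsub>H\<^esub> \<Omega>1) N \<Omega>1)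
              \<circ> tsigma H M N (M \<otimes>\<^bsub>H\<^esub> \<Omega>1) (N \<otimes>\<^bsub>H\<^esub> \<Omega>1) A B;
         R4 = wedge_last H \<Omega> MN 1 1
              \<circ> hmap H (MN \<otimes>\<^bsub>H\<^esub> \<Omega>1) \<Omega>1 (hassoc_inv H M N \<Omega>1) id
              \<circ> tsigma H MN \<Omega>1 (M \<otimes>\<^bsub>H\<^esub> (N \<otimes>\<^bsub>H\<^esub> \<Omega>1)) \<Omega>1
                  (tsigma H M N M (N \<otimes>\<^bsub>H\<^esub> \<Omega>1) id B) id
              \<circ> sigma23 H M \<Omega>1 N
              \<circ> tsigma H M N (M \<otimes>\<^bsub>H\<^esub> \<Omega>1) N A id
     in Dsum \<in> connections H \<Omega> MN
        \<and> right_linear MN (MN \<otimes>\<^bsub>H\<^esub> \<Omega>2) R1 \<and> right_linear MN (MN \<otimes>\<^bsub>H\<^esub> \<Omega>2) R2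
        \<and> right_linear MN (MN \<otimes>\<^bsub>H\<^esub> \<Omega>2) R3 \<and> right_linear MN (MN \<otimes>\<^bsub>H\<^esub> \<Omega>2) R4
        \<and> (\<forall>t\<in>car MN. curvature H \<Omega> MN Dsum t = R1 t + R2 t + R3 t + R4 t)"
proof -
  interpret bicov_calc H \<Omega> by unfold_locales fact+
  \<comment> \<open>The difference \<nabla>^N - d^N is right linear on a finitely generated module
    with values in a left covariant one, so \<open>lrep_exists\<close> supplies the parameter of the
    locale.\<close>
  obtain tB where tB: "lrep N (N \<otimes>\<^bsub>H\<^esub> forms \<Omega> 1) tB (DN - canonical_connection H \<Omega> N)"
    "\<And>h f. (h, f) \<in> Poly_Mapping.keys tB \<Longrightarrow> right_linear N (N \<otimes>\<^bsub>H\<^esub> forms \<Omega> 1) f"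
    using lrep_exists[OF \<open>bicov_bimodule H N\<close> \<open>fin_gen_right N\<close>
        lcov_htens[OF \<open>bicov_bimodule H N\<close> bicov_forms]
        right_linear_connection_diff[OF cogen_bicov[OF \<open>bicov_bimodule H N\<close>] \<open>DN \<in> connections H \<Omega> N\<close>]]
    by blast
  interpret connection_pair H \<Omega> M N DM DN tB by unfold_locales (fact assms tB)+
  show ?thesis
    unfolding Let_def
    using D_connection R1_right R2_right R3_right R4_right curvature_sum
    unfolding R1_def R2_def R3_def R4_def W3_def W4_def comp_assoc by blast
qed

end
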